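(* Let $\vec k'=(k'_j)_{j\in\mathcal J}$ with $k'_j\in\mathcal K_{r_j}$ for every $j$, put $\mathcal J_\infty=\{j\in\mathcal J: k'_j=\infty\}$, and assume $\sum_{j\in\mathcal J}(r_j-1)\ge 2\sum_{j\in\mathcal J_\infty}r_j$ and that $\vec k'$ is valid (the conditions below admit a solution). Let $(\vec\Lambda,\vec\Theta,\vec x)\in (E^\times)^f\times(E^\times)^f\times E^f$ be such that for every $j\in\mathcal J$ the quadruple $(\Lambda,\Theta,\Omega,x)=(\Lambda_j,\Theta_j,\Theta_{j+1},x_j)$ satisfies the conditions $\mathrm C(r_j;k'_j)$. Put $l_j=l(r_j;k'_j)$ and $\Delta^{(j)}(T)=\delta^{[r_j]}_{l_j}(T,x_j)$ for $j\in\mathcal J$. Let $\vec\varrho\in E^f$ be the unique vector with $p\varrho_j-\varrho_{j-1}=p x_j+\Delta^{(j-1)}(-1)$ for all $j$, and let $\vec{\mathfrak L}\in\mathbb P^1(E)^f$ be given by $\mathfrak L_j=\varrho_j$ for $j\notin\mathcal J_\infty$ and $\mathfrak L_j=\infty$ for $j\in\mathcal J_\infty$. Let $\lambda\in\mathcal O$ satisfy $\lambda^f=\prod_{j\in\mathcal J}\Lambda_j$, let $\vec\theta_1\in(E^\times)^f$ satisfy $\Lambda_j=\lambda\theta_{1,j}/\theta_{1,j+1}$ for all $j$, and put $\theta_{2,j}=\Theta_j\theta_{1,j}$. Then $\mathfrak M_{(\vec\theta_1,\vec\theta_2,\vec\varrho,\vec\Delta)}$ is a strongly divisible module of weight $r$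 in $\mathcal D(D(\lambda,\vec{\mathfrak L}))$.
   Context: Let $p$ be an odd prime, $f\ge1$, $\mathbf Q_{p^f}$ the unramified extension of $\mathbf Q_p$ of degree $f$ with ring of integers $\mathbf Z_{p^f}$ and arithmetic Frobenius $\varphi$. Let $E\supset\mathbf Q_{p^f}$ be a finite extension with ring of integers $\mathcal O$, maximal ideal $\mathfrak m$; $v_p$ is the $p$-adic valuation with $v_p(p)=1$, $v_p(0)=\infty$. Let $\mathcal J=\mathbf Z/f\mathbf Z$ (indices are taken mod $f$). Fix the isomorphism $\mathbf Z_{p^f}\otimes_{\mathbf Z_p}\mathcal O\cong\bigoplus_{j\in\mathcal J}\mathcal O$, $a\otimes b\mapsto(\varphi^{-j}(a)b)_j$ (and likewise $\mathbf Q_{p^f}\otimes_{\mathbf Q_p}E\cong E^f$), with idempotents $e_j$; $\varphi\otimes1$ sends $e_j$ to $e_{j+1}$. Vectors $\vec a\in E^f$ are viewed as elements $\sum_j a_je_j$ of $\mathbf Q_{p^f}\otimes E$. Fix integers $r_j$ with $1\le r_j<p-1$ ($j\in\mathcal J$) and $r$ with $r_j\le r<p-1$ for all $j$. Filtered module $D(\lambda,\vec{\mathfrak L})$: for $\lambda\in E$ and $\vec{\mathfrak L}=(\mathfrak L_j)\in\mathbb P^1(E)^f$, $D$ is the free $\mathbf Q_{p^f}\otimes E$-module with basis $\eta_1,\eta_2$, with $\varphi$-semilinear, $E$-linear Frobenius $\phi_D(\eta_1)=p\lambda\eta_1$, $\phi_D(\eta_2)=\lambda\eta_2$, linear monodromy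 $N_D(\eta_1)=\eta_2$, $N_D(\eta_2)=0$, and filtration $\mathrm{Fil}^iD=\bigoplus_j\mathrm{Fil}^iDe_j$ with $\mathrm{Fil}^iDe_j=De_j$ for $i\le0$, $=E(\xi_j\eta_1+\nu_j\eta_2)e_j$ for $0<i\le r_j$, $=0$ for $i>r_j$, where $\mathfrak L_j=[\xi_j:\nu_j]$ (i.e. $\xi_j=1,\nu_j=\mathfrak L_j$ if $\mathfrak L_j\ne\infty$, and $\xi_j=0,\nu_j=1$ if $\mathfrak L_j=\infty$). Breuil's ring: $S$ is the $p$-adic completion of $\mathbf Z_{p^f}[u^i/i!:i\ge1]$, $v=u-p$, $\phi:S\to S$ the continuous $\varphi$-semilinear map with $\phi(u)=u^p$, $N:S\to S$ the continuous $\mathbf Z_{p^f}$-linear derivation with $N(u)=-u$, $\mathrm{Fil}^iS$ the $p$-adic completion of $\sum_{j\ge i}\frac{v^j}{j!}S$; $S_{\mathcal O}=S\otimes_{\mathbf Z_p}\mathcal O$, $S_E=S_{\mathcal O}[1/p]$ (structures extended linearly); $\gamma=(u-p)^p/p\in S$. Let $E(T)_\Delta=E(T)\cap(E+\mathcal O[[T+1]])$ inside $E((T+1))$; for $\Delta\in E(T)_\Delta$, $\Delta(-1)$ is its constant term in $T+1$ and $\Delta(\gamma-1)\in S_E$ is obtained by substituting $T+1=\gamma$. $\mathcal D(D)=S\otimes_{\mathbf Z_{p^f}}D$ with $\phi=\phi\otimes\phi_D$, $N=N\otimes1+1\otimes N_D$, $\mathrm{Fil}^0\mathcal D=\mathcal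 D$ and $\mathrm{Fil}^{i+1}\mathcal D=\{y\in\mathcal D: N(y)\in\mathrm{Fil}^i\mathcal D,\ f_p(y)\in\mathrm{Fil}^{i+1}D\}$, where $f_p:\mathcal D\to D$ is $s(u)\otimes y\mapsto s(p)y$. A strongly divisible module of weight $r$ in $\mathcal D$ is an $S_{\mathcal O}$-submodule $\mathfrak M\subset\mathcal D$, free of finite rank over $S_{\mathcal O}$ with $\mathfrak M[1/p]=\mathcal D$, stable under $\phi$ and $N$, with $\phi(\mathfrak M\cap\mathrm{Fil}^r\mathcal D)\subset p^r\mathfrak M$. For $\vec\theta_1,\vec\theta_2\in(E^\times)^f$, $\vec\varrho\in E^f$ and $\vec\Delta=(\Delta^{(j)})\in(E(T)_\Delta)^f$ put $E_1=\sum_j\theta_{1,j}\big(\eta_1+\frac{\varrho_{j-1}+\Delta^{(j-1)}(\gamma-1)}{p}\eta_2\big)e_j$, $E_2=\sum_j\theta_{2,j}\eta_2e_j$, and $\mathfrak M_{(\vec\theta_1,\vec\theta_2,\vec\varrho,\vec\Delta)}=S_{\mathcal O}E_1+S_{\mathcal O}E_2\subset\mathcal D(D)$. For an integer $r'\ge1$ let $m'=\lfloor r'/2\rfloor$ and $\mathcal K_{r'}=\{\frac12,1,\frac32,\dots,r'+\frac12\}\cup\{\infty\}$. For $k'\in\mathcal K_{r'}$: $l(r';k')=\lceil k'\rceil$ if $\frac12\le k'\le m'+1$, $l(r';k')=r'+1-\lceil k'\rceil$ if $m'+1<k'\le r'+\frac12$, $l(r';k')=0$ if $k'=\infty$. The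 rational functions $\delta^{[r']}_l(T,x)$ ($0\le l\le m'+1$, $x\in E$): $\delta^{[r']}_0(T,x)=-x$; for $1\le l\le m'+1$, $\delta^{[r']}_l(T,x)=R(T)-x$ where $R(T)$ is the $[(r'-l)/(l-1)]$-Padé approximant of $x+\log(1+T)$, i.e. $R=Q/P$ with $\deg Q\le r'-l$, $\deg P\le l-1$, $R\equiv x+\log(1+T)\bmod T^{r'}$ (this is independent of $x$ unless $r'=2m'$ and $l=m'+1$). Conditions $\mathrm C(r';k')$ on $(\Lambda,\Theta,\Omega,x)\in(E^\times)^3\times E$ (write $v=v_p$, $k=\lfloor k'\rfloor$): - $k'=\frac12$: $v(\Lambda)=r'-1$, $v(\Theta\Omega^{-1})=-r'+1$; $v(\Theta)\le v(x)$, $v(\Omega)\le0$. - $\frac12<k'=k+\frac12\le\frac{r'}2$: $v(\Lambda)=r'-k-1$, $v(\Theta\Omega^{-1})=-r'+2k'$; $v(\Theta)\le v(x)$, $-1\le v(\Omega)\le0$. - $\frac{r'+1}2\le k'=k+\frac12<r'$: $v(\Lambda x)=r'-k-1$, $v(\Theta\Omega^{-1}x^{-2})=-r'+2k'$; $v(x)<0$, $v(x)\le v(\Theta)\le0$, $-1\le v(\Omega)\le0$. - $k'=r'+\frac12$: $v(\Lambda)=-1$, $v(\Theta\Omega^{-1})=r'+1$; $v(x)+r'\le v(\Theta)\le0$. - $\frac12<k'=k\le\frac{r'}2$: $v(\Lambda\Theta)=k-1$, $v(\Theta\Omega)=-r'+2k'-1$; $v(\Theta)\le v(x)$, $-1\le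 v(\Omega)\le0$. - $\frac{r'+1}2\le k'=k<r'$: $v(\Lambda\Theta x^{-1})=k-1$, $v(\Theta\Omega x^{-2})=-r'+2k'-1$; $v(x)<0$, $v(x)\le v(\Theta)\le0$, $-1\le v(\Omega)\le0$. - $k'=r'$: $v(\Lambda\Theta x^{-1})=r'-1$, $v(\Theta\Omega x^{-2})=r'-1$; $v(x)\le v(\Theta)\le v(x)+r'$, $v(\Omega)\le0$, $v(\Theta)\le0$. - $k'=\infty$: $v(\Lambda)=-1$, $v(\Theta\Omega^{-1})=r'+1$; $v(\Theta)\le0$. *)

theory Defs
  imports
    "HOL-Library.Extended_Real"
    "HOL-Library.Function_Algebras"
    "HOL-Library.Product_Plus"
    "HOL-Computational_Algebra.Computational_Algebra"
    "HOL-Algebra.Algebraic_Closure_Type"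
begin

section \<open>The fields\<close>

definition extends_padic_valuation :: "nat \<Rightarrow> ('e::field_char_0 \<Rightarrow> ereal) \<Rightarrow> bool" where
  "extends_padic_valuation p v \<longleftrightarrow>
     (\<forall>x. v x = \<infinity> \<longleftrightarrow> x = 0) \<and> (\<forall>x. v x \<noteq> - \<infinity>) \<and>
     (\<forall>x y. v (x * y) = v x + v y) \<and> (\<forall>x y. min (v x) (v y) \<le> v (x + y)) \<and>
     v (of_nat p) = 1"

definition vlim :: "('e::field_char_0 \<Rightarrow> ereal) \<Rightarrow> (nat \<Rightarrow> 'e) \<Rightarrow> 'e \<Rightarrow> bool" where
  "vlim v a s \<longleftrightarrow> (\<lambda>n. v (a n - s)) \<longlonglongrightarrow> \<infinity>"

definition vsum :: "('e::field_char_0 \<Rightarrow> ereal) \<Rightarrow> (nat \<Rightarrow> 'e) \<Rightarrow> 'e" where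
  "vsum v a = (THE s. vlim v (\<lambda>n. \<Sum>i<n. a i) s)"

definition vCauchy :: "('e::field_char_0 \<Rightarrow> ereal) \<Rightarrow> (nat \<Rightarrow> 'e) \<Rightarrow> bool" where
  "vCauchy v a \<longleftrightarrow> (\<forall>B::real. \<exists>n0. \<forall>m\<ge>n0. \<forall>n\<ge>n0. ereal B \<le> v (a m - a n))"

text \<open>The closure of the rationals. If every Cauchy sequence of rationals converges, as
  \<open>padic_field\<close> below demands, it is the completion of the rationals for the $p$-adic
  valuation, i.e. the field of $p$-adic numbers.\<close>

definition Qp_in :: "('e::field_char_0 \<Rightarrow> ereal) \<Rightarrow> 'e set" where
  "Qp_in v = {x. \<exists>q :: nat \<Rightarrow> rat. vlim v (\<lambda>n. of_rat (q n)) x}"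

definition padic_field :: "nat \<Rightarrow> ('e::field_char_0 \<Rightarrow> ereal) \<Rightarrow> bool" where
  "padic_field p v \<longleftrightarrow>
     extends_padic_valuation p v \<and>
     (\<forall>q :: nat \<Rightarrow> rat. vCauchy v (\<lambda>n. of_rat (q n)) \<longrightarrow> (\<exists>x. vlim v (\<lambda>n. of_rat (q n)) x)) \<and>
     ring.finite_dimension (ring_of_type_algebra :: 'e ring) (Qp_in v) UNIV"

text \<open>\<open>K\<close> is the unramified extension of degree \<open>f\<close> of the $p$-adic numbers inside the ambient
  field. The last clause says that the ramification index is 1.\<close>

definition unramified_subfield :: "('e::field_char_0 \<Rightarrow> ereal) \<Rightarrow> nat \<Rightarrow> 'e set \<Rightarrow> bool" where
  "unramified_subfield v f K \<longleftrightarrow>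
     subfield K (ring_of_type_algebra :: 'e ring) \<and> Qp_in v \<subseteq> K \<and>
     ring.dimension (ring_of_type_algebra :: 'e ring) f (Qp_in v) K \<and>
     (\<forall>x\<in>K. x \<noteq> 0 \<longrightarrow> (\<exists>n::int. v x = ereal (of_int n)))"

definition arith_frobenius :: "nat \<Rightarrow> ('e::field_char_0 \<Rightarrow> ereal) \<Rightarrow> 'e set \<Rightarrow> ('e \<Rightarrow> 'e) \<Rightarrow> bool" where
  "arith_frobenius p v K frob \<longleftrightarrow>
     frob \<in> ring_iso ((ring_of_type_algebra :: 'e ring)\<lparr>carrier := K\<rparr>)
                     ((ring_of_type_algebra :: 'e ring)\<lparr>carrier := K\<rparr>) \<and>
     (\<forall>x\<in>Qp_in v. frob x = x) \<and>
     (\<forall>x\<in>K. 0 \<le> v x \<longrightarrow> 0 < v (frob x - x ^ p))"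


section \<open>Breuil's ring\<close>

text \<open>Elements of \<open>S\<close> are power series in \<open>u = fps_X\<close>.
  \<open>pd_polys\<close> is the ring generated over the integers of \<open>K\<close> by the divided powers of \<open>u\<close>.\<close>

inductive_set pd_polys :: "('e::field_char_0 \<Rightarrow> ereal) \<Rightarrow> 'e set \<Rightarrow> 'e fps set"
  for v :: "'e \<Rightarrow> ereal" and K :: "'e set" where
  const: "c \<in> K \<Longrightarrow> 0 \<le> v c \<Longrightarrow> fps_const c \<in> pd_polys v K"
| gen: "1 \<le> i \<Longrightarrow> fps_const (1 / fact i) * fps_X ^ i \<in> pd_polys v K"
| add: "a \<in> pd_polys v K \<Longrightarrow> b \<in> pd_polys v K \<Longrightarrow> a + b \<in> pd_polys v K"
| mult: "a \<in> pd_polys v K \<Longrightarrow> b \<in> pd_polys v K \<Longrightarrow> a * b \<in> pd_polys v K"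

text \<open>An element of the $p$-adic completion $\varprojlim A/p^nA$ is given by a sequence
  $G_n \in A$ with $G_{n+1} \equiv G_n$ mod $p^nA$; it is identified with the coefficientwise
  limit of the sequence. For \<open>A = pd_polys v K\<close> this identification is injective, because
  \<open>A\<close> is free over the integers of \<open>K\<close> on the elements $u^i/i!$.\<close>

definition padic_completion ::
    "nat \<Rightarrow> ('e::field_char_0 \<Rightarrow> ereal) \<Rightarrow> 'e fps set \<Rightarrow> 'e fps set" where
  "padic_completion p v A =
     {F. \<exists>G :: nat \<Rightarrow> 'e fps. (\<forall>n. G n \<in> A) \<and>
         (\<forall>n. \<exists>H\<in>A. G (Suc n) - G n = of_nat (p ^ n) * H) \<and>
         (\<forall>i. vlim v (\<lambda>n. fps_nth (G n) i) (fps_nth F i))}"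

definition breuil_S :: "nat \<Rightarrow> ('e::field_char_0 \<Rightarrow> ereal) \<Rightarrow> 'e set \<Rightarrow> 'e fps set" where
  "breuil_S p v K = padic_completion p v (pd_polys v K)"

text \<open>Families indexed by $\mathbf Z/f\mathbf Z$ are functions on \<open>nat\<close> of which only the values at
  \<open>j < f\<close> matter; those that are elements of a module vanish for \<open>j \<ge> f\<close>.\<close>

definition nxt :: "nat \<Rightarrow> nat \<Rightarrow> nat" where
  "nxt f j = (j + 1) mod f"

definition prv :: "nat \<Rightarrow> nat \<Rightarrow> nat" where
  "prv f j = (j + (f - 1)) mod f"

definition tup :: "nat \<Rightarrow> (nat \<Rightarrow> 'a::zero) \<Rightarrow> nat \<Rightarrow> 'a" where
  "tup f a = (\<lambda>j. if j < f then a j else 0)"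

text \<open>The image of $s \otimes b$ under the fixed isomorphism: its component at $e_j$
  is $\varphi^{-j}(s)\,b$, where $\varphi$ acts on coefficients and
  \<open>inv_into K frob\<close> is the inverse of $\varphi$.\<close>

definition tensor_S ::
    "nat \<Rightarrow> 'e::field_char_0 set \<Rightarrow> ('e \<Rightarrow> 'e) \<Rightarrow> 'e fps \<Rightarrow> 'e \<Rightarrow> nat \<Rightarrow> 'e fps" where
  "tensor_S f K frob s b =
     tup f (\<lambda>j. Abs_fps (\<lambda>i. (inv_into K frob ^^ j) (fps_nth s i)) * fps_const b)"

text \<open>\<open>S_O\<close> is the tensor product of \<open>S\<close> with the integers of \<open>E\<close>, identified with its image
  in the product of \<open>f\<close> copies of the power series over \<open>E\<close>, that is, with the additive span of
  the pure tensors; \<open>S_E\<close> is \<open>S_O[1/p]\<close>.\<close>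

inductive_set S_O ::
    "nat \<Rightarrow> nat \<Rightarrow> ('e::field_char_0 \<Rightarrow> ereal) \<Rightarrow> 'e set \<Rightarrow> ('e \<Rightarrow> 'e) \<Rightarrow> (nat \<Rightarrow> 'e fps) set"
  for p f :: nat and v :: "'e \<Rightarrow> ereal" and K :: "'e set" and frob :: "'e \<Rightarrow> 'e" where
  zero: "0 \<in> S_O p f v K frob"
| tensor: "s \<in> breuil_S p v K \<Longrightarrow> 0 \<le> v b \<Longrightarrow> tensor_S f K frob s b \<in> S_O p f v K frob"
| add: "F \<in> S_O p f v K frob \<Longrightarrow> G \<in> S_O p f v K frob \<Longrightarrow> F + G \<in> S_O p f v K frob"

definition S_E ::
    "nat \<Rightarrow> nat \<Rightarrow> ('e::field_char_0 \<Rightarrow> ereal) \<Rightarrow> 'e set \<Rightarrow> ('e \<Rightarrow> 'e) \<Rightarrow> (nat \<Rightarrow> 'e fps) set" where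
  "S_E p f v K frob = {F. \<exists>n. (\<lambda>j. of_nat (p ^ n) * F j) \<in> S_O p f v K frob}"

text \<open>$\phi(s \otimes b) = \phi(s) \otimes b$ has component
  $\varphi^{-j}(\phi(s))\,b = (\varphi^{-(j-1)}(s)\,b)(u^p)$ at $e_j$; hence the shift by one.\<close>

definition phi_S :: "nat \<Rightarrow> nat \<Rightarrow> (nat \<Rightarrow> 'e::field_char_0 fps) \<Rightarrow> nat \<Rightarrow> 'e fps" where
  "phi_S p f F = tup f (\<lambda>j. fps_compose (F (prv f j)) (fps_X ^ p))"

definition N_S :: "nat \<Rightarrow> (nat \<Rightarrow> 'e::field_char_0 fps) \<Rightarrow> nat \<Rightarrow> 'e fps" where
  "N_S f F = tup f (\<lambda>j. - fps_X * fps_deriv (F j))"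

definition gam :: "nat \<Rightarrow> 'e::field_char_0 fps" where
  "gam p = fps_const (1 / of_nat p) * (fps_X - of_nat p) ^ p"


section \<open>The filtered module and its base change\<close>

datatype 'e proj_line = Fin 'e | Infty

fun xi :: "'e::field_char_0 proj_line \<Rightarrow> 'e" where
  "xi (Fin a) = 1" | "xi Infty = 0"

fun nu :: "'e::field_char_0 proj_line \<Rightarrow> 'e" where
  "nu (Fin a) = a" | "nu Infty = 1"

text \<open>The pair \<open>(a, b)\<close> stands for $\vec a\,\eta_1 + \vec b\,\eta_2$. It is used both for \<open>D\<close>
  (components in \<open>E\<close>) and for $\mathcal D = S \otimes D$ (components in power series over \<open>E\<close>).\<close>

type_synonym 'e Dmod = "(nat \<Rightarrow> 'e) \<times> (nat \<Rightarrow> 'e)"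
type_synonym 'e calDmod = "(nat \<Rightarrow> 'e fps) \<times> (nat \<Rightarrow> 'e fps)"

definition D_car :: "nat \<Rightarrow> 'e::field_char_0 Dmod set" where
  "D_car f = {(a, b). \<forall>j\<ge>f. a j = 0 \<and> b j = 0}"

definition eta1 :: "nat \<Rightarrow> 'e::field_char_0 Dmod" where
  "eta1 f = (tup f (\<lambda>j. 1), 0)"

definition eta2 :: "nat \<Rightarrow> 'e::field_char_0 Dmod" where
  "eta2 f = (0, tup f (\<lambda>j. 1))"

definition phi_D :: "nat \<Rightarrow> nat \<Rightarrow> 'e::field_char_0 \<Rightarrow> 'e Dmod \<Rightarrow> 'e Dmod" where
  "phi_D p f lam y =
     (tup f (\<lambda>j. fst y (prv f j) * (of_nat p * lam)), tup f (\<lambda>j. snd y (prv f j) * lam))"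

definition N_D :: "'e::field_char_0 Dmod \<Rightarrow> 'e Dmod" where
  "N_D y = (0, fst y)"

definition Fil_D ::
    "nat \<Rightarrow> (nat \<Rightarrow> nat) \<Rightarrow> (nat \<Rightarrow> 'e::field_char_0 proj_line) \<Rightarrow> int \<Rightarrow> 'e Dmod set" where
  "Fil_D f r L i = {y \<in> D_car f. \<forall>j<f.
     (fst y j, snd y j) \<in>
       (if i \<le> 0 then UNIV
        else if i \<le> int (r j) then {(c * xi (L j), c * nu (L j)) | c. True}
        else {(0, 0)})}"

text \<open>As \<open>D\<close> is free on $\eta_1,\eta_2$ over the tensor product of \<open>K\<close> and \<open>E\<close>, its base
  change to \<open>S\<close> is free on $\eta_1,\eta_2$ over \<open>S_E\<close>.\<close>

definition calD ::
    "nat \<Rightarrow> nat \<Rightarrow> ('e::field_char_0 \<Rightarrow> ereal) \<Rightarrow> 'e set \<Rightarrow> ('e \<Rightarrow> 'e) \<Rightarrow> 'e calDmod set" where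
  "calD p f v K frob = S_E p f v K frob \<times> S_E p f v K frob"

definition tens :: "(nat \<Rightarrow> 'e::field_char_0 fps) \<Rightarrow> 'e Dmod \<Rightarrow> 'e calDmod" where
  "tens F y = ((\<lambda>j. F j * fps_const (fst y j)), (\<lambda>j. F j * fps_const (snd y j)))"

definition smul :: "(nat \<Rightarrow> 'e::field_char_0 fps) \<Rightarrow> 'e calDmod \<Rightarrow> 'e calDmod" where
  "smul s y = ((\<lambda>j. s j * fst y j), (\<lambda>j. s j * snd y j))"

definition phi_calD :: "nat \<Rightarrow> nat \<Rightarrow> 'e::field_char_0 \<Rightarrow> 'e calDmod \<Rightarrow> 'e calDmod" where
  "phi_calD p f lam y =
     tens (phi_S p f (fst y)) (phi_D p f lam (eta1 f)) +
     tens (phi_S p f (snd y)) (phi_D p f lam (eta2 f))"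

definition N_calD :: "nat \<Rightarrow> 'e::field_char_0 calDmod \<Rightarrow> 'e calDmod" where
  "N_calD f y =
     tens (N_S f (fst y)) (eta1 f) + tens (N_S f (snd y)) (eta2 f) +
     tens (fst y) (N_D (eta1 f)) + tens (snd y) (N_D (eta2 f))"

definition eval_p :: "nat \<Rightarrow> ('e::field_char_0 \<Rightarrow> ereal) \<Rightarrow> 'e fps \<Rightarrow> 'e" where
  "eval_p p v F = vsum v (\<lambda>i. fps_nth F i * of_nat p ^ i)"

definition f_p :: "nat \<Rightarrow> ('e::field_char_0 \<Rightarrow> ereal) \<Rightarrow> 'e calDmod \<Rightarrow> 'e Dmod" where
  "f_p p v y = ((\<lambda>j. eval_p p v (fst y j)), (\<lambda>j. eval_p p v (snd y j)))"

primrec Fil_calD ::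
    "nat \<Rightarrow> nat \<Rightarrow> ('e::field_char_0 \<Rightarrow> ereal) \<Rightarrow> 'e set \<Rightarrow> ('e \<Rightarrow> 'e) \<Rightarrow>
     (nat \<Rightarrow> nat) \<Rightarrow> (nat \<Rightarrow> 'e proj_line) \<Rightarrow> nat \<Rightarrow> 'e calDmod set" where
  "Fil_calD p f v K frob r L 0 = calD p f v K frob"
| "Fil_calD p f v K frob r L (Suc i) =
     {y \<in> calD p f v K frob.
        N_calD f y \<in> Fil_calD p f v K frob r L i \<and> f_p p v y \<in> Fil_D f r L (int (Suc i))}"

definition SO_submodule :: "(nat \<Rightarrow> 'e::field_char_0 fps) set \<Rightarrow> 'e calDmod set \<Rightarrow> bool" where
  "SO_submodule A M \<longleftrightarrow>
     0 \<in> M \<and> (\<forall>x\<in>M. \<forall>y\<in>M. x + y \<in> M) \<and> (\<forall>s\<in>A. \<forall>x\<in>M. smul s x \<in> M)"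

definition free_finite_rank :: "(nat \<Rightarrow> 'e::field_char_0 fps) set \<Rightarrow> 'e calDmod set \<Rightarrow> bool" where
  "free_finite_rank A M \<longleftrightarrow>
     (\<exists>(d::nat) b. (\<forall>i<d. b i \<in> M) \<and>
        (\<forall>y\<in>M. \<exists>!c :: nat \<Rightarrow> nat \<Rightarrow> 'e fps.
           (\<forall>i<d. c i \<in> A) \<and> (\<forall>i\<ge>d. c i = 0) \<and> y = (\<Sum>i<d. smul (c i) (b i))))"

text \<open>\<open>r\<close> gives the jumps of the filtration of $D(\lambda,\vec{\mathfrak L})$, \<open>w\<close> is the weight.\<close>

definition strongly_divisible ::
    "nat \<Rightarrow> nat \<Rightarrow> ('e::field_char_0 \<Rightarrow> ereal) \<Rightarrow> 'e set \<Rightarrow> ('e \<Rightarrow> 'e) \<Rightarrow>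
     (nat \<Rightarrow> nat) \<Rightarrow> 'e \<Rightarrow> (nat \<Rightarrow> 'e proj_line) \<Rightarrow> nat \<Rightarrow> 'e calDmod set \<Rightarrow> bool" where
  "strongly_divisible p f v K frob r lam L w M \<longleftrightarrow>
     M \<subseteq> calD p f v K frob \<and>
     SO_submodule (S_O p f v K frob) M \<and>
     free_finite_rank (S_O p f v K frob) M \<and>
     {y. \<exists>n. smul (\<lambda>j. of_nat (p ^ n)) y \<in> M} = calD p f v K frob \<and>
     (\<forall>y\<in>M. phi_calD p f lam y \<in> M) \<and>
     (\<forall>y\<in>M. N_calD f y \<in> M) \<and>
     (\<forall>y \<in> M \<inter> Fil_calD p f v K frob r L w.
        \<exists>z\<in>M. phi_calD p f lam y = smul (\<lambda>j. of_nat (p ^ w)) z)"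


section \<open>Rational functions and Pade approximants\<close>

text \<open>\<open>'e poly fract\<close> is $E(T)$. \<open>laurent_at_m1 R\<close> is the image of \<open>R\<close> in $E((T+1))$, as a
  Laurent series in the variable $T+1$.\<close>

definition laurent_at_m1 :: "'e::field_char_0 poly fract \<Rightarrow> 'e fls" where
  "laurent_at_m1 R = (THE F. \<exists>P Q. P \<noteq> 0 \<and> R = Fract Q P \<and>
     F = fps_to_fls (fps_of_poly (pcompose Q [:-1, 1:])) /
         fps_to_fls (fps_of_poly (pcompose P [:-1, 1:])))"

definition E_T_Delta :: "('e::field_char_0 \<Rightarrow> ereal) \<Rightarrow> 'e poly fract set" where
  "E_T_Delta v = {R. (\<forall>n<0. fls_nth (laurent_at_m1 R) n = 0) \<and>
                     (\<forall>n>0. 0 \<le> v (fls_nth (laurent_at_m1 R) n))}"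

definition value_at_m1 :: "'e::field_char_0 poly fract \<Rightarrow> 'e" where
  "value_at_m1 R = fls_nth (laurent_at_m1 R) 0"

text \<open>$\Delta(\gamma-1)=\sum_n \Delta_n\gamma^n$, where $\Delta_n$ is the coefficient of $(T+1)^n$.
  The sum converges in $S_E$ because $\gamma^n \in \frac{(pn)!}{p^n}S$; the limit is taken
  coefficientwise in \<open>u\<close>. As $\gamma$ is defined over the rationals,
  this power series is the component of $\Delta(\gamma-1)$ at every $e_j$.\<close>

definition subst_gamma ::
    "nat \<Rightarrow> ('e::field_char_0 \<Rightarrow> ereal) \<Rightarrow> 'e poly fract \<Rightarrow> 'e fps" where
  "subst_gamma p v R =
     Abs_fps (\<lambda>i. vsum v (\<lambda>n. fls_nth (laurent_at_m1 R) (int n) * fps_nth (gam p ^ n) i))"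

text \<open>\<open>R\<close> is the $[(r'-l)/(l-1)]$-Pade approximant of $x+\log(1+T)$; \<open>fps_ln 1\<close> is
  $\log(1+T)$.\<close>

definition is_pade :: "nat \<Rightarrow> nat \<Rightarrow> 'e::field_char_0 \<Rightarrow> 'e poly fract \<Rightarrow> bool" where
  "is_pade r' l x R \<longleftrightarrow> (\<exists>P Q. R = Fract Q P \<and> poly P 0 \<noteq> 0 \<and>
     Polynomial.degree Q \<le> r' - l \<and> Polynomial.degree P \<le> l - 1 \<and>
     (\<forall>n<r'. fps_nth (fps_of_poly Q / fps_of_poly P) n = fps_nth (fps_const x + fps_ln 1) n))"

definition delta :: "nat \<Rightarrow> nat \<Rightarrow> 'e::field_char_0 \<Rightarrow> 'e poly fract" where
  "delta r' l x = (if l = 0 then 0 else (THE R. is_pade r' l x R)) - Fract [:x:] 1"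


section \<open>The conditions\<close>

definition K_set :: "nat \<Rightarrow> ereal set" where
  "K_set r' = {ereal (real n / 2) | n. 1 \<le> n \<and> n \<le> 2 * r' + 1} \<union> {\<infinity>}"

definition l_of :: "nat \<Rightarrow> ereal \<Rightarrow> nat" where
  "l_of r' k' =
     (if k' = \<infinity> then 0
      else if k' \<le> ereal (real (r' div 2 + 1)) then nat \<lceil>real_of_ereal k'\<rceil>
      else nat (int r' + 1 - \<lceil>real_of_ereal k'\<rceil>))"

text \<open>The clauses are mutually exclusive for half-integral \<open>k'\<close> between $1/2$ and $r'+1/2$, and
  one of them applies. Those with division by \<open>x\<close> or \<open>v (\<Lambda> * x)\<close> finite force
  \<open>x \<noteq> 0\<close>, because \<open>v 0 = \<infinity>\<close>.\<close>

definition cond_C_fin ::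
    "('e::field_char_0 \<Rightarrow> ereal) \<Rightarrow> real \<Rightarrow> real \<Rightarrow> 'e \<Rightarrow> 'e \<Rightarrow> 'e \<Rightarrow> 'e \<Rightarrow> bool" where
  "cond_C_fin v r' k' \<Lambda> \<Theta> \<Omega> x \<longleftrightarrow> (let k = real_of_int \<lfloor>k'\<rfloor> in
     (k' = 1/2 \<longrightarrow>
        v \<Lambda> = ereal (r' - 1) \<and> v (\<Theta> / \<Omega>) = ereal (- r' + 1) \<and>
        v \<Theta> \<le> v x \<and> v \<Omega> \<le> 0) \<and>
     (1/2 < k' \<and> k' = k + 1/2 \<and> k' \<le> r' / 2 \<longrightarrow>
        v \<Lambda> = ereal (r' - k - 1) \<and> v (\<Theta> / \<Omega>) = ereal (- r' + 2 * k') \<and>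
        v \<Theta> \<le> v x \<and> -1 \<le> v \<Omega> \<and> v \<Omega> \<le> 0) \<and>
     ((r' + 1) / 2 \<le> k' \<and> k' = k + 1/2 \<and> k' < r' \<longrightarrow>
        v (\<Lambda> * x) = ereal (r' - k - 1) \<and> v (\<Theta> / \<Omega> / x^2) = ereal (- r' + 2 * k') \<and>
        v x < 0 \<and> v x \<le> v \<Theta> \<and> v \<Theta> \<le> 0 \<and> -1 \<le> v \<Omega> \<and> v \<Omega> \<le> 0) \<and>
     (k' = r' + 1/2 \<longrightarrow>
        v \<Lambda> = -1 \<and> v (\<Theta> / \<Omega>) = ereal (r' + 1) \<and>
        v x + ereal r' \<le> v \<Theta> \<and> v \<Theta> \<le> 0) \<and>
     (1/2 < k' \<and> k' = k \<and> k' \<le> r' / 2 \<longrightarrow>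
        v (\<Lambda> * \<Theta>) = ereal (k - 1) \<and> v (\<Theta> * \<Omega>) = ereal (- r' + 2 * k' - 1) \<and>
        v \<Theta> \<le> v x \<and> -1 \<le> v \<Omega> \<and> v \<Omega> \<le> 0) \<and>
     ((r' + 1) / 2 \<le> k' \<and> k' = k \<and> k' < r' \<longrightarrow>
        v (\<Lambda> * \<Theta> / x) = ereal (k - 1) \<and> v (\<Theta> * \<Omega> / x^2) = ereal (- r' + 2 * k' - 1) \<and>
        v x < 0 \<and> v x \<le> v \<Theta> \<and> v \<Theta> \<le> 0 \<and> -1 \<le> v \<Omega> \<and> v \<Omega> \<le> 0) \<and>
     (k' = r' \<longrightarrow>
        v (\<Lambda> * \<Theta> / x) = ereal (r' - 1) \<and> v (\<Theta> * \<Omega> / x^2) = ereal (r' - 1) \<and>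
        v x \<le> v \<Theta> \<and> v \<Theta> \<le> v x + ereal r' \<and> v \<Omega> \<le> 0 \<and> v \<Theta> \<le> 0))"

definition cond_C ::
    "('e::field_char_0 \<Rightarrow> ereal) \<Rightarrow> nat \<Rightarrow> ereal \<Rightarrow> 'e \<Rightarrow> 'e \<Rightarrow> 'e \<Rightarrow> 'e \<Rightarrow> bool" where
  "cond_C v r' k' \<Lambda> \<Theta> \<Omega> x \<longleftrightarrow>
     (if k' = \<infinity> then
        v \<Lambda> = -1 \<and> v (\<Theta> / \<Omega>) = ereal (real r' + 1) \<and> v \<Theta> \<le> 0
      else cond_C_fin v (real r') (real_of_ereal k') \<Lambda> \<Theta> \<Omega> x)"

definition C_solution ::
    "('e::field_char_0 \<Rightarrow> ereal) \<Rightarrow> nat \<Rightarrow> (nat \<Rightarrow> nat) \<Rightarrow> (nat \<Rightarrow> ereal) \<Rightarrow>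
     (nat \<Rightarrow> 'e) \<Rightarrow> (nat \<Rightarrow> 'e) \<Rightarrow> (nat \<Rightarrow> 'e) \<Rightarrow> bool" where
  "C_solution v f r k' \<Lambda> \<Theta> x \<longleftrightarrow>
     (\<forall>j<f. \<Lambda> j \<noteq> 0 \<and> \<Theta> j \<noteq> 0 \<and> cond_C v (r j) (k' j) (\<Lambda> j) (\<Theta> j) (\<Theta> (nxt f j)) (x j))"

definition valid_k ::
    "('e::field_char_0 \<Rightarrow> ereal) \<Rightarrow> nat \<Rightarrow> (nat \<Rightarrow> nat) \<Rightarrow> (nat \<Rightarrow> ereal) \<Rightarrow> bool" where
  "valid_k v f r k' \<longleftrightarrow> (\<exists>\<Lambda> \<Theta> x. C_solution v f r k' \<Lambda> \<Theta> x)"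


section \<open>The modules\<close>

definition E1_gen ::
    "nat \<Rightarrow> nat \<Rightarrow> ('e::field_char_0 \<Rightarrow> ereal) \<Rightarrow> (nat \<Rightarrow> 'e) \<Rightarrow> (nat \<Rightarrow> 'e) \<Rightarrow>
     (nat \<Rightarrow> 'e poly fract) \<Rightarrow> 'e calDmod" where
  "E1_gen p f v \<theta>1 \<rho> \<Delta> =
     (tup f (\<lambda>j. fps_const (\<theta>1 j)),
      tup f (\<lambda>j. fps_const (\<theta>1 j) * fps_const (1 / of_nat p) *
                 (fps_const (\<rho> (prv f j)) + subst_gamma p v (\<Delta> (prv f j)))))"

definition E2_gen :: "nat \<Rightarrow> (nat \<Rightarrow> 'e::field_char_0) \<Rightarrow> 'e calDmod" where
  "E2_gen f \<theta>2 = (0, tup f (\<lambda>j. fps_const (\<theta>2 j)))"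

definition M_mod ::
    "nat \<Rightarrow> nat \<Rightarrow> ('e::field_char_0 \<Rightarrow> ereal) \<Rightarrow> 'e set \<Rightarrow> ('e \<Rightarrow> 'e) \<Rightarrow>
     (nat \<Rightarrow> 'e) \<Rightarrow> (nat \<Rightarrow> 'e) \<Rightarrow> (nat \<Rightarrow> 'e) \<Rightarrow> (nat \<Rightarrow> 'e poly fract) \<Rightarrow> 'e calDmod set" where
  "M_mod p f v K frob \<theta>1 \<theta>2 \<rho> \<Delta> =
     {smul s (E1_gen p f v \<theta>1 \<rho> \<Delta>) + smul t (E2_gen f \<theta>2) | s t.
        s \<in> S_O p f v K frob \<and> t \<in> S_O p f v K frob}"

end

theory Submission imports Defs begin

text \<open>A component of $S_{\mathcal O}$ consists of the series $\sum_i c_i u^i/i!$ with integral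
  $c_i \to 0$; that all families of such series occur comes down to the idempotents of
  $\mathbf Z_{p^f} \otimes \mathcal O$, which exist because the residue field of $\mathbf Q_{p^f}$ has
  $p^f$ elements.

  Put $T = u/p - 1$. At $e_j$, the element $sE_1 + tE_2$ lies in the filtration iff
  $s \in T^{w-r_j}$ and $\Theta_j t \equiv (x_j + \log(1+T))\,s$ modulo $T^w$. Frobenius substitutes
  $u^p/p - 1$ for $T$, and this is congruent to $\gamma - 1$ modulo $p$. Hence the image of
  $sE_1 + tE_2$ has the coordinates $p\Lambda_j\phi(s)$ and, up to small terms,
  $\Lambda_j\Theta_{j+1}^{-1}(\Theta_j t - R s)$ evaluated at $u^p/p - 1$, where $R = Q/P$ is the Pade
  approximant. As $P(-1)$ is a unit, it suffices to treat $\Theta_j P t - Q s$. It vanishes to order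
  \<open>w\<close>, so that only its top coefficients have to be estimated. For these and for the
  coefficients of \<open>s\<close> one solves the congruence for the unknown low coefficients; the matrices
  are Cauchy matrices $(1/(i-b))$ with indices below \<open>p\<close>, whose inverses are integral.\<close>

section \<open>Valuations\<close>

text \<open>Everything is read in the variable X = u/p = 1 + T. A series in X with bounded
  coefficients, evaluated at u^p/p, lies in the divided power ring, because v((pn)!) = n + v(n!)
  pays for p^n; so the image of Frobenius is controlled by coefficient bounds in X alone. Since w <
  p, v(p^n/n!) is n for n < w and at least w beyond, so modulo p^w only the Taylor coefficients of
  degree n < w matter, and these are a priori divisible by p^n. The work is to sharpen this to r - 1
  - v(\<Lambda>) for the coefficients of s and to r - v(\<Lambda>) + v(\<Omega>) for the combination
  in the second coordinate. If v(\<Theta>) <= v(x), the top rows of the congruence are solved for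
  the low coefficients of s directly. If v(x) <= v(\<Theta>) <= 0, one divides by x instead, and in
  the range v(x) < 0 a bound then improves itself. The single approximant that depends on x, r = 2m
  and l = m + 1, is a perturbation of a regular one by a coefficient b with v(b) >= -v(x) > 0, so
  that its denominator is still a unit at T = -1.\<close>

lemma tendsto_PInfty_ereal_iff:
  "(a \<longlonglongrightarrow> (\<infinity>::ereal)) \<longleftrightarrow> (\<forall>B::real. \<exists>n0. \<forall>n\<ge>n0. ereal B \<le> a n)"
proof
  assume "a \<longlonglongrightarrow> \<infinity>"
  then show "\<forall>B::real. \<exists>n0. \<forall>n\<ge>n0. ereal B \<le> a n"
    unfolding tendsto_PInfty eventually_sequentially by (meson less_imp_le)
next
  assume *: "\<forall>B::real. \<exists>n0. \<forall>n\<ge>n0. ereal B \<le> a n"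
  show "a \<longlonglongrightarrow> \<infinity>"
    unfolding tendsto_PInfty eventually_sequentially
  proof
    fix r :: real
    from * obtain n0 where "\<forall>n\<ge>n0. ereal (r + 1) \<le> a n" by blast
    moreover have "ereal r < ereal (r + 1)" by simp
    ultimately show "\<exists>N. \<forall>n\<ge>N. ereal r < a n" using less_le_trans by blast
  qed
qed

locale pval =
  fixes p :: nat and v :: "'e::field_char_0 \<Rightarrow> ereal"
  assumes prime: "prime p" and val: "extends_padic_valuation p v"
begin

text \<open>A lower bound instead of an equation: it holds for 0 at every level, so estimates of
  sums and products need no case distinction and no extended real arithmetic.\<close>

definition vge :: "real \<Rightarrow> 'e \<Rightarrow> bool" where
  "vge B x \<longleftrightarrow> ereal B \<le> v x"

text \<open>The value at 0 is 0, since \<open>real_of_ereal\<close> sends infinity to 0; this is why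
  the rules for \<open>vv\<close> ask for nonzero arguments while bounds are stated with
  \<open>vge\<close>.\<close>

definition vv :: "'e \<Rightarrow> real" where
  "vv x = real_of_ereal (v x)"

lemma p_gt_1: "1 < p" using prime prime_gt_1_nat by blast
lemma p_nz [simp]: "p \<noteq> 0" "0 < p" using p_gt_1 by auto

lemma v_eq_infinity: "v x = \<infinity> \<longleftrightarrow> x = 0"
  and v_not_minf: "v x \<noteq> - \<infinity>"
  and v_mult: "v (x * y) = v x + v y"
  and v_add: "min (v x) (v y) \<le> v (x + y)"
  and v_p: "v (of_nat p) = 1"
  using val unfolding extends_padic_valuation_def by auto

lemma v_zero [simp]: "v 0 = \<infinity>" using v_eq_infinity by blast

lemma v_vv: "x \<noteq> 0 \<Longrightarrow> v x = ereal (vv x)"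
  unfolding vv_def using v_eq_infinity[of x] v_not_minf[of x] by (cases "v x") auto

lemma vv_mult: "x \<noteq> 0 \<Longrightarrow> y \<noteq> 0 \<Longrightarrow> vv (x * y) = vv x + vv y"
  using v_mult[of x y] v_vv[of x] v_vv[of y] v_vv[of "x * y"] by simp

lemma vv_one [simp]: "vv 1 = 0"
  using vv_mult[OF one_neq_zero one_neq_zero] by simp

lemma vv_minus_one [simp]: "vv (- 1) = 0"
  using vv_mult[of "-1" "-1"] by simp

lemma vv_uminus [simp]: "vv (- x) = vv x"
proof (cases "x = 0")
  case False
  then show ?thesis using vv_mult[of "-1" x] by simp
qed simp

lemma vv_p [simp]: "vv (of_nat p) = 1"
  by (simp add: vv_def v_p)

lemma vv_inverse: "x \<noteq> 0 \<Longrightarrow> vv (inverse x) = - vv x"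
  using vv_mult[of x "inverse x"] by simp

lemma vv_divide: "x \<noteq> 0 \<Longrightarrow> y \<noteq> 0 \<Longrightarrow> vv (x / y) = vv x - vv y"
  by (simp add: divide_inverse vv_mult vv_inverse)

lemma vv_power: "x \<noteq> 0 \<Longrightarrow> vv (x ^ n) = real n * vv x"
  by (induction n) (auto simp: vv_mult algebra_simps)

lemma vge_iff: "x \<noteq> 0 \<Longrightarrow> vge B x \<longleftrightarrow> B \<le> vv x"
  by (simp add: vge_def v_vv)

lemma vge_zero [simp]: "vge B 0" by (simp add: vge_def)

lemma vge_mono: "vge B x \<Longrightarrow> C \<le> B \<Longrightarrow> vge C x"
  unfolding vge_def by (meson ereal_less_eq(3) order_trans)

lemma vge_add: "vge B x \<Longrightarrow> vge B y \<Longrightarrow> vge B (x + y)"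
  unfolding vge_def using v_add[of x y] by (meson min.boundedI order_trans)

lemma vge_uminus [simp]: "vge B (- x) = vge B x"
  by (cases "x = 0") (auto simp: vge_iff)

lemma vge_diff: "vge B x \<Longrightarrow> vge B y \<Longrightarrow> vge B (x - y)"
  using vge_add[of B x "-y"] by simp

lemma vge_minus_commute: "vge B (x - y) \<longleftrightarrow> vge B (y - x)"
  by (metis minus_diff_eq vge_uminus)

lemma vge_mult: "vge B x \<Longrightarrow> vge C y \<Longrightarrow> vge (B + C) (x * y)"
  by (cases "x = 0"; cases "y = 0") (auto simp: vge_iff vv_mult)

lemma vge_mult_left: "a \<noteq> 0 \<Longrightarrow> vge B (a * x) \<longleftrightarrow> vge (B - vv a) x"
  by (cases "x = 0") (auto simp: vge_iff vv_mult)

lemma vge_divide: "a \<noteq> 0 \<Longrightarrow> vge B (x / a) \<longleftrightarrow> vge (B + vv a) x"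
  by (cases "x = 0") (auto simp: vge_iff vv_divide)

lemma vge_sum: "(\<And>i. i \<in> A \<Longrightarrow> vge B (f i)) \<Longrightarrow> vge B (sum f A)"
  by (induction A rule: infinite_finite_induct) (auto intro: vge_add)

lemma vge_one: "vge 0 1" by (simp add: vge_iff)

lemma vge_of_nat: "vge 0 (of_nat n)"
  by (induction n) (auto intro: vge_add vge_one)

lemma vge_of_int: "vge 0 (of_int n)"
proof (cases n rule: int_cases2)
  case (nonneg m)
  then show ?thesis using vge_of_nat[of m] by simp
next
  case (nonpos m)
  then show ?thesis using vge_of_nat[of m] by simp
qed

lemma vge_mult0: "vge B x \<Longrightarrow> vge 0 y \<Longrightarrow> vge B (x * y)"
  using vge_mult[of B x 0 y] by simp

lemma vge_0mult: "vge 0 y \<Longrightarrow> vge B x \<Longrightarrow> vge B (y * x)"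
  using vge_mult[of 0 y B x] by simp

lemma vge_power: "vge B x \<Longrightarrow> vge (real n * B) (x ^ n)"
proof (induction n)
  case (Suc n)
  then show ?case using vge_mult[of B x "real n * B" "x ^ n"] by (simp add: algebra_simps)
qed (simp add: vge_one)

lemma vge_power0: "vge 0 x \<Longrightarrow> vge 0 (x ^ n)"
  using vge_power[of 0 x n] by simp

text \<open>Write 1 = p a + n b. If n had positive valuation, so would the right-hand side.\<close>

lemma vv_of_int_unit:
  assumes "\<not> int p dvd n"
  shows "vv (of_int n) = 0"
proof -
  have n0: "n \<noteq> 0" using assms by auto
  have "coprime (int p) n" using prime assms by (simp add: prime_imp_coprime)
  then obtain a b where ab: "int p * a + n * b = 1"
    using bezout_int[of "int p" n] by (metis coprime_imp_gcd_eq_1 mult.commute)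
  have "0 \<le> vv (of_int n)" using vge_of_int[of n] n0 by (simp add: vge_iff)
  moreover have "vv (of_int n) \<le> 0"
  proof (rule ccontr)
    assume "\<not> ?thesis"
    then obtain e where e: "e = min 1 (vv (of_int n))" "e > 0" by simp
    have "vge e (of_nat p * of_int a)"
      using vge_mult0[of e "of_nat p" "of_int a"] vge_of_int e(1) by (simp add: vge_iff)
    moreover have "vge e (of_int n * of_int b)"
      using vge_mult0[of e "of_int n" "of_int b"] vge_of_int e(1) n0 by (simp add: vge_iff)
    ultimately have "vge e (of_nat p * of_int a + of_int n * of_int b)" by (rule vge_add)
    moreover have "of_nat p * of_int a + of_int n * of_int b = (1::'e)"
      using ab by (metis of_int_1 of_int_add of_int_mult of_int_of_nat_eq)
    ultimately show False using e(2) by (simp add: vge_iff)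
  qed
  ultimately show ?thesis by simp
qed

lemma vv_of_nat_unit: "0 < n \<Longrightarrow> n < p \<Longrightarrow> vv (of_nat n) = 0"
  using vv_of_int_unit[of "int n"] by (simp add: nat_dvd_not_less)

lemma vge_div_nat: "0 < n \<Longrightarrow> n < p \<Longrightarrow> vge B (x / of_nat n) \<longleftrightarrow> vge B x"
  by (simp add: vge_divide vv_of_nat_unit)

text \<open>The isosceles property of an ultrametric: a perturbation smaller than x changes neither
  its valuation nor its being nonzero.\<close>

lemma vv_eq_of_close:
  assumes "x \<noteq> 0" "vge B (y - x)" "vv x < B"
  shows "y \<noteq> 0" "vv y = vv x"
proof -
  show y: "y \<noteq> 0"
    using assms vge_uminus[of B x] by (auto simp: vge_iff)
  have "vge (vv x) (y - x)" using assms vge_mono[of B "y - x" "vv x"] by simp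
  then have "vge (vv x) ((y - x) + x)" by (rule vge_add) (simp add: assms vge_iff)
  then have 1: "vv x \<le> vv y" using y by (simp add: vge_iff)
  show "vv y = vv x"
  proof (rule ccontr)
    assume "vv y \<noteq> vv x"
    with 1 obtain e where e: "e = min B (vv y)" "vv x < e" using assms by auto
    have "vge e (y - (y - x))"
      by (rule vge_diff) (use e y assms vge_mono[of B "y - x" e] in \<open>auto simp: vge_iff\<close>)
    then show False using e assms by (simp add: vge_iff)
  qed
qed

lemma vge_all_imp_zero: "(\<And>n::nat. vge (real n) x) \<Longrightarrow> x = 0"
proof (rule ccontr)
  assume *: "\<And>n::nat. vge (real n) x" and "x \<noteq> 0"
  then have "real n \<le> vv x" for n using vge_iff by blast
  then show False by (meson not_le reals_Archimedean2)
qed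

lemma vge_of_int_mod_p: "vge 1 (of_int n) \<longleftrightarrow> int p dvd n"
proof
  assume *: "vge 1 (of_int n)"
  show "int p dvd n"
  proof (rule ccontr)
    assume "\<not> ?thesis"
    then have "n \<noteq> 0" "vv (of_int n) = 0" using vv_of_int_unit by auto
    then show False using * by (simp add: vge_iff)
  qed
next
  assume "int p dvd n"
  then obtain k where "n = int p * k" by blast
  then have "(of_int n :: 'e) = of_nat p * of_int k" by simp
  then show "vge 1 (of_int n)"
    using vge_mult0[of 1 "of_nat p" "of_int k"] vge_of_int by (simp add: vge_iff)
qed

subsection \<open>Null sequences and series\<close>

definition vnull :: "(nat \<Rightarrow> 'e) \<Rightarrow> bool" where
  "vnull a \<longleftrightarrow> (\<forall>B. \<exists>n0. \<forall>n\<ge>n0. vge B (a n))"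

lemma vlim_iff: "vlim v a s \<longleftrightarrow> vnull (\<lambda>n. a n - s)"
  unfolding vlim_def vnull_def tendsto_PInfty_ereal_iff vge_def ..

lemma vnull_add: "vnull a \<Longrightarrow> vnull b \<Longrightarrow> vnull (\<lambda>n. a n + b n)"
  unfolding vnull_def
proof
  fix B assume "\<forall>B. \<exists>n0. \<forall>n\<ge>n0. vge B (a n)" "\<forall>B. \<exists>n0. \<forall>n\<ge>n0. vge B (b n)"
  then obtain n0 n1 where "\<forall>n\<ge>n0. vge B (a n)" "\<forall>n\<ge>n1. vge B (b n)" by blast
  then have "\<forall>n\<ge>max n0 n1. vge B (a n + b n)" by (simp add: vge_add)
  then show "\<exists>n0. \<forall>n\<ge>n0. vge B (a n + b n)" by blast
qed

lemma vnull_zero: "vnull (\<lambda>n. 0)" by (simp add: vnull_def)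

lemma vnull_sum: "(\<And>i. i \<in> A \<Longrightarrow> vnull (\<lambda>n. a i n)) \<Longrightarrow> vnull (\<lambda>n. \<Sum>i\<in>A. a i n)"
  by (induction A rule: infinite_finite_induct) (auto intro: vnull_add vnull_zero)

lemma vnull_uminus: "vnull (\<lambda>n. - a n) = vnull a"
  unfolding vnull_def vge_uminus ..

lemma vnull_diff: "vnull a \<Longrightarrow> vnull b \<Longrightarrow> vnull (\<lambda>n. a n - b n)"
  using vnull_add[of a "\<lambda>n. - b n"] by (simp add: vnull_uminus)

lemma vnull_mult_bounded:
  assumes "vnull a" "\<And>n. vge C (b n)"
  shows "vnull (\<lambda>n. a n * b n)"
  unfolding vnull_def
proof
  fix B
  from assms(1) obtain n0 where "\<forall>n\<ge>n0. vge (B - C) (a n)" unfolding vnull_def by blast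
  then show "\<exists>n0. \<forall>n\<ge>n0. vge B (a n * b n)"
    using vge_mult[of "B - C" _ C, OF _ assms(2)] by (intro exI[of _ n0]) simp
qed

lemma vge_exists: "\<exists>B. vge B c"
  by (cases "c = 0") (auto simp: vge_iff)

lemma vnull_cmult: "vnull a \<Longrightarrow> vnull (\<lambda>n. c * a n)"
  using vnull_mult_bounded[of a _ "\<lambda>n. c"] vge_exists[of c] by (auto simp: mult.commute)

lemma vnull_mono_index:
  assumes "vnull a" "\<And>n. n \<le> h n"
  shows "vnull (\<lambda>n. a (h n))"
  using assms unfolding vnull_def by (meson order_trans)

lemma vnull_shift: "vnull (\<lambda>n. a (n + k)) \<longleftrightarrow> vnull a"
proof
  assume *: "vnull (\<lambda>n. a (n + k))"
  show "vnull a" unfolding vnull_def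
  proof
    fix B from * obtain n0 where "\<forall>n\<ge>n0. vge B (a (n + k))" unfolding vnull_def by blast
    then have "vge B (a n)" if "n \<ge> n0 + k" for n
      using that spec[of "\<lambda>n. n \<ge> n0 \<longrightarrow> vge B (a (n + k))" "n - k"] by simp
    then show "\<exists>n0. \<forall>n\<ge>n0. vge B (a n)" by blast
  qed
qed (auto intro: vnull_mono_index)

lemma vnull_bounded: "vnull a \<Longrightarrow> \<exists>C. \<forall>n. vge C (a n)"
proof -
  assume "vnull a"
  then obtain n0 where n0: "\<forall>n\<ge>n0. vge 0 (a n)" unfolding vnull_def by blast
  have "\<exists>C. \<forall>n<m. vge C (a n)" for m
  proof (induction m)
    case (Suc m)
    then obtain C where "\<forall>n<m. vge C (a n)" by blast
    moreover obtain D where "vge D (a m)" using vge_exists by blast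
    ultimately have "\<forall>n<Suc m. vge (min C D) (a n)"
      by (metis less_Suc_eq min.cobounded1 min.cobounded2 vge_mono)
    then show ?case by blast
  qed auto
  then obtain C where "\<forall>n<n0. vge C (a n)" by blast
  then have "vge (min C 0) (a n)" for n
    using n0 by (metis min.cobounded1 min.cobounded2 not_le vge_mono)
  then show ?thesis by blast
qed

lemma vnull_const: "vnull (\<lambda>n. c) \<Longrightarrow> c = 0"
  unfolding vnull_def by (rule vge_all_imp_zero) blast

lemma vnull_p_power: "vnull (\<lambda>n. of_nat (p ^ n))"
  unfolding vnull_def
proof
  fix B
  obtain n0 where "B \<le> real n0" using real_arch_simple by blast
  then have "\<forall>n\<ge>n0. vge B (of_nat (p ^ n))"
    by (auto simp: vge_iff vv_power)
  then show "\<exists>n0. \<forall>n\<ge>n0. vge B (of_nat (p ^ n))" by blast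
qed

definition vsums :: "(nat \<Rightarrow> 'e) \<Rightarrow> 'e \<Rightarrow> bool" where
  "vsums a s \<longleftrightarrow> vnull (\<lambda>n. (\<Sum>i<n. a i) - s)"

lemma vsums_unique: "vsums a s \<Longrightarrow> vsums a t \<Longrightarrow> s = t"
  using vnull_diff[of "\<lambda>n. (\<Sum>i<n. a i) - s" "\<lambda>n. (\<Sum>i<n. a i) - t"] vnull_const[of "t - s"]
  unfolding vsums_def by simp

lemma vsum_eqI: "vsums a s \<Longrightarrow> vsum v a = s"
  unfolding vsum_def vlim_iff vsums_def[symmetric] by (rule the_equality) (auto intro: vsums_unique)

lemma vsums_add: "vsums a s \<Longrightarrow> vsums b t \<Longrightarrow> vsums (\<lambda>i. a i + b i) (s + t)"
  unfolding vsums_def using vnull_add[of "\<lambda>n. (\<Sum>i<n. a i) - s" "\<lambda>n. (\<Sum>i<n. b i) - t"]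
  by (simp add: sum.distrib algebra_simps)

lemma vsums_cmult: "vsums a s \<Longrightarrow> vsums (\<lambda>i. c * a i) (c * s)"
  unfolding vsums_def using vnull_cmult[of "\<lambda>n. (\<Sum>i<n. a i) - s" c]
  by (simp add: sum_distrib_left algebra_simps)

lemma vsums_zero: "vsums (\<lambda>i. 0) 0"
  by (simp add: vsums_def vnull_zero)

lemma vsums_sum:
  "(\<And>k. k \<in> A \<Longrightarrow> vsums (\<lambda>i. a k i) (s k)) \<Longrightarrow> vsums (\<lambda>i. \<Sum>k\<in>A. a k i) (\<Sum>k\<in>A. s k)"
  by (induction A rule: infinite_finite_induct) (auto intro: vsums_add vsums_zero)

lemma vsums_vge:
  assumes "vsums a s" "\<And>i. vge B (a i)"
  shows "vge B s"
proof -
  obtain n where "vge B ((\<Sum>i<n. a i) - s)"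
    using assms(1)[unfolded vsums_def vnull_def, rule_format, of B] by blast
  moreover have "vge B (\<Sum>i<n. a i)" using assms(2) by (intro vge_sum) auto
  ultimately have "vge B ((\<Sum>i<n. a i) - ((\<Sum>i<n. a i) - s))" by (metis vge_diff)
  then show ?thesis by (simp add: algebra_simps)
qed

lemma vsums_finite:
  assumes "\<And>i. i \<ge> N \<Longrightarrow> a i = 0"
  shows "vsums a (\<Sum>i<N. a i)"
proof -
  have "vge B ((\<Sum>i<n. a i) - (\<Sum>i<N. a i))" if "n \<ge> N" for n B
  proof -
    have "(\<Sum>i<n. a i) = (\<Sum>i<N. a i)"
      using that assms by (intro sum.mono_neutral_right) auto
    then show ?thesis by simp
  qed
  then show ?thesis unfolding vsums_def vnull_def by (intro allI exI[of _ N] impI)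
qed

lemma vsums_Suc: "vsums (\<lambda>i. a (Suc i)) s \<Longrightarrow> vsums a (a 0 + s)"
proof -
  assume "vsums (\<lambda>i. a (Suc i)) s"
  then have "vnull (\<lambda>n. (\<Sum>i<n + 1. a i) - (a 0 + s))"
    unfolding vsums_def by (simp add: sum.lessThan_Suc_shift algebra_simps del: sum.lessThan_Suc)
  then show ?thesis unfolding vsums_def using vnull_shift[of "\<lambda>n. (\<Sum>i<n. a i) - (a 0 + s)" 1] by simp
qed

lemma vlim_vge:
  assumes "vlim v a s" "\<And>n. vge B (a n)"
  shows "vge B s"
proof -
  obtain n where "vge B (a n - s)" using assms(1)[unfolded vlim_iff vnull_def, rule_format, of B] by blast
  then have "vge B (a n - (a n - s))" using assms(2) by (metis vge_diff)
  then show ?thesis by (simp add: algebra_simps)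
qed

end

section \<open>Lattices in finite-dimensional spaces over the p-adic numbers\<close>

abbreviation (input) typ_ring :: "'e::field_char_0 ring" where "typ_ring \<equiv> ring_of_type_algebra"

lemma typ_ring_sel:
  "carrier (typ_ring :: 'e ring) = UNIV"
  "\<zero>\<^bsub>typ_ring :: 'e ring\<^esub> = 0"
  "\<one>\<^bsub>typ_ring :: 'e ring\<^esub> = 1"
  "x \<oplus>\<^bsub>typ_ring\<^esub> y = x + y"
  "x \<otimes>\<^bsub>typ_ring\<^esub> y = x * y" for x y :: "'e::field_char_0"
  by (auto simp: ring_of_type_algebra_def)

lemma combine_eq_sum:
  fixes Ks Us :: "'e::field_char_0 list"
  shows "ring.combine typ_ring Ks Us = (\<Sum>i<min (length Ks) (length Us). Ks ! i * Us ! i)"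
proof -
  interpret ring "typ_ring :: 'e ring" by (rule ring_from_type_algebra)
  show ?thesis
  proof (induction Ks arbitrary: Us)
    case Nil
    show ?case by (simp add: typ_ring_sel)
  next
    case (Cons k Ks)
    show ?case
    proof (cases Us)
      case Nil
      then show ?thesis by (simp add: typ_ring_sel)
    next
      case (Cons u Us')
      then show ?thesis
        using Cons.IH[of Us']
        by (simp add: typ_ring_sel sum.lessThan_Suc_shift del: sum.lessThan_Suc)
    qed
  qed
qed

lemma independentI:
  fixes s :: "nat \<Rightarrow> 'e::field_char_0"
  assumes F: "subfield F (typ_ring :: 'e ring)"
    and triv: "\<And>a. (\<And>i. i < g \<Longrightarrow> a i \<in> F) \<Longrightarrow> (\<Sum>i<g. a i * s i) = 0 \<Longrightarrow> \<forall>i<g. a i = 0"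
  shows "ring.independent typ_ring F (map s [0..<g])"
proof (rule ring.trivial_combine_imp_independent[OF ring_from_type_algebra F])
  fix Ks assume Ks: "set Ks \<subseteq> F"
    and 0: "ring.combine typ_ring Ks (map s [0..<g]) = \<zero>\<^bsub>typ_ring\<^esub>"
  \<comment> \<open>\<open>combine\<close> stops at the end of the shorter list, so a short list of
    scalars is padded with zeros.\<close>
  define a where "a = (\<lambda>i. if i < length Ks then Ks ! i else 0)"
  have F0: "0 \<in> F"
    using subringE(2)[OF subfieldE(1)[OF F]] by (simp add: typ_ring_sel)
  have "(\<Sum>i<g. a i * s i) = (\<Sum>i<min (length Ks) g. a i * s i)"
    by (rule sum.mono_neutral_right) (auto simp: a_def)
  also have "\<dots> = (\<Sum>i<min (length Ks) g. Ks ! i * map s [0..<g] ! i)"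
    by (rule sum.cong) (auto simp: a_def)
  also have "\<dots> = 0" using 0 by (simp add: combine_eq_sum typ_ring_sel)
  finally have "\<forall>i<g. a i = 0"
    using Ks F0 by (intro triv) (auto simp: a_def)
  then show "set (take (length (map s [0..<g])) Ks) \<subseteq> {\<zero>\<^bsub>typ_ring\<^esub>}"
    unfolding a_def by (auto simp: in_set_conv_nth typ_ring_sel split: if_splits)
qed (simp add: typ_ring_sel)

lemma sum_in_Span:
  fixes s :: "nat \<Rightarrow> 'e::field_char_0"
  assumes F: "subfield F (typ_ring :: 'e ring)" and "\<And>i. i < g \<Longrightarrow> a i \<in> F"
  shows "(\<Sum>i<g. a i * s i) \<in> ring.Span typ_ring F (map s [0..<g])"
proof -
  have "ring.combine typ_ring (map a [0..<g]) (map s [0..<g]) = (\<Sum>i<g. a i * s i)"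
    by (simp add: combine_eq_sum)
  then show ?thesis
    using ring.Span_mem_iff_length_version[OF ring_from_type_algebra F, of "map s [0..<g]"] assms(2)
    by (auto simp: typ_ring_sel intro!: exI[of _ "map a [0..<g]"])
qed

text \<open>Applied to K over the p-adic numbers, it yields at least f elements that are independent
  modulo p, hence at least p^f residue classes in K.\<close>

lemma dimension_le_spanning:
  fixes s :: "nat \<Rightarrow> 'e::field_char_0"
  assumes F: "subfield F (typ_ring :: 'e ring)"
    and dim: "ring.dimension typ_ring d F V"
    and triv: "\<And>a. (\<And>i. i < g \<Longrightarrow> a i \<in> F) \<Longrightarrow> (\<Sum>i<g. a i * s i) = 0 \<Longrightarrow> \<forall>i<g. a i = 0"
    and span: "\<And>x. x \<in> V \<Longrightarrow> \<exists>a. (\<forall>i<g. a i \<in> F) \<and> x = (\<Sum>i<g. a i * s i)"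
  shows "d \<le> g"
proof -
  interpret ring "typ_ring :: 'e ring" by (rule ring_from_type_algebra)
  obtain Vs where Vs: "independent F Vs" "length Vs = d" "Span F Vs = V" "set Vs \<subseteq> carrier typ_ring"
    using exists_base[OF F dim] by blast
  then have "set Vs \<subseteq> V" using Span_base_incl[OF F] by blast
  then have "set Vs \<subseteq> Span F (map s [0..<g])"
  proof (intro subsetI)
    fix x assume "x \<in> set Vs"
    then obtain a where "\<forall>i<g. a i \<in> F" "x = (\<Sum>i<g. a i * s i)"
      using span \<open>set Vs \<subseteq> V\<close> by blast
    then show "x \<in> Span F (map s [0..<g])" using sum_in_Span[OF F, of g a s] by simp
  qed
  then have "length Vs \<le> length (map s [0..<g])"
    using independent_length_le[OF F Vs(1) independentI[OF F triv]] by blast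
  then show ?thesis using Vs(2) by simp
qed

locale padic = pval +
  assumes pf: "padic_field p v"
begin

section \<open>The p-adic numbers as the closure of the rationals\<close>

abbreviation Qp :: "'a set" where "Qp \<equiv> Qp_in v"

lemma Qp_iff: "x \<in> Qp \<longleftrightarrow> (\<exists>q :: nat \<Rightarrow> rat. vnull (\<lambda>n. of_rat (q n) - x))"
  by (simp add: Qp_in_def vlim_iff)

lemma Qp_of_rat: "of_rat q \<in> Qp"
  unfolding Qp_iff by (rule exI[of _ "\<lambda>_. q"]) (simp add: vnull_zero)

lemma Qp_of_int: "of_int n \<in> Qp" using Qp_of_rat[of "of_int n"] by simp
lemma Qp_of_nat: "of_nat n \<in> Qp" using Qp_of_rat[of "of_nat n"] by simp

lemma Qp_add: "x \<in> Qp \<Longrightarrow> y \<in> Qp \<Longrightarrow> x + y \<in> Qp"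
proof -
  assume "x \<in> Qp" "y \<in> Qp"
  then obtain q q' where "vnull (\<lambda>n. of_rat (q n) - x)" "vnull (\<lambda>n. of_rat (q' n) - y)"
    unfolding Qp_iff by blast
  then have "vnull (\<lambda>n. of_rat (q n + q' n) - (x + y))"
    using vnull_add[of "\<lambda>n. of_rat (q n) - x" "\<lambda>n. of_rat (q' n) - y"]
    by (simp add: of_rat_add algebra_simps)
  then show ?thesis unfolding Qp_iff by (rule exI[of _ "\<lambda>n. q n + q' n"])
qed

lemma Qp_mult: "x \<in> Qp \<Longrightarrow> y \<in> Qp \<Longrightarrow> x * y \<in> Qp"
proof -
  assume "x \<in> Qp" "y \<in> Qp"
  then obtain q q' where q: "vnull (\<lambda>n. of_rat (q n) - x)" "vnull (\<lambda>n. of_rat (q' n) - y)"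
    unfolding Qp_iff by blast
  obtain C where "\<forall>n. vge C (of_rat (q' n) - y)" using vnull_bounded[OF q(2)] by blast
  moreover obtain D where "vge D y" using vge_exists by blast
  ultimately have "vge (min C D) ((of_rat (q' n) - y) + y)" for n
    by (meson min.cobounded1 min.cobounded2 vge_add vge_mono)
  then have "vnull (\<lambda>n. (of_rat (q n) - x) * of_rat (q' n))"
    by (intro vnull_mult_bounded[OF q(1), of "min C D"]) (simp add: algebra_simps)
  then have "vnull (\<lambda>n. (of_rat (q n) - x) * of_rat (q' n) + x * (of_rat (q' n) - y))"
    by (intro vnull_add vnull_cmult q(2))
  then have "vnull (\<lambda>n. of_rat (q n * q' n) - x * y)"
    by (simp add: of_rat_mult algebra_simps)
  then show ?thesis unfolding Qp_iff by (rule exI[of _ "\<lambda>n. q n * q' n"])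
qed

lemma Qp_uminus: "x \<in> Qp \<Longrightarrow> - x \<in> Qp"
  using Qp_mult[OF Qp_of_int[of "-1"], of x] by simp

lemma Qp_sum: "(\<And>i. i \<in> A \<Longrightarrow> f i \<in> Qp) \<Longrightarrow> sum f A \<in> Qp"
  by (induction A rule: infinite_finite_induct) (use Qp_add Qp_of_int[of 0] in auto)

lemma Qp_inverse:
  assumes x: "x \<in> Qp"
  shows "inverse x \<in> Qp"
proof (cases "x = 0")
  case False
  from x obtain q where q: "vnull (\<lambda>n. of_rat (q n) - x)" unfolding Qp_iff by blast
  have "vnull (\<lambda>n. of_rat (inverse (q n)) - inverse x)"
    unfolding vnull_def
  proof
    fix B
    \<comment> \<open>The first bound forces the approximant to have the valuation of x; the second
      compensates the denominator \<open>of_rat (q n) * x\<close>, of valuation 2 v(x).\<close>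
    obtain n0 where n0: "\<forall>n\<ge>n0. vge (max (vv x + 1) (B + 2 * vv x)) (of_rat (q n) - x)"
      using q[unfolded vnull_def, rule_format, of "max (vv x + 1) (B + 2 * vv x)"] by blast
    have "vge B (of_rat (inverse (q n)) - inverse x)" if "n \<ge> n0" for n
    proof -
      have c: "vge (max (vv x + 1) (B + 2 * vv x)) (of_rat (q n) - x)" using n0 that by blast
      have qn: "of_rat (q n) \<noteq> (0::'a)" "vv (of_rat (q n)) = vv x"
        using vv_eq_of_close[OF False c] by auto
      have "of_rat (inverse (q n)) - inverse x = (- (of_rat (q n) - x)) / (of_rat (q n) * x)"
        unfolding of_rat_inverse using qn(1) False by (simp add: divide_simps)
      also have "vge B \<dots>"
        using c qn False vge_mono[OF c, of "B + 2 * vv x"] vge_minus_commute[of _ x] by (simp add: vge_divide vv_mult algebra_simps)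
      finally show ?thesis .
    qed
    then show "\<exists>n0. \<forall>n\<ge>n0. vge B (of_rat (inverse (q n)) - inverse x)" by blast
  qed
  then show ?thesis unfolding Qp_iff by (rule exI[of _ "\<lambda>n. inverse (q n)"])
qed (use x in simp)

lemma Qp_subfield: "subfield Qp (typ_ring :: 'a ring)"
proof (rule field.subfieldI'[OF field_from_type_algebra])
  interpret ring "typ_ring :: 'a ring" by (rule ring_from_type_algebra)
  have inv: "\<ominus>\<^bsub>typ_ring\<^esub> h = - h" for h :: 'a
    by (rule minus_equality[symmetric, of "-h" h, symmetric]) (auto simp: typ_ring_sel)
  show "subring Qp (typ_ring :: 'a ring)"
    by (rule subringI)
       (use Qp_add Qp_mult Qp_uminus Qp_of_int[of 1] inv in \<open>auto simp: typ_ring_sel\<close>)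
  fix k :: 'a assume k: "k \<in> Qp - {\<zero>\<^bsub>typ_ring\<^esub>}"
  interpret cring "typ_ring :: 'a ring" by (rule cring_from_type_algebra)
  have "inv\<^bsub>typ_ring\<^esub> k = inverse k"
    using comm_inv_char[of k "inverse k"] k by (auto simp: typ_ring_sel)
  then show "inv\<^bsub>typ_ring\<^esub> k \<in> Qp" using Qp_inverse k by simp
qed

text \<open>The residue field of the p-adic numbers is the prime field: a rational close to x has a
  denominator prime to p, which Bezout inverts modulo p.\<close>

lemma Qp_integer_approx:
  assumes "x \<in> Qp" "vge 0 x"
  shows "\<exists>b::int. vge 1 (x - of_int b)"
proof -
  obtain q where q: "vge 1 (of_rat q - x)"
    using assms(1)[unfolded Qp_iff vnull_def] by blast
  obtain m n where mn: "q = Rat.Fract m n" "n > 0" "coprime m n" by (cases q) auto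
  have q0: "vge 0 (of_rat q)"
    using vge_add[OF vge_mono[OF q, of 0] assms(2)] by simp
  have qe: "of_rat q = (of_int m / of_int n :: 'a)" using mn by (simp add: of_rat_rat)
  have n0: "(of_int n :: 'a) \<noteq> 0" using mn by simp
  have "\<not> int p dvd n"
  proof
    assume pn: "int p dvd n"
    then have "\<not> int p dvd m"
      using mn(3) prime by (meson coprime_common_divisor not_prime_unit prime_nat_int_transfer)
    then have "vv (of_int m) = 0" "m \<noteq> 0" by (auto simp: vv_of_int_unit)
    moreover have "1 \<le> vv (of_int n)" using pn vge_of_int_mod_p[of n] n0 by (simp add: vge_iff)
    ultimately show False using q0 n0 by (simp add: qe vge_iff vv_divide)
  qed
  then have vn: "vv (of_int n) = 0" and "coprime n (int p)"
    using vv_of_int_unit prime_imp_coprime[of "int p" n] prime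
    by (auto simp: coprime_commute)
  then obtain c e where ce: "n * c + int p * e = 1"
    using bezout_int[of n "int p"] by (metis coprime_imp_gcd_eq_1 mult.commute)
  have "of_rat q - of_int (m * c) = of_int (int p * (e * m)) / (of_int n :: 'a)"
  proof -
    have "of_int m - of_int (m * c) * of_int n = (of_int (m * (n * c + int p * e) - m * c * n) :: 'a)"
      using ce by simp
    also have "\<dots> = of_int (int p * (e * m))" by (simp add: algebra_simps)
    finally show ?thesis using n0 by (simp add: qe field_simps)
  qed
  moreover have "vge 1 (of_int (int p * (e * m)))" unfolding vge_of_int_mod_p by simp
  ultimately have "vge 1 (of_rat q - of_int (m * c))"
    using n0 vn by (simp add: vge_divide)
  then have "vge 1 ((of_rat q - of_int (m * c)) - (of_rat q - x))" using q by (rule vge_diff)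
  then show ?thesis by (intro exI[of _ "m * c"]) simp
qed

text \<open>Convergence is granted for Cauchy sequences of rationals only, so the n-th partial sum
  is first replaced by a rational that agrees with it to precision n.\<close>

lemma Qp_complete:
  assumes "vnull a" "\<And>n. a n \<in> Qp"
  shows "\<exists>s\<in>Qp. vsums a s"
proof -
  have "\<exists>q. vge (real n) (of_rat q - (\<Sum>i<n. a i))" for n
    using Qp_sum[of "{..<n}" a] assms(2) unfolding Qp_iff vnull_def by blast
  then obtain q where q: "\<And>n. vge (real n) (of_rat (q n) - (\<Sum>i<n. a i))" by metis
  have nullq: "vnull (\<lambda>n. of_rat (q n) - (\<Sum>i<n. a i))"
    unfolding vnull_def
  proof
    fix B
    obtain n0 where "B \<le> real n0" using real_arch_simple by blast
    then show "\<exists>n0. \<forall>n\<ge>n0. vge B (of_rat (q n) - (\<Sum>i<n. a i))"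
      using vge_mono[OF q] by (intro exI[of _ n0]) auto
  qed
  have "vCauchy v (\<lambda>n. of_rat (q n))"
    unfolding vCauchy_def vge_def[symmetric]
  proof
    fix B
    obtain n0 where n0: "\<forall>n\<ge>n0. vge B (a n)" using assms(1) unfolding vnull_def by blast
    obtain n1 where n1: "\<forall>n\<ge>n1. vge B (of_rat (q n) - (\<Sum>i<n. a i))"
      using nullq[unfolded vnull_def] by blast
    have le: "vge B (of_rat (q m) - of_rat (q n))"
      if "m \<ge> n0" "m \<ge> n1" "n \<ge> n1" "n \<ge> m" for m n
    proof -
      have "(\<Sum>i<n. a i) = (\<Sum>i<m. a i) + (\<Sum>i=m..<n. a i)"
        using that by (metis atLeast0LessThan bot_nat_0.extremum sum.atLeastLessThan_concat)
      moreover have "vge B (\<Sum>i=m..<n. a i)" using n0 that by (intro vge_sum) auto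
      moreover have "vge B ((of_rat (q m) - (\<Sum>i<m. a i)) - (of_rat (q n) - (\<Sum>i<n. a i)))"
        by (rule vge_diff) (use n1 that in auto)
      ultimately have "vge B ((of_rat (q m) - (\<Sum>i<m. a i)) - (of_rat (q n) - (\<Sum>i<n. a i)) - (\<Sum>i=m..<n. a i))"
        by (metis vge_diff)
      then show ?thesis using \<open>(\<Sum>i<n. a i) = _\<close> by simp
    qed
    have "vge B (of_rat (q m) - of_rat (q n))" if "m \<ge> max n0 n1" "n \<ge> max n0 n1" for m n
      using le[of m n] le[of n m] that vge_minus_commute[of B "of_rat (q m)" "of_rat (q n)"]
      by (metis max.bounded_iff nle_le)
    then show "\<exists>n0. \<forall>m\<ge>n0. \<forall>n\<ge>n0. vge B (of_rat (q m) - of_rat (q n))" by blast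
  qed
  then obtain x where x: "vnull (\<lambda>n. of_rat (q n) - x)"
    using pf unfolding padic_field_def vlim_iff by blast
  then have "x \<in> Qp" unfolding Qp_iff by blast
  moreover have "vsums a x"
    unfolding vsums_def using vnull_diff[OF x nullq] by (simp add: algebra_simps)
  ultimately show ?thesis by blast
qed

text \<open>Independence over the prime field of the classes modulo p. In a ramified field this
  concerns the quotient of the integers by p, which is larger than the residue field.\<close>

definition pindep :: "nat \<Rightarrow> (nat \<Rightarrow> 'a) \<Rightarrow> bool" where
  "pindep g s \<longleftrightarrow> (\<forall>c::nat \<Rightarrow> int. vge 1 (\<Sum>i<g. of_int (c i) * s i) \<longrightarrow> (\<forall>i<g. int p dvd c i))"

text \<open>Divide a relation by its coefficient of least valuation and reduce modulo p: the
  coefficient that became 1 would be divisible by p.\<close>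

lemma pindep_imp_lin_indep:
  assumes ind: "pindep g s" and s: "\<And>i. i < g \<Longrightarrow> vge 0 (s i)"
    and a: "\<And>i. i < g \<Longrightarrow> a i \<in> Qp" and sum0: "(\<Sum>i<g. a i * s i) = 0"
  shows "\<forall>i<g. a i = 0"
proof (rule ccontr)
  assume "\<not> ?thesis"
  then have ne: "{i. i < g \<and> a i \<noteq> 0} \<noteq> {}" by blast
  define k where "k = arg_min_on (\<lambda>i. vv (a i)) {i. i < g \<and> a i \<noteq> 0}"
  have k: "k < g" "a k \<noteq> 0"
    using arg_min_if_finite(1)[of "{i. i < g \<and> a i \<noteq> 0}" "\<lambda>i. vv (a i)"] ne by (auto simp: k_def)
  have kmin: "vv (a k) \<le> vv (a i)" if "i < g" "a i \<noteq> 0" for i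
    unfolding k_def using arg_min_least[of "{i. i < g \<and> a i \<noteq> 0}" i "\<lambda>i. vv (a i)"] ne that by auto
  define b where "b = (\<lambda>i. a i / a k)"
  have b: "b i \<in> Qp" "vge 0 (b i)" if "i < g" for i
  proof -
    show "b i \<in> Qp" using Qp_mult[OF a[OF that] Qp_inverse[OF a[OF k(1)]]] by (simp add: b_def divide_inverse)
    show "vge 0 (b i)"
      using kmin[OF that] k(2) by (cases "a i = 0") (auto simp: b_def vge_iff vv_divide)
  qed
  then have "\<exists>c::int. i < g \<longrightarrow> vge 1 (b i - of_int c)" for i
    using Qp_integer_approx by blast
  then obtain c :: "nat \<Rightarrow> int" where c: "\<And>i. i < g \<Longrightarrow> vge 1 (b i - of_int (c i))" by metis
  have "(\<Sum>i<g. b i * s i) = 0"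
    using sum0 by (simp add: b_def sum_divide_distrib[symmetric])
  then have "(\<Sum>i<g. of_int (c i) * s i) = - (\<Sum>i<g. (b i - of_int (c i)) * s i)"
    by (simp add: left_diff_distrib sum_subtractf)
  moreover have "vge 1 (\<Sum>i<g. (b i - of_int (c i)) * s i)"
    by (intro vge_sum vge_mult0) (auto simp: c s)
  ultimately have "vge 1 (\<Sum>i<g. of_int (c i) * s i)" by simp
  then have "int p dvd c k" using ind k(1) unfolding pindep_def by blast
  then have "vge 1 (of_int (c k))" by (simp add: vge_of_int_mod_p)
  then have "vge 1 ((b k - of_int (c k)) + of_int (c k))" using c[OF k(1)] by (intro vge_add)
  then show False using k(2) by (simp add: b_def vge_iff)
qed

text \<open>Take a family in the integral part of V that is independent modulo p and as long as
  possible; its length is bounded by the dimension. By maximality any integral x satisfies a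
  relation with it modulo p, in which x has a coefficient prime to p. So the family generates modulo
  p, and successive approximation with p-adic digits turns this into generation over the p-adic
  integers.\<close>

lemma lattice_basis:
  assumes V_add: "\<And>x y. x \<in> V \<Longrightarrow> y \<in> V \<Longrightarrow> x + y \<in> V"
    and V_smult: "\<And>a x. a \<in> Qp \<Longrightarrow> x \<in> V \<Longrightarrow> a * x \<in> V" and V0: "0 \<in> V"
  shows "\<exists>g s. (\<forall>i<g. s i \<in> V) \<and> (\<forall>i<g. vge 0 (s i)) \<and> pindep g s \<and>
    (\<forall>x\<in>V. vge 0 x \<longrightarrow> (\<exists>a. (\<forall>i<g. a i \<in> Qp \<and> vge 0 (a i)) \<and> x = (\<Sum>i<g. a i * s i)))"
proof -
  interpret R: ring "typ_ring :: 'a ring" by (rule ring_from_type_algebra)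
  obtain n where n: "R.dimension n Qp UNIV"
    using pf unfolding padic_field_def R.finite_dimension_def by blast
  define P where "P = (\<lambda>g. \<exists>s. (\<forall>i<g. s i \<in> V \<and> vge 0 (s i)) \<and> pindep g s)"
  have bound: "g \<le> n" if "P g" for g
  proof -
    from that obtain s where s: "\<forall>i<g. s i \<in> V \<and> vge 0 (s i)" "pindep g s" unfolding P_def by blast
    have "R.independent Qp (map s [0..<g])"
      by (rule independentI[OF Qp_subfield], rule pindep_imp_lin_indep[OF s(2)]) (use s in auto)
    from R.independent_length_le_dimension[OF Qp_subfield n this] show ?thesis by simp
  qed
  have "P 0" unfolding P_def pindep_def by simp
  then obtain g where g: "P g" "\<And>g'. P g' \<Longrightarrow> g' \<le> g"
    using Greatest_le_nat[of P _ n] GreatestI_nat[of P 0 n] bound by metis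
  from g(1) obtain s where s: "\<And>i. i < g \<Longrightarrow> s i \<in> V" "\<And>i. i < g \<Longrightarrow> vge 0 (s i)" "pindep g s"
    unfolding P_def by blast
  have step: "\<exists>c::nat \<Rightarrow> int. vge 1 (x - (\<Sum>i<g. of_int (c i) * s i))" if x: "x \<in> V" "vge 0 x" for x
  proof -
    have "\<not> P (Suc g)" using g(2) by fastforce
    then have "\<not> pindep (Suc g) (s(g := x))"
      unfolding P_def using s x by (auto dest!: spec[of _ "s(g := x)"] simp: less_Suc_eq)
    then obtain c :: "nat \<Rightarrow> int" where
      "vge 1 (\<Sum>i<Suc g. of_int (c i) * (s(g := x)) i)" and nd: "\<exists>i<Suc g. \<not> int p dvd c i"
      unfolding pindep_def by blast
    then have c: "vge 1 ((\<Sum>i<g. of_int (c i) * s i) + of_int (c g) * x)" by simp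
    have ndg: "\<not> int p dvd c g"
    proof
      assume d: "int p dvd c g"
      then have "vge 1 (of_int (c g) * x)" using x vge_of_int_mod_p by (intro vge_mult0) auto
      from vge_diff[OF c this] have "vge 1 (\<Sum>i<g. of_int (c i) * s i)" by simp
      then have "\<forall>i<g. int p dvd c i" using s(3) unfolding pindep_def by blast
      then show False using nd d by (auto simp: less_Suc_eq)
    qed
    then have "coprime (c g) (int p)" using prime by (simp add: prime_imp_coprime coprime_commute)
    then obtain d e where de: "c g * d + int p * e = 1"
      using bezout_int[of "c g" "int p"] by (metis coprime_imp_gcd_eq_1 mult.commute)
    have "x - (\<Sum>i<g. of_int (- d * c i) * s i)
        = of_int d * ((\<Sum>i<g. of_int (c i) * s i) + of_int (c g) * x) + of_int (int p * e) * x"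
    proof -
      have "x = of_int (c g * d + int p * e) * x" using de by simp
      then show ?thesis
        by (simp add: sum_distrib_left sum_negf algebra_simps)
    qed
    moreover have "vge 1 \<dots>"
      using vge_of_int_mod_p[of "int p * e"]
      by (intro vge_add[OF vge_0mult[OF vge_of_int c] vge_mult0[OF _ x(2)]]) simp
    ultimately show ?thesis by (intro exI[of _ "\<lambda>i. - d * c i"]) simp
  qed
  have V_int_sum: "(\<Sum>i<g. of_int (c i) * s i) \<in> V" for c :: "nat \<Rightarrow> int"
  proof -
    have "(\<Sum>i<m. of_int (c i) * s i) \<in> V" if "m \<le> g" for m
      using that by (induction m) (auto intro!: V_add V_smult Qp_of_int s simp: V0)
    then show ?thesis by blast
  qed
  \<comment> \<open>\<open>cc x\<close> holds the leading digits of x, and \<open>nx x\<close> is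
    what remains after subtracting them and dividing by p. Iterating \<open>nx\<close> produces the
    p-adic expansions of the coefficients.\<close>
  define cc where "cc = (\<lambda>x. SOME c::nat \<Rightarrow> int. vge 1 (x - (\<Sum>i<g. of_int (c i) * s i)))"
  define nx where "nx = (\<lambda>x. (x - (\<Sum>i<g. of_int (cc x i) * s i)) / of_nat p)"
  have cc: "vge 1 (x - (\<Sum>i<g. of_int (cc x i) * s i))" if "x \<in> V" "vge 0 x" for x
    unfolding cc_def by (rule someI_ex[OF step[OF that]])
  have nx: "nx x \<in> V" "vge 0 (nx x)" "x = (\<Sum>i<g. of_int (cc x i) * s i) + of_nat p * nx x"
    if "x \<in> V" "vge 0 x" for x
  proof -
    have "nx x = inverse (of_nat p) * (x + of_int (-1) * (\<Sum>i<g. of_int (cc x i) * s i))"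
      by (simp add: nx_def divide_inverse mult.commute)
    also have "\<dots> \<in> V" by (intro V_add V_smult Qp_inverse Qp_of_nat Qp_of_int V_int_sum that)
    finally show "nx x \<in> V" .
    show "vge 0 (nx x)" using cc[OF that] by (simp add: nx_def vge_divide)
    show "x = (\<Sum>i<g. of_int (cc x i) * s i) + of_nat p * nx x" by (simp add: nx_def)
  qed
  have gen: "\<exists>a. (\<forall>i<g. a i \<in> Qp \<and> vge 0 (a i)) \<and> x = (\<Sum>i<g. a i * s i)"
    if x: "x \<in> V" "vge 0 x" for x
  proof -
    define Y where "Y = rec_nat x (\<lambda>_. nx)"
    have Y: "Y n \<in> V" "vge 0 (Y n)" for n
      by (induction n) (auto simp: Y_def x nx)
    define t where "t = (\<lambda>i n. of_nat (p ^ n) * of_int (cc (Y n) i) :: 'a)"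
    have partial: "x = (\<Sum>n<N. \<Sum>i<g. t i n * s i) + of_nat (p ^ N) * Y N" for N
    proof (induction N)
      case 0 show ?case by (simp add: Y_def)
    next
      case (Suc N)
      have "of_nat (p ^ N) * Y N = (\<Sum>i<g. t i N * s i) + of_nat (p ^ Suc N) * Y (Suc N)"
        by (subst nx(3)[OF Y]) (simp add: Y_def t_def algebra_simps sum_distrib_left)
      then show ?case using Suc.IH by (simp add: algebra_simps)
    qed
    have "\<exists>a\<in>Qp. vsums (t i) a" for i
    proof (rule Qp_complete)
      show "vnull (t i)"
        unfolding t_def by (rule vnull_mult_bounded[OF vnull_p_power vge_of_int])
    qed (unfold t_def, intro Qp_mult Qp_of_int Qp_of_nat)
    then obtain a where a: "\<And>i. a i \<in> Qp" "\<And>i. vsums (t i) (a i)" by metis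
    have a0: "vge 0 (a i)" for i
      by (rule vsums_vge[OF a(2)]) (auto simp: t_def intro!: vge_mult0[of 0, simplified] vge_of_nat vge_of_int vge_power0)
    have "vsums (\<lambda>n. \<Sum>i<g. t i n * s i) (\<Sum>i<g. a i * s i)"
    proof (intro vsums_sum)
      fix i
      show "vsums (\<lambda>n. t i n * s i) (a i * s i)"
        using vsums_cmult[OF a(2), of "s i" i] by (simp add: mult.commute)
    qed
    moreover have "vsums (\<lambda>n. \<Sum>i<g. t i n * s i) x"
    proof -
      have "(\<Sum>n<N. \<Sum>i<g. t i n * s i) - x = - (of_nat (p ^ N) * Y N)" for N
        using partial[of N] by (simp add: algebra_simps)
      then show ?thesis unfolding vsums_def
        by (simp only: vnull_uminus) (rule vnull_mult_bounded[OF vnull_p_power Y(2)])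
    qed
    ultimately have "x = (\<Sum>i<g. a i * s i)" using vsums_unique by blast
    then show ?thesis using a(1) a0 by (intro exI[of _ a]) simp
  qed
  show ?thesis using s gen by (intro exI[of _ g] exI[of _ s]) blast
qed



text \<open>The last clause transfers divisibility by p^N to the coefficients. It is restricted to
  integral exponents because of ramification: an element of valuation 1/2 may itself be a basis
  element and have coefficient 1.\<close>

definition zp_basis :: "'a set \<Rightarrow> nat \<Rightarrow> (nat \<Rightarrow> 'a) \<Rightarrow> bool" where
  "zp_basis V g s \<longleftrightarrow> (\<forall>i<g. s i \<in> V) \<and> (\<forall>i<g. vge 0 (s i)) \<and> pindep g s \<and>
    (\<forall>x\<in>V. \<exists>a. (\<forall>i<g. a i \<in> Qp) \<and> x = (\<Sum>i<g. a i * s i) \<and>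
       (\<forall>N::nat. vge (real N) x \<longrightarrow> (\<forall>i<g. vge (real N) (a i))))"

lemma zp_basis_exists:
  assumes V_add: "\<And>x y. x \<in> V \<Longrightarrow> y \<in> V \<Longrightarrow> x + y \<in> V"
    and V_smult: "\<And>a x. a \<in> Qp \<Longrightarrow> x \<in> V \<Longrightarrow> a * x \<in> V" and V0: "0 \<in> V"
  shows "\<exists>g s. zp_basis V g s"
proof -
  have "\<exists>g s. (\<forall>i<g. s i \<in> V) \<and> (\<forall>i<g. vge 0 (s i)) \<and> pindep g s \<and>
    (\<forall>x\<in>V. vge 0 x \<longrightarrow> (\<exists>a. (\<forall>i<g. a i \<in> Qp \<and> vge 0 (a i)) \<and> x = (\<Sum>i<g. a i * s i)))"
    by (rule lattice_basis) (auto intro: V_add V_smult V0)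
  then obtain g s where gs: "(\<forall>i<g. s i \<in> V) \<and> (\<forall>i<g. vge 0 (s i)) \<and> pindep g s \<and>
    (\<forall>x\<in>V. vge 0 x \<longrightarrow> (\<exists>a. (\<forall>i<g. a i \<in> Qp \<and> vge 0 (a i)) \<and> x = (\<Sum>i<g. a i * s i)))"
    by (elim exE) (rule that)
  then have s: "i < g \<Longrightarrow> s i \<in> V" "i < g \<Longrightarrow> vge 0 (s i)" "pindep g s" for i by blast+
  have gen: "\<exists>a. (\<forall>i<g. a i \<in> Qp \<and> vge 0 (a i)) \<and> x = (\<Sum>i<g. a i * s i)" if "x \<in> V" "vge 0 x" for x using gs that by blast
  show ?thesis
    unfolding zp_basis_def
  proof (rule exI[of _ g], rule exI[of _ s], intro conjI ballI)
    fix x assume x: "x \<in> V"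
    have pw: "of_nat (p ^ N) \<noteq> (0::'a)" for N by simp
    show "\<exists>a. (\<forall>i<g. a i \<in> Qp) \<and> x = (\<Sum>i<g. a i * s i) \<and>
       (\<forall>N::nat. vge (real N) x \<longrightarrow> (\<forall>i<g. vge (real N) (a i)))"
    proof (cases "x = 0")
      case True
      then show ?thesis using Qp_of_int[of 0] by (intro exI[of _ "\<lambda>_. 0"]) simp
    next
      case x0: False
      show ?thesis
      proof (cases "vv x \<ge> 0")
        case True
        define N where "N = nat \<lfloor>vv x\<rfloor>"
        have N: "real N \<le> vv x" "\<And>M::nat. real M \<le> vv x \<Longrightarrow> M \<le> N"
          using True by (auto simp: N_def le_nat_floor)
        have "inverse (of_nat (p ^ N)) * x \<in> V" by (intro V_smult x Qp_inverse Qp_of_nat)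
        moreover have "vge 0 (inverse (of_nat (p ^ N)) * x)"
          using N(1) x0 by (simp add: vge_iff vv_mult vv_inverse vv_power)
        ultimately obtain a where a: "\<forall>i<g. a i \<in> Qp \<and> vge 0 (a i)"
          "inverse (of_nat (p ^ N)) * x = (\<Sum>i<g. a i * s i)"
          using gen by blast
        have "x = of_nat (p ^ N) * (inverse (of_nat (p ^ N)) * x)" by simp
        also have "\<dots> = (\<Sum>i<g. of_nat (p ^ N) * a i * s i)"
          unfolding a(2) by (simp add: sum_distrib_left mult.assoc)
        finally have eq: "x = (\<Sum>i<g. of_nat (p ^ N) * a i * s i)" .
        show ?thesis
        proof (intro exI conjI allI impI)
          fix i assume "i < g"
          then show "of_nat (p ^ N) * a i \<in> Qp" using a(1) by (intro Qp_mult Qp_of_nat) auto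
        next
          fix M i assume M: "vge (real M) x" and i: "i < g"
          have "M \<le> N" using M x0 by (intro N(2)) (simp add: vge_iff)
          then have "vge (real M) (of_nat (p ^ N))" by (simp add: vge_iff vv_power)
          then show "vge (real M) (of_nat (p ^ N) * a i)" using a(1) i by (intro vge_mult0) auto
        qed (rule eq)
      next
        \<comment> \<open>Now v(x) < 0, so no natural number N bounds it and the last clause is
          vacuous; it suffices to clear denominators.\<close>
        case False
        obtain N :: nat where "- vv x \<le> real N" using real_arch_simple by blast
        then have "vge 0 (of_nat (p ^ N) * x)" using x0 by (simp add: vge_iff vv_mult vv_power)
        moreover have "of_nat (p ^ N) * x \<in> V" by (intro V_smult x Qp_of_nat)
        ultimately obtain a where a: "\<forall>i<g. a i \<in> Qp \<and> vge 0 (a i)"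
          "of_nat (p ^ N) * x = (\<Sum>i<g. a i * s i)"
          using gen by blast
        have "x = inverse (of_nat (p ^ N)) * (of_nat (p ^ N) * x)" by simp
        also have "\<dots> = (\<Sum>i<g. inverse (of_nat (p ^ N)) * a i * s i)"
          unfolding a(2) by (simp add: sum_distrib_left mult.assoc)
        finally have eq: "x = (\<Sum>i<g. inverse (of_nat (p ^ N)) * a i * s i)" .
        have "\<not> vge (real M) x" for M using False x0 by (simp add: vge_iff)
        then show ?thesis
          using eq a(1) by (intro exI[of _ "\<lambda>i. inverse (of_nat (p ^ N)) * a i"] conjI allI impI
              Qp_mult Qp_inverse Qp_of_nat) auto
      qed
    qed
  qed (use s in auto)
qed

section \<open>Completeness and closedness of subspaces\<close>

lemma vnull_from_nat_bounds:
  assumes "vnull y" "\<And>n (N::nat). vge (real N) (y n) \<Longrightarrow> vge (real N) (a n)"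
  shows "vnull a"
  unfolding vnull_def
proof
  fix B
  obtain N :: nat where N: "B \<le> real N" using real_arch_simple by blast
  obtain n0 where "\<forall>n\<ge>n0. vge (real N) (y n)" using assms(1) unfolding vnull_def by blast
  then have "\<forall>n\<ge>n0. vge B (a n)" using assms(2) vge_mono N by blast
  then show "\<exists>n0. \<forall>n\<ge>n0. vge B (a n)" by blast
qed

text \<open>The coordinates with respect to a \<open>zp_basis\<close> of a null sequence are null
  sequences, and each of them is summable in the p-adic numbers. With V the whole field this is
  completeness of the ambient field.\<close>

lemma subspace_complete:
  assumes V_add: "\<And>x y. x \<in> V \<Longrightarrow> y \<in> V \<Longrightarrow> x + y \<in> V"
    and V_smult: "\<And>a x. a \<in> Qp \<Longrightarrow> x \<in> V \<Longrightarrow> a * x \<in> V" and V0: "0 \<in> V"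
    and y: "vnull y" "\<And>n. y n \<in> V"
  shows "\<exists>s\<in>V. vsums y s"
proof -
  have "\<exists>g s. zp_basis V g s"
    by (rule zp_basis_exists) (auto intro: V_add V_smult V0)
  then obtain g s where gs: "zp_basis V g s" by blast
  then have s: "i < g \<Longrightarrow> s i \<in> V" "i < g \<Longrightarrow> vge 0 (s i)" "pindep g s" for i unfolding zp_basis_def by blast+
  have gen: "\<exists>a. (\<forall>i<g. a i \<in> Qp) \<and> x = (\<Sum>i<g. a i * s i) \<and>
       (\<forall>N::nat. vge (real N) x \<longrightarrow> (\<forall>i<g. vge (real N) (a i)))" if "x \<in> V" for x
    using gs that unfolding zp_basis_def by blast
  from gen[OF y(2)] obtain a where a: "\<And>n i. i < g \<Longrightarrow> a n i \<in> Qp"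
    "\<And>n. y n = (\<Sum>i<g. a n i * s i)"
    "\<And>n (N::nat) i. vge (real N) (y n) \<Longrightarrow> i < g \<Longrightarrow> vge (real N) (a n i)"
    by metis
  have "\<exists>A\<in>Qp. vsums (\<lambda>n. a n i) A" if "i < g" for i
    by (rule Qp_complete[OF vnull_from_nat_bounds[OF y(1)]]) (use that a in auto)
  then obtain A where A: "\<And>i. i < g \<Longrightarrow> A i \<in> Qp" "\<And>i. i < g \<Longrightarrow> vsums (\<lambda>n. a n i) (A i)" by metis
  have "vsums (\<lambda>n. \<Sum>i<g. a n i * s i) (\<Sum>i<g. A i * s i)"
  proof (rule vsums_sum)
    fix i assume "i \<in> {..<g}"
    then show "vsums (\<lambda>n. a n i * s i) (A i * s i)"
      using vsums_cmult[OF A(2), of i "s i"] by (simp add: mult.commute)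
  qed
  then have "vsums y (\<Sum>i<g. A i * s i)" using a(2) by presburger
  moreover have "(\<Sum>i<m. A i * s i) \<in> V" if "m \<le> g" for m
    using that by (induction m) (auto intro!: V_add V_smult A s simp: V0)
  ultimately show ?thesis by blast
qed

lemma vsums_vsum: "vnull y \<Longrightarrow> vsums y (vsum v y)"
  using subspace_complete[of UNIV y] vsum_eqI by auto

lemma subspace_closed:
  assumes V_add: "\<And>x y. x \<in> V \<Longrightarrow> y \<in> V \<Longrightarrow> x + y \<in> V"
    and V_smult: "\<And>a x. a \<in> Qp \<Longrightarrow> x \<in> V \<Longrightarrow> a * x \<in> V" and V0: "0 \<in> V"
    and a: "vlim v a x" "\<And>n. a n \<in> V"
  shows "x \<in> V"
proof -
  \<comment> \<open>Passing to differences makes the sequence a series, whose sum in V must agree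
    with the limit.\<close>
  define y where "y = (\<lambda>n. case n of 0 \<Rightarrow> a 0 | Suc m \<Rightarrow> a (Suc m) - a m)"
  have part: "(\<Sum>i<Suc n. y i) = a n" for n
    by (induction n) (auto simp: y_def)
  have "vsums y x"
    unfolding vsums_def
    using a(1) vnull_shift[of "\<lambda>n. (\<Sum>i<n. y i) - x" 1] part by (simp add: vlim_iff del: sum.lessThan_Suc)
  moreover have "y n \<in> V" for n
    using a(2) V_add[OF a(2) V_smult[OF Qp_of_int[of "-1"] a(2)]] by (auto simp: y_def split: nat.split)
  moreover have "vnull y"
  proof -
    have "vnull (\<lambda>n. a n - x)" using a(1) by (simp add: vlim_iff)
    then have "vnull (\<lambda>n. (a (n + 1) - x) - (a n - x))"
      using vnull_shift[of "\<lambda>n. a n - x" 1] by (intro vnull_diff[where a="\<lambda>n. a (n + 1) - x"]) simp_all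
    then have "vnull (\<lambda>n. y (n + 1))" by (simp add: y_def)
    then show ?thesis by (simp only: vnull_shift)
  qed
  ultimately show ?thesis using subspace_complete[OF V_add V_smult V0] vsums_unique by blast
qed

end

section \<open>The unramified subfield\<close>

locale unram = padic +
  fixes f :: nat and K :: "'a set" and frob :: "'a \<Rightarrow> 'a"
  assumes f: "1 \<le> f" and ur: "unramified_subfield v f K" and af: "arith_frobenius p v K frob"
begin

lemma K_subfield: "subfield K (typ_ring :: 'a ring)" using ur unfolding unramified_subfield_def by blast

lemma Qp_K: "x \<in> Qp \<Longrightarrow> x \<in> K" using ur unfolding unramified_subfield_def by blast

lemma K_add: "x \<in> K \<Longrightarrow> y \<in> K \<Longrightarrow> x + y \<in> K"
  and K_mult: "x \<in> K \<Longrightarrow> y \<in> K \<Longrightarrow> x * y \<in> K"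
  using subringE(6,7)[OF subfieldE(1)[OF K_subfield]] by (auto simp: typ_ring_sel)

lemma K_0: "0 \<in> K" and K_1: "1 \<in> K"
  using Qp_K[OF Qp_of_int[of 0]] Qp_K[OF Qp_of_int[of 1]] by auto

lemma K_diff: "x \<in> K \<Longrightarrow> y \<in> K \<Longrightarrow> x - y \<in> K"
  using K_add[OF _ K_mult[OF Qp_K[OF Qp_of_int[of "-1"]]], of x y] by simp

lemma K_power: "x \<in> K \<Longrightarrow> x ^ n \<in> K"
  by (induction n) (auto intro: K_1 K_mult)

lemma K_closed: "vlim v a x \<Longrightarrow> (\<And>n. a n \<in> K) \<Longrightarrow> x \<in> K"
  by (rule subspace_closed[of K a]) (auto intro: K_add K_mult K_0 Qp_K)

lemma vv_K: "x \<in> K \<Longrightarrow> x \<noteq> 0 \<Longrightarrow> vv x \<in> \<int>"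
  using ur unfolding unramified_subfield_def vv_def by fastforce

text \<open>Ramification index 1 leaves no valuation strictly between 0 and 1. It upgrades the
  congruence that characterizes the Frobenius to a congruence modulo p.\<close>

lemma vge_1_K: "x \<in> K \<Longrightarrow> 0 < v x \<Longrightarrow> vge 1 x"
proof (cases "x = 0")
  case False
  assume "x \<in> K" "0 < v x"
  with False obtain n :: int where "vv x = n" "0 < vv x"
    using vv_K[of x] v_vv[of x] by (auto elim!: Ints_cases)
  then show ?thesis using False by (simp add: vge_iff)
qed simp

section \<open>The Frobenius of K and its inverse\<close>

lemma frob_iso: "frob \<in> ring_iso (typ_ring\<lparr>carrier := K\<rparr>) (typ_ring\<lparr>carrier := K\<rparr>)"
  using af unfolding arith_frobenius_def by blast

lemma frob_K: "x \<in> K \<Longrightarrow> frob x \<in> K"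
  and frob_add: "x \<in> K \<Longrightarrow> y \<in> K \<Longrightarrow> frob (x + y) = frob x + frob y"
  and frob_mult: "x \<in> K \<Longrightarrow> y \<in> K \<Longrightarrow> frob (x * y) = frob x * frob y"
  and frob_bij: "bij_betw frob K K"
  using frob_iso unfolding ring_iso_def ring_hom_def by (auto simp: typ_ring_sel)

lemma frob_Qp: "x \<in> Qp \<Longrightarrow> frob x = x"
  using af unfolding arith_frobenius_def by blast

lemma frob_mod: "x \<in> K \<Longrightarrow> vge 0 x \<Longrightarrow> vge 1 (frob x - x ^ p)"
  using af unfolding arith_frobenius_def vge_def
  by (metis K_diff K_power frob_K vge_1_K vge_def zero_ereal_def)

lemma frob_nz: "x \<in> K \<Longrightarrow> x \<noteq> 0 \<Longrightarrow> frob x \<noteq> 0"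
  using frob_bij frob_Qp[OF Qp_of_int[of 0]] K_0
  by (metis bij_betw_imp_inj_on inj_on_def of_int_0)

text \<open>Scaling by a power of p, which the Frobenius fixes, reduces this to units; for a unit
  the image is congruent modulo p to the p-th power.\<close>

lemma vv_frob: 
  assumes "x \<in> K"
  shows "vv (frob x) = vv x"
proof (cases "x = 0")
  case True
  then show ?thesis using frob_Qp[OF Qp_of_int[of 0]] by simp
next
  case False
  obtain n :: int where n: "vv x = n" using vv_K[OF assms False] by (auto elim: Ints_cases)
  define c where "c = (if n \<ge> 0 then of_nat (p ^ nat n) else inverse (of_nat (p ^ nat (- n))) :: 'a)"
  have c: "c \<in> Qp" "c \<noteq> 0" "vv c = vv x"
    using Qp_of_nat[of "p ^ nat n"] Qp_inverse[OF Qp_of_nat[of "p ^ nat (- n)"]]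
    by (auto simp: c_def vv_power vv_inverse n)
  define u where "u = x * inverse c"
  have u: "u \<in> K" "u \<noteq> 0" "vv u = 0" "x = c * u"
    using c False K_mult[OF assms Qp_K[OF Qp_inverse[OF c(1)]]]
    by (auto simp: u_def vv_mult vv_inverse)
  have "vge 1 (frob u - u ^ p)" using u by (intro frob_mod) (auto simp: vge_iff)
  then have "vv (frob u) = 0"
    using vv_eq_of_close(2)[of "u ^ p" 1 "frob u"] u by (simp add: vv_power)
  moreover have "frob x = c * frob u"
    unfolding u(4) using frob_mult[OF Qp_K[OF c(1)] u(1)] frob_Qp[OF c(1)] by simp
  ultimately show ?thesis using c u frob_nz[OF u(1,2)] by (simp add: vv_mult)
qed

lemma vge_frob: "x \<in> K \<Longrightarrow> vge B (frob x) \<longleftrightarrow> vge B x"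
  by (cases "x = 0") (auto simp: vge_iff vv_frob frob_nz frob_Qp[OF Qp_of_int[of 0], simplified])

definition frinv :: "nat \<Rightarrow> 'a \<Rightarrow> 'a" where "frinv j = (inv_into K frob ^^ j)"

lemma frinv_0 [simp]: "frinv 0 x = x" and frinv_Suc: "frinv (Suc j) x = inv_into K frob (frinv j x)"
  by (auto simp: frinv_def)

lemma frinv_add_index: "frinv (i + j) x = frinv i (frinv j x)"
  by (simp add: frinv_def funpow_add)

lemma inv_frob: "x \<in> K \<Longrightarrow> inv_into K frob x \<in> K" "x \<in> K \<Longrightarrow> frob (inv_into K frob x) = x"
  "x \<in> K \<Longrightarrow> inv_into K frob (frob x) = x"
  using frob_bij by (auto simp: bij_betw_def inv_into_into f_inv_into_f inv_into_f_f)

lemma frinv_K: "x \<in> K \<Longrightarrow> frinv j x \<in> K"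
  by (induction j) (auto simp: frinv_Suc inv_frob)

lemma frinv_add: "x \<in> K \<Longrightarrow> y \<in> K \<Longrightarrow> frinv j (x + y) = frinv j x + frinv j y"
proof (induction j)
  case (Suc j)
  then show ?case
    using frob_add[of "inv_into K frob (frinv j x)" "inv_into K frob (frinv j y)"]
      inv_frob(3)[of "inv_into K frob (frinv j x) + inv_into K frob (frinv j y)"]
    by (simp add: frinv_Suc inv_frob frinv_K K_add)
qed simp

lemma frinv_mult: "x \<in> K \<Longrightarrow> y \<in> K \<Longrightarrow> frinv j (x * y) = frinv j x * frinv j y"
proof (induction j)
  case (Suc j)
  then show ?case
    using frob_mult[of "inv_into K frob (frinv j x)" "inv_into K frob (frinv j y)"]
      inv_frob(3)[of "inv_into K frob (frinv j x) * inv_into K frob (frinv j y)"]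
    by (simp add: frinv_Suc inv_frob frinv_K K_mult)
qed simp

lemma frinv_Qp: "x \<in> Qp \<Longrightarrow> frinv j x = x"
  by (induction j) (auto simp: frinv_Suc, metis Qp_K frob_Qp inv_frob(3))

lemma frinv_zero [simp]: "frinv j 0 = 0"
  using frinv_Qp[OF Qp_of_int[of 0]] by simp

lemma vge_frinv: "x \<in> K \<Longrightarrow> vge B (frinv j x) \<longleftrightarrow> vge B x"
  by (induction j) (auto simp: frinv_Suc, metis frinv_K inv_frob(1,2) vge_frob, metis frinv_K inv_frob(1,2) vge_frob)

lemma frinv_frob: "x \<in> K \<Longrightarrow> frinv (i + d) ((frob ^^ d) x) = frinv i x"
proof (induction d arbitrary: x)
  case (Suc d)
  have "frinv (i + Suc d) ((frob ^^ Suc d) x) = frinv (i + d) (inv_into K frob (frob ((frob ^^ d) x)))"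
    using frinv_add_index[of "i + d" 1] by (simp add: frinv_Suc)
  also have "(frob ^^ d) x \<in> K" using Suc.prems by (induction d) (auto intro: frob_K)
  then have "inv_into K frob (frob ((frob ^^ d) x)) = (frob ^^ d) x" by (rule inv_frob)
  finally show ?case using Suc by simp
qed simp

lemma frob_pow_K: "x \<in> K \<Longrightarrow> (frob ^^ d) x \<in> K"
  by (induction d) (auto intro: frob_K)

lemma frob_pow_vge: "x \<in> K \<Longrightarrow> vge B ((frob ^^ d) x) \<longleftrightarrow> vge B x"
  by (induction d) (auto simp: vge_frob frob_pow_K)

lemma vge_power_diff:
  assumes "vge B (x - y)" "vge 0 x" "vge 0 y"
  shows "vge B (x ^ n - y ^ n)"
proof (induction n)
  case (Suc n)
  have "x ^ Suc n - y ^ Suc n = x * (x ^ n - y ^ n) + (x - y) * y ^ n" by (simp add: algebra_simps)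
  also have "vge B \<dots>"
    by (intro vge_add vge_0mult vge_mult0 Suc.IH assms vge_power0)
  finally show ?case .
qed simp

lemma frob_pow_mod:
  assumes "x \<in> K" "vge 0 x"
  shows "vge 1 ((frob ^^ d) x - x ^ (p ^ d))"
proof (induction d)
  case (Suc d)
  have "vge 1 (frob ((frob ^^ d) x) - ((frob ^^ d) x) ^ p)"
    using assms by (intro frob_mod) (auto simp: frob_pow_K frob_pow_vge)
  moreover have "vge 1 (((frob ^^ d) x) ^ p - (x ^ (p ^ d)) ^ p)"
    using assms by (intro vge_power_diff Suc.IH vge_power0) (auto simp: frob_pow_vge)
  ultimately have "vge 1 ((frob ((frob ^^ d) x) - ((frob ^^ d) x) ^ p) + (((frob ^^ d) x) ^ p - (x ^ (p ^ d)) ^ p))"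
    by (rule vge_add)
  then show ?case by (simp add: power_mult[symmetric] mult.commute)
qed simp

section \<open>Separating the powers of Frobenius by counting residue classes\<close>

lemma vge_poly: "(\<And>i. vge 0 (coeff P i)) \<Longrightarrow> vge 0 x \<Longrightarrow> vge 0 (poly P x)"
  by (simp add: poly_altdef vge_sum vge_mult0 vge_power0)

lemma vge_synthetic_div:
  assumes "\<And>i. vge 0 (coeff P i)" "vge 0 x"
  shows "vge 0 (coeff (synthetic_div P x) i)"
  using assms(1)
proof (induction P arbitrary: i)
  case (pCons a P)
  have P: "vge 0 (coeff P i)" for i using pCons.prems[of "Suc i"] by simp
  then show ?case using pCons.IH[OF P] vge_poly[OF P assms(2)]
    by (cases i) auto
qed simp

text \<open>The quotient modulo p need not be a domain, but the usual argument survives: after a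
  root x is split off, the factor y - x is a unit at every other root y.\<close>

lemma poly_residue_roots:
  assumes "\<And>i. vge 0 (coeff P i)" "Polynomial.degree P \<le> n" "finite A" "card A > n"
    "\<And>x. x \<in> A \<Longrightarrow> vge 0 x" "\<And>x y. x \<in> A \<Longrightarrow> y \<in> A \<Longrightarrow> x \<noteq> y \<Longrightarrow> vv (x - y) = 0"
    "\<And>x. x \<in> A \<Longrightarrow> vge 1 (poly P x)"
  shows "vge 1 (coeff P i)"
  using assms
proof (induction n arbitrary: P A i)
  case 0
  obtain x where "x \<in> A" using 0 by fastforce
  moreover obtain c where "P = [:c:]" using 0(2) by (metis degree_0_id le_zero_eq)
  ultimately show ?case using 0(7) by (cases i) auto
next
  case (Suc n)
  obtain x where x: "x \<in> A" using Suc(5) by fastforce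
  define Q where "Q = synthetic_div P x"
  have PQ: "P = [:-x, 1:] * Q + [:poly P x:]"
    unfolding Q_def by (rule synthetic_div_correct'[symmetric])
  have "vge 1 (coeff Q i)" for i
  proof (rule Suc.IH[of Q "A - {x}"])
    show "vge 0 (coeff Q i)" for i unfolding Q_def using Suc x by (intro vge_synthetic_div) auto
    show "Polynomial.degree Q \<le> n" using Suc(3) by (simp add: Q_def degree_synthetic_div)
    show "card (A - {x}) > n" using Suc x by simp
    fix y assume y: "y \<in> A - {x}"
    have "poly P y = (y - x) * poly Q y + poly P x"
      using arg_cong[OF PQ, of "\<lambda>P. poly P y"] by (simp add: algebra_simps)
    then have "(y - x) * poly Q y = poly P y - poly P x" by simp
    moreover have "vge 1 \<dots>" using Suc y x by (intro vge_diff) auto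
    ultimately have "vge 1 ((y - x) * poly Q y)" by simp
    then show "vge 1 (poly Q y)"
      using Suc(7)[of y x] y x by (simp add: vge_mult_left)
  qed (use Suc in auto)
  then have Q: "vge 1 (coeff Q i)" for i .
  have "vge 1 (coeff ([:-x, 1:] * Q + [:poly P x:]) i)"
    using Q Suc x vge_mult0[OF Q, of x] by (cases i) (auto intro!: vge_add vge_diff simp: mult.commute)
  then show ?case by (simp only: PQ[symmetric])
qed

text \<open>The combinations of a \<open>zp_basis\<close> of K with digits below p give p^g pairwise
  incongruent elements, and g >= f > d. The d-th power of the Frobenius is congruent to the p^d-th
  power map, so if it fixed all of them modulo p, the monic polynomial X^(p^d) - X would have more
  roots than its degree allows.\<close>

lemma exists_frob_separating:
  assumes d: "0 < d" "d < f"
  shows "\<exists>x\<in>K. vge 0 x \<and> (frob ^^ d) x - x \<noteq> 0 \<and> vv ((frob ^^ d) x - x) = 0"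
proof -
  have "\<exists>g s. zp_basis K g s"
    by (rule zp_basis_exists) (auto intro: K_add K_mult Qp_K K_0)
  then obtain g s where gs: "zp_basis K g s" by blast
  then have s: "i < g \<Longrightarrow> s i \<in> K" "i < g \<Longrightarrow> vge 0 (s i)" "pindep g s" for i unfolding zp_basis_def by blast+
  have gen': "\<exists>a. (\<forall>i<g. a i \<in> Qp) \<and> x = (\<Sum>i<g. a i * s i) \<and>
       (\<forall>N::nat. vge (real N) x \<longrightarrow> (\<forall>i<g. vge (real N) (a i)))" if "x \<in> K" for x
    using gs that unfolding zp_basis_def by blast
  have gen: "\<exists>a. (\<forall>i<g. a i \<in> Qp) \<and> x = (\<Sum>i<g. a i * s i)" if "x \<in> K" for x
    using gen'[OF that] by blast
  have "ring.dimension typ_ring f Qp K" using ur unfolding unramified_subfield_def by blast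
  then have fg: "f \<le> g"
    by (rule dimension_le_spanning[OF Qp_subfield])
       (rule pindep_imp_lin_indep[OF s(3,2)], assumption+, rule gen, assumption)
  define C where "C = (\<lambda>c::nat \<Rightarrow> nat. \<Sum>i<g. of_nat (c i) * s i)"
  define I where "I = {..<g} \<rightarrow>\<^sub>E {..<p}"
  have C: "C c \<in> K" "vge 0 (C c)" for c
  proof -
    have "(\<Sum>i<m. of_nat (c i) * s i) \<in> K" if "m \<le> g" for m
      using that by (induction m) (auto intro!: K_add K_mult s Qp_K[OF Qp_of_nat] K_0)
    then show "C c \<in> K" by (simp add: C_def)
    show "vge 0 (C c)" unfolding C_def by (intro vge_sum vge_mult0 vge_of_nat s) auto
  qed
  have inc: "\<not> vge 1 (C c - C c')" if "c \<in> I" "c' \<in> I" "c \<noteq> c'" for c c'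
  proof
    assume "vge 1 (C c - C c')"
    then have "vge 1 (\<Sum>i<g. of_int (int (c i) - int (c' i)) * s i)"
      by (simp add: C_def sum_subtractf algebra_simps)
    then have dv: "\<forall>i<g. int p dvd int (c i) - int (c' i)"
      using s(3)[unfolded pindep_def, THEN spec, of "\<lambda>i. int (c i) - int (c' i)"] by blast
    have "c i = c' i" for i
    proof (cases "i < g")
      case True
      then have "c i < p" "c' i < p" using that by (auto simp: I_def PiE_iff)
      moreover have "int (c i) mod int p = int (c' i) mod int p" using dv True by (simp add: mod_eq_dvd_iff)
      ultimately show ?thesis by simp
    next
      case False
      then show ?thesis using that by (auto simp: I_def PiE_def extensional_def)
    qed
    then show False using that by auto
  qed
  have vv0: "vv x = 0" if xK: "x \<in> K" "vge 0 x" "\<not> vge 1 x" for x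
  proof -
    have x0: "x \<noteq> 0" using xK(3) by auto
    then obtain n :: int where "vv x = n" using vv_K[OF xK(1)] by (auto elim: Ints_cases)
    then show ?thesis using xK x0 by (simp add: vge_iff)
  qed
  have vvC: "vv (C c - C c') = 0" if "c \<in> I" "c' \<in> I" "C c \<noteq> C c'" for c c'
    using that inc C by (intro vv0 K_diff vge_diff) auto
  have inj: "inj_on C I" using inc by (auto simp: inj_on_def) (metis diff_self vge_zero)
  have fin: "finite I" unfolding I_def by (intro finite_PiE) auto
  have "card (C ` I) = p ^ g"
    using inj by (simp add: card_image I_def card_PiE)
  moreover have "p ^ d < p ^ g" using d fg p_gt_1 by simp
  ultimately have card: "p ^ d < card (C ` I)" by simp
  define P where "P = (monom 1 (p ^ d) - monom 1 1 :: 'a poly)"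
  have pd: "1 < p ^ d" using d p_gt_1 one_less_power[of p d] by simp
  have degP: "Polynomial.degree P \<le> p ^ d"
    unfolding P_def using pd by (intro degree_diff_le) (auto simp: degree_monom_eq)
  have Pint: "vge 0 (coeff P i)" for i
    by (auto simp: P_def vge_one intro: vge_diff)
  have "\<exists>x\<in>C ` I. \<not> vge 1 (poly P x)"
  proof (rule ccontr)
    assume "\<not> ?thesis"
    then have "vge 1 (coeff P (p ^ d))"
      by (intro poly_residue_roots[OF Pint degP _ card])
         (use C vvC fin in auto)
    then show False using pd by (simp add: P_def vge_iff)
  qed
  then obtain x where x: "x \<in> K" "vge 0 x" "\<not> vge 1 (poly P x)" using C by auto
  have Px: "poly P x = x ^ (p ^ d) - x" by (simp add: P_def poly_monom)
  have "\<not> vge 1 ((frob ^^ d) x - x)"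
  proof
    assume "vge 1 ((frob ^^ d) x - x)"
    then have "vge 1 (((frob ^^ d) x - x) - ((frob ^^ d) x - x ^ (p ^ d)))"
      using frob_pow_mod[OF x(1,2)] by (rule vge_diff)
    then show False using x(3) Px by simp
  qed
  then show ?thesis
    using x vv0[OF K_diff[OF frob_pow_K[OF x(1)] x(1)]] vge_diff[of 0] frob_pow_vge
    by (intro bexI[of _ x]) auto
qed

text \<open>The image in $\mathcal O^f$ of the tensor product of the integers of \<open>K\<close> and \<open>E\<close>.\<close>

inductive_set tensor_consts :: "(nat \<Rightarrow> 'a) set" where
  base: "a \<in> K \<Longrightarrow> vge 0 a \<Longrightarrow> vge 0 b \<Longrightarrow> (\<lambda>j. frinv j a * b) \<in> tensor_consts"
| add: "c \<in> tensor_consts \<Longrightarrow> d \<in> tensor_consts \<Longrightarrow> (\<lambda>j. c j + d j) \<in> tensor_consts"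

lemma tensor_consts_mult: "c \<in> tensor_consts \<Longrightarrow> d \<in> tensor_consts \<Longrightarrow> (\<lambda>j. c j * d j) \<in> tensor_consts"
proof (induction c rule: tensor_consts.induct)
  case (base a b)
  from base(4) show ?case
  proof (induction d rule: tensor_consts.induct)
    case (base a' b')
    then show ?case
      using tensor_consts.base[of "a * a'" "b * b'"] \<open>a \<in> K\<close> \<open>vge 0 a\<close> \<open>vge 0 b\<close>
      by (simp add: K_mult vge_mult0 frinv_mult ac_simps)
  next
    case (add c d)
    then show ?case using tensor_consts.add by (fastforce simp: algebra_simps)
  qed
next
  case (add c d)
  then show ?case using tensor_consts.add by (fastforce simp: algebra_simps)
qed

lemma tensor_consts_one: "(\<lambda>j. 1) \<in> tensor_consts"
  using tensor_consts.base[OF K_1 vge_one vge_one] frinv_Qp[OF Qp_of_int[of 1]] by simp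

text \<open>For x in K whose conjugates at i and j differ by a unit, the tensor x (x) 1 - 1 (x)
  \<open>frinv j x\<close> vanishes at j and is a unit at i; it is then normalized by the constant
  \<open>u\<close>. Such an x comes from \<open>exists_frob_separating\<close> with d the distance
  of the indices.\<close>

lemma tensor_consts_separate:
  assumes "i < f" "j < f" "i \<noteq> j"
  shows "\<exists>c\<in>tensor_consts. c i = 1 \<and> c j = 0"
proof -
  have *: "\<exists>x\<in>K. vge 0 x \<and> frinv i x - frinv j x \<noteq> 0 \<and> vv (frinv i x - frinv j x) = 0" if "i < j" "j < f" for i j
  proof -
    obtain x where x: "x \<in> K" "vge 0 x" "(frob ^^ (j - i)) x - x \<noteq> 0" "vv ((frob ^^ (j - i)) x - x) = 0"
      using exists_frob_separating[of "j - i"] \<open>i < j\<close> \<open>j < f\<close> by fastforce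
    define z where "z = (frob ^^ (j - i)) x - x"
    have z: "z \<in> K" "z \<noteq> 0" "vv z = 0" using x by (auto simp: z_def intro: K_diff frob_pow_K)
    have "frinv j z + frinv j x = frinv j ((frob ^^ (j - i)) x)"
      using frinv_add[OF z(1) x(1), of j] by (simp add: z_def)
    also have "\<dots> = frinv i x" using frinv_frob[OF x(1), of i "j - i"] \<open>i < j\<close> by simp
    finally have e: "frinv i x - frinv j x = frinv j z" by (simp add: algebra_simps)
    have "frinv j z \<noteq> 0"
      using vge_frinv[OF z(1), of 1 j] z by (auto simp: vge_iff)
    moreover have "vv (frinv j z) = 0"
      using vge_frinv[OF z(1), of "vv (frinv j z)" j] vge_frinv[OF z(1), of 0 j] z \<open>frinv j z \<noteq> 0\<close> by (simp add: vge_iff)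
    ultimately show ?thesis using x e by auto
  qed
  obtain x where x: "x \<in> K" "vge 0 x" "frinv i x - frinv j x \<noteq> 0" "vv (frinv i x - frinv j x) = 0"
  proof (cases "i < j")
    case True
    then show ?thesis using *[of i j] assms that by blast
  next
    case False
    then obtain x where x: "x \<in> K" "vge 0 x" "frinv j x - frinv i x \<noteq> 0" "vv (frinv j x - frinv i x) = 0"
      using *[of j i] assms by auto
    have "vv (frinv i x - frinv j x) = 0" using vv_uminus[of "frinv j x - frinv i x"] x(4) by simp
    then show ?thesis using x that[of x] by auto
  qed
  define u where "u = inverse (frinv i x - frinv j x)"
  have u: "vge 0 u" using x by (simp add: u_def vge_iff vv_inverse)
  have "(\<lambda>k. frinv k x * u + frinv k 1 * (- (frinv j x * u))) \<in> tensor_consts"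
    by (intro tensor_consts.add tensor_consts.base x K_1 vge_one u) (use x u in \<open>simp add: vge_mult0 vge_frinv\<close>)
  moreover have "frinv k 1 = 1" for k using frinv_Qp[OF Qp_of_int[of 1]] by simp
  ultimately have "(\<lambda>k. frinv k x * u - frinv j x * u) \<in> tensor_consts" by simp
  moreover have "frinv i x * u - frinv j x * u = 1"
    using x(3) by (simp add: u_def left_diff_distrib[symmetric])
  ultimately show ?thesis by (intro bexI[of _ "\<lambda>k. frinv k x * u - frinv j x * u"]) auto
qed

text \<open>The product over the other indices of the elements that separate i from each of
  them.\<close>

lemma tensor_consts_idempotent:
  assumes "i < f"
  shows "\<exists>c\<in>tensor_consts. c i = 1 \<and> (\<forall>j<f. j \<noteq> i \<longrightarrow> c j = 0)"
proof -
  have "finite J \<Longrightarrow> J \<subseteq> {..<f} - {i} \<Longrightarrow> \<exists>c\<in>tensor_consts. c i = 1 \<and> (\<forall>j\<in>J. c j = 0)" for J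
  proof (induction J rule: finite_induct)
    case empty
    then show ?case using tensor_consts_one by (intro bexI[of _ "\<lambda>_. 1"]) auto
  next
    case (insert j J)
    then obtain c where c: "c \<in> tensor_consts" "c i = 1" "\<forall>j\<in>J. c j = 0" by auto
    obtain d where "d \<in> tensor_consts" "d i = 1" "d j = 0" using tensor_consts_separate[of i j] insert assms by auto
    then show ?case using c tensor_consts_mult[OF c(1), of d] by (intro bexI[of _ "\<lambda>j. c j * d j"]) auto
  qed
  from this[of "{..<f} - {i}"] show ?thesis by auto
qed

end

section \<open>The components of Breuil's ring\<close>

lemma sum_fun_apply: "(\<Sum>i\<in>A. F i) x = (\<Sum>i\<in>A. F i x)" for F :: "'i \<Rightarrow> 'a \<Rightarrow> 'b::comm_monoid_add"
  by (induction A rule: infinite_finite_induct) auto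

lemma fps_compose_monom_nth:
  assumes "0 < p"
  shows "fps_nth (fps_compose F (fps_const c * fps_X ^ p)) n =
    (if p dvd n then fps_nth F (n div p) * c ^ (n div p) else (0::'a::comm_ring_1))"
proof -
  have "fps_nth (fps_compose F (fps_const c * fps_X ^ p)) n =
      (\<Sum>i=0..n. fps_nth F i * (if n = p * i then c ^ i else 0))"
    unfolding fps_compose_nth power_mult_distrib power_mult[symmetric] fps_const_power
    by (intro sum.cong) (auto simp: fps_X_power_nth)
  also have "\<dots> = (if p dvd n then fps_nth F (n div p) * c ^ (n div p) else 0)"
  proof (cases "p dvd n")
    case True
    then obtain m where m: "n = p * m" by blast
    have "(\<Sum>i=0..n. fps_nth F i * (if n = p * i then c ^ i else 0)) = (\<Sum>i\<in>{m}. fps_nth F i * c ^ i)"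
      by (rule sum.mono_neutral_cong_right) (use assms in \<open>auto simp: m Suc_le_eq\<close>)
    then show ?thesis using assms by (simp add: m)
  next
    case False
    then have "n \<noteq> p * i" for i by auto
    then show ?thesis using False by simp
  qed
  finally show ?thesis .
qed

context pval
begin

text \<open>For \<open>B = 0\<close> this is the ring of the series $\sum_i c_i u^i/i!$ with integral $c_i \to 0$, which
  is a component of $S_{\mathcal O}$; for a natural number \<open>B\<close> it is $p^B$ times that ring.\<close>

definition SB :: "real \<Rightarrow> 'e fps set" where
  "SB B = {F. (\<forall>i. vge B (fps_nth F i * fact i)) \<and> vnull (\<lambda>i. fps_nth F i * fact i)}"

lemma SB_vge: "F \<in> SB B \<Longrightarrow> vge B (fps_nth F i * fact i)"
  and SB_vnull: "F \<in> SB B \<Longrightarrow> vnull (\<lambda>i. fps_nth F i * fact i)"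
  by (auto simp: SB_def)

lemma SB_mono: "F \<in> SB B \<Longrightarrow> C \<le> B \<Longrightarrow> F \<in> SB C"
  by (auto simp: SB_def intro: vge_mono)

lemma SB_zero [simp]: "0 \<in> SB B" by (simp add: SB_def vnull_zero)

lemma SB_add: "F \<in> SB B \<Longrightarrow> G \<in> SB B \<Longrightarrow> F + G \<in> SB B"
  by (auto simp: SB_def distrib_right intro: vge_add vnull_add)

lemma SB_uminus: "F \<in> SB B \<Longrightarrow> - F \<in> SB B"
  by (auto simp: SB_def vnull_uminus)

lemma SB_diff: "F \<in> SB B \<Longrightarrow> G \<in> SB B \<Longrightarrow> F - G \<in> SB B"
  using SB_add[OF _ SB_uminus, of F B G] by simp

lemma SB_sum: "(\<And>i. i \<in> A \<Longrightarrow> F i \<in> SB B) \<Longrightarrow> sum F A \<in> SB B"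
  by (induction A rule: infinite_finite_induct) (auto intro: SB_add)

text \<open>In the coordinates F_i i! the product is a convolution with binomial coefficients, hence
  integral. In degree n >= a + b one of the two indices is beyond its threshold, which makes the
  product a null sequence again.\<close>

lemma SB_mult:
  assumes F: "F \<in> SB B" and G: "G \<in> SB C"
  shows "F * G \<in> SB (B + C)"
proof -
  have nth: "fps_nth (F * G) n * fact n = (\<Sum>i=0..n. of_nat (n choose i) *
    ((fps_nth F i * fact i) * (fps_nth G (n - i) * fact (n - i))))" for n
  proof -
    have "fps_nth F i * fps_nth G (n - i) * fact n = of_nat (n choose i) *
      ((fps_nth F i * fact i) * (fps_nth G (n - i) * fact (n - i)))" if "i \<le> n" for i
      using binomial_fact[OF that, where 'a = 'e] by (simp add: field_simps)
    then show ?thesis unfolding fps_mult_nth sum_distrib_right by (intro sum.cong) auto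
  qed
  have "vge (B + C) (fps_nth (F * G) n * fact n)" for n
    unfolding nth by (intro vge_sum vge_0mult vge_of_nat vge_mult SB_vge[OF F] SB_vge[OF G])
  moreover have "vnull (\<lambda>n. fps_nth (F * G) n * fact n)"
    unfolding vnull_def
  proof
    fix M
    obtain a where a: "\<forall>i\<ge>a. vge (M - C) (fps_nth F i * fact i)"
      using SB_vnull[OF F] unfolding vnull_def by blast
    obtain b where b: "\<forall>i\<ge>b. vge (M - B) (fps_nth G i * fact i)"
      using SB_vnull[OF G] unfolding vnull_def by blast
    have "vge M (fps_nth (F * G) n * fact n)" if "n \<ge> a + b" for n
      unfolding nth
    proof (rule vge_sum, rule vge_0mult[OF vge_of_nat])
      fix i assume "i \<in> {0..n}"
      show "vge M ((fps_nth F i * fact i) * (fps_nth G (n - i) * fact (n - i)))"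
      proof (cases "i \<ge> a")
        case True
        then show ?thesis using vge_mult[OF a[rule_format, OF True] SB_vge[OF G]] by simp
      next
        case False
        then have "n - i \<ge> b" using that by simp
        then show ?thesis using vge_mult[OF SB_vge[OF F] b[rule_format]] by simp
      qed
    qed
    then show "\<exists>n0. \<forall>n\<ge>n0. vge M (fps_nth (F * G) n * fact n)" by blast
  qed
  ultimately show ?thesis by (simp add: SB_def)
qed

lemma SB_mult0: "F \<in> SB B \<Longrightarrow> G \<in> SB 0 \<Longrightarrow> F * G \<in> SB B"
  using SB_mult[of F B G 0] by simp

lemma SB_0mult: "G \<in> SB 0 \<Longrightarrow> F \<in> SB B \<Longrightarrow> G * F \<in> SB B"
  using SB_mult[of G 0 F B] by simp

lemma SB_finite:
  assumes "\<And>i. vge B (fps_nth F i * fact i)" "\<And>i. i \<ge> N \<Longrightarrow> fps_nth F i = 0"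
  shows "F \<in> SB B"
  using assms by (auto simp: SB_def vnull_def intro!: exI[of _ N])

lemma SB_const: "vge B c \<Longrightarrow> fps_const c \<in> SB B"
  by (rule SB_finite[of _ _ 1]) auto

lemma SB_one: "1 \<in> SB 0"
  using SB_const[OF vge_one] by simp

lemma SB_of_nat: "of_nat n \<in> SB 0"
  using SB_const[OF vge_of_nat[of n]] by (simp add: fps_of_nat)

lemma SB_power: "F \<in> SB 0 \<Longrightarrow> F ^ n \<in> SB 0"
  by (induction n) (auto intro: SB_one SB_0mult)

lemma vge_fact: "vge 0 (fact n)"
  using vge_of_nat[of "fact n"] by simp

lemma SB_X: "fps_X \<in> SB 0"
  by (rule SB_finite[of _ _ 2]) (auto simp: fps_X_def vge_one)

lemma SB_const_mult_iff:
  assumes "c \<noteq> 0"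
  shows "fps_const c * F \<in> SB B \<longleftrightarrow> F \<in> SB (B - vv c)"
proof
  assume "fps_const c * F \<in> SB B"
  then have "fps_const (inverse c) * (fps_const c * F) \<in> SB (- vv c + B)"
    using assms by (intro SB_mult SB_const) (auto simp: vge_iff vv_inverse)
  then show "F \<in> SB (B - vv c)" using assms by (simp add: mult.assoc[symmetric])
next
  assume "F \<in> SB (B - vv c)"
  then have "fps_const c * F \<in> SB (vv c + (B - vv c))"
    using assms by (intro SB_mult SB_const) (auto simp: vge_iff)
  then show "fps_const c * F \<in> SB B" by simp
qed

lemma SB_p_power_iff: "of_nat (p ^ n) * F \<in> SB B \<longleftrightarrow> F \<in> SB (B - real n)"
proof -
  have "(of_nat (p ^ n) :: 'e fps) = fps_const (of_nat (p ^ n))" by (rule fps_of_nat[symmetric])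
  moreover have "vv (of_nat (p ^ n)) = real n" by (simp add: vv_power)
  moreover have "(of_nat (p ^ n) :: 'e) \<noteq> 0" by simp
  ultimately show ?thesis using SB_const_mult_iff by metis
qed

text \<open>The coefficient of u^m moves to u^(pm), and m! divides (pm)!.\<close>

lemma SB_frobenius:
  assumes F: "F \<in> SB B"
  shows "fps_compose F (fps_X ^ p) \<in> SB B"
proof -
  have nth: "fps_nth (fps_compose F (fps_X ^ p)) n = (if p dvd n then fps_nth F (n div p) else 0)" for n
    using fps_compose_monom_nth[of p F 1 n] by simp
  have le: "vge M (fps_nth F (n div p) * fact n)" if "vge M (fps_nth F (n div p) * fact (n div p))" for M n
  proof -
    have "(fact n :: 'e) = fact (n div p) * of_nat (fact n div fact (n div p))"
      using fact_dvd[of "n div p" n]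
      by (metis div_le_dividend dvd_mult_div_cancel of_nat_fact of_nat_mult)
    then show ?thesis using vge_mult0[OF that vge_of_nat] by (metis mult.assoc)
  qed
  have "vge B (fps_nth (fps_compose F (fps_X ^ p)) n * fact n)" for n
    using le SB_vge[OF F] by (simp add: nth)
  moreover have "vnull (\<lambda>n. fps_nth (fps_compose F (fps_X ^ p)) n * fact n)"
    unfolding vnull_def
  proof
    fix M
    obtain a where a: "\<forall>i\<ge>a. vge M (fps_nth F i * fact i)"
      using SB_vnull[OF F] unfolding vnull_def by blast
    have "vge M (fps_nth (fps_compose F (fps_X ^ p)) n * fact n)" if "n \<ge> p * a" for n
    proof -
      have "n div p \<ge> a" using that by (simp add: less_eq_div_iff_mult_less_eq mult.commute)
      then show ?thesis using le a by (simp add: nth)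
    qed
    then show "\<exists>n0. \<forall>n\<ge>n0. vge M (fps_nth (fps_compose F (fps_X ^ p)) n * fact n)" by blast
  qed
  ultimately show ?thesis by (simp add: SB_def)
qed

lemma SB_X_deriv:
  assumes "F \<in> SB B"
  shows "fps_X * fps_deriv F \<in> SB B"
proof -
  have "fps_nth (fps_X * fps_deriv F) i * fact i = (fps_nth F i * fact i) * of_nat i" for i
    by (cases i) auto
  then show ?thesis
    using vnull_mult_bounded[OF SB_vnull[OF assms] vge_of_nat] vge_mult0[OF SB_vge[OF assms] vge_of_nat]
    by (simp only: SB_def mem_Collect_eq simp_thms)
qed

text \<open>Coefficientwise limits stay in \<open>SB B\<close> if the terms become uniformly small:
  up to p^M only finitely many terms count, and each of them has coefficients tending to 0.\<close>

lemma SB_vsum: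
  assumes F: "\<And>n. F n \<in> SB B" and lim: "\<And>C. \<exists>n0. \<forall>n\<ge>n0. F n \<in> SB C"
    and s: "\<And>i. vsums (\<lambda>n. fps_nth (F n) i) (fps_nth S i)"
  shows "S \<in> SB B"
proof -
  have s': "vsums (\<lambda>n. fps_nth (F n) i * fact i) (fps_nth S i * fact i)" for i
    using vsums_cmult[OF s, of "fact i"] by (simp add: mult.commute)
  have "vge B (fps_nth S i * fact i)" for i
    by (rule vsums_vge[OF s' SB_vge[OF F]])
  moreover have "vnull (\<lambda>i. fps_nth S i * fact i)"
    unfolding vnull_def
  proof
    fix M
    obtain n0 where n0: "\<forall>n\<ge>n0. F n \<in> SB M" using lim by blast
    have "\<exists>i0. \<forall>i\<ge>i0. \<forall>n<m. vge M (fps_nth (F n) i * fact i)" for m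
    proof (induction m)
      case (Suc m)
      then obtain a where a: "\<forall>i\<ge>a. \<forall>n<m. vge M (fps_nth (F n) i * fact i)" by blast
      obtain b where "\<forall>i\<ge>b. vge M (fps_nth (F m) i * fact i)"
        using SB_vnull[OF F] unfolding vnull_def by blast
      then have "\<forall>i\<ge>max a b. \<forall>n<Suc m. vge M (fps_nth (F n) i * fact i)"
        using a by (auto simp: less_Suc_eq)
      then show ?case by blast
    qed auto
    then obtain i0 where i0: "\<forall>i\<ge>i0. \<forall>n<n0. vge M (fps_nth (F n) i * fact i)" by blast
    have "vge M (fps_nth S i * fact i)" if "i \<ge> i0" for i
    proof (rule vsums_vge[OF s'])
      fix n
      show "vge M (fps_nth (F n) i * fact i)"
        using i0 n0 that SB_vge by (cases "n < n0") (auto simp: not_less)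
    qed
    then show "\<exists>n0. \<forall>n\<ge>n0. vge M (fps_nth S n * fact n)" by blast
  qed
  ultimately show ?thesis by (simp add: SB_def)
qed

lemma SB_null_coeff:
  assumes "\<And>C. \<exists>n0. \<forall>n\<ge>n0. F n \<in> SB C"
  shows "vnull (\<lambda>n. fps_nth (F n) i)"
  unfolding vnull_def
proof
  fix M
  obtain n0 where n0: "\<forall>n\<ge>n0. F n \<in> SB (M + vv (fact i))" using assms by blast
  have "vge M (fps_nth (F n) i)" if "n \<ge> n0" for n
    using SB_vge[OF n0[rule_format, OF that], of i] vge_mult_left[of "fact i" "M + vv (fact i)" "fps_nth (F n) i"]
    by (simp add: mult.commute)
  then show "\<exists>n0. \<forall>n\<ge>n0. vge M (fps_nth (F n) i)" by blast
qed

end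

section \<open>Identification of Breuil's ring and of its tensor product with the integers\<close>

context unram
begin

lemma pd_polys_SB:
  "F \<in> pd_polys v K \<Longrightarrow> (\<forall>i. fps_nth F i \<in> K) \<and> (\<exists>N. \<forall>i\<ge>N. fps_nth F i = 0) \<and> F \<in> SB 0"
proof (induction rule: pd_polys.induct)
  case (const c)
  then show ?case
    by (auto simp: SB_const vge_def zero_ereal_def K_0 intro!: exI[of _ 1])
next
  case (gen i)
  have "fps_nth (fps_const (1 / fact i) * fps_X ^ i) k = (if k = i then inverse (of_nat (fact i)) else 0 :: 'a)" for k
    by (simp add: fps_X_power_nth inverse_eq_divide)
  then show ?case
    by (auto intro!: SB_finite[of 0 _ "Suc i"] exI[of _ "Suc i"] Qp_K[OF Qp_inverse[OF Qp_of_nat]] K_0 simp: vge_one simp del: of_nat_fact)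
      (simp_all add: vge_one)
next
  case (add a b)
  then obtain N M where "\<forall>i\<ge>N. fps_nth a i = 0" "\<forall>i\<ge>M. fps_nth b i = 0" by blast
  then have "\<forall>i\<ge>max N M. fps_nth (a + b) i = 0" by simp
  moreover have "\<forall>i. fps_nth (a + b) i \<in> K" using add by (auto intro: K_add)
  ultimately show ?case using add SB_add by blast
next
  case (mult a b)
  then obtain N M where NM: "\<forall>i\<ge>N. fps_nth a i = 0" "\<forall>i\<ge>M. fps_nth b i = 0" by blast
  have "fps_nth (a * b) i = 0" if "i \<ge> N + M" for i
    unfolding fps_mult_nth
  proof (rule sum.neutral, rule ballI)
    fix k assume "k \<in> {0..i}"
    then have "k \<ge> N \<or> i - k \<ge> M" using that by auto
    then show "fps_nth a k * fps_nth b (i - k) = 0" using NM by auto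
  qed
  moreover have "fps_nth (a * b) i \<in> K" for i
  proof -
    have "(\<Sum>k\<in>A. fps_nth a k * fps_nth b (i - k)) \<in> K" for A
      by (induction A rule: infinite_finite_induct) (use mult in \<open>auto intro: K_0 K_add K_mult\<close>)
    then show ?thesis by (simp add: fps_mult_nth)
  qed
  ultimately show ?case using mult SB_mult0 by blast
qed

lemma pd_polysI:
  assumes "\<And>i. fps_nth F i \<in> K" "\<And>i. i \<ge> N \<Longrightarrow> fps_nth F i = 0" "\<And>i. vge 0 (fps_nth F i * fact i)"
  shows "F \<in> pd_polys v K"
proof -
  have zero: "0 \<in> pd_polys v K" using pd_polys.const[OF K_0, of v] by simp
  define t where "t = (\<lambda>i. fps_const (fps_nth F i) * fps_X ^ i)"
  have t: "t i \<in> pd_polys v K" for i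
  proof (cases "i = 0")
    case True
    then show ?thesis
      using pd_polys.const[OF assms(1)[of 0], of v] assms(3)[of 0] by (simp add: t_def vge_def zero_ereal_def)
  next
    case False
    have "fps_nth F i * fact i \<in> K"
      using K_mult[OF assms(1) Qp_K[OF Qp_of_nat[of "fact i"]]] by simp
    then have "fps_const (fps_nth F i * fact i) * (fps_const (1 / fact i) * fps_X ^ i) \<in> pd_polys v K"
      using False assms(3)[of i] by (intro pd_polys.mult pd_polys.const pd_polys.gen) (auto simp: vge_def zero_ereal_def)
    also have "fps_const (fps_nth F i * fact i) * (fps_const (1 / fact i) * fps_X ^ i) = t i"
      unfolding mult.assoc[symmetric] fps_const_mult by (simp add: t_def)
    finally show ?thesis .
  qed
  have "F = (\<Sum>i<N. t i)"
  proof (rule fps_ext)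
    fix n
    have "fps_nth (\<Sum>i<N. t i) n = (\<Sum>i<N. if i = n then fps_nth F i else 0)"
      by (simp add: fps_sum_nth t_def fps_X_power_nth if_distrib cong: if_cong)
    then show "fps_nth F n = fps_nth (\<Sum>i<N. t i) n" using assms(2)[of n] by (auto simp: not_less)
  qed
  also have "\<dots> \<in> pd_polys v K"
    by (induction N) (auto intro: zero t pd_polys.add)
  finally show ?thesis .
qed

text \<open>In one direction an approximant G N is a polynomial, so beyond its degree the limit is
  divisible by p^N. In the other direction F is approximated by discarding its coefficients that are
  small in divided power coordinates.\<close>

lemma breuil_S_iff: "F \<in> breuil_S p v K \<longleftrightarrow> (\<forall>i. fps_nth F i \<in> K) \<and> F \<in> SB 0"
proof
  assume "F \<in> breuil_S p v K"
  then obtain G where G: "\<And>n. G n \<in> pd_polys v K"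
    "\<And>n. \<exists>H\<in>pd_polys v K. G (Suc n) - G n = of_nat (p ^ n) * H"
    "\<And>i. vlim v (\<lambda>n. fps_nth (G n) i) (fps_nth F i)"
    unfolding breuil_S_def padic_completion_def by blast
  have Gs: "G n \<in> SB 0" "fps_nth (G n) i \<in> K" for n i using pd_polys_SB[OF G(1)] by auto
  have "fps_nth F i \<in> K" for i by (rule K_closed[OF G(3) Gs(2)])
  moreover have lim: "vlim v (\<lambda>n. fps_nth (G n) i * fact i) (fps_nth F i * fact i)" for i
    using vnull_cmult[of "\<lambda>n. fps_nth (G n) i - fps_nth F i" "fact i"] G(3)[of i]
    by (simp add: vlim_iff algebra_simps)
  have "vge 0 (fps_nth F i * fact i)" for i by (rule vlim_vge[OF lim SB_vge[OF Gs(1)]])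
  moreover have "vnull (\<lambda>i. fps_nth F i * fact i)"
    unfolding vnull_def
  proof
    fix B
    obtain N :: nat where N: "B \<le> real N" using real_arch_simple by blast
    \<comment> \<open>All later approximants agree with G N modulo p^N, by summing the successive
      congruences.\<close>
    have step: "G (N + k) - G N \<in> SB (real N)" for k
    proof (induction k)
      case (Suc k)
      obtain H where H: "H \<in> pd_polys v K" "G (Suc (N + k)) - G (N + k) = of_nat (p ^ (N + k)) * H"
        using G(2) by blast
      have "H \<in> SB 0" using pd_polys_SB[OF H(1)] by blast
      then have "H \<in> SB (real N - real (N + k))" by (rule SB_mono) simp
      then have "of_nat (p ^ (N + k)) * H \<in> SB (real N)" unfolding SB_p_power_iff .
      then have "(G (N + k) - G N) + (G (Suc (N + k)) - G (N + k)) \<in> SB (real N)"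
        using Suc.IH H(2) by (intro SB_add) auto
      then show ?case by simp
    qed simp
    obtain n0 where n0: "\<forall>i\<ge>n0. fps_nth (G N) i = 0" using pd_polys_SB[OF G(1)] by blast
    have "vge B (fps_nth F i * fact i)" if "i \<ge> n0" for i
    proof (rule vge_mono[OF _ N], rule vlim_vge)
      show "vlim v (\<lambda>k. fps_nth (G (k + N)) i * fact i) (fps_nth F i * fact i)"
        using lim[of i] vnull_shift[of "\<lambda>n. fps_nth (G n) i * fact i - fps_nth F i * fact i" N]
        by (simp add: vlim_iff)
      show "vge (real N) (fps_nth (G (k + N)) i * fact i)" for k
        using SB_vge[OF step[of k], of i] n0 that by (simp add: add.commute)
    qed
    then show "\<exists>n0. \<forall>n\<ge>n0. vge B (fps_nth F n * fact n)" by blast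
  qed
  ultimately show "(\<forall>i. fps_nth F i \<in> K) \<and> F \<in> SB 0" by (simp add: SB_def)
next
  assume F: "(\<forall>i. fps_nth F i \<in> K) \<and> F \<in> SB 0"
  \<comment> \<open>Dropping the terms divisible by p^n leaves finitely many, and passing from n to
    n + 1 restores only terms divisible by p^n, as the completion demands.\<close>
  define G where "G = (\<lambda>n. Abs_fps (\<lambda>i. if vge (real n) (fps_nth F i * fact i) then 0 else fps_nth F i))"
  have fin: "\<exists>N. \<forall>i\<ge>N. vge (real n) (fps_nth F i * fact i)" for n
    using SB_vnull[of F 0] F unfolding vnull_def by blast
  have "G n \<in> pd_polys v K" for n
  proof -
    obtain N where "\<forall>i\<ge>N. vge (real n) (fps_nth F i * fact i)" using fin by blast
    then show ?thesis
      using F SB_vge[of F 0] by (intro pd_polysI[of _ N]) (auto simp: G_def K_0)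
  qed
  moreover have "\<exists>H\<in>pd_polys v K. G (Suc n) - G n = of_nat (p ^ n) * H" for n
  proof -
    define H where "H = Abs_fps (\<lambda>i. if vge (real n) (fps_nth F i * fact i) \<and>
      \<not> vge (real (Suc n)) (fps_nth F i * fact i) then inverse (of_nat (p ^ n)) * fps_nth F i else 0)"
    obtain N where "\<forall>i\<ge>N. vge (real (Suc n)) (fps_nth F i * fact i)" using fin by blast
    then have "H \<in> pd_polys v K"
    proof (intro pd_polysI[of _ N])
      show "fps_nth H i \<in> K" for i
        using K_mult[OF Qp_K[OF Qp_inverse[OF Qp_of_nat[of "p ^ n"]]], of "fps_nth F i"] F by (auto simp: H_def K_0)
      show "vge 0 (fps_nth H i * fact i)" for i
        using vge_mult_left[of "inverse (of_nat (p ^ n))" 0 "fps_nth F i * fact i"]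
        by (simp add: H_def mult.assoc vv_inverse vv_power)
    qed (auto simp: H_def)
    moreover have "G (Suc n) - G n = of_nat (p ^ n) * H"
    proof (rule fps_ext)
      fix i
      have "vge (real n) (fps_nth F i * fact i)" if "vge (1 + real n) (fps_nth F i * fact i)"
        using that by (rule vge_mono) simp
      then show "fps_nth (G (Suc n) - G n) i = fps_nth (of_nat (p ^ n) * H) i"
        by (auto simp: G_def H_def fps_of_nat[symmetric] fps_mult_left_const_nth simp del: of_nat_power)
    qed
    ultimately show ?thesis by blast
  qed
  moreover have "vlim v (\<lambda>n. fps_nth (G n) i) (fps_nth F i)" for i
    unfolding vlim_iff
  proof (cases "fps_nth F i = 0")
    case True
    then show "vnull (\<lambda>n. fps_nth (G n) i - fps_nth F i)" by (simp add: G_def vnull_zero)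
  next
    case False
    then have nz: "fps_nth F i * fact i \<noteq> 0" by simp
    obtain n0 where n0: "vv (fps_nth F i * fact i) < real n0" using reals_Archimedean2 by blast
    have "fps_nth (G n) i - fps_nth F i = 0" if "n \<ge> n0" for n
      using n0 that nz by (simp add: G_def vge_iff)
    then show "vnull (\<lambda>n. fps_nth (G n) i - fps_nth F i)"
      unfolding vnull_def by (intro allI exI[of _ n0]) simp
  qed
  ultimately show "F \<in> breuil_S p v K"
    unfolding breuil_S_def padic_completion_def by blast
qed

abbreviation "SO \<equiv> S_O p f v K frob"

lemma tensor_S_eq: "tensor_S f K frob s b = tup f (\<lambda>j. Abs_fps (\<lambda>i. frinv j (fps_nth s i)) * fps_const b)"
  by (simp add: tensor_S_def frinv_def)

lemma SO_sum: "(\<And>i. i \<in> A \<Longrightarrow> F i \<in> SO) \<Longrightarrow> (\<Sum>i\<in>A. F i) \<in> SO"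
  by (induction A rule: infinite_finite_induct) (auto intro: S_O.zero S_O.add)

lemma SO_components: "F \<in> SO \<Longrightarrow> (\<forall>j<f. F j \<in> SB 0) \<and> (\<forall>j\<ge>f. F j = 0)"
proof (induction rule: S_O.induct)
  case (tensor s b)
  then have s: "\<And>i. fps_nth s i \<in> K" "s \<in> SB 0" by (auto simp: breuil_S_iff)
  have "Abs_fps (\<lambda>i. frinv j (fps_nth s i)) \<in> SB 0" for j
  proof -
    have "fps_nth (Abs_fps (\<lambda>i. frinv j (fps_nth s i))) i * fact i = frinv j (fps_nth s i * fact i)" for i
      using frinv_mult[OF s(1) Qp_K[OF Qp_of_nat[of "fact i"]]] frinv_Qp[OF Qp_of_nat[of "fact i"]] by simp
    moreover have "fps_nth s i * fact i \<in> K" for i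
      using K_mult[OF s(1) Qp_K[OF Qp_of_nat[of "fact i"]]] by simp
    ultimately show ?thesis using s(2) by (simp add: SB_def vnull_def vge_frinv)
  qed
  then show ?case
    using tensor SB_const[of 0 b] by (auto simp: tensor_S_eq tup_def vge_def zero_ereal_def intro!: SB_mult0)
qed (auto intro: SB_add)

text \<open>The coefficients of F lie in the large field. In a \<open>zp_basis\<close> of it, F
  becomes a finite sum of \<open>T i * fps_const (s i)\<close> with \<open>T i\<close> defined over
  the p-adic numbers; such a \<open>T i\<close> is fixed by the Frobenius and therefore looks the
  same in all components of a tensor.\<close>

lemma diag_in_SO:
  assumes F: "F \<in> SB 0" and c: "c \<in> tensor_consts"
  shows "tup f (\<lambda>j. fps_const (c j) * F) \<in> SO"
  using c
proof (induction rule: tensor_consts.induct)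
  case (base a b)
  have "\<exists>g s. zp_basis UNIV g s" by (rule zp_basis_exists) auto
  then obtain g s where gs: "zp_basis UNIV g s" by blast
  then have s: "\<forall>i<g. vge 0 (s i)" unfolding zp_basis_def by blast
  have gen: "\<exists>a. (\<forall>i<g. a i \<in> Qp) \<and> x = (\<Sum>i<g. a i * s i) \<and>
       (\<forall>N::nat. vge (real N) x \<longrightarrow> (\<forall>i<g. vge (real N) (a i)))" for x
    using gs unfolding zp_basis_def by blast
  have "\<forall>n. \<exists>a. (\<forall>i<g. a i \<in> Qp) \<and> fps_nth F n * fact n = (\<Sum>i<g. a i * s i) \<and>
       (\<forall>N::nat. vge (real N) (fps_nth F n * fact n) \<longrightarrow> (\<forall>i<g. vge (real N) (a i)))"
    using gen by blast
  then obtain \<alpha> where "\<forall>n. (\<forall>i<g. \<alpha> n i \<in> Qp) \<and> fps_nth F n * fact n = (\<Sum>i<g. \<alpha> n i * s i) \<and>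
       (\<forall>N::nat. vge (real N) (fps_nth F n * fact n) \<longrightarrow> (\<forall>i<g. vge (real N) (\<alpha> n i)))"
    by (rule choice[THEN exE])
  then have \<alpha>: "\<And>n i. i < g \<Longrightarrow> \<alpha> n i \<in> Qp" "\<And>n. fps_nth F n * fact n = (\<Sum>i<g. \<alpha> n i * s i)"
    "\<And>n (N::nat) i. vge (real N) (fps_nth F n * fact n) \<Longrightarrow> i < g \<Longrightarrow> vge (real N) (\<alpha> n i)"
    by auto
  define T where "T = (\<lambda>i. Abs_fps (\<lambda>n. \<alpha> n i * inverse (of_nat (fact n))) :: 'a fps)"
  have TQ: "fps_nth (T i) n \<in> Qp" if "i < g" for i n
    using \<alpha>(1)[OF that] Qp_inverse[OF Qp_of_nat] by (simp add: T_def Qp_mult del: of_nat_fact)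
  have T: "T i \<in> SB 0" if "i < g" for i
  proof -
    have "vge 0 (\<alpha> n i)" for n using \<alpha>(3)[of 0 n i] SB_vge[OF F] that by simp
    moreover have "vnull (\<lambda>n. \<alpha> n i)"
      by (rule vnull_from_nat_bounds[OF SB_vnull[OF F]]) (use \<alpha>(3) that in auto)
    ultimately show ?thesis by (simp add: SB_def T_def mult.assoc)
  qed
  have FT: "F = (\<Sum>i<g. T i * fps_const (s i))"
  proof (rule fps_ext)
    fix n
    have "fps_nth F n = (fps_nth F n * fact n) * inverse (fact n)" by simp
    also have "\<dots> = fps_nth (\<Sum>i<g. T i * fps_const (s i)) n"
      unfolding \<alpha>(2) by (simp add: fps_sum_nth T_def sum_distrib_left sum_distrib_right ac_simps)
    finally show "fps_nth F n = fps_nth (\<Sum>i<g. T i * fps_const (s i)) n" .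
  qed
  have "tup f (\<lambda>j. fps_const (frinv j a * b) * F) = (\<Sum>i<g. tensor_S f K frob (fps_const a * T i) (b * s i))"
  proof
    fix j
    have "Abs_fps (\<lambda>n. frinv j (a * fps_nth (T i) n)) = fps_const (frinv j a) * T i" if "i < g" for i
      by (rule fps_ext) (simp add: frinv_mult[OF base(1) Qp_K[OF TQ[OF that]]] frinv_Qp[OF TQ[OF that]])
    then have "(\<Sum>i<g. tensor_S f K frob (fps_const a * T i) (b * s i) j) =
      (\<Sum>i<g. tup f (\<lambda>j. fps_const (frinv j a * b) * (T i * fps_const (s i))) j)"
      by (intro sum.cong) (auto simp: tensor_S_eq tup_def fps_const_mult[symmetric] ac_simps simp del: fps_const_mult)
    also have "\<dots> = tup f (\<lambda>j. fps_const (frinv j a * b) * F) j"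
      by (subst FT) (simp add: tup_def sum_distrib_left)
    finally show "tup f (\<lambda>j. fps_const (frinv j a * b) * F) j =
      (\<Sum>i<g. tensor_S f K frob (fps_const a * T i) (b * s i)) j"
      by (simp add: sum_fun_apply)
  qed
  moreover have "tensor_S f K frob (fps_const a * T i) (b * s i) \<in> SO" if "i < g" for i
  proof (rule S_O.tensor)
    show "fps_const a * T i \<in> breuil_S p v K"
      unfolding breuil_S_iff using base T[OF that] Qp_K[OF TQ[OF that]]
      by (auto intro!: K_mult SB_0mult SB_const)
    show "0 \<le> v (b * s i)"
      using vge_mult0[of 0 b "s i"] base s that by (simp add: vge_def zero_ereal_def)
  qed
  ultimately show ?case
    using SO_sum[of "{..<g}" "\<lambda>i. tensor_S f K frob (fps_const a * T i) (b * s i)"] by simp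
next
  case (add c d)
  have "tup f (\<lambda>j. fps_const (c j + d j) * F) = tup f (\<lambda>j. fps_const (c j) * F) + tup f (\<lambda>j. fps_const (d j) * F)"
    by (auto simp: tup_def fps_const_add[symmetric] distrib_right simp del: fps_const_add)
  then show ?case using S_O.add[OF add.IH] by (simp only:)
qed

lemma SO_iff: "F \<in> SO \<longleftrightarrow> (\<forall>j<f. F j \<in> SB 0) \<and> (\<forall>j\<ge>f. F j = 0)"
proof
  assume F: "(\<forall>j<f. F j \<in> SB 0) \<and> (\<forall>j\<ge>f. F j = 0)"
  have "\<forall>i. \<exists>c. i < f \<longrightarrow> c \<in> tensor_consts \<and> c i = 1 \<and> (\<forall>j<f. j \<noteq> i \<longrightarrow> c j = 0)"
    using tensor_consts_idempotent by blast
  then obtain c where "\<forall>i. i < f \<longrightarrow> c i \<in> tensor_consts \<and> c i i = 1 \<and> (\<forall>j<f. j \<noteq> i \<longrightarrow> c i j = 0)"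
    by (rule choice[THEN exE])
  then have c: "\<And>i. i < f \<Longrightarrow> c i \<in> tensor_consts" "\<And>i. i < f \<Longrightarrow> c i i = 1"
    "\<And>i j. i < f \<Longrightarrow> j < f \<Longrightarrow> j \<noteq> i \<Longrightarrow> c i j = 0"
    by auto
  have "F = (\<Sum>i<f. tup f (\<lambda>j. fps_const (c i j) * F i))"
  proof
    fix j
    show "F j = (\<Sum>i<f. tup f (\<lambda>j. fps_const (c i j) * F i)) j"
    proof (cases "j < f")
      case True
      have "(\<Sum>i<f. fps_const (c i j) * F i) = (\<Sum>i\<in>{j}. fps_const (c i j) * F i)"
        using True by (intro sum.mono_neutral_right) (auto simp: c)
      then show ?thesis using True c by (simp add: sum_fun_apply tup_def)
    next
      case False
      then show ?thesis using F by (simp add: sum_fun_apply tup_def)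
    qed
  qed
  also have "\<dots> \<in> SO" using F c by (intro SO_sum diag_in_SO) auto
  finally show "F \<in> SO" .
qed (rule SO_components)

lemma SE_iff: "F \<in> S_E p f v K frob \<longleftrightarrow> (\<forall>j<f. \<exists>B. F j \<in> SB B) \<and> (\<forall>j\<ge>f. F j = 0)"
proof -
  have "F \<in> S_E p f v K frob \<longleftrightarrow> (\<exists>n. (\<forall>j<f. F j \<in> SB (- real n)) \<and> (\<forall>j\<ge>f. F j = 0))"
    unfolding S_E_def mem_Collect_eq SO_iff SB_p_power_iff by simp
  also have "\<dots> \<longleftrightarrow> (\<forall>j<f. \<exists>B. F j \<in> SB B) \<and> (\<forall>j\<ge>f. F j = 0)"
  proof
    assume *: "(\<forall>j<f. \<exists>B. F j \<in> SB B) \<and> (\<forall>j\<ge>f. F j = 0)"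
    have "\<exists>n::nat. \<forall>j<m. F j \<in> SB (- real n)" if "m \<le> f" for m
      using that
    proof (induction m)
      case (Suc m)
      then obtain n :: nat where n: "\<forall>j<m. F j \<in> SB (- real n)" by auto
      obtain B where B: "F m \<in> SB B" using * Suc.prems by (meson Suc_le_lessD)
      obtain n' :: nat where "- B \<le> real n'" using real_arch_simple by blast
      then have "F m \<in> SB (- real (n + n'))" using B by (elim SB_mono) simp
      moreover have "\<forall>j<m. F j \<in> SB (- real (n + n'))" using SB_mono[of _ "- real n" "- real (n + n')"] n by simp
      ultimately show ?case by (intro exI[of _ "n + n'"]) (auto simp: less_Suc_eq)
    qed auto
    then show "\<exists>n. (\<forall>j<f. F j \<in> SB (- real n)) \<and> (\<forall>j\<ge>f. F j = 0)" using * by blast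
  qed auto
  finally show ?thesis .
qed

end

context pval
begin

section \<open>Valuations of factorials\<close>

lemma vv_p_mult_add_unit: "0 < r \<Longrightarrow> r < p \<Longrightarrow> vv (of_nat (p * q + r)) = 0"
proof -
  assume "0 < r" "r < p"
  then have "\<not> p dvd p * q + r" using nat_dvd_not_less by (simp add: dvd_add_right_iff)
  then show ?thesis using vv_of_int_unit[of "int (p * q + r)"]
    by (simp only: int_dvd_int_iff of_int_of_nat_eq not_False_eq_True simp_thms)
qed

lemma vv_fact_mult_add: "r < p \<Longrightarrow> vv (fact (p * q + r)) = vv (fact (p * q))"
proof (induction r)
  case (Suc r)
  have "(fact (p * q + Suc r) :: 'e) = of_nat (p * q + Suc r) * fact (p * q + r)" by simp
  then have "vv (fact (p * q + Suc r)) = vv (of_nat (p * q + Suc r)) + vv (fact (p * q + r))"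
    by (metis fact_nonzero mult_zero_left vv_mult)
  then show ?case using Suc vv_p_mult_add_unit[of "Suc r" q] by simp
qed simp

lemma vv_fact_mult: "vv (fact (p * q)) = real q + vv (fact q)"
proof (induction q)
  case (Suc q)
  have e: "p * Suc q = Suc (p * q + (p - 1))" using p_gt_1 by (simp add: algebra_simps)
  have "(fact (p * Suc q) :: 'e) = of_nat (p * Suc q) * fact (p * q + (p - 1))"
    unfolding e by simp
  also have "\<dots> = of_nat p * (of_nat (Suc q) * fact (p * q + (p - 1)))"
    by (simp only: of_nat_mult mult.assoc)
  finally have "vv (fact (p * Suc q)) = 1 + (vv (of_nat (Suc q)) + vv (fact (p * q + (p - 1))))"
    using vv_mult[OF of_nat_neq_0[of q] fact_nonzero[of "p * q + (p - 1)"]]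
      vv_mult[of "of_nat p" "of_nat (Suc q) * fact (p * q + (p - 1))"]
    by (simp del: of_nat_Suc fact_Suc)
  moreover have "vv (fact (Suc q)) = vv (of_nat (Suc q)) + vv (fact q)"
    unfolding fact_Suc by (rule vv_mult[OF of_nat_neq_0 fact_nonzero])
  ultimately show ?case using vv_fact_mult_add[of "p - 1" q] Suc by (simp del: fact_Suc mult_Suc_right)
qed simp

lemma vv_fact_div: "vv (fact n) = real (n div p) + vv (fact (n div p))"
  using vv_fact_mult_add[of "n mod p" "n div p"] vv_fact_mult[of "n div p"] by simp

lemma vv_fact_nonneg: "0 \<le> vv (fact n)"
  using vge_fact[of n] by (simp add: vge_iff)

lemma vv_fact_ge_div: "real (n div p) \<le> vv (fact n)"
  using vv_fact_div[of n] vv_fact_nonneg[of "n div p"] by simp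

lemma vv_fact_small: "n < p \<Longrightarrow> vv (fact n) = 0"
  using vv_fact_div[of n] by simp

text \<open>The consequence of Legendre's formula that (p - 1) v(n!) is n minus the digit sum of n;
  here by induction through v(n!) = q + v(q!) with q = n div p.\<close>

lemma vv_fact_le: "n \<ge> 1 \<Longrightarrow> (real p - 1) * vv (fact n) \<le> real n - 1"
proof (induction n rule: less_induct)
  case (less n)
  show ?case
  proof (cases "n < p")
    case True
    then show ?thesis using less by (simp add: vv_fact_small)
  next
    case False
    define q where "q = n div p"
    have q: "q < n" "1 \<le> q" "p * q \<le> n"
      using False less p_gt_1 by (auto simp: q_def Suc_le_eq div_greater_zero_iff)
    have "(real p - 1) * vv (fact q) \<le> real q - 1" using less.IH q by simp
    then have "(real p - 1) * (real q + vv (fact q)) \<le> real p * real q - 1" by (simp add: algebra_simps)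
    moreover have "real p * real q \<le> real n" using q(3) by (metis of_nat_le_iff of_nat_mult)
    ultimately show ?thesis using vv_fact_div[of n] by (simp add: q_def)
  qed
qed

lemma vge_fact_null: "\<exists>n0. \<forall>n\<ge>n0. C \<le> vv (fact n)"
proof -
  obtain N :: nat where N: "C \<le> real N" using real_arch_simple by blast
  have "C \<le> vv (fact n)" if "n \<ge> p * N" for n
  proof -
    have "N \<le> n div p" using that by (simp add: less_eq_div_iff_mult_less_eq mult.commute)
    then show ?thesis using N vv_fact_ge_div[of n] by linarith
  qed
  then show ?thesis by blast
qed

text \<open>The value at u = p of the divided power u^n/n!.\<close>

definition pdv :: "nat \<Rightarrow> 'e" where "pdv n = of_nat p ^ n / fact n"

lemma pdv_nz [simp]: "pdv n \<noteq> 0" by (simp add: pdv_def)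

lemma vv_pdv: "vv (pdv n) = real n - vv (fact n)"
  by (simp add: pdv_def vv_divide vv_power)

lemma vv_pdv_nonneg: "0 \<le> vv (pdv n)"
proof (cases "n = 0")
  case False
  have "vv (fact n) \<le> (real p - 1) * vv (fact n)"
    using mult_right_mono[of 1 "real p - 1" "vv (fact n)"] vv_fact_nonneg p_gt_1 by simp
  then show ?thesis using vv_fact_le[of n] False by (simp add: vv_pdv)
qed (simp add: vv_pdv)

text \<open>For n < p the factorial is a unit; for n >= p the bound on v(n!) gives n - v(n!) >= p -
  1. This is where a weight below p matters: high divided powers of p cannot spoil congruences
  modulo p^w.\<close>

lemma vv_pdv_ge: "w < p \<Longrightarrow> w \<le> n \<Longrightarrow> real w \<le> vv (pdv n)"
proof (cases "n < p")
  case False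
  assume "w < p" "w \<le> n"
  have "(real p - 1) * (real p - 1 + vv (fact n)) \<le> (real p - 1) * real n"
  proof -
    have "(real p - 1) * (real p - 1) - 1 \<le> (real p - 2) * real n"
    proof -
      have "(real p - 2) * real p \<le> (real p - 2) * real n"
        using False p_gt_1 by (intro mult_left_mono) auto
      then show ?thesis by (simp add: algebra_simps)
    qed
    then show ?thesis using vv_fact_le[of n] False p_gt_1 by (simp add: algebra_simps)
  qed
  then have "real p - 1 + vv (fact n) \<le> real n" using p_gt_1 by (simp add: mult_le_cancel_left_pos)
  then show ?thesis using \<open>w < p\<close> by (simp add: vv_pdv)
qed (simp add: vv_pdv vv_fact_small)

end

locale odd_padic = padic + assumes odd_p: "odd p"
begin

lemma p_ge_3: "3 \<le> p" using p_gt_1 odd_p by (cases "p = 2") auto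

text \<open>For odd p one has v(n!) <= (n - 1)/2. For p = 2 the valuation of p^n/n! is the binary
  digit sum of n, which does not tend to infinity.\<close>

lemma vnull_pdv: "vnull pdv"
  unfolding vnull_def
proof
  fix B
  obtain N :: nat where N: "2 * B \<le> real N" using real_arch_simple by blast
  have "vge B (pdv n)" if "n \<ge> Suc N" for n
  proof -
    have "2 * vv (fact n) \<le> (real p - 1) * vv (fact n)"
      using p_ge_3 vv_fact_nonneg by (intro mult_right_mono) auto
    then have "2 * vv (fact n) \<le> real n" using vv_fact_le[of n] that by simp
    then show ?thesis using that N by (simp add: vge_iff vv_pdv)
  qed
  then show "\<exists>n0. \<forall>n\<ge>n0. vge B (pdv n)" by blast
qed

section \<open>Substitution into power series\<close>

text \<open>W has divided powers, that is, W^n/n! stays in the ring. As v(n!) tends to infinity,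
  every series with bounded coefficients can be evaluated at W.\<close>

definition pd_nil :: "'a fps \<Rightarrow> bool" where
  "pd_nil W \<longleftrightarrow> (\<forall>n. W ^ n \<in> SB (vv (fact n)))"

text \<open>A p-adic limit of coefficients, because \<open>fps_compose\<close> is not the
  substitution when W has a constant term, and gamma has one.\<close>

definition subst :: "'a fps \<Rightarrow> 'a fps \<Rightarrow> 'a fps" where
  "subst W h = Abs_fps (\<lambda>i. vsum v (\<lambda>n. fps_nth h n * fps_nth (W ^ n) i))"

lemma pd_nil_SB: "pd_nil W \<Longrightarrow> W ^ n \<in> SB 0"
  unfolding pd_nil_def using SB_mono vv_fact_nonneg by blast

lemma pd_nil_null:
  assumes "pd_nil W" "\<And>n. vge B (a n)"
  shows "\<exists>n0. \<forall>n\<ge>n0. fps_const (a n) * W ^ n \<in> SB C"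
proof -
  obtain n0 where n0: "\<forall>n\<ge>n0. C - B \<le> vv (fact n)" using vge_fact_null by blast
  have "fps_const (a n) * W ^ n \<in> SB C" if "n \<ge> n0" for n
  proof -
    have "W ^ n \<in> SB (C - B)" using assms(1) n0 that unfolding pd_nil_def by (blast intro: SB_mono)
    from SB_mult[OF SB_const[OF assms(2)] this] show ?thesis by simp
  qed
  then show ?thesis by blast
qed

lemma subst_vsums:
  assumes "pd_nil W" "\<And>n. vge B (fps_nth h n)"
  shows "vsums (\<lambda>n. fps_nth h n * fps_nth (W ^ n) i) (fps_nth (subst W h) i)"
  unfolding subst_def
  using vsums_vsum[OF SB_null_coeff[of "\<lambda>n. fps_const (fps_nth h n) * W ^ n" i]] pd_nil_null[OF assms(1), of B "fps_nth h"] assms(2)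
  by simp

lemma subst_SB:
  assumes "pd_nil W" "\<And>n. vge B (fps_nth h n)"
  shows "subst W h \<in> SB B"
proof (rule SB_vsum[of "\<lambda>n. fps_const (fps_nth h n) * W ^ n"])
  show "fps_const (fps_nth h n) * W ^ n \<in> SB B" for n
    using SB_mult0[OF SB_const[OF assms(2)] pd_nil_SB[OF assms(1)]] .
qed (use pd_nil_null[OF assms(1), of B "fps_nth h"] subst_vsums[OF assms] assms(2) in auto)

lemma vsums_fps_mult:
  assumes "\<And>i. vsums (\<lambda>n. fps_nth (F n) i) (fps_nth S i)"
  shows "vsums (\<lambda>n. fps_nth (G * F n) i) (fps_nth (G * S) i)"
  unfolding fps_mult_nth by (intro vsums_sum vsums_cmult assms)

text \<open>It splits off the constant term of h, the one coefficient that need not be integral in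
  the application.\<close>

lemma subst_shift:
  assumes W: "pd_nil W" and h: "\<And>n. vge B (fps_nth h n)"
  shows "subst W h = fps_const (fps_nth h 0) + W * subst W (fps_shift 1 h)"
proof (rule fps_ext)
  fix i
  have "vsums (\<lambda>n. fps_nth (fps_const (fps_nth h (Suc n)) * W ^ n) k) (fps_nth (subst W (fps_shift 1 h)) k)" for k
    using subst_vsums[OF W, of B "fps_shift 1 h"] h by simp
  from vsums_fps_mult[OF this, of W i]
  have "vsums (\<lambda>n. fps_nth h (Suc n) * fps_nth (W ^ Suc n) i) (fps_nth (W * subst W (fps_shift 1 h)) i)"
    by (simp add: mult.left_commute[of W])
  from vsums_Suc[OF this]
  have "vsums (\<lambda>n. fps_nth h n * fps_nth (W ^ n) i)
    (fps_nth h 0 * fps_nth (W ^ 0) i + fps_nth (W * subst W (fps_shift 1 h)) i)"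
    by simp
  from vsums_unique[OF subst_vsums[OF W h] this]
  show "fps_nth (subst W h) i = fps_nth (fps_const (fps_nth h 0) + W * subst W (fps_shift 1 h)) i"
    by simp
qed

lemma power_diff_SB:
  assumes "W \<in> SB 0" "W' \<in> SB 0" "W - W' \<in> SB B"
  shows "W ^ n - W' ^ n \<in> SB B"
  unfolding power_diff_sumr2
  by (intro SB_mult0 assms SB_sum SB_power) 

text \<open>Constant terms cancel in the difference, so the bound B is asked for in positive degrees
  only; the weaker bound C on all coefficients secures convergence. Each W^n - W'^n is divisible by
  W - W', which supplies the gain of 1.\<close>

lemma subst_diff_SB:
  assumes W: "pd_nil W" "pd_nil W'" "W - W' \<in> SB 1"
    and h: "\<And>n. vge C (fps_nth h n)" "\<And>n. n \<ge> 1 \<Longrightarrow> vge B (fps_nth h n)"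
  shows "subst W h - subst W' h \<in> SB (B + 1)"
proof (rule SB_vsum[of "\<lambda>n. fps_const (fps_nth h n) * (W ^ n - W' ^ n)"])
  have W0: "W \<in> SB 0" "W' \<in> SB 0" using pd_nil_SB[OF W(1), of 1] pd_nil_SB[OF W(2), of 1] by auto
  show "fps_const (fps_nth h n) * (W ^ n - W' ^ n) \<in> SB (B + 1)" for n
    using SB_mult[OF SB_const[OF h(2)[of n]] power_diff_SB[OF W0 W(3), of n]] by (cases "n = 0") auto
  fix M
  obtain a b where "\<forall>n\<ge>a. fps_const (fps_nth h n) * W ^ n \<in> SB M"
    "\<forall>n\<ge>b. fps_const (fps_nth h n) * W' ^ n \<in> SB M"
    using pd_nil_null[OF W(1), of C "fps_nth h" M] pd_nil_null[OF W(2), of C "fps_nth h" M] h(1) by blast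
  then have "\<forall>n\<ge>max a b. fps_const (fps_nth h n) * (W ^ n - W' ^ n) \<in> SB M"
    unfolding right_diff_distrib by (auto intro!: SB_diff)
  then show "\<exists>n0. \<forall>n\<ge>n0. fps_const (fps_nth h n) * (W ^ n - W' ^ n) \<in> SB M" by blast
next
  fix i
  show "vsums (\<lambda>n. fps_nth (fps_const (fps_nth h n) * (W ^ n - W' ^ n)) i) (fps_nth (subst W h - subst W' h) i)"
    using vsums_add[OF subst_vsums[OF W(1) h(1), of i] vsums_cmult[OF subst_vsums[OF W(2) h(1), of i], of "-1"]]
    by (simp add: algebra_simps)
qed

text \<open>The derivative of W^n contains that of W, the source of the gain of 1, and the constant
  term of h disappears.\<close>

lemma subst_deriv_SB:
  assumes W: "pd_nil W" "fps_X * fps_deriv W \<in> SB 1"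
    and h: "\<And>n. vge C (fps_nth h n)" "\<And>n. n \<ge> 1 \<Longrightarrow> vge B (fps_nth h n)"
  shows "fps_X * fps_deriv (subst W h) \<in> SB (B + 1)"
proof (rule SB_vsum[of "\<lambda>n. fps_X * fps_deriv (fps_const (fps_nth h n) * W ^ n)"])
  show "fps_X * fps_deriv (fps_const (fps_nth h n) * W ^ n) \<in> SB (B + 1)" for n
  proof (cases n)
    case (Suc m)
    have d: "fps_deriv (W ^ n) = of_nat n * W ^ m * fps_deriv W"
      using fps_deriv_power[of W n] Suc by (simp add: fps_of_nat ac_simps del: power_Suc of_nat_Suc)
    have eq: "fps_X * fps_deriv (fps_const (fps_nth h n) * W ^ n) =
      fps_const (fps_nth h n) * (of_nat n * W ^ m * (fps_X * fps_deriv W))"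
      unfolding fps_deriv_mult_const_left d by (simp only: ac_simps)
    show ?thesis
      unfolding eq
      by (rule SB_mult[OF SB_const[OF h(2)] SB_0mult[OF SB_mult0[OF SB_of_nat pd_nil_SB[OF W(1)]] W(2)]])
         (simp add: Suc)
  qed simp
  show "\<exists>n0. \<forall>n\<ge>n0. fps_X * fps_deriv (fps_const (fps_nth h n) * W ^ n) \<in> SB M" for M
    using pd_nil_null[OF W(1), of C "fps_nth h" M] h(1) SB_X_deriv by blast
  show "vsums (\<lambda>n. fps_nth (fps_X * fps_deriv (fps_const (fps_nth h n) * W ^ n)) i)
      (fps_nth (fps_X * fps_deriv (subst W h)) i)" for i
  proof -
    have e: "fps_nth (fps_X * fps_deriv F) i = of_nat i * fps_nth F i" for F :: "'a fps"
      by (cases i) auto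
    show ?thesis unfolding e using vsums_cmult[OF subst_vsums[OF W(1) h(1), of i], of "of_nat i"] by simp
  qed
qed

subsection \<open>The elements $u^p/p$ and $\gamma$\<close>

definition upow :: "'a fps" where "upow = fps_const (1 / of_nat p) * fps_X ^ p"

abbreviation gamma :: "'a fps" where "gamma \<equiv> gam p"

lemma compose_upow_nth: "fps_nth (fps_compose F upow) n =
    (if p dvd n then fps_nth F (n div p) * (1 / of_nat p) ^ (n div p) else 0)"
  unfolding upow_def by (rule fps_compose_monom_nth) simp

text \<open>The coefficient of u^(pm) is G_m/p^m, and v((pm)!) = m + v(m!). The factor p^m is paid
  for and v(m!) is left over, which even makes merely bounded coefficients a null sequence.\<close>

lemma compose_upow_SB:
  assumes "\<And>n. vge B (fps_nth G n)"
  shows "fps_compose G upow \<in> SB B"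
proof -
  have b: "vge (B + vv (fact (n div p))) (fps_nth (fps_compose G upow) n * fact n)" for n
  proof (cases "p dvd n \<and> fps_nth G (n div p) \<noteq> 0")
    case True
    then have "B \<le> vv (fps_nth G (n div p))" using assms vge_iff by blast
    then show ?thesis
      using True vv_fact_div[of n]
      by (simp add: compose_upow_nth vge_iff vv_mult vv_power vv_divide)
  qed (auto simp: compose_upow_nth)
  have "vnull (\<lambda>n. fps_nth (fps_compose G upow) n * fact n)"
    unfolding vnull_def
  proof
    fix M
    obtain n0 where n0: "\<forall>n\<ge>n0. M - B \<le> vv (fact n)" using vge_fact_null by blast
    have "vge M (fps_nth (fps_compose G upow) n * fact n)" if "n \<ge> p * n0" for n
    proof -
      have "n0 \<le> n div p" using that by (simp add: less_eq_div_iff_mult_less_eq mult.commute)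
      then show ?thesis using vge_mono[OF b[of n], of M] n0 by fastforce
    qed
    then show "\<exists>n0. \<forall>n\<ge>n0. vge M (fps_nth (fps_compose G upow) n * fact n)" by blast
  qed
  moreover have "vge B (fps_nth (fps_compose G upow) n * fact n)" for n
    using vge_mono[OF b[of n]] vv_fact_nonneg by simp
  ultimately show ?thesis by (simp add: SB_def)
qed

lemma upow_nth0 [simp]: "fps_nth upow 0 = 0"
  by (simp add: upow_def fps_X_power_nth)

lemma upow_power: "upow ^ n = fps_compose (fps_X ^ n) upow"
  by (simp add: fps_compose_power[symmetric])

text \<open>By the binomial theorem (u - p)^m/m! is the sum of the products of u^i/i! with
  (-p)^(m-i)/(m-i)!, and the latter are integral.\<close>

lemma X_minus_p_power_SB: "(fps_X - of_nat p) ^ m \<in> SB (vv (fact m))"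
proof (rule SB_finite[of _ _ "Suc m"])
  have nth: "fps_nth ((fps_X - of_nat p) ^ m) i =
    (if i \<le> m then of_nat (m choose i) * (- of_nat p) ^ (m - i) else (0 :: 'a))" for i
  proof -
    have "(fps_X - of_nat p) ^ m = (fps_X + fps_const (- of_nat p :: 'a)) ^ m"
      by (simp add: fps_of_nat fps_const_neg[symmetric] del: fps_const_neg)
    also have "\<dots> = (\<Sum>k\<le>m. fps_const (of_nat (m choose k) * (- of_nat p) ^ (m - k)) * fps_X ^ k)"
      unfolding binomial_ring fps_const_power fps_of_nat[symmetric]
      by (intro sum.cong refl) (simp only: fps_const_mult[symmetric] ac_simps)
    finally show ?thesis
      by (simp add: fps_sum_nth fps_X_power_nth if_distrib cong: if_cong)
  qed
  fix i
  show "vge (vv (fact m)) (fps_nth ((fps_X - of_nat p) ^ m) i * fact i)"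
  proof (cases "i \<le> m")
    case True
    have "fps_nth ((fps_X - of_nat p) ^ m) i * fact i = fact m * ((-1) ^ (m - i) * pdv (m - i))"
      using True by (simp add: nth binomial_fact pdv_def power_minus[of "of_nat p"])
    then show ?thesis
      using vge_mult0[of "vv (fact m)" "fact m" "(-1) ^ (m - i) * pdv (m - i)"]
        vge_mult0[of 0 "(-1) ^ (m - i)" "pdv (m - i)"] vge_power0[of "-1" "m - i"] vge_one vv_pdv_nonneg
      by (simp add: vge_iff)
  qed (simp add: nth)
  show "i \<ge> Suc m \<Longrightarrow> fps_nth ((fps_X - of_nat p) ^ m) i = (0 :: 'a)" by (simp add: nth)
qed

text \<open>gamma^n = (u - p)^(pn)/p^n, and v((pn)!) - n = v(n!).\<close>

lemma pd_nil_gamma: "pd_nil gamma"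
  unfolding pd_nil_def
proof
  fix n
  have "gamma ^ n = fps_const ((1 / of_nat p) ^ n) * (fps_X - of_nat p) ^ (p * n)"
    by (simp add: gam_def power_mult_distrib power_mult)
  also have "\<dots> \<in> SB (- real n + vv (fact (p * n)))"
    by (intro SB_mult SB_const X_minus_p_power_SB) (simp add: vge_iff vv_power vv_divide)
  finally show "gamma ^ n \<in> SB (vv (fact n))" by (simp add: vv_fact_mult)
qed

lemma pd_nil_upow: "pd_nil upow"
  unfolding pd_nil_def
proof
  fix n
  have "upow ^ n = fps_const ((1 / of_nat p) ^ n) * fps_X ^ (p * n)"
    by (simp add: upow_def power_mult_distrib power_mult)
  also have "\<dots> \<in> SB (- real n + vv (fact (p * n)))"
    by (intro SB_mult SB_const SB_finite[of _ _ "Suc (p * n)"])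
       (auto simp: vge_iff vv_power vv_divide fps_X_power_nth)
  finally show "upow ^ n \<in> SB (vv (fact n))" by (simp add: vv_fact_mult)
qed

lemma subst_upow: "subst upow h = fps_compose h upow"
proof (rule fps_ext)
  fix i
  have "fps_nth (upow ^ n) i = 0" if "n \<ge> Suc i" for n
  proof -
    have "n * 1 \<le> n * p" using p_gt_1 by (intro mult_le_mono) auto
    then have "i \<noteq> n * p" using that by linarith
    then show ?thesis using p_gt_1 by (auto simp: upow_power compose_upow_nth fps_X_power_nth mult.commute elim!: dvdE)
  qed
  then have "vsums (\<lambda>n. fps_nth h n * fps_nth (upow ^ n) i) (\<Sum>n<Suc i. fps_nth h n * fps_nth (upow ^ n) i)"
    by (intro vsums_finite) simp
  from vsum_eqI[OF this] show "fps_nth (subst upow h) i = fps_nth (fps_compose h upow) i"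
    by (simp add: subst_def fps_compose_nth lessThan_Suc_atMost atLeast0AtMost)
qed

lemma p_in_SB: "of_nat p \<in> SB 1"
  using SB_const[of 1 "of_nat p"] by (simp add: fps_of_nat vge_iff)

lemma X_p_SB: "fps_X - of_nat p \<in> SB 0"
  by (intro SB_diff SB_X SB_of_nat)

text \<open>Factoring the difference of p-th powers, the quotient by p is minus the sum of (u - p)^k
  u^(p-1-k) over k < p. Modulo p all p summands equal u^(p-1), so the sum vanishes modulo p.\<close>

lemma gamma_minus_upow: "gamma - upow \<in> SB 1"
proof -
  have d: "(fps_X - of_nat p) ^ k - fps_X ^ k \<in> SB 1" for k
    by (rule power_diff_SB[OF X_p_SB SB_X]) (simp add: SB_uminus p_in_SB)
  have "(\<Sum>k<p. (fps_X - of_nat p) ^ k * fps_X ^ (p - Suc k)) =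
     (\<Sum>k<p. ((fps_X - of_nat p) ^ k - fps_X ^ k) * fps_X ^ (p - Suc k)) + (\<Sum>k<p. fps_X ^ (p - 1) :: 'a fps)"
    unfolding sum.distrib[symmetric]
    by (intro sum.cong refl) (simp add: algebra_simps power_add[symmetric])
  also have "\<dots> \<in> SB 1"
    by (rule SB_add[OF SB_sum[OF SB_mult0[OF d SB_power[OF SB_X]]]])
       (simp add: SB_mult0 SB_power SB_X p_in_SB)
  finally have "- (\<Sum>k<p. (fps_X - of_nat p) ^ k * fps_X ^ (p - Suc k)) \<in> SB 1"
    by (rule SB_uminus)
  also have "- (\<Sum>k<p. (fps_X - of_nat p) ^ k * fps_X ^ (p - Suc k)) = gamma - upow"
  proof -
    have "gamma - upow = fps_const (1 / of_nat p) * ((fps_X - of_nat p) ^ p - fps_X ^ p)"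
      by (simp add: gam_def upow_def right_diff_distrib)
    also have "(fps_X - of_nat p) ^ p - fps_X ^ p =
        fps_const (of_nat p) * (- (\<Sum>k<p. (fps_X - of_nat p) ^ k * fps_X ^ (p - Suc k)) :: 'a fps)"
      unfolding power_diff_sumr2 by (simp add: fps_of_nat sum_negf mult.commute)
    also have "fps_const (1 / of_nat p) * (fps_const (of_nat p) * (- (\<Sum>k<p. (fps_X - of_nat p) ^ k * fps_X ^ (p - Suc k))))
      = (- (\<Sum>k<p. (fps_X - of_nat p) ^ k * fps_X ^ (p - Suc k)) :: 'a fps)"
      unfolding mult.assoc[symmetric] fps_const_mult by simp
    finally show ?thesis by simp
  qed
  finally show ?thesis .
qed

lemma X_minus_p_power_p: "(fps_X - of_nat p) ^ p = of_nat p * gamma"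
  unfolding gam_def fps_of_nat[symmetric] mult.assoc[symmetric] fps_const_mult by simp

text \<open>u (u - p)^(p-1) = (u - p)^p + p (u - p)^(p-1), and the first summand is p times
  gamma.\<close>

lemma gamma_X_deriv: "fps_X * fps_deriv gamma \<in> SB 1"
proof -
  have "fps_deriv gamma = (fps_X - of_nat p) ^ (p - 1)"
  proof -
    have "fps_deriv gamma = fps_const (1 / of_nat p) * (fps_const (of_nat p) * (fps_X - of_nat p) ^ (p - 1))"
      by (simp add: gam_def fps_deriv_power fps_of_nat)
    then show ?thesis unfolding mult.assoc[symmetric] fps_const_mult by simp
  qed
  then have "fps_X * fps_deriv gamma = (fps_X - of_nat p) * (fps_X - of_nat p) ^ (p - 1) + of_nat p * (fps_X - of_nat p) ^ (p - 1)"
    by (simp add: algebra_simps)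
  also have "(fps_X - of_nat p) * (fps_X - of_nat p) ^ (p - 1) = (of_nat p * gamma :: 'a fps)"
    using p_gt_1 X_minus_p_power_p by (metis p_nz(2) power_eq_if p_nz(1))
  finally show ?thesis
    using SB_mult0[OF p_in_SB pd_nil_SB[OF pd_nil_gamma, of 1]]
    by (auto intro!: SB_add SB_mult0 p_in_SB SB_power X_p_SB)
qed

text \<open>(u^p - p)^p / p = p^(p-1) (u^p/p - 1)^p.\<close>

lemma gamma_frobenius: "fps_compose gamma (fps_X ^ p) \<in> SB (real p - 1)"
proof -
  have X0: "fps_nth (fps_X ^ p :: 'a fps) 0 = 0" by (simp add: fps_X_power_nth)
  have pc: "fps_compose (of_nat p) (fps_X ^ p) = (of_nat p :: 'a fps)"
    unfolding fps_of_nat[symmetric] by (rule fps_const_compose)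
  have gX: "fps_X ^ p = of_nat p * upow"
    unfolding upow_def fps_of_nat[symmetric] mult.assoc[symmetric] fps_const_mult by simp
  have "fps_compose gamma (fps_X ^ p) = fps_const (1 / of_nat p) * (fps_X ^ p - of_nat p) ^ p"
    unfolding gam_def using X0
    by (simp add: fps_compose_mult_distrib fps_compose_power[symmetric] fps_compose_sub_distrib pc)
  also have "(fps_X ^ p - of_nat p) ^ p = (of_nat p * (upow - 1) :: 'a fps) ^ p"
    unfolding gX by (simp add: right_diff_distrib)
  also have "\<dots> = fps_const (of_nat p ^ p) * (upow - 1) ^ p"
    by (simp add: power_mult_distrib fps_of_nat[symmetric])
  also have "fps_const (1 / of_nat p) * (fps_const (of_nat p ^ p) * (upow - 1) ^ p) =
      fps_const (1 / of_nat p * of_nat p ^ p) * (upow - 1) ^ p"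
    unfolding mult.assoc[symmetric] fps_const_mult ..
  also have "\<dots> \<in> SB (real p - 1)"
    using pd_nil_SB[OF pd_nil_upow, of 1]
    by (intro SB_mult0 SB_const SB_power SB_diff SB_one) (auto simp: vge_iff vv_mult vv_power vv_divide)
  finally show ?thesis .
qed


section \<open>Expansion at \<open>u = p\<close>\<close>


text \<open>Passing from \<open>F\<close> to \<open>F(pX)\<close> moves the point \<open>u = p\<close> to \<open>X = 1\<close>; the image of \<open>F\<close>
  under Frobenius is \<open>F(pX)\<close> evaluated at \<open>X = u^p / p\<close>.\<close>

definition dilate :: "'a fps \<Rightarrow> 'a fps" where
  "dilate F = fps_compose F (fps_const (of_nat p) * fps_X)"

lemma dilate_nth: "fps_nth (dilate F) i = fps_nth F i * of_nat p ^ i"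
  unfolding dilate_def using fps_compose_monom_nth[of 1 F "of_nat p" i] by simp

lemma dilate_mult: "dilate (F * G) = dilate F * dilate G"
  unfolding dilate_def by (rule fps_compose_mult_distrib) simp

lemma dilate_add: "dilate (F + G) = dilate F + dilate G" by (rule fps_ext) (simp add: dilate_nth algebra_simps)
lemma dilate_const [simp]: "dilate (fps_const c) = fps_const c" by (simp add: dilate_def)

lemma dilate_power: "dilate (F ^ n) = dilate F ^ n"
  by (induction n) (auto simp: dilate_mult simp flip: fps_const_1_eq_1)

lemma dilate_X_p: "dilate (fps_X - of_nat p) = fps_const (of_nat p) * (fps_X - 1)"
  by (rule fps_ext) (auto simp: dilate_nth fps_of_nat[symmetric] fps_X_def fps_one_def)

lemma frobenius_eq_dilate: "fps_compose F (fps_X ^ p) = fps_compose (dilate F) upow"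
  by (rule fps_ext) (use fps_compose_monom_nth[of p F 1] in
    \<open>auto simp: compose_upow_nth dilate_nth power_one_over\<close>)

lemma dilate_nth_pdv: "fps_nth (dilate F) i = (fps_nth F i * fact i) * pdv i"
  by (simp add: dilate_nth pdv_def)

lemma dilate_null: "F \<in> SB B \<Longrightarrow> vnull (fps_nth (dilate F))"
  using vnull_mult_bounded[OF vnull_pdv, of B "\<lambda>i. fps_nth F i * fact i"] SB_vge[of F B]
  by (simp add: dilate_nth_pdv[abs_def] mult.commute)

text \<open>The n-th Taylor coefficient of G at X = 1, that is, the coefficient of T^n when X = 1 +
  T. The series converges whenever the coefficients of G tend to 0.\<close>

definition taylor :: "nat \<Rightarrow> 'a fps \<Rightarrow> 'a" where
  "taylor n G = vsum v (\<lambda>i. of_nat (i choose n) * fps_nth G i)"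

lemma taylor_vsums: "vnull (fps_nth G) \<Longrightarrow> vsums (\<lambda>i. of_nat (i choose n) * fps_nth G i) (taylor n G)"
  unfolding taylor_def by (rule vsums_vsum) (simp add: vnull_mult_bounded[OF _ vge_of_nat] mult.commute)

lemma taylor_eqI: "vsums (\<lambda>i. of_nat (i choose n) * fps_nth G i) s \<Longrightarrow> taylor n G = s"
  unfolding taylor_def by (rule vsum_eqI)

lemma taylor_add: "vnull (fps_nth G) \<Longrightarrow> vnull (fps_nth H) \<Longrightarrow> taylor n (G + H) = taylor n G + taylor n H"
  using vsums_add[OF taylor_vsums[of G n] taylor_vsums[of H n]] by (intro taylor_eqI) (simp add: distrib_left)

lemma taylor_cmult: "vnull (fps_nth G) \<Longrightarrow> taylor n (fps_const c * G) = c * taylor n G"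
  using vsums_cmult[OF taylor_vsums[of G n], of c] by (intro taylor_eqI) (simp add: mult.left_commute)

lemma X1_mult_nth: "fps_nth ((fps_X - 1) * G) i = (case i of 0 \<Rightarrow> 0 | Suc k \<Rightarrow> fps_nth G k) - fps_nth G i"
  for G :: "'a fps"
proof -
  have "(fps_X - 1) * G = fps_X * G - G" by (simp add: algebra_simps)
  then show ?thesis by (cases i) auto
qed

lemma vnull_X1_mult: "vnull (fps_nth G) \<Longrightarrow> vnull (fps_nth ((fps_X - 1) * G))"
proof -
  assume G: "vnull (fps_nth G)"
  have "vnull (\<lambda>i. case i of 0 \<Rightarrow> 0 | Suc k \<Rightarrow> fps_nth G k)"
    using G vnull_shift[of "\<lambda>i. case i of 0 \<Rightarrow> 0 | Suc k \<Rightarrow> fps_nth G k" 1] by simp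
  from vnull_diff[OF this G] show ?thesis by (simp add: X1_mult_nth[abs_def])
qed

text \<open>Multiplication by T shifts the expansion in T; on the level of the sums this is Pascal's
  rule.\<close>

lemma taylor_X1_mult:
  assumes G: "vnull (fps_nth G)"
  shows "taylor n ((fps_X - 1) * G) = (case n of 0 \<Rightarrow> 0 | Suc m \<Rightarrow> taylor m G)"
proof (rule taylor_eqI)
  have "vsums (\<lambda>i. of_nat (Suc i choose n) * fps_nth G i) ((case n of 0 \<Rightarrow> 0 | Suc m \<Rightarrow> taylor m G) + taylor n G)"
  proof (cases n)
    case 0
    then show ?thesis using taylor_vsums[OF G, of 0] by simp
  next
    case (Suc m)
    then show ?thesis using vsums_add[OF taylor_vsums[OF G, of m] taylor_vsums[OF G, of n]]
      by (simp add: distrib_right)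
  qed
  then have "vsums (\<lambda>i. of_nat (i choose n) * (case i of 0 \<Rightarrow> 0 | Suc k \<Rightarrow> fps_nth G k))
    (0 + ((case n of 0 \<Rightarrow> 0 | Suc m \<Rightarrow> taylor m G) + taylor n G))"
    using vsums_Suc[of "\<lambda>i. of_nat (i choose n) * (case i of 0 \<Rightarrow> 0 | Suc k \<Rightarrow> fps_nth G k)"] by simp
  from vsums_add[OF this vsums_cmult[OF taylor_vsums[OF G, of n], of "-1"]]
  show "vsums (\<lambda>i. of_nat (i choose n) * fps_nth ((fps_X - 1) * G) i) (case n of 0 \<Rightarrow> 0 | Suc m \<Rightarrow> taylor m G)"
    by (simp add: X1_mult_nth right_diff_distrib)
qed

lemma taylor_X1_power_mult:
  "vnull (fps_nth G) \<Longrightarrow> n < k \<Longrightarrow> taylor n ((fps_X - 1) ^ k * G) = 0"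
proof (induction k arbitrary: n)
  case (Suc k)
  have "vnull (fps_nth ((fps_X - 1) ^ k * G))" for k
  proof (induction k)
    case (Suc k)
    then show ?case using vnull_X1_mult by (simp add: mult.assoc)
  qed (simp add: Suc.prems)
  then show ?case using Suc by (auto simp: mult.assoc taylor_X1_mult split: nat.split)
qed simp

lemma vge_X1_power: "vge 0 (fps_nth ((fps_X - 1) ^ n) k)"
proof (induction n arbitrary: k)
  case (Suc n)
  then show ?case by (auto simp: X1_mult_nth intro!: vge_diff split: nat.split)
qed (auto simp: vge_one)

text \<open>The factor p^n/n! can be taken out of every term, as C(i,n) p^i/i! is the product of
  p^n/n! and p^(i-n)/(i-n)!.\<close>

lemma taylor_dilate_vge:
  assumes "F \<in> SB B"
  shows "vge (B + vv (pdv n)) (taylor n (dilate F))"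
proof (rule vsums_vge[OF taylor_vsums[OF dilate_null[OF assms]]])
  fix i
  show "vge (B + vv (pdv n)) (of_nat (i choose n) * fps_nth (dilate F) i)"
  proof (cases "n \<le> i")
    case True
    have "of_nat (i choose n) * fps_nth (dilate F) i = (fps_nth F i * fact i) * (pdv n * pdv (i - n))"
      using True by (simp add: dilate_nth pdv_def binomial_fact power_add[symmetric])
    also have "vge (B + vv (pdv n)) \<dots>"
      by (intro vge_mult[OF SB_vge[OF assms]] vge_mult0) (auto simp: vge_iff vv_pdv_nonneg)
    finally show ?thesis .
  qed (simp add: binomial_eq_0)
qed

text \<open>Expand each X^i in powers of X - 1. The part of degree n >= w carries the factor p^n/n!,
  which is divisible by p^w since w < p; hence the Taylor polynomial of degree below w suffices
  modulo p^w.\<close>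

lemma dilate_expansion:
  assumes F: "F \<in> SB 0" and w: "w < p"
  shows "vge (real w) (fps_nth (dilate F - (\<Sum>n<w. fps_const (taylor n (dilate F)) * (fps_X - 1) ^ n)) k)"
proof -
  let ?c = "\<lambda>i n. of_nat (i choose n) * fps_nth (dilate F) i"
  have "vsums (\<lambda>i. fps_nth (dilate F) i * (if k = i then 1 else 0)) (fps_nth (dilate F) k)"
    using vsums_finite[of "Suc k" "\<lambda>i. fps_nth (dilate F) i * (if k = i then 1 else 0)"] by simp
  moreover have "vsums (\<lambda>i. \<Sum>n<w. fps_nth ((fps_X - 1) ^ n) k * ?c i n)
      (\<Sum>n<w. fps_nth ((fps_X - 1) ^ n) k * taylor n (dilate F))"
    by (intro vsums_sum vsums_cmult taylor_vsums dilate_null[OF F])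
  ultimately have "vsums (\<lambda>i. fps_nth (dilate F) i * (if k = i then 1 else 0) +
      (-1) * (\<Sum>n<w. fps_nth ((fps_X - 1) ^ n) k * ?c i n))
    (fps_nth (dilate F) k + (-1) * (\<Sum>n<w. fps_nth ((fps_X - 1) ^ n) k * taylor n (dilate F)))"
    by (intro vsums_add vsums_cmult)
  moreover have "vge (real w) (fps_nth (dilate F) i * (if k = i then 1 else 0) +
      (-1) * (\<Sum>n<w. fps_nth ((fps_X - 1) ^ n) k * ?c i n))" for i
  proof -
    have "fps_X ^ i = (\<Sum>n\<le>i. of_nat (i choose n) * (fps_X - 1 :: 'a fps) ^ n)"
      using binomial_ring[of "fps_X - 1 :: 'a fps" 1 i] by simp
    \<comment> \<open>Binomial coefficients beyond i vanish, so the range may be enlarged until it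
      contains all n < w, whatever i is.\<close>
    also have "\<dots> = (\<Sum>n<max w (Suc i). of_nat (i choose n) * (fps_X - 1) ^ n)"
      by (rule sum.mono_neutral_left) auto
    finally have X': "fps_X ^ i = (\<Sum>n<max w (Suc i). of_nat (i choose n) * (fps_X - 1 :: 'a fps) ^ n)" .
    have "fps_nth (fps_X ^ i) k = (\<Sum>n<max w (Suc i). of_nat (i choose n) * fps_nth ((fps_X - 1 :: 'a fps) ^ n) k)"
      unfolding X' fps_sum_nth fps_of_nat[symmetric] fps_mult_left_const_nth ..
    then have X: "(if k = i then 1 else 0) = (\<Sum>n<max w (Suc i). of_nat (i choose n) * fps_nth ((fps_X - 1 :: 'a fps) ^ n) k)"
      by (simp only: fps_X_power_nth)
    have "{..<max w (Suc i)} = {..<w} \<union> {w..<max w (Suc i)}" by auto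
    then have "(\<Sum>n<max w (Suc i). fps_nth ((fps_X - 1) ^ n) k * ?c i n) =
      (\<Sum>n<w. fps_nth ((fps_X - 1) ^ n) k * ?c i n) + (\<Sum>n=w..<max w (Suc i). fps_nth ((fps_X - 1) ^ n) k * ?c i n)"
      by (simp add: sum.union_disjoint ivl_disj_int)
    then have "fps_nth (dilate F) i * (if k = i then 1 else 0) + (-1) * (\<Sum>n<w. fps_nth ((fps_X - 1) ^ n) k * ?c i n)
      = (\<Sum>n=w..<max w (Suc i). fps_nth ((fps_X - 1) ^ n) k * ?c i n)"
      unfolding X by (simp add: sum_distrib_left sum_negf mult_ac)
    moreover have "vge (real w) (fps_nth ((fps_X - 1) ^ n) k * ?c i n)" if "n \<ge> w" for n
    proof (rule vge_0mult[OF vge_X1_power])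
      show "vge (real w) (?c i n)"
      proof (cases "n \<le> i")
        case True
        have "?c i n = pdv n * ((fps_nth F i * fact i) * pdv (i - n))"
          using True by (simp add: dilate_nth pdv_def binomial_fact power_add[symmetric])
        also have "vge (real w) \<dots>"
          using vge_mult0[OF _ vge_mult0[OF SB_vge[OF F]]] vv_pdv_ge[OF w that] vv_pdv_nonneg by (simp add: vge_iff)
        finally show ?thesis .
      qed (simp add: binomial_eq_0)
    qed
    ultimately show ?thesis by (auto intro: vge_sum)
  qed
  ultimately have "vge (real w) (fps_nth (dilate F) k + (-1) * (\<Sum>n<w. fps_nth ((fps_X - 1) ^ n) k * taylor n (dilate F)))"
    using vsums_vge by blast
  then show ?thesis by (simp add: fps_sum_nth mult.commute)
qed

section \<open>Polynomial moments\<close>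

text \<open>The value at X = 1 of q(X d/dX) G. The monomials q = X^m describe the iterates of N, the
  binomial polynomials the Taylor coefficients; everything about the filtration is a change of basis
  between the two.\<close>

definition moment :: "'a poly \<Rightarrow> 'a fps \<Rightarrow> 'a" where
  "moment q G = vsum v (\<lambda>i. poly q (of_nat i) * fps_nth G i)"

lemma moment_vsums:
  assumes "vnull (fps_nth G)"
  shows "vsums (\<lambda>i. poly q (of_nat i) * fps_nth G i) (moment q G)"
  unfolding moment_def
proof (rule vsums_vsum)
  have "vnull (\<lambda>i. \<Sum>k\<le>Polynomial.degree q. coeff q k * (fps_nth G i * of_nat (i ^ k)))"
    by (intro vnull_sum vnull_cmult vnull_mult_bounded[OF assms vge_of_nat])
  then show "vnull (\<lambda>i. poly q (of_nat i) * fps_nth G i)"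
    by (simp add: poly_altdef sum_distrib_left sum_distrib_right mult_ac)
qed

lemma moment_eqI: "vsums (\<lambda>i. poly q (of_nat i) * fps_nth G i) s \<Longrightarrow> moment q G = s"
  unfolding moment_def by (rule vsum_eqI)

lemma moment_smult: "vnull (fps_nth G) \<Longrightarrow> moment (smult c q) G = c * moment q G"
  using vsums_cmult[OF moment_vsums[of G q], of c] by (intro moment_eqI) (simp add: mult.assoc)

lemma moment_sum: "vnull (fps_nth G) \<Longrightarrow> moment (\<Sum>k\<in>A. q k) G = (\<Sum>k\<in>A. moment (q k) G)"
  using vsums_sum[of A "\<lambda>k i. poly (q k) (of_nat i) * fps_nth G i" "\<lambda>k. moment (q k) G"] moment_vsums
  by (intro moment_eqI) (simp add: poly_sum sum_distrib_right)

primrec binom_poly :: "nat \<Rightarrow> 'a poly" where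
  "binom_poly 0 = 1"
| "binom_poly (Suc n) = smult (1 / of_nat (Suc n)) (binom_poly n * [:- of_nat n, 1:])"

lemma poly_binom_poly: "poly (binom_poly n) x = x gchoose n"
proof (induction n)
  case (Suc n)
  have e: "x gchoose Suc n = (x gchoose n) * (x - of_nat n) / of_nat (Suc n)"
    by (simp add: gbinomial_prod_rev)
  show ?case unfolding e by (simp add: Suc del: of_nat_Suc, simp add: algebra_simps)
qed simp

lemma poly_binom_poly_nat: "poly (binom_poly n) (of_nat i) = of_nat (i choose n)"
  by (simp add: poly_binom_poly binomial_gbinomial)

lemma degree_binom_poly: "Polynomial.degree (binom_poly n) \<le> n"
proof (induction n)
  case (Suc n)
  have "Polynomial.degree (binom_poly (Suc n)) \<le> Polynomial.degree (binom_poly n * [:- of_nat n, 1:])"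
    unfolding binom_poly.simps by (rule degree_smult_le)
  also have "\<dots> \<le> Polynomial.degree (binom_poly n) + Polynomial.degree [:- of_nat n, 1 :: 'a:]"
    by (rule degree_mult_le)
  also have "\<dots> \<le> Suc n" using Suc by simp
  finally show ?case .
qed simp

lemma taylor_eq_moment: "taylor n G = moment (binom_poly n) G"
  by (simp add: taylor_def moment_def poly_binom_poly_nat)

definition log_coeff :: "nat \<Rightarrow> 'a" where "log_coeff a = (if a = 0 then 0 else (-1) ^ (a - 1) / of_nat a)"

lemma smult_sum_right: "smult c (\<Sum>k\<in>A. q k) = (\<Sum>k\<in>A. smult c (q k))"
  by (induction A rule: infinite_finite_induct) (auto simp: smult_add_right)

lemma binom_poly_mult_linear: "binom_poly m * [:- of_nat (m + a), 1:] =
    smult (of_nat (Suc m)) (binom_poly (Suc m)) - smult (of_nat a) (binom_poly m)"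
proof -
  have "smult (of_nat (Suc m)) (binom_poly (Suc m)) = binom_poly m * [:- of_nat m, 1:]"
    by (simp del: of_nat_Suc)
  moreover have "[:- of_nat (m + a), 1:] = [:- of_nat m, 1:] - [:of_nat a:: 'a:]" by simp
  ultimately show ?thesis
    by (simp only: right_diff_distrib mult.commute[of "binom_poly m" "[:of_nat a:]"] mult_pCons_left) simp
qed

text \<open>Differentiation is the logarithm of the shift: $\frac{d}{dz}(1+T)^z = \log(1+T)\,(1+T)^z$.\<close>

lemma pderiv_binom_poly: "pderiv (binom_poly n) = (\<Sum>a=1..n. smult (log_coeff a) (binom_poly (n - a)))"
proof (induction n)
  case (Suc n)
  have log_coeff: "log_coeff a * of_nat a = (if a = 0 then 0 else (-1) ^ (a - 1))" for a by (simp add: log_coeff_def)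
  have S: "smult (of_nat (Suc n)) (pderiv (binom_poly (Suc n))) = pderiv (binom_poly n * [:- of_nat n, 1:])"
    by (simp add: pderiv_smult del: of_nat_Suc)
  also have "\<dots> = binom_poly n + pderiv (binom_poly n) * [:- of_nat n, 1:]"
    unfolding pderiv_mult by (simp add: pderiv_pCons mult.commute)
  also have "pderiv (binom_poly n) * [:- of_nat n, 1:] = (\<Sum>a=1..n. smult (log_coeff a) (binom_poly (n - a) * [:- of_nat ((n - a) + a), 1:]))"
    unfolding Suc.IH sum_distrib_right
  proof (intro sum.cong refl)
    fix a assume "a \<in> {1..n}"
    then have "(n - a) + a = n" by simp
    then show "smult (log_coeff a) (binom_poly (n - a)) * [:- of_nat n, 1:] = smult (log_coeff a) (binom_poly (n - a) * [:- of_nat ((n - a) + a), 1:])"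
      by (simp only: mult_smult_left)
  qed
  also have "\<dots> = (\<Sum>a=1..n. smult (log_coeff a * of_nat (Suc n - a)) (binom_poly (Suc n - a)) - smult (log_coeff a * of_nat a) (binom_poly (n - a)))"
    unfolding binom_poly_mult_linear
    by (intro sum.cong refl) (simp add: smult_diff_right Suc_diff_le del: binom_poly.simps of_nat_Suc)
  also have "\<dots> = (\<Sum>a=1..n. smult (of_nat (Suc n)) (smult (log_coeff a) (binom_poly (Suc n - a)))
      + (- smult ((-1) ^ (a - 1)) (binom_poly (Suc n - a)) - smult ((-1) ^ (a - 1)) (binom_poly (n - a))))"
  proof (intro sum.cong refl)
    fix a assume a: "a \<in> {1..n}"
    have "log_coeff a * of_nat (Suc n - a) = of_nat (Suc n) * log_coeff a - (-1) ^ (a - 1)"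
      using a log_coeff[of a] by (simp add: of_nat_diff algebra_simps del: of_nat_Suc)
    then show "smult (log_coeff a * of_nat (Suc n - a)) (binom_poly (Suc n - a)) - smult (log_coeff a * of_nat a) (binom_poly (n - a)) =
      smult (of_nat (Suc n)) (smult (log_coeff a) (binom_poly (Suc n - a)))
      + (- smult ((-1) ^ (a - 1)) (binom_poly (Suc n - a)) - smult ((-1) ^ (a - 1)) (binom_poly (n - a)))"
      using a log_coeff[of a] by (simp add: smult_diff_left del: binom_poly.simps of_nat_Suc)
  qed
  also have "\<dots> = smult (of_nat (Suc n)) (\<Sum>a=1..n. smult (log_coeff a) (binom_poly (Suc n - a))) +
      (\<Sum>a=1..n. - smult ((-1) ^ (a - 1)) (binom_poly (Suc n - a)) - smult ((-1) ^ (a - 1)) (binom_poly (n - a)))"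
    by (simp only: sum.distrib smult_sum_right)
  \<comment> \<open>What is left over from \<open>log_coeff a * of_nat a\<close>, a sign, telescopes
    down to the boundary terms a = 1 and a = n + 1.\<close>
  also have "(\<Sum>a=1..n. - smult ((-1) ^ (a - 1)) (binom_poly (Suc n - a)) - smult ((-1) ^ (a - 1)) (binom_poly (n - a)))
      = (\<Sum>a=1..n. smult ((-1) ^ a) (binom_poly (Suc n - a)) - smult ((-1) ^ Suc a) (binom_poly (Suc n - Suc a)))"
  proof (intro sum.cong refl)
    fix a assume "a \<in> {1..n}"
    then obtain b where "a = Suc b" by (cases a) auto
    then show "- smult ((-1) ^ (a - 1)) (binom_poly (Suc n - a)) - smult ((-1) ^ (a - 1)) (binom_poly (n - a)) =
      smult ((-1) ^ a) (binom_poly (Suc n - a)) - smult ((-1) ^ Suc a) (binom_poly (Suc n - Suc a))"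
      by simp
  qed
  also have "\<dots> = - (\<Sum>a=1..n. (\<lambda>a. smult ((-1) ^ a) (binom_poly (Suc n - a))) (Suc a) - (\<lambda>a. smult ((-1) ^ a) (binom_poly (Suc n - a))) a)"
    unfolding sum_negf[symmetric] by (intro sum.cong) auto
  also have "\<dots> = - (smult ((-1) ^ Suc n) (binom_poly 0) + binom_poly n)"
    by (subst sum_Suc_diff) auto
  finally have "smult (of_nat (Suc n)) (pderiv (binom_poly (Suc n))) =
      smult (of_nat (Suc n)) (\<Sum>a=1..n. smult (log_coeff a) (binom_poly (Suc n - a))) + smult ((-1) ^ n) (binom_poly 0)"
    by simp
  also have "\<dots> = smult (of_nat (Suc n)) (\<Sum>a=1..Suc n. smult (log_coeff a) (binom_poly (Suc n - a)))"
    by (simp add: smult_add_right log_coeff_def del: of_nat_Suc)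
  finally show ?case by (metis of_nat_neq_0 smult_cancel)
qed (simp add: pderiv_1)

lemma pderiv_sum: "pderiv (sum q A) = (\<Sum>i\<in>A. pderiv (q i))"
  by (induction A rule: infinite_finite_induct) (auto simp: pderiv_add)

lemma moment_eq_zero:
  assumes G: "vnull (fps_nth G)" and z: "\<And>m. m < d \<Longrightarrow> moment (monom 1 m) G = 0" and n: "n < d"
  shows "taylor n G = 0"
proof -
  have "binom_poly n = (\<Sum>i\<le>Polynomial.degree (binom_poly n). smult (coeff (binom_poly n) i) (monom 1 i))"
    using poly_as_sum_of_monoms[of "binom_poly n"] by (simp add: smult_monom)
  then have "moment (binom_poly n) G = moment (\<Sum>i\<le>Polynomial.degree (binom_poly n). smult (coeff (binom_poly n) i) (monom 1 i)) G"
    by simp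
  also have "\<dots> = (\<Sum>i\<le>Polynomial.degree (binom_poly n). coeff (binom_poly n) i * moment (monom 1 i) G)"
    by (simp add: moment_sum[OF G] moment_smult[OF G] del: smult_monom)
  also have "\<dots> = 0" using degree_binom_poly[of n] n z by (intro sum.neutral) auto
  finally show ?thesis by (simp add: taylor_eq_moment)
qed

text \<open>The hypothesis is linear in the test polynomial and says moment q H - moment q' G =
  \<rho> moment q G for every q of degree below w. For the binomial polynomial, q' is its image
  under the logarithm of the shift, so H = (\<rho> + log(1+T)) G modulo T^w.\<close>

lemma log_relation:
  assumes G: "vnull (fps_nth G)" and H: "vnull (fps_nth H)"
    and z: "\<And>m. m < w \<Longrightarrow> moment (monom 1 m) H - of_nat m * moment (monom 1 (m - 1)) G = \<rho> * moment (monom 1 m) G"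
    and n: "n < w"
  shows "taylor n H = \<rho> * taylor n G + (\<Sum>a=1..n. log_coeff a * taylor (n - a) G)"
proof -
  have mon: "smult c (monom 1 i) = monom c i" for c :: 'a and i by (simp add: smult_monom)
  let ?d = "Polynomial.degree (binom_poly n)"
  have q: "binom_poly n = (\<Sum>i\<le>?d. smult (coeff (binom_poly n) i) (monom 1 i))"
    unfolding mon by (rule poly_as_sum_of_monoms[symmetric])
  have dq: "pderiv (binom_poly n) = (\<Sum>i\<le>?d. smult (coeff (binom_poly n) i) (smult (of_nat i) (monom 1 (i - 1))))"
    by (subst q) (simp add: pderiv_sum pderiv_smult pderiv_monom mon smult_monom mult.commute)
  have 1: "moment (binom_poly n) H = (\<Sum>i\<le>?d. coeff (binom_poly n) i * moment (monom 1 i) H)"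
    by (subst q) (simp add: moment_sum[OF H] moment_smult[OF H])
  have 2: "moment (binom_poly n) G = (\<Sum>i\<le>?d. coeff (binom_poly n) i * moment (monom 1 i) G)"
    by (subst q) (simp add: moment_sum[OF G] moment_smult[OF G])
  have 3: "moment (pderiv (binom_poly n)) G = (\<Sum>i\<le>?d. coeff (binom_poly n) i * (of_nat i * moment (monom 1 (i - 1)) G))"
    by (subst dq) (simp add: moment_sum[OF G] moment_smult[OF G] mult.assoc)
  have "moment (binom_poly n) H - moment (pderiv (binom_poly n)) G = (\<Sum>i\<le>?d. coeff (binom_poly n) i * (moment (monom 1 i) H - of_nat i * moment (monom 1 (i - 1)) G))"
    unfolding 1 3 by (simp add: right_diff_distrib sum_subtractf)
  also have "\<dots> = (\<Sum>i\<le>?d. coeff (binom_poly n) i * (\<rho> * moment (monom 1 i) G))"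
    using degree_binom_poly[of n] n z by (intro sum.cong) auto
  also have "\<dots> = \<rho> * moment (binom_poly n) G" unfolding 2 by (simp add: sum_distrib_left mult_ac)
  finally have "moment (binom_poly n) H = \<rho> * moment (binom_poly n) G + moment (pderiv (binom_poly n)) G" by (simp add: algebra_simps)
  moreover have "moment (pderiv (binom_poly n)) G = (\<Sum>a=1..n. log_coeff a * moment (binom_poly (n - a)) G)"
    unfolding pderiv_binom_poly by (simp add: moment_sum[OF G] moment_smult[OF G])
  ultimately show ?thesis by (simp add: taylor_eq_moment)
qed

section \<open>The filtration\<close>

lemma Fil_calD_funpow:
  "y \<in> Fil_calD p f v K frob r L i \<Longrightarrow> m < i \<Longrightarrow>
   f_p p v ((N_calD f ^^ m) y) \<in> Fil_D f r L (int (i - m))"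
proof (induction i arbitrary: y m)
  case (Suc i)
  show ?case
  proof (cases m)
    case 0
    then show ?thesis using Suc.prems by simp
  next
    case (Suc m')
    then show ?thesis using Suc.IH[of "N_calD f y" m'] Suc.prems Suc
      by (simp add: funpow_swap1)
  qed
qed simp

lemma N_calD_components:
  assumes "j < f"
  shows "fst (N_calD f y) j = - (fps_X * fps_deriv (fst y j))"
    "snd (N_calD f y) j = - (fps_X * fps_deriv (snd y j)) + fst y j"
  using assms by (auto simp: N_calD_def tens_def N_S_def eta1_def eta2_def N_D_def tup_def)

text \<open>N acts as -u d/du plus the map sending eta_1 to eta_2. The two commute and the second
  has square zero, so the m-th power has just one mixed term, with factor m; for m = 0 this factor
  makes the truncated exponent m - 1 harmless.\<close>

lemma N_calD_funpow:
  fixes y :: "'a calDmod"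
  assumes "j < f"
  shows "fps_nth (fst ((N_calD f ^^ m) y) j) i = (-1) ^ m * (of_nat i ^ m * fps_nth (fst y j) i)"
    (is "?P m")
    and "fps_nth (snd ((N_calD f ^^ m) y) j) i = (-1) ^ m *
       (of_nat i ^ m * fps_nth (snd y j) i - of_nat m * (of_nat i ^ (m - 1) * fps_nth (fst y j) i))"
    (is "?Q m")
proof -
  have D: "fps_nth (fps_X * fps_deriv F) i = of_nat i * fps_nth F i" for F :: "'a fps"
    by (cases i) auto
  have "?P m \<and> ?Q m"
  proof (induction m)
    case (Suc m)
    have m: "of_nat m * (of_nat i * of_nat i ^ (m - 1)) = of_nat m * (of_nat i ^ m :: 'a)"
      by (cases m) auto
    have 1: "fps_nth (fst ((N_calD f ^^ Suc m) y) j) i = - (of_nat i * fps_nth (fst ((N_calD f ^^ m) y) j) i)"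
      unfolding funpow.simps o_apply N_calD_components[OF assms] fps_neg_nth D ..
    have 2: "fps_nth (snd ((N_calD f ^^ Suc m) y) j) i =
      - (of_nat i * fps_nth (snd ((N_calD f ^^ m) y) j) i) + fps_nth (fst ((N_calD f ^^ m) y) j) i"
      unfolding funpow.simps o_apply N_calD_components[OF assms] fps_neg_nth fps_add_nth D ..
    show ?case
      unfolding 1 2 conjunct1[OF Suc.IH] conjunct2[OF Suc.IH] using m by (auto simp: algebra_simps)
  qed simp
  then show "?P m" "?Q m" by auto
qed

text \<open>The m-th iterate of N maps the w-th step of the filtration to the step w - m, whose
  image at u = p is a line if w - m <= r_j and zero otherwise.\<close>

lemma Fil_moments:
  assumes y: "y \<in> Fil_calD p f v K frob r L w" and j: "j < f" and m: "m < w"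
    and A: "vnull (fps_nth (dilate (fst y j)))" and B: "vnull (fps_nth (dilate (snd y j)))"
  defines "a \<equiv> moment (monom 1 m) (dilate (fst y j))"
    and "b \<equiv> moment (monom 1 m) (dilate (snd y j)) - of_nat m * moment (monom 1 (m - 1)) (dilate (fst y j))"
  shows "if w - m \<le> r j then \<exists>c. a = c * xi (L j) \<and> b = c * nu (L j) else a = 0 \<and> b = 0"
proof -
  have mono: "poly (monom 1 m) x = x ^ m" for x :: 'a and m by (simp add: poly_monom)
  have "vsums (\<lambda>i. (-1) ^ m * (poly (monom 1 m) (of_nat i) * fps_nth (dilate (fst y j)) i)) ((-1) ^ m * a)"
    unfolding a_def by (intro vsums_cmult moment_vsums A)
  then have 1: "eval_p p v (fst ((N_calD f ^^ m) y) j) = (-1) ^ m * a"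
    unfolding eval_p_def N_calD_funpow[OF j] by (intro vsum_eqI) (simp add: mono dilate_nth mult_ac)
  have "vsums (\<lambda>i. (-1) ^ m * (poly (monom 1 m) (of_nat i) * fps_nth (dilate (snd y j)) i
      + (- of_nat m) * (poly (monom 1 (m - 1)) (of_nat i) * fps_nth (dilate (fst y j)) i)))
    ((-1) ^ m * (moment (monom 1 m) (dilate (snd y j)) + (- of_nat m) * moment (monom 1 (m - 1)) (dilate (fst y j))))"
    by (intro vsums_add vsums_cmult moment_vsums A B)
  then have 2: "eval_p p v (snd ((N_calD f ^^ m) y) j) = (-1) ^ m * b"
    unfolding eval_p_def N_calD_funpow[OF j] b_def
    by (intro vsum_eqI) (simp add: mono dilate_nth algebra_simps)
  have "f_p p v ((N_calD f ^^ m) y) \<in> Fil_D f r L (int (w - m))"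
    by (rule Fil_calD_funpow[OF y m])
  then have *: "((-1) ^ m * a, (-1) ^ m * b) \<in> (if w - m \<le> r j
      then {(c * xi (L j), c * nu (L j)) | c. True} else {(0, 0)})"
    using j m unfolding Fil_D_def f_p_def 1[symmetric] 2[symmetric]
    by (simp add: of_nat_diff[symmetric] del: of_nat_diff split: if_splits)
  have s: "(-1) ^ m * ((-1) ^ m * z) = z" for z :: 'a
    by (simp add: mult.assoc[symmetric] power_add[symmetric] flip: mult_2)
  show ?thesis
  proof (cases "w - m \<le> r j")
    case True
    then obtain c where "(-1) ^ m * a = c * xi (L j)" "(-1) ^ m * b = c * nu (L j)" using * by auto
    then have "a = ((-1) ^ m * c) * xi (L j)" "b = ((-1) ^ m * c) * nu (L j)"
      using s[of a] s[of b] by (simp_all add: mult.assoc)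
    then show ?thesis using True by auto
  qed (use * in auto)
qed

text \<open>The vanishing in degrees below w - r_j reflects that the filtration of D at e_j is zero
  beyond r_j.\<close>

lemma Fil_finite_slope:
  assumes y: "y \<in> Fil_calD p f v K frob r L w" and j: "j < f" and L: "L j = Fin \<rho>"
    and A: "vnull (fps_nth (dilate (fst y j)))" and B: "vnull (fps_nth (dilate (snd y j)))"
  shows "n < w \<Longrightarrow> taylor n (dilate (snd y j)) = \<rho> * taylor n (dilate (fst y j)) + (\<Sum>a=1..n. log_coeff a * taylor (n - a) (dilate (fst y j)))"
    and "n < w - r j \<Longrightarrow> taylor n (dilate (fst y j)) = 0"
proof -
  note * = Fil_moments[OF y j _ A B]
  show "taylor n (dilate (snd y j)) = \<rho> * taylor n (dilate (fst y j)) + (\<Sum>a=1..n. log_coeff a * taylor (n - a) (dilate (fst y j)))" if "n < w"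
  proof (rule log_relation[OF A B _ that])
    fix m assume "m < w"
    from *[OF this] show "moment (monom 1 m) (dilate (snd y j)) - of_nat m * moment (monom 1 (m - 1)) (dilate (fst y j)) =
        \<rho> * moment (monom 1 m) (dilate (fst y j))"
      by (cases "w - m \<le> r j") (auto simp: L mult.commute)
  qed
  show "taylor n (dilate (fst y j)) = 0" if "n < w - r j"
    by (rule moment_eq_zero[OF A _ that]) (use * in \<open>force split: if_splits\<close>)
qed

text \<open>The line is now spanned by eta_2, so all moments of the first coordinate below w vanish,
  and with them the correction terms in those of the second.\<close>

lemma Fil_infinite_slope:
  assumes y: "y \<in> Fil_calD p f v K frob r L w" and j: "j < f" and L: "L j = Infty"
    and A: "vnull (fps_nth (dilate (fst y j)))" and B: "vnull (fps_nth (dilate (snd y j)))"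
  shows "n < w \<Longrightarrow> taylor n (dilate (fst y j)) = 0"
    and "n < w - r j \<Longrightarrow> taylor n (dilate (snd y j)) = 0"
proof -
  have a: "moment (monom 1 m) (dilate (fst y j)) = 0" if "m < w" for m
    using Fil_moments[OF y j that A B] L by (auto split: if_splits)
  show "taylor n (dilate (fst y j)) = 0" if "n < w" by (rule moment_eq_zero[OF A a that])
  show "taylor n (dilate (snd y j)) = 0" if "n < w - r j"
  proof (rule moment_eq_zero[OF B _ that])
    fix m assume m: "m < w - r j"
    then have "moment (monom 1 m) (dilate (snd y j)) - of_nat m * moment (monom 1 (m - 1)) (dilate (fst y j)) = 0"
      using Fil_moments[OF y j _ A B, of m] m by (cases "w - m \<le> r j") auto
    then show "moment (monom 1 m) (dilate (snd y j)) = 0" using a[of "m - 1"] m by simp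
  qed
qed

end

section \<open>Finite differences\<close>

lemma alternating_sum_Suc:
  fixes F :: "nat \<Rightarrow> 'a::comm_ring_1"
  shows "(\<Sum>k\<le>Suc m. (-1) ^ k * of_nat (Suc m choose k) * F k) =
    (\<Sum>k\<le>m. (-1) ^ k * of_nat (m choose k) * (F k - F (Suc k)))"
proof -
  have "(\<Sum>k\<le>Suc m. (-1) ^ k * of_nat (Suc m choose k) * F k) =
      F 0 + (\<Sum>k\<le>m. (-1) ^ Suc k * of_nat (Suc m choose Suc k) * F (Suc k))"
    by (subst sum.atMost_Suc_shift) simp
  also have "\<dots> = F 0 + (\<Sum>k\<le>m. (-1) ^ Suc k * of_nat (m choose Suc k) * F (Suc k))
      - (\<Sum>k\<le>m. (-1) ^ k * of_nat (m choose k) * F (Suc k))"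
    by (simp add: algebra_simps sum.distrib sum_negf sum_subtractf)
  also have "F 0 + (\<Sum>k\<le>m. (-1) ^ Suc k * of_nat (m choose Suc k) * F (Suc k)) =
      (\<Sum>k\<le>Suc m. (-1) ^ k * of_nat (m choose k) * F k)"
    unfolding sum.atMost_Suc_shift by simp
  also have "\<dots> = (\<Sum>k\<le>m. (-1) ^ k * of_nat (m choose k) * F k)" by (simp add: binomial_eq_0)
  finally show ?thesis by (simp add: right_diff_distrib sum_subtractf)
qed

lemma degree_diff_shift:
  fixes q :: "'a::field_char_0 poly"
  assumes "Polynomial.degree q \<le> Suc d"
  shows "Polynomial.degree (q - pcompose q [:1, 1:]) \<le> d"
proof (rule degree_le, intro allI impI)
  fix i assume i: "i > d"
  have deg: "Polynomial.degree (pcompose q [:1, 1:]) = Polynomial.degree q" by (simp add: degree_pcompose)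
  have lead: "lead_coeff (pcompose q [:1, 1:]) = lead_coeff q" by (subst lead_coeff_comp) auto
  show "coeff (q - pcompose q [:1, 1:]) i = 0"
  proof (cases "i = Polynomial.degree q")
    case True
    then show ?thesis using lead deg by simp
  next
    case False
    then have "i > Polynomial.degree q" using i assms by simp
    then show ?thesis using deg by (simp add: coeff_eq_0)
  qed
qed

text \<open>Up to sign the sum is the m-th finite difference of q, and each difference lowers the
  degree.\<close>

lemma alternating_sum_poly:
  fixes q :: "'a::field_char_0 poly"
  shows "Polynomial.degree q < m \<Longrightarrow> (\<Sum>k\<le>m. (-1) ^ k * of_nat (m choose k) * poly q (c + of_nat k)) = 0"
proof (induction m arbitrary: q)
  case (Suc m)
  have e: "poly q (c + of_nat k) - poly q (c + of_nat (Suc k)) =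
    poly (q - pcompose q [:1, 1:]) (c + of_nat k)" for k
    by (simp add: poly_pcompose algebra_simps)
  show ?case
  proof (cases m)
    case 0
    then have "Polynomial.degree q = 0" using Suc.prems by simp
    then obtain a where "q = [:a:]" by (metis degree_0_id)
    then show ?thesis using 0 by simp
  next
    case (Suc d)
    then have "Polynomial.degree (q - pcompose q [:1, 1:]) < m"
      using degree_diff_shift[of q d] Suc.prems by simp
    then show ?thesis unfolding alternating_sum_Suc e by (rule Suc.IH)
  qed
qed simp

text \<open>The m-th finite difference in k of C(n+k, m), a polynomial of degree m with leading
  coefficient 1/m!, is 1.\<close>

lemma alternating_sum_binomial:
  "(\<Sum>k\<le>m. (-1) ^ k * of_nat (m choose k) * of_nat (n + k choose m)) = ((-1) ^ m :: 'a::comm_ring_1)"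
proof (induction m)
  case (Suc m)
  have "of_nat (n + k choose Suc m) - of_nat (n + Suc k choose Suc m) = (- of_nat (n + k choose m) :: 'a)" for k
    by simp
  then show ?case unfolding alternating_sum_Suc using Suc by (simp add: sum_negf)
qed simp

section \<open>Pade approximants of the logarithm\<close>

context pval
begin

lemma vge_fps_inverse:
  assumes P: "\<And>i. vge 0 (fps_nth P i)" and P0: "fps_nth P 0 \<noteq> 0" "vv (fps_nth P 0) = 0"
  shows "vge 0 (fps_nth (inverse P) n)"
proof (induction n rule: less_induct)
  case (less n)
  show ?case
  proof (cases "n = 0")
    case True
    then show ?thesis using P0 by (simp add: vge_iff vv_inverse)
  next
    case False
    have "(\<Sum>i=0..n. fps_nth P i * fps_nth (inverse P) (n - i)) = fps_nth (P * inverse P) n"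
      by (simp add: fps_mult_nth)
    also have "\<dots> = 0" using inverse_mult_eq_1'[OF P0(1)] False by simp
    finally have "fps_nth P 0 * fps_nth (inverse P) n = - (\<Sum>i=1..n. fps_nth P i * fps_nth (inverse P) (n - i))"
      by (simp add: sum.atLeast_Suc_atMost eq_neg_iff_add_eq_0)
    moreover have "vge 0 (\<Sum>i=1..n. fps_nth P i * fps_nth (inverse P) (n - i))"
      by (intro vge_sum vge_0mult P less) auto
    ultimately have "vge 0 (fps_nth P 0 * fps_nth (inverse P) n)" by simp
    then show ?thesis using P0 by (simp add: vge_mult_left)
  qed
qed

lemma vge_fps_mult: "(\<And>i. vge B (fps_nth F i)) \<Longrightarrow> (\<And>i. vge C (fps_nth G i)) \<Longrightarrow> vge (B + C) (fps_nth (F * G) i)"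
  by (simp add: fps_mult_nth vge_sum vge_mult)

lemma vge_pcompose:
  "(\<And>i. vge B (coeff P i)) \<Longrightarrow> vge B (coeff (pcompose P [:-1, 1:]) i)"
proof (induction P arbitrary: i)
  case (pCons a P)
  have "vge B (coeff P i)" for i using pCons.prems[of "Suc i"] by simp
  then have IH: "vge B (coeff (pcompose P [:-1, 1:]) i)" for i by (rule pCons.IH)
  show ?case using pCons.prems[of 0] IH[of 0] IH
    by (cases i) (auto simp: pcompose_pCons intro!: vge_add vge_diff)
qed simp

lemma vv_binomial: "N < p \<Longrightarrow> k \<le> N \<Longrightarrow> vv (of_nat (N choose k)) = 0"
proof -
  assume "N < p" "k \<le> N"
  show ?thesis
    unfolding binomial_fact[OF \<open>k \<le> N\<close>] using vv_fact_small[of N] vv_fact_small[of k] vv_fact_small[of "N - k"] \<open>N < p\<close> \<open>k \<le> N\<close>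
    by (simp add: vv_divide vv_mult)
qed

end

context odd_padic
begin

lemma log_coeff_vge: "a < p \<Longrightarrow> vge 0 (log_coeff a)"
  by (auto simp: log_coeff_def vge_div_nat vge_one intro!: vge_power0)

lemma fps_ln_nth: "fps_nth (fps_ln 1) a = log_coeff a"
  by (simp add: fps_ln_def log_coeff_def)

text \<open>The Jacobi polynomial that is the denominator of the $[n/m]$-approximant.\<close>

definition pade_den :: "nat \<Rightarrow> nat \<Rightarrow> 'a poly" where
  "pade_den n m = (\<Sum>a\<le>m. monom (of_nat ((m choose a) * (n + m - a choose m))) a)"

definition pade_num :: "nat \<Rightarrow> nat \<Rightarrow> 'a poly" where
  "pade_num n m = (\<Sum>i\<le>n. monom (fps_nth (fps_of_poly (pade_den n m) * fps_ln 1) i) i)"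

lemma coeff_pade_den: "coeff (pade_den n m) a = (if a \<le> m then of_nat ((m choose a) * (n + m - a choose m)) else 0)"
  by (simp add: pade_den_def coeff_sum if_distrib cong: if_cong)

lemma coeff_pade_num: "coeff (pade_num n m) i = (if i \<le> n then fps_nth (fps_of_poly (pade_den n m) * fps_ln 1) i else 0)"
  by (simp add: pade_num_def coeff_sum if_distrib cong: if_cong)

lemma degree_pade_den: "Polynomial.degree (pade_den n m) \<le> m"
  by (rule degree_le) (simp add: coeff_pade_den)

lemma degree_pade_num: "Polynomial.degree (pade_num n m) \<le> n"
  by (rule degree_le) (simp add: coeff_pade_num)

lemma vge_pade_den: "vge 0 (coeff (pade_den n m) a)"
  using vge_of_nat by (simp add: coeff_pade_den del: of_nat_mult)

lemma vge_pade_num: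
  assumes "n < p"
  shows "vge 0 (coeff (pade_num n m) i)"
proof (cases "i \<le> n")
  case True
  have "vge 0 (\<Sum>k=0..i. coeff (pade_den n m) k * log_coeff (i - k))"
    using assms True by (intro vge_sum vge_0mult vge_pade_den log_coeff_vge) auto
  then show ?thesis using True by (simp add: coeff_pade_num fps_mult_nth fps_ln_nth)
qed (simp add: coeff_pade_num)

text \<open>Up to a sign the coefficient is the alternating sum over k of C(m,k) C(n+k,m) / (i - m +
  k). Since n < i <= n + m, the product that defines C(n+k,m) contains the factor i - m + k; the
  quotient is a polynomial in k of degree below m, and its m-th difference vanishes.\<close>

lemma pade_den_log_vanish:
  assumes nm: "m \<le> n" and i: "n < i" "i \<le> n + m"
  shows "fps_nth (fps_of_poly (pade_den n m) * fps_ln 1) i = 0"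
proof -
  \<comment> \<open>The factor n + k - s of the falling product is the denominator i - m +
    k.\<close>
  define s where "s = n + m - i"
  have s: "s < m" "n - s = i - m" "s \<le> n" "m < i" using assms by (auto simp: s_def)
  define q where "q = smult (1 / fact m) (\<Prod>t\<in>{..<m} - {s}. [:of_nat n - of_nat t, 1 :: 'a:])"
  have "Polynomial.degree (\<Prod>t\<in>{..<m} - {s}. [:of_nat n - of_nat t, 1 :: 'a:]) \<le> (\<Sum>t\<in>{..<m} - {s}. 1)"
    by (rule order_trans[OF degree_prod_sum_le]) (auto intro!: sum_mono)
  then have degq: "Polynomial.degree q < m"
    using s(1) degree_smult_le[of "1 / fact m" "\<Prod>t\<in>{..<m} - {s}. [:of_nat n - of_nat t, 1 :: 'a:]"]
    by (simp add: q_def)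
  have q: "poly q (of_nat k) = of_nat (n + k choose m) / of_nat (i - m + k)" for k
  proof -
    have "of_nat (n + k choose m) = (\<Prod>t\<in>{0..<m}. of_nat (n + k) - of_nat t :: 'a) / fact m"
      by (simp only: binomial_gbinomial gbinomial_prod_rev)
    also have "(\<Prod>t\<in>{0..<m}. of_nat (n + k) - of_nat t :: 'a) =
        (of_nat (n + k) - of_nat s) * (\<Prod>t\<in>{..<m} - {s}. of_nat (n + k) - of_nat t)"
      using s(1) by (simp add: atLeast0LessThan prod.remove[of _ s])
    also have "(of_nat (n + k) - of_nat s :: 'a) = of_nat (i - m + k)"
      using s by (simp add: of_nat_diff[symmetric] del: of_nat_diff of_nat_add)
    finally have "of_nat (n + k choose m) = of_nat (i - m + k) * poly q (of_nat k)"
      by (simp add: q_def poly_prod algebra_simps)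
    moreover have "of_nat (i - m + k) \<noteq> (0 :: 'a)" using s(4) by (simp del: of_nat_add)
    ultimately show ?thesis by (simp del: of_nat_add)
  qed
  have "fps_nth (fps_of_poly (pade_den n m) * fps_ln 1) i = (\<Sum>a=0..i. coeff (pade_den n m) a * log_coeff (i - a))"
    by (simp add: fps_mult_nth fps_ln_nth)
  also have "\<dots> = (\<Sum>a\<le>m. coeff (pade_den n m) a * log_coeff (i - a))"
    using s(4) by (intro sum.mono_neutral_right) (auto simp: coeff_pade_den)
  also have "\<dots> = (\<Sum>k\<le>m. coeff (pade_den n m) (m - k) * log_coeff (i - (m - k)))"
    by (rule sum.reindex_bij_witness[of _ "\<lambda>k. m - k" "\<lambda>k. m - k"]) auto
  also have "\<dots> = (\<Sum>k\<le>m. (-1) ^ (i - m - 1) * ((-1) ^ k * of_nat (m choose k) * poly q (0 + of_nat k)))"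
  proof (intro sum.cong refl)
    fix k assume "k \<in> {..m}"
    then have k: "k \<le> m" by simp
    have "log_coeff (i - (m - k)) = (-1) ^ (i - m - 1) * (-1) ^ k / of_nat (i - m + k)"
    proof -
      obtain d where "i = Suc (m + d)" using less_imp_Suc_add[OF s(4)] by blast
      then have "i - (m - k) = Suc (d + k)" "i - m - 1 = d" "i - m + k = Suc (d + k)" using k by auto
      then show ?thesis by (simp add: log_coeff_def power_add)
    qed
    moreover have "coeff (pade_den n m) (m - k) = of_nat (m choose k) * of_nat (n + k choose m)"
      using k binomial_symmetric[OF k] by (simp add: coeff_pade_den)
    ultimately show "coeff (pade_den n m) (m - k) * log_coeff (i - (m - k)) =
        (-1) ^ (i - m - 1) * ((-1) ^ k * of_nat (m choose k) * poly q (0 + of_nat k))"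
      by (simp add: q mult_ac del: of_nat_add)
  qed
  also have "\<dots> = 0"
    unfolding sum_distrib_left[symmetric] using alternating_sum_poly[OF degq, of 0] by simp
  finally show ?thesis .
qed

lemma pade_den_pade_num: "m \<le> n \<Longrightarrow> i \<le> n + m \<Longrightarrow> fps_nth (fps_of_poly (pade_den n m) * fps_ln 1) i = coeff (pade_num n m) i"
  using pade_den_log_vanish[of m n i] by (simp add: coeff_pade_num)

lemma poly_pade_den_0: "poly (pade_den n m) 0 = of_nat (n + m choose m)"
  by (simp add: poly_0_coeff_0 coeff_pade_den)

text \<open>Reversing the sum gives (-1)^m times the alternating sum of C(m,k) C(n+k,m), which is
  again (-1)^m. The normalization of the denominator is chosen for this: it is invertible in the
  integral power series in T + 1.\<close>

lemma poly_pade_den_m1: "poly (pade_den n m) (-1) = 1"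
proof -
  have "poly (pade_den n m) (-1) = (\<Sum>a\<le>m. of_nat ((m choose a) * (n + m - a choose m)) * (-1) ^ a)"
    by (simp add: pade_den_def poly_sum poly_monom)
  also have "\<dots> = (\<Sum>k\<le>m. of_nat ((m choose (m - k)) * (n + m - (m - k) choose m)) * (-1) ^ (m - k))"
    by (rule sum.reindex_bij_witness[of _ "\<lambda>k. m - k" "\<lambda>k. m - k"]) auto
  also have "\<dots> = (\<Sum>k\<le>m. (-1) ^ m * ((-1) ^ k * of_nat (m choose k) * of_nat (n + k choose m)))"
  proof (intro sum.cong refl)
    fix k assume "k \<in> {..m}"
    then have k: "k \<le> m" by simp
    have "(-1) ^ (m - k) = ((-1) ^ m * (-1) ^ k :: 'a)"
    proof -
      have "(-1 :: 'a) ^ m = (-1) ^ (m - k) * (-1) ^ k" using k by (simp add: power_add[symmetric])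
      then show ?thesis by (simp add: mult.assoc power_mult_distrib[symmetric])
    qed
    then show "of_nat ((m choose (m - k)) * (n + m - (m - k) choose m)) * (-1) ^ (m - k) =
        ((-1) ^ m * ((-1) ^ k * of_nat (m choose k) * of_nat (n + k choose m)) :: 'a)"
      using k binomial_symmetric[OF k] by (simp add: mult_ac)
  qed
  also have "\<dots> = (-1) ^ m * (-1) ^ m"
    unfolding sum_distrib_left[symmetric] alternating_sum_binomial ..
  also have "\<dots> = 1" by (simp add: power_mult_distrib[symmetric])
  finally show ?thesis .
qed

text \<open>Numerator \<open>Q0 + x P\<close> and denominator \<open>P\<close> of the approximant of \<open>x + log(1 + T)\<close>. In the
  last clause \<open>2 l = r' + 2\<close> is the case where the approximant depends on \<open>x\<close>.\<close>

definition pade_pair :: "nat \<Rightarrow> nat \<Rightarrow> 'a \<Rightarrow> 'a poly \<Rightarrow> 'a poly \<Rightarrow> bool" where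
  "pade_pair r' l x P Q0 \<longleftrightarrow>
     (\<forall>i. vge 0 (coeff P i)) \<and> (\<forall>i. vge 0 (coeff Q0 i)) \<and>
     Polynomial.degree P \<le> l - 1 \<and> Polynomial.degree (Q0 + smult x P) \<le> r' - l \<and>
     poly P 0 \<noteq> 0 \<and> poly P (-1) \<noteq> 0 \<and> vv (poly P (-1)) = 0 \<and>
     (\<forall>i<r'. fps_nth (fps_of_poly P * fps_ln 1) i = coeff Q0 i) \<and>
     (2 * l = r' + 2 \<longrightarrow> vge (- vv x) (coeff P (l - 1)))"

text \<open>The denominator has degree l - 1 <= r' - l, so adding x times it to the numerator does
  not exceed the admissible degree. That is why one and the same pair serves every x.\<close>

lemma pade_pair_generic:
  assumes "1 \<le> l" "2 * l \<le> r' + 1" "r' < p"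
  shows "\<exists>P Q0. pade_pair r' l x P Q0"
proof -
  have le: "l - 1 \<le> r' - l" "r' - l + (l - 1) = r' - 1" using assms by auto
  let ?P = "pade_den (r' - l) (l - 1)" and ?Q = "pade_num (r' - l) (l - 1)"
  have "Polynomial.degree (?Q + smult x ?P) \<le> r' - l"
    using degree_pade_den[of "r' - l" "l - 1"] degree_pade_num[of "r' - l" "l - 1"] le degree_smult_le[of x ?P]
    by (intro degree_add_le) auto
  moreover have "poly ?P 0 \<noteq> 0" using le by (simp add: poly_pade_den_0)
  moreover have "vge 0 (coeff ?Q i)" for i using assms by (intro vge_pade_num) simp
  moreover have "fps_nth (fps_of_poly ?P * fps_ln 1) i = coeff ?Q i" if "i < r'" for i
    using that le by (intro pade_den_pade_num) auto
  ultimately have "pade_pair r' l x ?P ?Q"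
    using assms vge_pade_den degree_pade_den[of "r' - l" "l - 1"] unfolding pade_pair_def poly_pade_den_m1 by simp
  then show ?thesis by blast
qed

text \<open>The numerator may only have degree m - 1, below that of the denominator. Both the
  [m/(m-1)] and the [m/m] approximant are exact modulo T^(2m), and b is chosen so that in their
  combination the coefficient of T^m of the numerator, q + b (x + d), vanishes. As d is integral and
  v(x) < 0, v(b) >= -v(x) > 0, and the values of the denominator at 0 and -1 remain nonzero, at -1 a
  unit.\<close>

lemma pade_pair_special:
  assumes m: "1 \<le> m" "2 * m < p" and x: "x \<noteq> 0" "vv x < 0"
  shows "\<exists>P Q0. pade_pair (2 * m) (m + 1) x P Q0"
proof -
  define q d where "q = coeff (pade_num m (m - 1)) m" and "d = coeff (pade_num m m) m"
  have qd: "vge 0 q" "vge 0 d" using m vge_pade_num by (auto simp: q_def d_def)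
  have xd: "x + d \<noteq> 0" "vv (x + d) = vv x"
    using vv_eq_of_close[of x 0 "x + d"] x qd by auto
  define b where "b = - q / (x + d)"
  have b: "vge (- vv x) b" using qd xd by (simp add: b_def vge_divide)
  have b0: "vge 0 b" using b x by (auto elim: vge_mono)
  define P where "P = pade_den m (m - 1) + smult b (pade_den m m)"
  define Q0 where "Q0 = pade_num m (m - 1) + smult b (pade_num m m)"
  have cP: "coeff P m = b" using m by (simp add: P_def coeff_pade_den)
  have degP: "Polynomial.degree P \<le> m"
    unfolding P_def using degree_pade_den[of m "m - 1"] degree_pade_den[of m m] degree_smult_le[of b "pade_den m m"]
    by (intro degree_add_le) auto
  have degQ: "Polynomial.degree (Q0 + smult x P) \<le> m - 1"
  proof (rule degree_le, intro allI impI)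
    fix i assume i: "i > m - 1"
    show "coeff (Q0 + smult x P) i = 0"
    proof (cases "i = m")
      case True
      have "coeff (Q0 + smult x P) m = q + b * (x + d)"
        by (simp add: cP Q0_def q_def d_def algebra_simps)
      then show ?thesis using True xd by (simp add: b_def)
    next
      case False
      then show ?thesis using i m by (simp add: Q0_def P_def coeff_pade_den coeff_pade_num)
    qed
  qed
  have close: "poly P z \<noteq> 0" "vv (poly P z) = 0"
    if z: "vge 0 (poly (pade_den m m) z)" "poly (pade_den m (m - 1)) z \<noteq> 0" "vv (poly (pade_den m (m - 1)) z) = 0" for z
  proof -
    have "vge (- vv x) (poly P z - poly (pade_den m (m - 1)) z)"
      unfolding P_def using vge_mult0[OF b z(1)] by simp
    from vv_eq_of_close[OF z(2) this] show "poly P z \<noteq> 0" "vv (poly P z) = 0" using x z(3) by auto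
  qed
  have P0: "poly P 0 \<noteq> 0"
    using m vv_binomial[of "m + (m - 1)" "m - 1"] vge_of_nat by (intro close) (auto simp: poly_pade_den_0)
  have P1: "poly P (-1) \<noteq> 0" "vv (poly P (-1)) = 0"
    using close[of "-1"] by (auto simp: poly_pade_den_m1 vge_one)
  have ln: "fps_nth (fps_of_poly P * fps_ln 1) i = coeff Q0 i" if "i < 2 * m" for i
  proof -
    have "fps_of_poly P * fps_ln 1 = fps_of_poly (pade_den m (m - 1)) * fps_ln 1
        + fps_const b * (fps_of_poly (pade_den m m) * fps_ln 1)"
      by (simp add: P_def fps_of_poly_add fps_of_poly_smult algebra_simps)
    then show ?thesis using pade_den_pade_num[of "m - 1" m i] pade_den_pade_num[of m m i] that by (simp add: Q0_def)
  qed
  have "vge 0 (coeff P i)" "vge 0 (coeff Q0 i)" for i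
    unfolding P_def Q0_def using m b0 by (auto intro!: vge_add vge_0mult vge_pade_den vge_pade_num)
  then show ?thesis
    using degP degQ P0 P1 ln cP b m by (intro exI[of _ P] exI[of _ Q0]) (simp add: pade_pair_def)
qed

lemma fps_of_poly_eqI_degree:
  fixes q :: "'a poly"
  assumes "Polynomial.degree q < n" "\<And>i. i < n \<Longrightarrow> coeff q i = 0"
  shows "q = 0"
  using assms by (metis coeff_eq_0 poly_eqI coeff_0 not_le order_less_le_trans)

text \<open>Uniqueness of Pade approximants: for two of them the cross difference Q'P - QP' has
  degree below r' and vanishes modulo T^r'. Subtracting x removes the summand x P of the
  numerator.\<close>

lemma delta_pade:
  assumes pp: "pade_pair r' l x P Q0" and l: "1 \<le> l" "l \<le> r'"
  shows "delta r' l x = Fract Q0 P"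
proof -
  define Q where "Q = Q0 + smult x P"
  have P0: "poly P 0 \<noteq> 0" and Pn: "P \<noteq> 0" using pp by (auto simp: pade_pair_def)
  have degs: "Polynomial.degree P \<le> l - 1" "Polynomial.degree Q \<le> r' - l"
    using pp by (auto simp: pade_pair_def Q_def)
  have Qc: "coeff Q i = fps_nth (fps_of_poly P * (fps_const x + fps_ln 1)) i" if "i < r'" for i
    using pp that by (simp add: pade_pair_def Q_def distrib_left mult.commute[of _ "fps_const x"])
  \<comment> \<open>A denominator with nonzero constant term can be cleared without changing
    congruences modulo a power of T.\<close>
  have char: "(\<forall>i<n. fps_nth (fps_of_poly Q' / fps_of_poly P') i = fps_nth F i) \<longleftrightarrow>
      (\<forall>i<n. coeff Q' i = fps_nth (fps_of_poly P' * F) i)" if P': "poly P' 0 \<noteq> 0" for P' Q' :: "'a poly" and F n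
  proof -
    let ?p = "fps_of_poly P'" and ?q = "fps_of_poly Q'"
    have p0: "fps_nth ?p 0 \<noteq> 0" using P' by (simp add: poly_0_coeff_0)
    have inv: "inverse ?p * ?p = 1" using inverse_mult_eq_1[OF p0] .
    have agree: "fps_nth (G * A) i = fps_nth (G * B) i" if "\<forall>i<n. fps_nth A i = fps_nth B i" "i < n" for G A B :: "'a fps" and i
      using that by (auto simp: fps_mult_nth intro!: sum.cong)
    have q1: "?q / ?p = inverse ?p * ?q" using p0 by (simp add: fps_divide_unit mult.commute)
    have q2: "?p * (inverse ?p * ?q) = ?q" "inverse ?p * (?p * F) = F"
      using inv by (simp_all add: mult.assoc[symmetric] mult.commute[of ?p])
    show ?thesis
    proof
      assume "\<forall>i<n. fps_nth (?q / ?p) i = fps_nth F i"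
      then have "\<forall>i<n. fps_nth (?p * (inverse ?p * ?q)) i = fps_nth (?p * F) i"
        unfolding q1 using agree by blast
      then show "\<forall>i<n. coeff Q' i = fps_nth (?p * F) i" unfolding q2 by simp
    next
      assume "\<forall>i<n. coeff Q' i = fps_nth (?p * F) i"
      then have "\<forall>i<n. fps_nth ?q i = fps_nth (?p * F) i" by simp
      then have "\<forall>i<n. fps_nth (inverse ?p * ?q) i = fps_nth (inverse ?p * (?p * F)) i"
        using agree by blast
      then show "\<forall>i<n. fps_nth (?q / ?p) i = fps_nth F i" unfolding q1 q2 .
    qed
  qed
  have "is_pade r' l x (Fract Q P)"
    unfolding is_pade_def
    by (intro exI[of _ P] exI[of _ Q] conjI refl P0 degs, unfold char[OF P0]) (use Qc in blast)
  moreover have "R = Fract Q P" if R: "is_pade r' l x R" for R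
  proof -
    from R obtain P' Q' where R': "R = Fract Q' P'" "poly P' 0 \<noteq> 0"
      "Polynomial.degree Q' \<le> r' - l" "Polynomial.degree P' \<le> l - 1"
      "\<forall>n<r'. fps_nth (fps_of_poly Q' / fps_of_poly P') n = fps_nth (fps_const x + fps_ln 1) n"
      unfolding is_pade_def by blast
    have Q'c: "\<forall>i<r'. coeff Q' i = fps_nth (fps_of_poly P' * (fps_const x + fps_ln 1)) i"
      using R'(5) unfolding char[OF R'(2)] .
    have "Q' * P - Q * P' = 0"
    proof (rule fps_of_poly_eqI_degree[of _ r'])
      have "Polynomial.degree (Q' * P - Q * P') \<le> r' - 1"
        using degs R'(3,4) l degree_mult_le[of Q' P] degree_mult_le[of Q P']
        by (intro degree_diff_le) auto
      then show "Polynomial.degree (Q' * P - Q * P') < r'" using l by simp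
      fix i assume i: "i < r'"
      have "coeff (Q' * P) i = fps_nth (fps_of_poly Q' * fps_of_poly P) i"
        by (simp add: fps_of_poly_mult[symmetric])
      also have "\<dots> = fps_nth ((fps_of_poly P' * (fps_const x + fps_ln 1)) * fps_of_poly P) i"
        using i Q'c by (auto simp: fps_mult_nth[of _ "fps_of_poly P"] intro!: sum.cong)
      also have "\<dots> = fps_nth ((fps_of_poly P * (fps_const x + fps_ln 1)) * fps_of_poly P') i"
        by (simp only: mult_ac)
      also have "\<dots> = fps_nth (fps_of_poly Q * fps_of_poly P') i"
        using i Qc by (auto simp: fps_mult_nth[of _ "fps_of_poly P'"] intro!: sum.cong)
      also have "\<dots> = coeff (Q * P') i" by (simp add: fps_of_poly_mult[symmetric])
      finally show "coeff (Q' * P - Q * P') i = 0" by simp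
    qed
    moreover have "P' \<noteq> 0" using R'(2) by auto
    ultimately show ?thesis using R'(1) Pn by (simp add: eq_fract)
  qed
  ultimately have "(THE R. is_pade r' l x R) = Fract Q P" by (rule the_equality)
  then have "delta r' l x = Fract Q P - Fract [:x:] 1" using l by (simp add: delta_def)
  also have "\<dots> = Fract Q0 P"
    using Pn by (simp add: Q_def eq_fract mult.commute)
  finally show ?thesis .
qed

text \<open>The expansion of Q/P at T = -1, as a power series in the variable T + 1; the composition
  with \<open>[:-1, 1:]\<close> substitutes T = (T + 1) - 1.\<close>

definition expm1 :: "'a poly \<Rightarrow> 'a poly \<Rightarrow> 'a fps" where
  "expm1 P Q = fps_of_poly (pcompose Q [:-1, 1:]) * inverse (fps_of_poly (pcompose P [:-1, 1:]))"

lemma pcompose_m1_nth0: "fps_nth (fps_of_poly (pcompose P [:-1, 1:])) 0 = poly P (-1)" for P :: "'a poly"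
  using poly_pcompose[of P "[:-1, 1:]" 0] by (simp add: poly_0_coeff_0)

lemma expm1_mult:
  assumes "poly P (-1) \<noteq> 0"
  shows "fps_of_poly (pcompose P [:-1, 1:]) * expm1 P Q = fps_of_poly (pcompose Q [:-1, 1:])"
proof -
  have "fps_of_poly (pcompose P [:-1, 1:]) * inverse (fps_of_poly (pcompose P [:-1, 1:])) = 1"
    using assms by (intro inverse_mult_eq_1') (simp add: pcompose_m1_nth0)
  then show ?thesis unfolding expm1_def by (simp add: mult.left_commute[of "fps_of_poly (pcompose P _)"])
qed

text \<open>The description has a unique solution because equality of fractions, as cross
  multiplication, is preserved by the shift of the variable.\<close>

lemma laurent_at_m1_Fract:
  assumes P: "poly P (-1) \<noteq> 0"
  shows "laurent_at_m1 (Fract Q P) = fps_to_fls (expm1 P Q)"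
  unfolding laurent_at_m1_def
proof (rule the_equality)
  have nz: "fps_of_poly (pcompose P [:-1, 1:]) \<noteq> 0" if "P \<noteq> 0" for P :: "'a poly"
    using that by (simp add: pcompose_eq_0_iff)
  have eq: "fps_to_fls (expm1 P Q) = fps_to_fls (fps_of_poly (pcompose Q' [:-1, 1:])) /
      fps_to_fls (fps_of_poly (pcompose P' [:-1, 1:]))"
    if P': "P' \<noteq> 0" and F: "Q' * P = Q * P'" for P' Q'
  proof -
    let ?c = "\<lambda>P. fps_of_poly (pcompose P [:-1, 1:] :: 'a poly)"
    have "?c Q' * ?c P = ?c Q * ?c P'"
      using arg_cong[OF F, of ?c] by (simp add: pcompose_mult fps_of_poly_mult)
    then have "?c P * (expm1 P Q * ?c P') = ?c P * ?c Q'"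
      using expm1_mult[OF P, of Q] by (simp add: mult.assoc[symmetric] mult.commute)
    then have "expm1 P Q * ?c P' = ?c Q'" using nz P by (metis mult_left_cancel poly_0)
    then have "fps_to_fls (expm1 P Q) * fps_to_fls (?c P') = fps_to_fls (?c Q')"
      by (simp add: fls_times_fps_to_fls[symmetric])
    moreover have "fps_to_fls (?c P') \<noteq> 0" using nz[OF P'] by simp
    ultimately show ?thesis by (simp add: nonzero_eq_divide_eq)
  qed
  have Pn: "P \<noteq> 0" using P by auto
  show "\<exists>P' Q'. P' \<noteq> 0 \<and> Fract Q P = Fract Q' P' \<and> fps_to_fls (expm1 P Q) =
     fps_to_fls (fps_of_poly (pcompose Q' [:-1, 1:])) / fps_to_fls (fps_of_poly (pcompose P' [:-1, 1:]))"
    using eq[OF Pn, of Q] Pn by blast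
  fix F assume "\<exists>P' Q'. P' \<noteq> 0 \<and> Fract Q P = Fract Q' P' \<and> F =
     fps_to_fls (fps_of_poly (pcompose Q' [:-1, 1:])) / fps_to_fls (fps_of_poly (pcompose P' [:-1, 1:]))"
  then obtain P' Q' where *: "P' \<noteq> 0" "Fract Q P = Fract Q' P'" "F =
     fps_to_fls (fps_of_poly (pcompose Q' [:-1, 1:])) / fps_to_fls (fps_of_poly (pcompose P' [:-1, 1:]))"
    by blast
  then have "Q' * P = Q * P'" using Pn by (simp add: eq_fract mult.commute)
  from eq[OF *(1) this] show "F = fps_to_fls (expm1 P Q)" using *(3) by simp
qed

lemma vge_expm1:
  assumes "\<And>i. vge 0 (coeff P i)" "\<And>i. vge B (coeff Q i)" "poly P (-1) \<noteq> 0" "vv (poly P (-1)) = 0"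
  shows "vge B (fps_nth (expm1 P Q) i)"
  unfolding expm1_def
  using vge_fps_mult[of B "fps_of_poly (pcompose Q [:-1, 1:])" 0 "inverse (fps_of_poly (pcompose P [:-1, 1:]))" i]
    vge_pcompose[OF assms(2)] vge_fps_inverse[of "fps_of_poly (pcompose P [:-1, 1:])"] vge_pcompose[OF assms(1)]
    assms(3,4)
  by (simp add: pcompose_m1_nth0[unfolded fps_of_poly_nth] )


section \<open>Estimates for truncated power series\<close>


lemma vv_of_nat_diff_unit:
  assumes "a \<noteq> b" "a < p" "b < p"
  shows "vv (of_nat a - of_nat b) = 0"
proof -
  have "\<not> int p dvd int a - int b"
    using assms by (metis int_ops(6) mod_eq_dvd_iff mod_less of_nat_eq_iff zmod_int)
  then have "vv (of_int (int a - int b)) = 0" by (rule vv_of_int_unit)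
  then show ?thesis by simp
qed

text \<open>Integrality of the inverse of a Cauchy matrix: the numerator of $\sum_b c_b/(z-b)$ is a
  polynomial of degree less than \<open>k\<close>, so that its values at \<open>k\<close> consecutive integers control
  all its values at smaller integers.\<close>

lemma cauchy_integral:
  assumes i0: "k \<le> i0" "i0 + k \<le> p"
    and rows: "\<And>i. i0 \<le> i \<Longrightarrow> i < i0 + k \<Longrightarrow> vge B (\<Sum>b<k. c b / (of_nat i - of_nat b))"
    and b: "b < k"
  shows "vge B (c b)"
proof -
  define q where "q = (\<Sum>b<k. smult (c b) (\<Prod>d\<in>{..<k} - {b}. [:- of_nat d, 1:]))"
  have pq: "poly q z = (\<Sum>b<k. c b * (\<Prod>d\<in>{..<k} - {b}. z - of_nat d))" for z
    by (simp add: q_def poly_sum poly_prod)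
  have degq: "Polynomial.degree q < k"
  proof -
    have "Polynomial.degree (smult (c b) (\<Prod>d\<in>{..<k} - {b}. [:- of_nat d, 1:])) \<le> k - 1" if "b < k" for b
    proof -
      have "Polynomial.degree (\<Prod>d\<in>{..<k} - {b}. [:- of_nat d, 1 :: 'a:]) \<le> (\<Sum>d\<in>{..<k} - {b}. 1)"
        by (rule order_trans[OF degree_prod_sum_le]) (auto intro!: sum_mono)
      also have "\<dots> = k - 1" using that by simp
      finally show ?thesis using degree_smult_le order_trans by blast
    qed
    then have "Polynomial.degree q \<le> k - 1" unfolding q_def by (intro degree_sum_le) auto
    then show ?thesis using b by simp
  qed
  have top: "vge B (poly q (of_nat i))" if i: "i0 \<le> i" "i < i0 + k" for i
  proof -
    have nz: "of_nat i - of_nat d \<noteq> (0 :: 'a)" if "d < k" for d using that i i0 by simp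
    have "poly q (of_nat i) = (\<Sum>b<k. c b / (of_nat i - of_nat b)) * (\<Prod>d<k. of_nat i - of_nat d)"
      unfolding pq sum_distrib_right
    proof (intro sum.cong refl)
      fix b assume "b \<in> {..<k}"
      then show "c b * (\<Prod>d\<in>{..<k} - {b}. of_nat i - of_nat d) =
          c b / (of_nat i - of_nat b) * (\<Prod>d<k. of_nat i - of_nat d)"
        using nz[of b] by (subst prod.remove[of "{..<k}" b]) auto
    qed
    moreover have "vge 0 (\<Prod>d<k. of_nat i - of_nat d)"
    proof -
      have "vge 0 (of_int (\<Prod>d<k. int i - int d))" by (rule vge_of_int)
      then show ?thesis by simp
    qed
    ultimately show ?thesis using rows[OF i] by (simp add: vge_mult0)
  qed
  have down: "vge B (poly q (of_nat z))" if "i0 \<le> z + d" "z < i0 + k" for z d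
    using that
  proof (induction d arbitrary: z)
    case 0
    then show ?case using top by simp
  next
    case (Suc d)
    show ?case
    proof (cases "i0 \<le> z + d")
      case True
      then show ?thesis using Suc by simp
    next
      case False
      have "(\<Sum>j\<le>k. (-1) ^ j * of_nat (k choose j) * poly q (of_nat z + of_nat j)) = 0"
        by (rule alternating_sum_poly[OF degq])
      then have "poly q (of_nat z) = - (\<Sum>j=1..k. (-1) ^ j * of_nat (k choose j) * poly q (of_nat (z + j)))"
        by (simp add: atMost_atLeast0 sum.atLeast_Suc_atMost eq_neg_iff_add_eq_0)
      moreover have "vge B (\<Sum>j=1..k. (-1) ^ j * of_nat (k choose j) * poly q (of_nat (z + j)))"
      proof (rule vge_sum, rule vge_0mult)
        fix j assume j: "j \<in> {1..k}"
        have "vge 0 (of_int ((-1) ^ j * int (k choose j)))" by (rule vge_of_int)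
        then show "vge 0 ((-1) ^ j * of_nat (k choose j))" by simp
        show "vge B (poly q (of_nat (z + j)))" using j Suc.prems False by (intro Suc.IH) auto
      qed
      ultimately show ?thesis by simp
    qed
  qed
  have bk: "\<And>d. d \<in> {..<k} - {b} \<Longrightarrow> vv (of_nat b - of_nat d) = 0"
    using b i0 by (intro vv_of_nat_diff_unit) auto
  have "poly q (of_nat b) = c b * (\<Prod>d\<in>{..<k} - {b}. of_nat b - of_nat d)"
  proof -
    have "poly q (of_nat b) = (\<Sum>e\<in>{b}. c e * (\<Prod>d\<in>{..<k} - {e}. of_nat b - of_nat d))"
      unfolding pq
    proof (rule sum.mono_neutral_right)
      show "\<forall>e\<in>{..<k} - {b}. c e * (\<Prod>d\<in>{..<k} - {e}. of_nat b - of_nat d) = 0"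
        using b by (auto intro!: bexI[of _ b])
    qed (use b in auto)
    then show ?thesis by simp
  qed
  moreover have "(\<Prod>d\<in>A. of_nat b - of_nat d) \<noteq> (0 :: 'a) \<and> vv (\<Prod>d\<in>A. of_nat b - of_nat d) = 0"
    if "A \<subseteq> {..<k} - {b}" for A
  proof -
    have "finite A" using that finite_subset by blast
    then show ?thesis using that
      by (induction A rule: finite_induct) (use bk in \<open>auto simp: vv_mult\<close>)
  qed
  ultimately show ?thesis
    using down[of i0 b] top b i0 down[of b i0] vge_mult_left[of "\<Prod>d\<in>{..<k} - {b}. of_nat b - of_nat d" B "c b"]
    by (auto simp: mult.commute)
qed

text \<open>The congruence $\Theta\tau \equiv (x + \log(1+T))\sigma$ modulo $T^r$ that the filtration imposes.\<close>

definition log_rel :: "nat \<Rightarrow> 'a \<Rightarrow> 'a \<Rightarrow> (nat \<Rightarrow> 'a) \<Rightarrow> (nat \<Rightarrow> 'a) \<Rightarrow> bool" where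
  "log_rel r \<Theta> x \<sigma> \<tau> \<longleftrightarrow> (\<forall>i<r. \<Theta> * \<tau> i = x * \<sigma> i + (\<Sum>a=1..i. log_coeff a * \<sigma> (i - a)))"

lemma log_rel_sum:
  assumes "log_rel r \<Theta> x \<sigma> \<tau>" "i < r"
  shows "\<Theta> * \<tau> i = x * \<sigma> i + (\<Sum>b<i. log_coeff (i - b) * \<sigma> b)"
proof -
  have "(\<Sum>a=1..i. log_coeff a * \<sigma> (i - a)) = (\<Sum>b<i. log_coeff (i - b) * \<sigma> b)"
    by (rule sum.reindex_bij_witness[of _ "\<lambda>b. i - b" "\<lambda>a. i - a"]) auto
  then show ?thesis using assms by (simp add: log_rel_def)
qed

text \<open>The top k rows are k equations for the k unknowns of index below k, once the known tail
  is moved to the other side. The condition 2k <= r keeps all row indices at or above k, so that the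
  rows form a Cauchy matrix.\<close>

lemma log_rows:
  assumes k: "2 * k \<le> r" "r < p"
    and rows: "\<And>i. r - k \<le> i \<Longrightarrow> i < r \<Longrightarrow> vge B (\<Sum>b<i. log_coeff (i - b) * \<sigma> b)"
    and tail: "\<And>b. k \<le> b \<Longrightarrow> b < r \<Longrightarrow> vge B (\<sigma> b)"
    and b: "b < r"
  shows "vge B (\<sigma> b)"
proof (cases "b < k")
  case True
  \<comment> \<open>The sign of \<open>log_coeff (i - b)\<close> splits into a row sign, which is
    multiplied through, and the column sign (-1)^b, which is absorbed in the unknown.\<close>
  have "vge B ((-1) ^ b * \<sigma> b)"
  proof (rule cauchy_integral[of k "r - k" B "\<lambda>b. (-1) ^ b * \<sigma> b" b])
    fix i assume i: "r - k \<le> i" "i < r - k + k"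
    then have ik: "k \<le> i" "i < r" using k by auto
    have "{..<i} = {..<k} \<union> {k..<i}" using ik by auto
    then have "(\<Sum>b<i. log_coeff (i - b) * \<sigma> b) = (\<Sum>b<k. log_coeff (i - b) * \<sigma> b) + (\<Sum>b=k..<i. log_coeff (i - b) * \<sigma> b)"
      by (simp add: sum.union_disjoint ivl_disj_int)
    moreover have "vge B (\<Sum>b=k..<i. log_coeff (i - b) * \<sigma> b)"
      using ik k by (intro vge_sum vge_0mult log_coeff_vge tail) auto
    ultimately have "vge B (\<Sum>b<k. log_coeff (i - b) * \<sigma> b)"
      using vge_diff[OF rows[OF i(1) ik(2)], of "\<Sum>b=k..<i. log_coeff (i - b) * \<sigma> b"] by simp
    then have "vge B ((-1) ^ Suc i * (\<Sum>b<k. log_coeff (i - b) * \<sigma> b))"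
      by (intro vge_0mult) (auto intro!: vge_power0 simp: vge_one)
    also have "(-1) ^ Suc i * (\<Sum>b<k. log_coeff (i - b) * \<sigma> b) = (\<Sum>b<k. (-1) ^ b * \<sigma> b / (of_nat i - of_nat b))"
      unfolding sum_distrib_left
    proof (intro sum.cong refl)
      fix b assume "b \<in> {..<k}"
      then obtain d where d: "i = b + Suc d" using ik by (metis lessThan_iff less_le_trans less_imp_Suc_add add_Suc_right)
      have "(-1) ^ Suc i * (-1) ^ d = ((-1) ^ b :: 'a)"
        by (simp add: d power_add power_mult_distrib[symmetric])
      then show "(-1) ^ Suc i * (log_coeff (i - b) * \<sigma> b) = (-1) ^ b * \<sigma> b / (of_nat i - of_nat b)"
        by (simp add: d log_coeff_def mult.assoc[symmetric] del: power_Suc)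
    qed
    finally show "vge B (\<Sum>b<k. (-1) ^ b * \<sigma> b / (of_nat i - of_nat b))" .
  qed (use k True in auto)
  then have "vge B ((-1) ^ b * ((-1) ^ b * \<sigma> b))"
    by (rule vge_0mult[rotated]) (auto intro!: vge_power0 simp: vge_one)
  then show ?thesis by (simp add: mult.assoc[symmetric] power_mult_distrib[symmetric])
qed (use tail b in auto)

text \<open>Used when v(\<Theta>) <= v(x): the top rows have index at least r - k, where the a
  priori divisibility of \<tau> and \<sigma> makes the terms with \<Theta> and x small
  enough.\<close>

lemma log_rel_small:
  assumes rel: "log_rel r \<Theta> x \<sigma> \<tau>" and k: "2 * k \<le> r" "r < p"
    and t: "\<And>i. r - k \<le> i \<Longrightarrow> i < r \<Longrightarrow> vge B (\<Theta> * \<tau> i)"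
    and s: "\<And>i. r - k \<le> i \<Longrightarrow> i < r \<Longrightarrow> vge B (x * \<sigma> i)"
    and tail: "\<And>b. k \<le> b \<Longrightarrow> b < r \<Longrightarrow> vge B (\<sigma> b)"
    and b: "b < r"
  shows "vge B (\<sigma> b)"
proof (rule log_rows[OF k _ tail b])
  fix i assume i: "r - k \<le> i" "i < r"
  show "vge B (\<Sum>b<i. log_coeff (i - b) * \<sigma> b)"
    using vge_diff[OF t[OF i] s[OF i]] log_rel_sum[OF rel i(2)] by simp
qed

lemma log_rel_divide:
  assumes rel: "log_rel r \<Theta> x \<sigma> \<tau>" and x: "x \<noteq> 0" and i: "i < r"
  shows "\<sigma> i = \<Theta> / x * \<tau> i - (\<Sum>b<i. log_coeff (i - b) * (\<sigma> b / x))"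
proof -
  have "\<sigma> i = (\<Theta> * \<tau> i - (\<Sum>b<i. log_coeff (i - b) * \<sigma> b)) / x"
    using log_rel_sum[OF rel i] x by simp
  then show ?thesis by (simp add: diff_divide_distrib sum_divide_distrib)
qed

lemma vge_Theta_tau:
  assumes "\<Theta> \<noteq> 0" "x \<noteq> 0" "vge (real i) t"
  shows "vge (real i + vv \<Theta> - vv x) (\<Theta> / x * t)"
  using vge_mult[of "vv \<Theta> - vv x" "\<Theta> / x" "real i" t] assms
  by (simp add: vge_iff vv_divide algebra_simps)

text \<open>The relation is triangular. Solved from the bottom for \<sigma>, it divides by x in each
  step, and this loses nothing because v(x) <= 0.\<close>

lemma log_rel_direct:
  assumes rel: "log_rel r \<Theta> x \<sigma> \<tau>" and r: "r < p" and x: "x \<noteq> 0" "vv x \<le> 0" and \<Theta>: "\<Theta> \<noteq> 0"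
    and \<tau>: "\<And>i. i < r \<Longrightarrow> vge (real i) (\<tau> i)"
  shows "b < r \<Longrightarrow> vge (vv \<Theta> - vv x) (\<sigma> b)"
proof (induction b rule: less_induct)
  case (less b)
  have "vge (vv \<Theta> - vv x) (\<Theta> / x * \<tau> b - (\<Sum>a<b. log_coeff (b - a) * (\<sigma> a / x)))"
  proof (rule vge_diff[OF _ vge_sum[OF vge_0mult]])
    show "vge (vv \<Theta> - vv x) (\<Theta> / x * \<tau> b)"
      by (rule vge_mono[OF vge_Theta_tau[OF \<Theta> x(1) \<tau>]]) (use less in auto)
    fix a assume a: "a \<in> {..<b}"
    show "vge 0 (log_coeff (b - a))" using less r by (intro log_coeff_vge) auto
    have "vge (vv \<Theta> - vv x) (\<sigma> a)" using a less by auto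
    then show "vge (vv \<Theta> - vv x) (\<sigma> a / x)" using x by (simp add: vge_divide vge_mono)
  qed
  then show ?case using log_rel_divide[OF rel x(1) less.prems] by simp
qed

text \<open>One pass of the triangular relation: a bound on all \<sigma>/x yields a bound on
  \<sigma> itself, and hence a better one on \<sigma>/x when v(x) < 0.\<close>

lemma log_rel_step:
  assumes rel: "log_rel r \<Theta> x \<sigma> \<tau>" and r: "r < p" and x: "x \<noteq> 0" and \<Theta>: "\<Theta> \<noteq> 0"
    and \<tau>: "\<And>i. i < r \<Longrightarrow> vge (real i) (\<tau> i)"
    and \<sigma>: "\<And>b. b < r \<Longrightarrow> vge D (\<sigma> b / x)" and b: "b < r"
  shows "vge (min (real b + vv \<Theta> - vv x) D) (\<sigma> b)"
proof -
  have "vge (min (real b + vv \<Theta> - vv x) D) (\<Theta> / x * \<tau> b - (\<Sum>a<b. log_coeff (b - a) * (\<sigma> a / x)))"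
  proof (rule vge_diff[OF _ vge_sum[OF vge_0mult]])
    show "vge (min (real b + vv \<Theta> - vv x) D) (\<Theta> / x * \<tau> b)"
      by (rule vge_mono[OF vge_Theta_tau[OF \<Theta> x(1) \<tau>[OF b]]]) simp
    fix a assume a: "a \<in> {..<b}"
    show "vge 0 (log_coeff (b - a))" using b r by (intro log_coeff_vge) auto
    show "vge (min (real b + vv \<Theta> - vv x) D) (\<sigma> a / x)"
      using a b by (intro vge_mono[OF \<sigma>]) auto
  qed
  then show ?thesis using log_rel_divide[OF rel x(1) b] by simp
qed

text \<open>As \<open>1 / x\<close> has positive valuation, every bound on \<open>\<sigma> / x\<close> improves itself until it
  reaches \<open>C\<close>.\<close>

lemma log_rel_large:
  assumes rel: "log_rel r \<Theta> x \<sigma> \<tau>" and r: "r < p" and x: "x \<noteq> 0" "vv x < 0" and \<Theta>: "\<Theta> \<noteq> 0"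
    and \<tau>: "\<And>i. i < r \<Longrightarrow> vge (real i) (\<tau> i)" and \<sigma>: "\<And>i. i < r \<Longrightarrow> vge (real i) (\<sigma> i)"
    and k: "k \<le> r" "r \<le> 2 * k" and T: "vv x \<le> vv \<Theta>"
    and C: "C \<le> real k" "C \<le> real (r - k) + vv \<Theta> - 2 * vv x"
    and b: "b < r"
  shows "vge C (\<sigma> b / x)"
proof -
  have step: "vge (min C (D - vv x)) (\<sigma> b / x)"
    if D: "\<And>b. b < r \<Longrightarrow> vge D (\<sigma> b / x)" and b: "b < r" for D b
  \<comment> \<open>Used with r - k in the role of k, for which 2 (r - k) <= r. The tail b >= r - k
    improves by \<open>log_rel_step\<close>; the rows i >= k are divisible by p^i already, and C <=
    k.\<close>
  proof (rule log_rows[of "r - k" r _ "\<lambda>b. \<sigma> b / x"])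
    fix b assume b: "r - k \<le> b" "b < r"
    have "vge (min (real b + vv \<Theta> - vv x) D) (\<sigma> b)"
      by (rule log_rel_step[OF rel r x(1) \<Theta> \<tau> D b(2)])
    moreover have "real (r - k) \<le> real b" using b by simp
    ultimately show "vge (min C (D - vv x)) (\<sigma> b / x)"
      using x C(2) by (simp add: vge_divide) (erule vge_mono, auto simp: min_def)
  next
    fix i assume i: "r - (r - k) \<le> i" "i < r"
    have "(\<Sum>b<i. log_coeff (i - b) * (\<sigma> b / x)) = \<Theta> / x * \<tau> i - \<sigma> i"
      using log_rel_divide[OF rel x(1) i(2)] by simp
    moreover have "vge (real i) (\<Theta> / x * \<tau> i)"
      by (rule vge_mono[OF vge_Theta_tau[OF \<Theta> x(1) \<tau>[OF i(2)]]]) (use T in simp)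
    ultimately have "vge (real i) (\<Sum>b<i. log_coeff (i - b) * (\<sigma> b / x))"
      using \<sigma>[OF i(2)] by (simp add: vge_diff)
    then show "vge (min C (D - vv x)) (\<Sum>b<i. log_coeff (i - b) * (\<sigma> b / x))"
      by (rule vge_mono) (use C i k in auto)
  qed (use k r b in auto)
  have iter: "vge (min C (- real n * vv x)) (\<sigma> b / x)" if "b < r" for n b
    using that
  proof (induction n arbitrary: b)
    case 0
    have "vge 0 (\<sigma> b / x)" using \<sigma>[OF 0] x by (simp add: vge_divide vge_mono)
    then show ?case by (rule vge_mono) simp
  next
    case (Suc n)
    from step[OF Suc.IH Suc.prems] show ?case
      by (rule vge_mono) (use x in \<open>auto simp: min_def algebra_simps\<close>)
  qed
  obtain n :: nat where "C / (- vv x) \<le> real n" using real_arch_simple by blast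
  then have "C \<le> - real n * vv x" using x by (simp add: field_simps)
  then show ?thesis using iter[OF b, of n] by simp
qed

section \<open>The product with a Pade approximant\<close>

definition trunc_poly :: "nat \<Rightarrow> (nat \<Rightarrow> 'a) \<Rightarrow> 'a poly" where
  "trunc_poly r \<sigma> = (\<Sum>i<r. monom (\<sigma> i) i)"

lemma coeff_trunc: "coeff (trunc_poly r \<sigma>) i = (if i < r then \<sigma> i else 0)"
  by (simp add: trunc_poly_def coeff_sum if_distrib cong: if_cong)

lemma vge_coeff_mult:
  assumes "\<And>a b. a + b = i \<Longrightarrow> vge B (coeff P a * coeff Q b)"
  shows "vge B (coeff (P * Q) i)"
  unfolding coeff_mult by (rule vge_sum) (use assms in auto)

text \<open>Modulo T^r one has P \<Theta> \<tau> = P (x + log(1+T)) \<sigma> = Q \<sigma>, where Q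
  is \<open>Q0 + smult x P\<close>.\<close>

lemma pade_low_coeffs:
  assumes pp: "pade_pair r l x P Q0" and rel: "log_rel r \<Theta> x \<sigma> \<tau>" and i: "i < r"
  shows "coeff (smult \<Theta> (P * trunc_poly r \<tau>) - (Q0 + smult x P) * trunc_poly r \<sigma>) i = 0"
proof -
  let ?S = "fps_of_poly (trunc_poly r \<sigma>)" and ?T = "fps_of_poly (trunc_poly r \<tau>)"
  let ?P = "fps_of_poly P" and ?Q = "fps_of_poly (Q0 + smult x P)"
  have agree: "fps_nth (G * A) i = fps_nth (G * B) i"
    if "\<And>n. n < r \<Longrightarrow> fps_nth A n = fps_nth B n" for G A B :: "'a fps"
    using that i by (auto simp: fps_mult_nth intro!: sum.cong)
  have 1: "fps_nth (fps_const \<Theta> * ?T) n = fps_nth ((fps_const x + fps_ln 1) * ?S) n" if n: "n < r" for n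
  proof -
    have "fps_nth (fps_ln 1 * ?S) n = (\<Sum>a=0..n. log_coeff a * \<sigma> (n - a))"
      using n by (auto simp: fps_mult_nth fps_ln_nth coeff_trunc intro!: sum.cong)
    also have "\<dots> = (\<Sum>a=1..n. log_coeff a * \<sigma> (n - a))"
      by (simp add: sum.atLeast_Suc_atMost) (simp add: log_coeff_def)
    finally show ?thesis using n rel by (simp add: distrib_right coeff_trunc log_rel_def)
  qed
  have 2: "fps_nth (?P * (fps_const x + fps_ln 1)) n = fps_nth ?Q n" if n: "n < r" for n
    using pp n by (simp add: pade_pair_def distrib_left mult.commute[of _ "fps_const x"])
  have "coeff (smult \<Theta> (P * trunc_poly r \<tau>)) i = fps_nth (?P * (fps_const \<Theta> * ?T)) i"
    by (simp add: fps_of_poly_mult[symmetric] mult.left_commute[of _ "fps_const \<Theta>"])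
  also have "\<dots> = fps_nth (?P * ((fps_const x + fps_ln 1) * ?S)) i" by (rule agree[OF 1])
  also have "\<dots> = fps_nth (?S * (?P * (fps_const x + fps_ln 1))) i" by (simp only: mult_ac)
  also have "\<dots> = fps_nth (?S * ?Q) i" by (rule agree[OF 2])
  also have "\<dots> = coeff ((Q0 + smult x P) * trunc_poly r \<sigma>) i"
    by (simp only: fps_of_poly_mult[symmetric] fps_of_poly_nth mult.commute)
  finally show ?thesis by simp
qed

lemma pade_bound:
  assumes pp: "pade_pair r l x P Q0" and rel: "log_rel r \<Theta> x \<sigma> \<tau>"
    and t: "\<And>a b. r \<le> a + b \<Longrightarrow> b < r \<Longrightarrow> a \<le> l - 1 \<Longrightarrow> vge B (\<Theta> * (coeff P a * \<tau> b))"
    and s: "\<And>a b. r \<le> a + b \<Longrightarrow> b < r \<Longrightarrow> a \<le> r - l \<Longrightarrow> vge B (coeff (Q0 + smult x P) a * \<sigma> b)"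
  shows "vge B (coeff (smult \<Theta> (P * trunc_poly r \<tau>) - (Q0 + smult x P) * trunc_poly r \<sigma>) i)"
proof (cases "i < r")
  case True
  then show ?thesis using pade_low_coeffs[OF pp rel] by simp
next
  case False
  have "vge B (coeff (smult \<Theta> P * trunc_poly r \<tau>) i)"
  proof (rule vge_coeff_mult)
    fix a b assume "a + b = i"
    then show "vge B (coeff (smult \<Theta> P) a * coeff (trunc_poly r \<tau>) b)"
      using t[of a b] False pp coeff_eq_0[of P a]
      by (cases "b < r"; cases "a \<le> l - 1") (auto simp: coeff_trunc pade_pair_def mult.assoc)
  qed
  moreover have "vge B (coeff ((Q0 + smult x P) * trunc_poly r \<sigma>) i)"
  proof (rule vge_coeff_mult)
    fix a b assume ab: "a + b = i"
    show "vge B (coeff (Q0 + smult x P) a * coeff (trunc_poly r \<sigma>) b)"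
    proof (cases "b < r \<and> a \<le> r - l")
      case True
      then show ?thesis using s[of a b] False ab by (simp add: coeff_trunc)
    next
      case F: False
      then have "b \<ge> r \<or> coeff (Q0 + smult x P) a = 0"
        using pp coeff_eq_0[of "Q0 + smult x P" a] by (auto simp: pade_pair_def simp del: coeff_add)
      then show ?thesis by (auto simp: coeff_trunc simp del: coeff_add)
    qed
  qed
  ultimately show ?thesis by (simp add: vge_diff)
qed

text \<open>A product of total degree at least r pairs a coefficient of P, of index at most l - 1,
  with an index b >= r - l + 1, and a coefficient of the numerator, of index at most r - l, with b
  >= l. These ranges give the three numerical hypotheses; for l = 1 the denominator is constant and
  the first range is empty.\<close>

lemma pade_bound_generic:
  assumes pp: "pade_pair r l x P Q0" and rel: "log_rel r \<Theta> x \<sigma> \<tau>"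
    and l: "1 \<le> l" "2 * l \<le> r + 1" and \<Theta>: "\<Theta> \<noteq> 0"
    and \<tau>: "\<And>i. i < r \<Longrightarrow> vge (real i) (\<tau> i)" and \<sigma>: "\<And>i. i < r \<Longrightarrow> vge (real i) (\<sigma> i)"
    and N1: "2 \<le> l \<Longrightarrow> B \<le> vv \<Theta> + real (r - l + 1)"
    and N2: "2 \<le> l \<Longrightarrow> vge (B - real (r - l + 1)) x"
    and N3: "\<And>b. l \<le> b \<Longrightarrow> b < r \<Longrightarrow> vge B (\<sigma> b)"
  shows "vge B (coeff (smult \<Theta> (P * trunc_poly r \<tau>) - (Q0 + smult x P) * trunc_poly r \<sigma>) i)"
proof (rule pade_bound[OF pp rel])
  fix a b assume ab: "r \<le> a + b" "b < r" "a \<le> l - 1"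
  then have l2: "2 \<le> l" and b: "r - l + 1 \<le> b" using l by auto
  have "vge (vv \<Theta> + real b) (\<Theta> * (coeff P a * \<tau> b))"
    using pp \<tau>[OF ab(2)] \<Theta> by (intro vge_mult vge_0mult) (auto simp: pade_pair_def vge_iff)
  moreover have "real (r - l + 1) \<le> real b" using b by simp
  ultimately show "vge B (\<Theta> * (coeff P a * \<tau> b))" using N1[OF l2] by (elim vge_mono) simp
next
  fix a b assume ab: "r \<le> a + b" "b < r" "a \<le> r - l"
  have "vge B (coeff Q0 a * \<sigma> b)"
    using pp ab l by (intro vge_0mult N3) (auto simp: pade_pair_def)
  moreover have "vge B (x * coeff P a * \<sigma> b)"
  proof (cases "a \<le> l - 1")
    case True
    then have l2: "2 \<le> l" and b: "real (r - l + 1) \<le> real b" using ab l by auto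
    have "vge ((B - real (r - l + 1)) + real b) (x * coeff P a * \<sigma> b)"
      using N2[OF l2] pp \<sigma>[OF ab(2)] by (intro vge_mult vge_mult0) (auto simp: pade_pair_def)
    then show ?thesis using b by (elim vge_mono) simp
  next
    case False
    then show ?thesis using pp coeff_eq_0[of P a] by (simp add: pade_pair_def)
  qed
  ultimately show "vge B (coeff (Q0 + smult x P) a * \<sigma> b)" by (simp add: distrib_right vge_add)
qed

text \<open>The top coefficient of P meets \<tau> already at b = m, one degree earlier than the
  others; its extra divisibility -v(x) makes up for that and appears in N1. For \<sigma> only b >= m
  + 1 occurs.\<close>

lemma pade_bound_special:
  assumes pp: "pade_pair (2 * m) (m + 1) x P Q0" and rel: "log_rel (2 * m) \<Theta> x \<sigma> \<tau>"
    and x: "x \<noteq> 0" "vv x < 0" and \<Theta>: "\<Theta> \<noteq> 0"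
    and \<tau>: "\<And>i. i < 2 * m \<Longrightarrow> vge (real i) (\<tau> i)" and \<sigma>: "\<And>i. i < 2 * m \<Longrightarrow> vge (real i) (\<sigma> i)"
    and N1: "B \<le> vv \<Theta> - vv x + real m" and N2: "B \<le> vv \<Theta> + real m + 1" and N3: "B \<le> vv x + real m + 1"
  shows "vge B (coeff (smult \<Theta> (P * trunc_poly (2 * m) \<tau>) - (Q0 + smult x P) * trunc_poly (2 * m) \<sigma>) i)"
proof (rule pade_bound[OF pp rel])
  fix a b assume ab: "2 * m \<le> a + b" "b < 2 * m" "a \<le> m + 1 - 1"
  show "vge B (\<Theta> * (coeff P a * \<tau> b))"
  proof (cases "a = m")
    case True
    have "vge (vv \<Theta> + (- vv x + real b)) (\<Theta> * (coeff P a * \<tau> b))"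
      using pp \<tau>[OF ab(2)] \<Theta> True by (intro vge_mult) (auto simp: pade_pair_def vge_iff)
    then show ?thesis using N1 ab True by (elim vge_mono) simp
  next
    case False
    have "vge (vv \<Theta> + real b) (\<Theta> * (coeff P a * \<tau> b))"
      using pp \<tau>[OF ab(2)] \<Theta> by (intro vge_mult vge_0mult) (auto simp: pade_pair_def vge_iff)
    then show ?thesis using N2 ab False by (elim vge_mono) simp
  qed
next
  fix a b assume ab: "2 * m \<le> a + b" "b < 2 * m" "a \<le> 2 * m - (m + 1)"
  have "vge (vv x) (coeff (Q0 + smult x P) a)"
    using pp x vge_mult0[of "vv x" x "coeff P a"]
    by (auto simp: pade_pair_def vge_iff intro!: vge_add intro: vge_mono)
  from vge_mult[OF this \<sigma>[OF ab(2)]]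
  show "vge B (coeff (Q0 + smult x P) a * \<sigma> b)"
    by (rule vge_mono) (use N3 ab in auto)
qed


section \<open>The conditions\<close>


lemma v_eq_ereal: "v x = ereal a \<longleftrightarrow> x \<noteq> 0 \<and> vv x = a"
  by (cases "x = 0") (auto simp: v_vv)

text \<open>All that the module needs from one index. The inequalities between valuations and the
  bound on x + \<open>expm1 P Q0\<close> give stability under N and Frobenius. In the implication, r
  - 1 - v(\<Lambda>) is what makes p \<Lambda> \<phi>(s) divisible by p^r, and r - v(\<Lambda>) +
  v(\<Omega>) does the same for the second coordinate with its factor \<Lambda>/\<Omega>.\<close>

definition comp_data ::
    "nat \<Rightarrow> bool \<Rightarrow> 'a \<Rightarrow> 'a \<Rightarrow> 'a \<Rightarrow> 'a \<Rightarrow> 'a poly \<Rightarrow> 'a poly \<Rightarrow> bool" where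
  "comp_data r isinf \<Lambda> \<Theta> \<Omega> x P Q0 \<longleftrightarrow>
     (\<forall>i. vge 0 (coeff P i)) \<and> poly P (-1) \<noteq> 0 \<and> vv (poly P (-1)) = 0 \<and>
     (\<forall>n\<ge>1. vge 0 (fps_nth (expm1 P Q0) n)) \<and>
     - 1 \<le> vv \<Lambda> \<and> vv \<Omega> \<le> vv \<Lambda> + vv \<Theta> \<and> vv \<Omega> \<le> 0 \<and> vv \<Theta> \<le> 0 \<and>
     (\<forall>n. vge (vv \<Omega> - vv \<Lambda>) (fps_nth (fps_const x + expm1 P Q0) n)) \<and>
     (\<forall>\<sigma> \<tau>. (\<forall>i<r. vge (real i) (\<sigma> i)) \<longrightarrow> (\<forall>i<r. vge (real i) (\<tau> i)) \<longrightarrow>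
       (if isinf then \<forall>i<r. \<sigma> i = 0 else log_rel r \<Theta> x \<sigma> \<tau>) \<longrightarrow>
       (\<forall>i<r. vge (real r - 1 - vv \<Lambda>) (\<sigma> i)) \<and>
       (\<forall>i. vge (real r - vv \<Lambda> + vv \<Omega>)
          (coeff (smult \<Theta> (P * trunc_poly r \<tau>) - (Q0 + smult x P) * trunc_poly r \<sigma>) i)))"

lemma comp_data_pade:
  assumes pp: "pade_pair r l x P Q0" and l: "1 \<le> l" "l \<le> r"
    and S: "- 1 \<le> vv \<Lambda>" "vv \<Omega> \<le> vv \<Lambda> + vv \<Theta>" "vv \<Omega> \<le> 0" "vv \<Theta> \<le> 0" "vv \<Omega> \<le> vv \<Lambda>"
      "vge (vv \<Omega> - vv \<Lambda>) x"
    and core: "\<And>\<sigma> \<tau>. (\<And>i. i < r \<Longrightarrow> vge (real i) (\<sigma> i)) \<Longrightarrow> (\<And>i. i < r \<Longrightarrow> vge (real i) (\<tau> i)) \<Longrightarrow>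
      log_rel r \<Theta> x \<sigma> \<tau> \<Longrightarrow> (\<forall>i<r. vge (real r - 1 - vv \<Lambda>) (\<sigma> i)) \<and>
       (\<forall>i. vge (real r - vv \<Lambda> + vv \<Omega>)
          (coeff (smult \<Theta> (P * trunc_poly r \<tau>) - (Q0 + smult x P) * trunc_poly r \<sigma>) i))"
  shows "\<exists>P Q0. delta r l x = Fract Q0 P \<and> comp_data r False \<Lambda> \<Theta> \<Omega> x P Q0"
proof -
  have h: "vge 0 (fps_nth (expm1 P Q0) n)" for n
    using pp by (intro vge_expm1) (auto simp: pade_pair_def)
  have "vge (vv \<Omega> - vv \<Lambda>) (fps_nth (fps_const x + expm1 P Q0) n)" for n
    using S(5,6) vge_mono[OF h, of "vv \<Omega> - vv \<Lambda>" n] by (auto intro: vge_add)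
  moreover have "\<forall>\<sigma> \<tau>. (\<forall>i<r. vge (real i) (\<sigma> i)) \<longrightarrow> (\<forall>i<r. vge (real i) (\<tau> i)) \<longrightarrow> log_rel r \<Theta> x \<sigma> \<tau> \<longrightarrow>
       (\<forall>i<r. vge (real r - 1 - vv \<Lambda>) (\<sigma> i)) \<and>
       (\<forall>i. vge (real r - vv \<Lambda> + vv \<Omega>)
          (coeff (smult \<Theta> (P * trunc_poly r \<tau>) - (Q0 + smult x P) * trunc_poly r \<sigma>) i))"
    by (intro allI impI core) auto
  moreover have "\<forall>i. vge 0 (coeff P i)" "poly P (-1) \<noteq> 0" "vv (poly P (-1)) = 0"
    using pp by (auto simp: pade_pair_def)
  ultimately have "comp_data r False \<Lambda> \<Theta> \<Omega> x P Q0"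
    unfolding comp_data_def if_False using S(1-4) h by blast
  then show ?thesis using delta_pade[OF pp l] by blast
qed

text \<open>The approximant is 0, so that only \<Theta> \<tau> remains, and the required bound is
  exactly v(\<Theta>). What has to be gained is divisibility of \<sigma> by p^r: for infinite slope
  \<sigma> vanishes, otherwise x is so large that the triangular recursion gives it.\<close>

lemma comp_data_l0:
  assumes S: "vv \<Lambda> = - 1" "vv \<Theta> - vv \<Omega> = real r + 1" "vv \<Theta> \<le> 0" and \<Theta>: "\<Theta> \<noteq> 0"
    and fin: "\<not> isinf \<Longrightarrow> x \<noteq> 0 \<and> vv x + real r \<le> vv \<Theta>" and r: "r < p"
  shows "\<exists>P Q0. delta r 0 x = Fract Q0 P \<and> comp_data r isinf \<Lambda> \<Theta> \<Omega> x P Q0"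
proof (intro exI conjI)
  show "delta r 0 x = Fract [:-x:] 1" by (simp add: delta_def Zero_fract_def)
  have h: "expm1 1 [:-x:] = fps_const (- x)" by (simp add: expm1_def pcompose_1 fps_of_poly_const)
  have core: "(\<forall>i<r. vge (real r) (\<sigma> i)) \<and> (\<forall>i. vge (vv \<Theta>) (\<Theta> * (if i < r then \<tau> i else 0)))"
    if \<sigma>: "\<forall>i<r. vge (real i) (\<sigma> i)" and \<tau>: "\<forall>i<r. vge (real i) (\<tau> i)"
      and rel: "if isinf then \<forall>i<r. \<sigma> i = 0 else log_rel r \<Theta> x \<sigma> \<tau>" for \<sigma> \<tau>
  proof
    show "\<forall>i<r. vge (real r) (\<sigma> i)"
    proof (cases isinf)
      case False
      then have x: "x \<noteq> 0" "vv x + real r \<le> vv \<Theta>" using fin by auto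
      have "vge (vv \<Theta> - vv x) (\<sigma> i)" if "i < r" for i
        using rel False x(2) S(3) \<tau> that
        by (intro log_rel_direct[where r = r and \<tau> = \<tau>, OF _ r x(1) _ \<Theta>]) auto
      moreover have "real r \<le> vv \<Theta> - vv x" using x(2) by linarith
      ultimately show ?thesis using vge_mono by blast
    qed (use rel in auto)
    show "\<forall>i. vge (vv \<Theta>) (\<Theta> * (if i < r then \<tau> i else 0))"
      using \<tau> \<Theta> by (auto simp: vge_mult_left intro: vge_mono)
  qed
  show "comp_data r isinf \<Lambda> \<Theta> \<Omega> x 1 [:-x:]"
  proof -
    have "[:-x:] + smult x 1 = (0 :: 'a poly)" by simp
    then have e: "smult \<Theta> (1 * trunc_poly r \<tau>) - ([:-x:] + smult x 1) * trunc_poly r \<sigma> = smult \<Theta> (trunc_poly r \<tau>)" for \<sigma> \<tau>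
      by simp
    have z: "fps_nth (fps_const x + expm1 1 [:-x:]) n = 0" for n by (simp add: h)
    have B: "real r - vv \<Lambda> + vv \<Omega> = vv \<Theta>" "real r - 1 - vv \<Lambda> = real r" using S by auto
    have c1: "vge 0 (coeff (1 :: 'a poly) i)" for i by (simp add: vge_one)
    show ?thesis
      unfolding comp_data_def e z B coeff_smult coeff_trunc
      using core S c1 by (auto simp: h)
  qed
qed

text \<open>Here the target for \<sigma> is 0, and the one for the combination is 1 + v(\<Omega>) <=
  1, while \<sigma> enters only in degrees b >= 1: the a priori bounds suffice.\<close>

lemma comp_data_half0:
  assumes \<Theta>: "\<Theta> \<noteq> 0" and r: "1 \<le> r" "r < p"
    and S: "vv \<Lambda> = real r - 1" "vv \<Theta> - vv \<Omega> = 1 - real r" "vge (vv \<Theta>) x" "vv \<Omega> \<le> 0"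
  shows "\<exists>P Q0. delta r 1 x = Fract Q0 P \<and> comp_data r False \<Lambda> \<Theta> \<Omega> x P Q0"
proof -
  obtain P Q0 where pp: "pade_pair r 1 x P Q0" using pade_pair_generic[of 1 r x] r by auto
  show ?thesis
  proof (rule comp_data_pade[OF pp])
    fix \<sigma> \<tau> assume \<sigma>: "\<And>i. i < r \<Longrightarrow> vge (real i) (\<sigma> i)" and \<tau>: "\<And>i. i < r \<Longrightarrow> vge (real i) (\<tau> i)"
      and rel: "log_rel r \<Theta> x \<sigma> \<tau>"
    have "vge (real r - vv \<Lambda> + vv \<Omega>) (coeff (smult \<Theta> (P * trunc_poly r \<tau>) - (Q0 + smult x P) * trunc_poly r \<sigma>) i)" for i
      by (rule pade_bound_generic[OF pp rel _ _ \<Theta> \<tau> \<sigma>])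
         (use r S \<sigma> in \<open>auto intro!: vge_mono[OF \<sigma>]\<close>)
    moreover have "vge (real r - 1 - vv \<Lambda>) (\<sigma> i)" if "i < r" for i
      by (rule vge_mono[OF \<sigma>[OF that]]) (use S in simp)
    ultimately show "(\<forall>i<r. vge (real r - 1 - vv \<Lambda>) (\<sigma> i)) \<and> (\<forall>i. vge (real r - vv \<Lambda> + vv \<Omega>)
          (coeff (smult \<Theta> (P * trunc_poly r \<tau>) - (Q0 + smult x P) * trunc_poly r \<sigma>) i))" by blast
  qed (use r S in \<open>auto elim: vge_mono\<close>)
qed

text \<open>The two families with \<open>k' \<le> r' / 2\<close>; \<open>l\<close> is \<open>k + 1\<close> for \<open>k' = k + 1/2\<close>
  and \<open>k\<close> for \<open>k' = k\<close>.\<close>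

lemma comp_data_small:
  assumes \<Theta>: "\<Theta> \<noteq> 0" and r: "r < p" and k: "1 \<le> k" "2 * k \<le> r" and l: "1 \<le> l" "2 * l \<le> r + 1"
    and x: "vge (vv \<Theta>) x"
    and S: "- 1 \<le> vv \<Lambda>" "vv \<Omega> \<le> vv \<Lambda> + vv \<Theta>" "vv \<Omega> \<le> 0" "vv \<Theta> \<le> 0" "vv \<Omega> \<le> vv \<Lambda>"
    and A: "real r - 1 - vv \<Lambda> \<le> real k" "real r - 1 - vv \<Lambda> \<le> vv \<Theta> + real r - real k"
    and N: "real l - 1 \<le> vv \<Theta> + vv \<Lambda> - vv \<Omega>" "real r - vv \<Lambda> + vv \<Omega> \<le> real l"
  shows "\<exists>P Q0. delta r l x = Fract Q0 P \<and> comp_data r False \<Lambda> \<Theta> \<Omega> x P Q0"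
proof -
  obtain P Q0 where pp: "pade_pair r l x P Q0" using pade_pair_generic[of l r x] l r by auto
  have lr: "real (r - l + 1) = real r - real l + 1" using l by simp
  show ?thesis
  proof (rule comp_data_pade[OF pp])
    fix \<sigma> \<tau> assume \<sigma>: "\<And>i. i < r \<Longrightarrow> vge (real i) (\<sigma> i)" and \<tau>: "\<And>i. i < r \<Longrightarrow> vge (real i) (\<tau> i)"
      and rel: "log_rel r \<Theta> x \<sigma> \<tau>"
    have "vge (real r - vv \<Lambda> + vv \<Omega>) (coeff (smult \<Theta> (P * trunc_poly r \<tau>) - (Q0 + smult x P) * trunc_poly r \<sigma>) i)" for i
    proof (rule pade_bound_generic[OF pp rel l \<Theta> \<tau> \<sigma>])
      show "real r - vv \<Lambda> + vv \<Omega> \<le> vv \<Theta> + real (r - l + 1)" using N lr by linarith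
      show "vge (real r - vv \<Lambda> + vv \<Omega> - real (r - l + 1)) x"
        by (rule vge_mono[OF x]) (use N lr in linarith)
      show "vge (real r - vv \<Lambda> + vv \<Omega>) (\<sigma> b)" if "l \<le> b" "b < r" for b
        by (rule vge_mono[OF \<sigma>[OF that(2)]]) (use N that in linarith)
    qed
    moreover have "vge (real r - 1 - vv \<Lambda>) (\<sigma> i)" if "i < r" for i
    proof (rule log_rel_small[OF rel k(2) r _ _ _ that])
      fix i assume i: "r - k \<le> i" "i < r"
      have ik: "real r - real k \<le> real i" using i k by linarith
      show "vge (real r - 1 - vv \<Lambda>) (\<Theta> * \<tau> i)"
        by (rule vge_mono[OF vge_mult[OF _ \<tau>[OF i(2)], of "vv \<Theta>"]]) (use A ik \<Theta> in \<open>auto simp: vge_iff\<close>)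
      show "vge (real r - 1 - vv \<Lambda>) (x * \<sigma> i)"
        by (rule vge_mono[OF vge_mult[OF x \<sigma>[OF i(2)]]]) (use A ik in auto)
    next
      fix b assume "k \<le> b" "b < r"
      then show "vge (real r - 1 - vv \<Lambda>) (\<sigma> b)" using A by (intro vge_mono[OF \<sigma>]) auto
    qed
    ultimately show "(\<forall>i<r. vge (real r - 1 - vv \<Lambda>) (\<sigma> i)) \<and> (\<forall>i. vge (real r - vv \<Lambda> + vv \<Omega>)
          (coeff (smult \<Theta> (P * trunc_poly r \<tau>) - (Q0 + smult x P) * trunc_poly r \<sigma>) i))" by blast
  next
    show "vge (vv \<Omega> - vv \<Lambda>) x" by (rule vge_mono[OF x]) (use S in linarith)
  qed (use l S in auto)
qed

text \<open>The cases with \<open>k' > r' / 2\<close>, where \<open>C\<close> bounds \<open>\<sigma> / x\<close>. The numerical hypothesis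
  \<open>gen\<close> is used for the approximants that do not depend on \<open>x\<close>, \<open>spec\<close> for the others.\<close>

lemma comp_data_large:
  assumes \<Theta>: "\<Theta> \<noteq> 0" and r: "r < p" and x: "x \<noteq> 0" and l: "1 \<le> l" "l \<le> r" "2 * l \<le> r + 2"
    and S: "- 1 \<le> vv \<Lambda>" "vv \<Omega> \<le> vv \<Lambda> + vv \<Theta>" "vv \<Omega> \<le> 0" "vv \<Theta> \<le> 0" "vv \<Omega> \<le> vv \<Lambda> + vv x"
      "vv x \<le> 0" "vv x \<le> vv \<Theta>"
    and C: "C + vv x = real r - 1 - vv \<Lambda>"
    and bound: "\<And>\<sigma> \<tau> b. (\<And>i. i < r \<Longrightarrow> vge (real i) (\<sigma> i)) \<Longrightarrow> (\<And>i. i < r \<Longrightarrow> vge (real i) (\<tau> i)) \<Longrightarrow>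
      log_rel r \<Theta> x \<sigma> \<tau> \<Longrightarrow> b < r \<Longrightarrow> vge C (\<sigma> b / x)"
    and gen: "2 * l \<le> r + 1 \<Longrightarrow>
      (2 \<le> l \<longrightarrow> real l - 1 \<le> vv x + vv \<Lambda> - vv \<Omega>) \<and>
      (l < r \<longrightarrow> real r - vv \<Lambda> + vv \<Omega> \<le> real l \<or>
        real r - vv \<Lambda> + vv \<Omega> \<le> real l + vv \<Theta> - vv x \<and> real r - vv \<Lambda> + vv \<Omega> \<le> C)"
    and spec: "2 * l = r + 2 \<Longrightarrow> vv x < 0 \<and>
      real r - vv \<Lambda> + vv \<Omega> \<le> vv \<Theta> - vv x + (real l - 1) \<and>
      real r - vv \<Lambda> + vv \<Omega> \<le> vv \<Theta> + real l \<and>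
      real r - vv \<Lambda> + vv \<Omega> \<le> vv x + real l"
  shows "\<exists>P Q0. delta r l x = Fract Q0 P \<and> comp_data r False \<Lambda> \<Theta> \<Omega> x P Q0"
proof -
  let ?B = "real r - vv \<Lambda> + vv \<Omega>"
  have lr: "real (r - l + 1) = real r - real l + 1" using l by simp
  have taylor: "vge (real r - 1 - vv \<Lambda>) s" if "vge C (s / x)" for s
    using that x C by (simp add: vge_divide)
  have "\<exists>P Q0. pade_pair r l x P Q0 \<and> (\<forall>\<sigma> \<tau> i. (\<forall>i<r. vge (real i) (\<sigma> i)) \<longrightarrow>
    (\<forall>i<r. vge (real i) (\<tau> i)) \<longrightarrow> log_rel r \<Theta> x \<sigma> \<tau> \<longrightarrow>
    vge ?B (coeff (smult \<Theta> (P * trunc_poly r \<tau>) - (Q0 + smult x P) * trunc_poly r \<sigma>) i))"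
  proof (cases "2 * l \<le> r + 1")
    case True
    obtain P Q0 where pp: "pade_pair r l x P Q0" using pade_pair_generic[of l r x] True l r by auto
    have "vge ?B (coeff (smult \<Theta> (P * trunc_poly r \<tau>) - (Q0 + smult x P) * trunc_poly r \<sigma>) i)"
      if \<sigma>: "\<forall>i<r. vge (real i) (\<sigma> i)" and \<tau>: "\<forall>i<r. vge (real i) (\<tau> i)" and rel: "log_rel r \<Theta> x \<sigma> \<tau>"
      for \<sigma> \<tau> i
    proof (rule pade_bound_generic[OF pp rel l(1) True \<Theta>])
      show "?B \<le> vv \<Theta> + real (r - l + 1)" if "2 \<le> l" using gen[OF True] that lr S by linarith
      show "vge (?B - real (r - l + 1)) x" if "2 \<le> l"
        using gen[OF True] that lr x by (simp add: vge_iff)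
      fix b assume b: "l \<le> b" "b < r"
      \<comment> \<open>Either the a priori bound b >= l is enough, or one pass of
        \<open>log_rel_step\<close> applied to the bound C is.\<close>
      then consider "?B \<le> real l" | "?B \<le> real l + vv \<Theta> - vv x" "?B \<le> C" using gen[OF True] by auto
      then show "vge ?B (\<sigma> b)"
      proof cases
        case 1
        have "vge (real b) (\<sigma> b)" using \<sigma> b by blast
        then show ?thesis by (rule vge_mono) (use 1 b in linarith)
      next
        case 2
        have "vge (min (real b + vv \<Theta> - vv x) C) (\<sigma> b)"
          by (rule log_rel_step[OF rel r x \<Theta>]) (use bound[OF _ _ rel] \<sigma> \<tau> b in auto)
        then show ?thesis by (rule vge_mono) (use 2 b in linarith)
      qed
    qed (use \<sigma> \<tau> in auto)
    then show ?thesis using pp by blast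
  next
    case False
    define m where "m = l - 1"
    have m: "r = 2 * m" "l = m + 1" "1 \<le> m" using False l by (auto simp: m_def)
    have sp: "vv x < 0" "?B \<le> vv \<Theta> - vv x + real m" "?B \<le> vv \<Theta> + real m + 1" "?B \<le> vv x + real m + 1"
      using spec m by auto
    obtain P Q0 where pp: "pade_pair (2 * m) (m + 1) x P Q0"
      using pade_pair_special[of m x] m r x sp(1) by auto
    have "vge ?B (coeff (smult \<Theta> (P * trunc_poly r \<tau>) - (Q0 + smult x P) * trunc_poly r \<sigma>) i)"
      if \<sigma>: "\<forall>i<r. vge (real i) (\<sigma> i)" and \<tau>: "\<forall>i<r. vge (real i) (\<tau> i)" and rel: "log_rel r \<Theta> x \<sigma> \<tau>"
      for \<sigma> \<tau> i
      unfolding m(1)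
      by (rule pade_bound_special[OF pp rel[unfolded m(1)] x sp(1) \<Theta>])
         (use \<sigma> \<tau> sp in \<open>unfold m(1), blast+\<close>)
    then show ?thesis using pp unfolding m(1,2) by blast
  qed
  then obtain P Q0 where pp: "pade_pair r l x P Q0" and core: "\<And>\<sigma> \<tau> i. (\<forall>i<r. vge (real i) (\<sigma> i)) \<Longrightarrow>
    (\<forall>i<r. vge (real i) (\<tau> i)) \<Longrightarrow> log_rel r \<Theta> x \<sigma> \<tau> \<Longrightarrow>
    vge ?B (coeff (smult \<Theta> (P * trunc_poly r \<tau>) - (Q0 + smult x P) * trunc_poly r \<sigma>) i)"
    by blast
  show ?thesis
  proof (rule comp_data_pade[OF pp l(1,2)])
    show "vge (vv \<Omega> - vv \<Lambda>) x" "vv \<Omega> \<le> vv \<Lambda>" using S x by (auto simp: vge_iff)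
    fix \<sigma> \<tau> assume *: "\<And>i. i < r \<Longrightarrow> vge (real i) (\<sigma> i)" "\<And>i. i < r \<Longrightarrow> vge (real i) (\<tau> i)"
      "log_rel r \<Theta> x \<sigma> \<tau>"
    show "(\<forall>i<r. vge (real r - 1 - vv \<Lambda>) (\<sigma> i)) \<and> (\<forall>i. vge ?B
          (coeff (smult \<Theta> (P * trunc_poly r \<tau>) - (Q0 + smult x P) * trunc_poly r \<sigma>) i))"
    proof (intro conjI allI impI)
      show "vge (real r - 1 - vv \<Lambda>) (\<sigma> i)" if "i < r" for i
        by (rule taylor, rule bound[of \<sigma> \<tau>]) (use * that in auto)
      show "vge ?B (coeff (smult \<Theta> (P * trunc_poly r \<tau>) - (Q0 + smult x P) * trunc_poly r \<sigma>) i)" for i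
        by (rule core) (use * in auto)
    qed
  qed (use S in auto)
qed

section \<open>The case distinction over k'\<close>

lemma l_of_eq:
  assumes "r < p"
  shows "2 * k + 1 \<le> r \<Longrightarrow> l_of r (ereal (real k + 1 / 2)) = k + 1"
    and "2 * k = r \<Longrightarrow> l_of r (ereal (real k + 1 / 2)) = k + 1"
    and "r < 2 * k \<or> r = k \<Longrightarrow> 1 \<le> r \<Longrightarrow> l_of r (ereal (real k + 1 / 2)) = r - k"
    and "2 * k \<le> r + 2 \<Longrightarrow> 2 * k \<noteq> r + 1 \<Longrightarrow> l_of r (ereal (real k)) = k"
    and "r < 2 * k \<Longrightarrow> 2 * k \<noteq> r + 2 \<Longrightarrow> l_of r (ereal (real k)) = r + 1 - k"
proof -
  have ce: "\<lceil>real k + 1 / 2\<rceil> = int k + 1" by (simp add: ceiling_eq_iff)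
  have d: "2 * (r div 2) \<le> r" "r \<le> 2 * (r div 2) + 1" by auto
  have h: "ereal (real k + 1 / 2) \<le> ereal (real (r div 2 + 1)) \<longleftrightarrow> k \<le> r div 2"
  proof -
    have "real k + 1 / 2 \<le> real (r div 2 + 1) \<longleftrightarrow> real k \<le> real (r div 2)"
    proof
      assume "real k + 1 / 2 \<le> real (r div 2 + 1)"
      then have "real k < real (r div 2 + 1)" by linarith
      then have "k < r div 2 + 1" by (simp only: of_nat_less_iff)
      then show "real k \<le> real (r div 2)" by simp
    qed simp
    then show ?thesis by simp
  qed
  have i: "ereal (real k) \<le> ereal (real (r div 2 + 1)) \<longleftrightarrow> k \<le> r div 2 + 1"
    by (simp only: ereal_less_eq(3) of_nat_le_iff)
  have L1: "l_of r (ereal (real k + 1 / 2)) = (if k \<le> r div 2 then k + 1 else r - k)"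
    unfolding l_of_def h real_of_ereal.simps ce by (simp add: nat_diff_distrib' nat_add_distrib)
  have L2: "l_of r (ereal (real k)) = (if k \<le> r div 2 + 1 then k else r + 1 - k)"
    unfolding l_of_def i real_of_ereal.simps by (simp add: nat_diff_distrib' nat_add_distrib)
  show "2 * k + 1 \<le> r \<Longrightarrow> l_of r (ereal (real k + 1 / 2)) = k + 1" unfolding L1 using d by auto
  show "2 * k = r \<Longrightarrow> l_of r (ereal (real k + 1 / 2)) = k + 1" unfolding L1 using d by auto
  show "r < 2 * k \<or> r = k \<Longrightarrow> 1 \<le> r \<Longrightarrow> l_of r (ereal (real k + 1 / 2)) = r - k" unfolding L1 using d by auto
  show "2 * k \<le> r + 2 \<Longrightarrow> 2 * k \<noteq> r + 1 \<Longrightarrow> l_of r (ereal (real k)) = k" unfolding L2 using d by auto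
  show "r < 2 * k \<Longrightarrow> 2 * k \<noteq> r + 2 \<Longrightarrow> l_of r (ereal (real k)) = r + 1 - k" unfolding L2 using d by auto
qed

lemma comp_data_half:
  assumes r: "1 \<le> r" "r < p" and k: "k \<le> r" and nz: "\<Lambda> \<noteq> 0" "\<Theta> \<noteq> 0" "\<Omega> \<noteq> 0"
    and C: "cond_C_fin v (real r) (real k + 1 / 2) \<Lambda> \<Theta> \<Omega> x"
  shows "\<exists>P Q0. delta r (l_of r (ereal (real k + 1 / 2))) x = Fract Q0 P \<and> comp_data r False \<Lambda> \<Theta> \<Omega> x P Q0"
proof -
  have fl: "\<lfloor>real k + 1 / 2\<rfloor> = int k" by (simp add: floor_eq_iff)
  note C' = C[unfolded cond_C_fin_def Let_def fl]
  consider "k = 0" | "1 \<le> k" "2 * k + 1 \<le> r" | "1 \<le> k" "r \<le> 2 * k" "k < r" | "k = r"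
    using k by linarith
  then show ?thesis
  proof cases
    case 1
    then have "v \<Lambda> = ereal (real r - 1) \<and> v (\<Theta> / \<Omega>) = ereal (- real r + 1) \<and> v \<Theta> \<le> v x \<and> v \<Omega> \<le> 0"
      using C' by auto
    then have "vv \<Lambda> = real r - 1" "vv \<Theta> - vv \<Omega> = 1 - real r" "vge (vv \<Theta>) x" "vv \<Omega> \<le> 0"
      using nz by (auto simp: v_eq_ereal vge_def vv_divide v_vv zero_ereal_def)
    from comp_data_half0[OF nz(2) r this] show ?thesis
      using l_of_eq(1,3)[OF r(2), of k] l_of_eq(2)[OF r(2), of k] 1 r by (cases "r = 0") auto
  next
    case 2
    then have p2: "1 / 2 < real k + 1 / 2 \<and> real k + 1 / 2 = real_of_int (int k) + 1 / 2 \<and> real k + 1 / 2 \<le> real r / 2"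
      by auto
    then have "v \<Lambda> = ereal (real r - real_of_int (int k) - 1) \<and> v (\<Theta> / \<Omega>) = ereal (- real r + 2 * (real k + 1 / 2)) \<and>
        v \<Theta> \<le> v x \<and> -1 \<le> v \<Omega> \<and> v \<Omega> \<le> 0"
      using C' by blast
    then have S: "vv \<Lambda> = real r - real k - 1" "vv \<Theta> - vv \<Omega> = - real r + 2 * real k + 1" "vge (vv \<Theta>) x"
      "- 1 \<le> vv \<Omega>" "vv \<Omega> \<le> 0"
      using nz by (auto simp: v_eq_ereal vge_def vv_divide v_vv zero_ereal_def one_ereal_def)
    have rk: "2 * real k + 1 \<le> real r" "1 \<le> real k" "real (k + 1) = real k + 1" "2 * (k + 1) \<le> r + 1"
      using 2 by auto
    have "\<exists>P Q0. delta r (k + 1) x = Fract Q0 P \<and> comp_data r False \<Lambda> \<Theta> \<Omega> x P Q0"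
      by (rule comp_data_small[OF nz(2) r(2) 2(1) _ _ _ S(3)]) (use S rk 2 in linarith)+
    then show ?thesis using l_of_eq(1)[OF r(2) 2(2)] by simp
  next
    case 3
    then have "(real r + 1) / 2 \<le> real k + 1 / 2 \<and> real k + 1 / 2 = real_of_int (int k) + 1 / 2 \<and> real k + 1 / 2 < real r"
      by auto
    then have "v (\<Lambda> * x) = ereal (real r - real_of_int (int k) - 1) \<and>
        v (\<Theta> / \<Omega> / x^2) = ereal (- real r + 2 * (real k + 1 / 2)) \<and>
        v x < 0 \<and> v x \<le> v \<Theta> \<and> v \<Theta> \<le> 0 \<and> -1 \<le> v \<Omega> \<and> v \<Omega> \<le> 0"
      using C' by blast
    then have x0: "x \<noteq> 0" and S: "vv \<Lambda> + vv x = real r - real k - 1"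
      "vv \<Theta> - vv \<Omega> - 2 * vv x = - real r + 2 * real k + 1" "vv x < 0" "vv x \<le> vv \<Theta>" "vv \<Theta> \<le> 0"
      "- 1 \<le> vv \<Omega>" "vv \<Omega> \<le> 0"
      using nz by (auto simp: v_eq_ereal vv_divide vv_mult vv_power v_vv zero_ereal_def one_ereal_def)
    have rk: "real r \<le> 2 * real k" "real k + 1 \<le> real r" "1 \<le> real k" using 3 by linarith+
    \<comment> \<open>For r = 2k the number k + 1/2 is still at most r div 2 + 1, whence l = k + 1
      and the approximant depends on x; beyond that l = r - k.\<close>
    define l where "l = (if r = 2 * k then k + 1 else r - k)"
    have l: "1 \<le> l" "l \<le> r" "2 * l \<le> r + 2" using 3 by (auto simp: l_def)
    have "\<exists>P Q0. delta r l x = Fract Q0 P \<and> comp_data r False \<Lambda> \<Theta> \<Omega> x P Q0"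
    \<comment> \<open>The value of r - 1 - v(\<Lambda>) - v(x), as v(\<Lambda> x) = r - k -
      1.\<close>
    proof (rule comp_data_large[OF nz(2) r(2) x0 l, where C = "real k"])
      show "2 * l \<le> r + 1 \<Longrightarrow> (2 \<le> l \<longrightarrow> real l - 1 \<le> vv x + vv \<Lambda> - vv \<Omega>) \<and>
        (l < r \<longrightarrow> real r - vv \<Lambda> + vv \<Omega> \<le> real l \<or>
          real r - vv \<Lambda> + vv \<Omega> \<le> real l + vv \<Theta> - vv x \<and> real r - vv \<Lambda> + vv \<Omega> \<le> real k)"
      proof -
        assume "2 * l \<le> r + 1"
        then have "r \<noteq> 2 * k" by (auto simp: l_def)
        then have "real l = real r - real k" "real r + 1 \<le> 2 * real k" using 3 by (auto simp: l_def)
        then show ?thesis using S rk by (intro conjI impI disjI2) linarith+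
      qed
      show "2 * l = r + 2 \<Longrightarrow> vv x < 0 \<and>
        real r - vv \<Lambda> + vv \<Omega> \<le> vv \<Theta> - vv x + (real l - 1) \<and>
        real r - vv \<Lambda> + vv \<Omega> \<le> vv \<Theta> + real l \<and> real r - vv \<Lambda> + vv \<Omega> \<le> vv x + real l"
      proof -
        assume "2 * l = r + 2"
        then have "real l = real k + 1" "real r = 2 * real k" using 3 by (auto simp: l_def split: if_splits)
        then show ?thesis using S rk by (intro conjI) linarith+
      qed
      fix \<sigma> \<tau> b assume *: "\<And>i. i < r \<Longrightarrow> vge (real i) (\<sigma> i)" "\<And>i. i < r \<Longrightarrow> vge (real i) (\<tau> i)"
        "log_rel r \<Theta> x \<sigma> \<tau>" "b < r"
      have "real (r - k) = real r - real k" using 3 by simp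
      then show "vge (real k) (\<sigma> b / x)"
        using S 3 by (intro log_rel_large[OF *(3) r(2) x0 _ nz(2) *(2) *(1) k _ _ _ _ *(4)]) auto
    qed (use S rk in linarith)+
    moreover have "l_of r (ereal (real k + 1 / 2)) = l"
      using l_of_eq(2,3)[OF r(2), of k] 3 by (auto simp: l_def)
    ultimately show ?thesis by simp
  next
    case 4
    then have "v \<Lambda> = -1 \<and> v (\<Theta> / \<Omega>) = ereal (real r + 1) \<and> v x + ereal (real r) \<le> v \<Theta> \<and> v \<Theta> \<le> 0"
      using C' by auto
    then have "vv \<Lambda> = - 1" "vv \<Theta> - vv \<Omega> = real r + 1" "vv \<Theta> \<le> 0" "x \<noteq> 0 \<and> vv x + real r \<le> vv \<Theta>"
      using nz by (auto simp: v_eq_ereal vv_divide v_vv zero_ereal_def one_ereal_def)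
         (cases "x = 0"; simp add: v_vv)+
    from comp_data_l0[OF this(1-3) nz(2) this(4) r(2)] show ?thesis
      using l_of_eq(3)[OF r(2), of k] 4 r by auto
  qed
qed

lemma comp_data_int:
  assumes r: "1 \<le> r" "r < p" and k: "1 \<le> k" "k \<le> r" and nz: "\<Lambda> \<noteq> 0" "\<Theta> \<noteq> 0" "\<Omega> \<noteq> 0"
    and C: "cond_C_fin v (real r) (real k) \<Lambda> \<Theta> \<Omega> x"
  shows "\<exists>P Q0. delta r (l_of r (ereal (real k))) x = Fract Q0 P \<and> comp_data r False \<Lambda> \<Theta> \<Omega> x P Q0"
proof -
  have fl: "\<lfloor>real k\<rfloor> = int k" by simp
  note C' = C[unfolded cond_C_fin_def Let_def fl]
  consider "2 * k \<le> r" | "r < 2 * k" "k < r" | "k = r" "r < 2 * k" using k by linarith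
  then show ?thesis
  proof cases
    case 1
    then have "1 / 2 < real k \<and> real k = real_of_int (int k) \<and> real k \<le> real r / 2" using k by auto
    then have "v (\<Lambda> * \<Theta>) = ereal (real_of_int (int k) - 1) \<and> v (\<Theta> * \<Omega>) = ereal (- real r + 2 * real k - 1) \<and>
        v \<Theta> \<le> v x \<and> -1 \<le> v \<Omega> \<and> v \<Omega> \<le> 0"
      using C' by blast
    then have S: "vv \<Lambda> + vv \<Theta> = real k - 1" "vv \<Theta> + vv \<Omega> = - real r + 2 * real k - 1" "vge (vv \<Theta>) x"
      "- 1 \<le> vv \<Omega>" "vv \<Omega> \<le> 0"
      using nz by (auto simp: v_eq_ereal vge_def vv_mult v_vv zero_ereal_def one_ereal_def)
    have rk: "2 * real k \<le> real r" "1 \<le> real k" using 1 k by linarith+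
    have "\<exists>P Q0. delta r k x = Fract Q0 P \<and> comp_data r False \<Lambda> \<Theta> \<Omega> x P Q0"
      by (rule comp_data_small[OF nz(2) r(2) k(1) 1 k(1) _ S(3)]) (use S rk 1 in linarith)+
    then show ?thesis using l_of_eq(4)[OF r(2), of k] 1 by auto
  next
    case 2
    then have "(real r + 1) / 2 \<le> real k \<and> real k = real_of_int (int k) \<and> real k < real r" by auto
    then have "v (\<Lambda> * \<Theta> / x) = ereal (real_of_int (int k) - 1) \<and> v (\<Theta> * \<Omega> / x^2) = ereal (- real r + 2 * real k - 1) \<and>
        v x < 0 \<and> v x \<le> v \<Theta> \<and> v \<Theta> \<le> 0 \<and> -1 \<le> v \<Omega> \<and> v \<Omega> \<le> 0"
      using C' by blast
    then have x0: "x \<noteq> 0" and S: "vv \<Lambda> + vv \<Theta> - vv x = real k - 1"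
      "vv \<Theta> + vv \<Omega> - 2 * vv x = - real r + 2 * real k - 1" "vv x < 0" "vv x \<le> vv \<Theta>" "vv \<Theta> \<le> 0"
      "- 1 \<le> vv \<Omega>" "vv \<Omega> \<le> 0"
      using nz by (auto simp: v_eq_ereal vv_divide vv_mult vv_power v_vv zero_ereal_def one_ereal_def)
    have rk: "real r + 1 \<le> 2 * real k" "real k + 1 \<le> real r" "1 \<le> real k" using 2 k by linarith+
    \<comment> \<open>k = r div 2 + 1 with r even is the case of the approximant that depends on x;
      for 2k = r + 1 both formulas for l agree.\<close>
    define l where "l = (if 2 * k = r + 2 then k else r + 1 - k)"
    have l: "1 \<le> l" "l \<le> r" "2 * l \<le> r + 2" using 2 k by (auto simp: l_def)
    have "\<exists>P Q0. delta r l x = Fract Q0 P \<and> comp_data r False \<Lambda> \<Theta> \<Omega> x P Q0"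
    \<comment> \<open>Again r - 1 - v(\<Lambda>) - v(x), rewritten by the two equations of the
      condition. The lower bound -1 <= v(\<Omega>) gives C <= k, as the self-improving estimate
      requires.\<close>
    proof (rule comp_data_large[OF nz(2) r(2) x0 l, where C = "real k - 1 - vv \<Omega>"])
      show "2 * l \<le> r + 1 \<Longrightarrow> (2 \<le> l \<longrightarrow> real l - 1 \<le> vv x + vv \<Lambda> - vv \<Omega>) \<and>
        (l < r \<longrightarrow> real r - vv \<Lambda> + vv \<Omega> \<le> real l \<or>
          real r - vv \<Lambda> + vv \<Omega> \<le> real l + vv \<Theta> - vv x \<and> real r - vv \<Lambda> + vv \<Omega> \<le> real k - 1 - vv \<Omega>)"
      proof -
        assume "2 * l \<le> r + 1"
        then have ne: "2 * k \<noteq> r + 2" by (auto simp: l_def split: if_splits)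
        then have rl: "real l = real r + 1 - real k" using 2 by (auto simp: l_def)
        show ?thesis
        proof (cases "2 * k = r + 1")
          case True
          then have "2 * real k = real r + 1" by linarith
          then show ?thesis using S rk rl by (intro conjI impI disjI1) linarith+
        next
          case False
          then have "real r + 3 \<le> 2 * real k" using 2 ne by linarith
          then show ?thesis using S rk rl by (intro conjI impI disjI2) linarith+
        qed
      qed
      show "2 * l = r + 2 \<Longrightarrow> vv x < 0 \<and>
        real r - vv \<Lambda> + vv \<Omega> \<le> vv \<Theta> - vv x + (real l - 1) \<and>
        real r - vv \<Lambda> + vv \<Omega> \<le> vv \<Theta> + real l \<and> real r - vv \<Lambda> + vv \<Omega> \<le> vv x + real l"
      proof -
        assume "2 * l = r + 2"
        then have "real l = real k" "real r = 2 * real k - 2" using 2 by (auto simp: l_def split: if_splits)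
        then show ?thesis using S rk by (intro conjI) linarith+
      qed
      fix \<sigma> \<tau> b assume *: "\<And>i. i < r \<Longrightarrow> vge (real i) (\<sigma> i)" "\<And>i. i < r \<Longrightarrow> vge (real i) (\<tau> i)"
        "log_rel r \<Theta> x \<sigma> \<tau>" "b < r"
      have "real (r - k) = real r - real k" using 2 by simp
      then show "vge (real k - 1 - vv \<Omega>) (\<sigma> b / x)"
        using S 2 by (intro log_rel_large[OF *(3) r(2) x0 _ nz(2) *(2) *(1) k(2) _ _ _ _ *(4)]) auto
    qed (use S rk in linarith)+
    moreover have "l_of r (ereal (real k)) = l"
      using l_of_eq(4,5)[OF r(2), of k] 2 by (auto simp: l_def)
    ultimately show ?thesis by simp
  next
    case 3
    then have "v (\<Lambda> * \<Theta> / x) = ereal (real r - 1) \<and> v (\<Theta> * \<Omega> / x^2) = ereal (real r - 1) \<and>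
        v x \<le> v \<Theta> \<and> v \<Theta> \<le> v x + ereal (real r) \<and> v \<Omega> \<le> 0 \<and> v \<Theta> \<le> 0"
      using C' by auto
    then have x0: "x \<noteq> 0" and S: "vv \<Lambda> + vv \<Theta> - vv x = real r - 1"
      "vv \<Theta> + vv \<Omega> - 2 * vv x = real r - 1" "vv x \<le> vv \<Theta>" "vv \<Theta> \<le> vv x + real r" "vv \<Omega> \<le> 0" "vv \<Theta> \<le> 0"
      using nz by (auto simp: v_eq_ereal vv_divide vv_mult vv_power v_vv zero_ereal_def one_ereal_def)
    \<comment> \<open>l is r + 1 - k = 1, except that for r = 2 one has k = r div 2 + 1 and hence l
      = 2.\<close>
    define l :: nat where "l = (if r = 2 then 2 else 1)"
    have l: "1 \<le> l" "l \<le> r" "2 * l \<le> r + 2" using r by (auto simp: l_def)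
    have "\<exists>P Q0. delta r l x = Fract Q0 P \<and> comp_data r False \<Lambda> \<Theta> \<Omega> x P Q0"
    \<comment> \<open>v(\<Omega>) has no lower bound here, so C may exceed r and the self-improving
      estimate is out of reach; the triangular recursion gives C directly.\<close>
    proof (rule comp_data_large[OF nz(2) r(2) x0 l, where C = "vv \<Theta> - 2 * vv x"])
      show "2 * l \<le> r + 1 \<Longrightarrow> (2 \<le> l \<longrightarrow> real l - 1 \<le> vv x + vv \<Lambda> - vv \<Omega>) \<and>
        (l < r \<longrightarrow> real r - vv \<Lambda> + vv \<Omega> \<le> real l \<or>
          real r - vv \<Lambda> + vv \<Omega> \<le> real l + vv \<Theta> - vv x \<and> real r - vv \<Lambda> + vv \<Omega> \<le> vv \<Theta> - 2 * vv x)"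
      proof -
        assume "2 * l \<le> r + 1"
        then have l1: "l = 1" by (auto simp: l_def split: if_splits)
        have "r \<noteq> 2" using l1 unfolding l_def by (cases "r = 2") simp_all
        then have r3: "3 \<le> real r" if "1 < r" using that by linarith
        have rl: "real l = 1" using l1 by simp
        show ?thesis
        proof (rule conjI; rule impI)
          assume "l < r"
          then have "3 \<le> real r" using r3 unfolding l1 by blast
          then have "real r - vv \<Lambda> + vv \<Omega> \<le> real l + vv \<Theta> - vv x \<and> real r - vv \<Lambda> + vv \<Omega> \<le> vv \<Theta> - 2 * vv x"
            using S rl by (intro conjI) linarith+
          then show "real r - vv \<Lambda> + vv \<Omega> \<le> real l \<or>
              real r - vv \<Lambda> + vv \<Omega> \<le> real l + vv \<Theta> - vv x \<and> real r - vv \<Lambda> + vv \<Omega> \<le> vv \<Theta> - 2 * vv x" ..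
        qed (use l1 in simp)
      qed
      show "2 * l = r + 2 \<Longrightarrow> vv x < 0 \<and>
        real r - vv \<Lambda> + vv \<Omega> \<le> vv \<Theta> - vv x + (real l - 1) \<and>
        real r - vv \<Lambda> + vv \<Omega> \<le> vv \<Theta> + real l \<and> real r - vv \<Lambda> + vv \<Omega> \<le> vv x + real l"
      proof -
        assume "2 * l = r + 2"
        then have "real l = 2" "real r = 2" using r by (auto simp: l_def split: if_splits)
        then show ?thesis using S by (intro conjI) linarith+
      qed
      fix \<sigma> \<tau> b assume *: "\<And>i. i < r \<Longrightarrow> vge (real i) (\<sigma> i)" "\<And>i. i < r \<Longrightarrow> vge (real i) (\<tau> i)"
        "log_rel r \<Theta> x \<sigma> \<tau>" "b < r"
      have "vge (vv \<Theta> - vv x) (\<sigma> b)"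
        using S *(4) by (intro log_rel_direct[OF *(3) r(2) x0 _ nz(2) *(2)]) auto
      then show "vge (vv \<Theta> - 2 * vv x) (\<sigma> b / x)" using x0 by (simp add: vge_divide)
    qed (use S in linarith)+
    moreover have "l_of r (ereal (real k)) = l"
      using l_of_eq(4,5)[OF r(2), of k] 3 r by (auto simp: l_def)
    ultimately show ?thesis by simp
  qed
qed

theorem comp_data_exists:
  assumes r: "1 \<le> r" "r < p" and k': "k' \<in> K_set r" and nz: "\<Lambda> \<noteq> 0" "\<Theta> \<noteq> 0" "\<Omega> \<noteq> 0"
    and C: "cond_C v r k' \<Lambda> \<Theta> \<Omega> x"
  shows "\<exists>P Q0. delta r (l_of r k') x = Fract Q0 P \<and> comp_data r (k' = \<infinity>) \<Lambda> \<Theta> \<Omega> x P Q0"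
proof (cases "k' = \<infinity>")
  case True
  then have "v \<Lambda> = -1 \<and> v (\<Theta> / \<Omega>) = ereal (real r + 1) \<and> v \<Theta> \<le> 0"
    using C by (simp add: cond_C_def)
  then have "vv \<Lambda> = - 1" "vv \<Theta> - vv \<Omega> = real r + 1" "vv \<Theta> \<le> 0"
    using nz by (auto simp: v_eq_ereal vv_divide v_vv zero_ereal_def one_ereal_def)
  from comp_data_l0[OF this nz(2) _ r(2), of True x] show ?thesis
    using True by (simp add: l_of_def)
next
  case False
  then obtain n where n: "k' = ereal (real n / 2)" "1 \<le> n" "n \<le> 2 * r + 1" using k' by (auto simp: K_set_def)
  have C': "cond_C_fin v (real r) (real n / 2) \<Lambda> \<Theta> \<Omega> x" using C False n by (simp add: cond_C_def)
  show ?thesis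
  proof (cases "even n")
    case True
    then obtain k where "n = 2 * k" by blast
    then show ?thesis using comp_data_int[OF r _ _ nz, of k x] n C' by simp
  next
    case False
    then obtain k where k: "n = 2 * k + 1" by (blast elim: oddE)
    then have "real n / 2 = real k + 1 / 2" by simp
    then show ?thesis using comp_data_half[OF r _ nz, of k x] n C' k by simp
  qed
qed

end

section \<open>The module\<close>

lemma nxt_prv: "j < f \<Longrightarrow> nxt f (prv f j) = j" and prv_nxt: "j < f \<Longrightarrow> prv f (nxt f j) = j"
  and prv_less: "0 < f \<Longrightarrow> prv f j < f" and nxt_less: "0 < f \<Longrightarrow> nxt f j < f"
proof -
  show "nxt f (prv f j) = j" if "j < f"
  proof -
    have "((j + (f - 1)) mod f + 1) mod f = (j + (f - 1) + 1) mod f" by (rule mod_add_left_eq)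
    then show ?thesis using that by (simp add: nxt_def prv_def)
  qed
  show "prv f (nxt f j) = j" if "j < f"
  proof -
    have "((j + 1) mod f + (f - 1)) mod f = (j + 1 + (f - 1)) mod f" by (rule mod_add_left_eq)
    then show ?thesis using that by (simp add: nxt_def prv_def)
  qed
qed (simp_all add: prv_def nxt_def)

locale breuil_module = unram + odd_padic +
  fixes r :: "nat \<Rightarrow> nat" and w :: nat and \<Lambda> \<Theta> x \<rho> \<theta>1 \<theta>2 :: "nat \<Rightarrow> 'a" and lam :: 'a
    and \<Delta> :: "nat \<Rightarrow> 'a poly fract" and L :: "nat \<Rightarrow> 'a proj_line" and P Q0 :: "nat \<Rightarrow> 'a poly"
  assumes r: "j < f \<Longrightarrow> 1 \<le> r j" "j < f \<Longrightarrow> r j \<le> w" and w: "w < p - 1"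
    and nz: "j < f \<Longrightarrow> \<Lambda> j \<noteq> 0" "j < f \<Longrightarrow> \<Theta> j \<noteq> 0" "j < f \<Longrightarrow> \<theta>1 j \<noteq> 0"
    and cd: "j < f \<Longrightarrow> comp_data (r j) (L j = Infty) (\<Lambda> j) (\<Theta> j) (\<Theta> (nxt f j)) (x j) (P j) (Q0 j)"
    and Delta: "j < f \<Longrightarrow> \<Delta> j = Fract (Q0 j) (P j)"
    and rho: "j < f \<Longrightarrow> of_nat p * \<rho> j - \<rho> (prv f j) = of_nat p * x j + value_at_m1 (\<Delta> (prv f j))"
    and L: "j < f \<Longrightarrow> L j = Infty \<or> L j = Fin (\<rho> j)"
    and lam: "j < f \<Longrightarrow> \<Lambda> j * \<theta>1 (nxt f j) = lam * \<theta>1 j"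
    and \<theta>2: "j < f \<Longrightarrow> \<theta>2 j = \<Theta> j * \<theta>1 j"
begin

section \<open>The generator E_1 at each component\<close>

definition h :: "nat \<Rightarrow> 'a fps" where "h j = expm1 (P j) (Q0 j)"

text \<open>Chosen so that \<Delta>(gamma - 1) = \<Delta>(-1) + gamma H, with H integral although
  \<Delta>(-1) need not be.\<close>

definition H :: "nat \<Rightarrow> 'a fps" where "H j = subst gamma (fps_shift 1 (h j))"

abbreviation Frob :: "'a fps \<Rightarrow> 'a fps" where "Frob F \<equiv> fps_compose F (fps_X ^ p)"

lemma f_pos: "0 < f" using f by simp

lemma P_unit: "j < f \<Longrightarrow> poly (P j) (-1) \<noteq> 0" and P_int: "j < f \<Longrightarrow> vge 0 (coeff (P j) i)"
  and P_vv: "j < f \<Longrightarrow> vv (poly (P j) (-1)) = 0"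
  and h_int: "j < f \<Longrightarrow> 1 \<le> n \<Longrightarrow> vge 0 (fps_nth (h j) n)"
  and x_h: "j < f \<Longrightarrow> vge (vv (\<Theta> (nxt f j)) - vv (\<Lambda> j)) (fps_nth (fps_const (x j) + h j) n)"
  and S: "j < f \<Longrightarrow> - 1 \<le> vv (\<Lambda> j)" "j < f \<Longrightarrow> vv (\<Theta> (nxt f j)) \<le> vv (\<Lambda> j) + vv (\<Theta> j)"
    "j < f \<Longrightarrow> vv (\<Theta> (nxt f j)) \<le> 0" "j < f \<Longrightarrow> vv (\<Theta> j) \<le> 0"
  using cd unfolding comp_data_def h_def by blast+

lemma laurent_Delta: "j < f \<Longrightarrow> laurent_at_m1 (\<Delta> j) = fps_to_fls (h j)"
  unfolding Delta h_def by (rule laurent_at_m1_Fract[OF P_unit])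

lemma Delta_in_E_T_Delta: "j < f \<Longrightarrow> \<Delta> j \<in> E_T_Delta v"
proof -
  assume j: "j < f"
  have "0 \<le> v (fps_nth (h j) (nat n))" if "n > 0" for n :: int
    using h_int[OF j, of "nat n"] that by (simp add: vge_def zero_ereal_def)
  then show ?thesis by (simp add: E_T_Delta_def laurent_Delta[OF j])
qed

lemma subst_gamma_Delta: "j < f \<Longrightarrow> subst_gamma p v (\<Delta> j) = subst gamma (h j)"
  by (simp add: subst_gamma_def subst_def laurent_Delta)

lemma value_Delta: "j < f \<Longrightarrow> value_at_m1 (\<Delta> j) = fps_nth (h j) 0"
  by (simp add: value_at_m1_def laurent_Delta)

lemma h_bounded: "j < f \<Longrightarrow> \<exists>C. \<forall>n. vge C (fps_nth (h j) n)"
proof -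
  assume j: "j < f"
  obtain C where C: "vge C (fps_nth (h j) 0)" using vge_exists by blast
  have "vge (min C 0) (fps_nth (h j) n)" for n
  proof (cases "n = 0")
    case True
    then show ?thesis using C by (auto elim: vge_mono)
  next
    case False
    then have "vge 0 (fps_nth (h j) n)" using h_int[OF j] by simp
    then show ?thesis by (rule vge_mono) simp
  qed
  then show ?thesis by blast
qed

lemma H_SB: "j < f \<Longrightarrow> H j \<in> SB 0"
  unfolding H_def using h_int by (intro subst_SB pd_nil_gamma) simp

lemma subst_h: "j < f \<Longrightarrow> subst gamma (h j) = fps_const (fps_nth (h j) 0) + gamma * H j"
  unfolding H_def using h_bounded[of j] subst_shift[OF pd_nil_gamma] by blast

lemma subst_x_h: "j < f \<Longrightarrow> subst gamma (fps_const (x j) + h j) = fps_const (x j) + subst gamma (h j)"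
proof -
  assume j: "j < f"
  have sh: "fps_shift 1 (fps_const (x j) + h j) = fps_shift 1 (h j)" by (rule fps_ext) simp
  show ?thesis
    using subst_shift[OF pd_nil_gamma x_h[OF j]] subst_h[OF j]
    unfolding sh H_def by (simp add: fps_const_add[symmetric] add.assoc del: fps_const_add)
qed

definition E1_tail :: "nat \<Rightarrow> 'a fps" where
  "E1_tail j = fps_const (1 / of_nat p) * (fps_const (\<rho> (prv f j)) + subst gamma (h (prv f j)))"

text \<open>The equation defining \<rho> turns (\<rho>_(j-1) + \<Delta>(-1))/p into \<rho>_j - x_j.
  Up to a multiple of gamma, E_1 is therefore eta_1 + (\<rho>_j - x_j) eta_2, and comparison with
  the slope \<rho>_j of the filtration leaves just x_j in the congruence.\<close>

lemma E1_tail_eq: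
  assumes j: "j < f"
  shows "E1_tail j = fps_const (\<rho> j - x j) + fps_const (1 / of_nat p) * (gamma * H (prv f j))"
proof -
  have pj: "prv f j < f" by (rule prv_less[OF f_pos])
  have "\<rho> j - x j = 1 / of_nat p * (\<rho> (prv f j) + fps_nth (h (prv f j)) 0)"
    using rho[OF j] value_Delta[OF pj] by (simp add: field_simps)
  then show ?thesis
    unfolding E1_tail_def subst_h[OF pj]
    by (simp add: distrib_left fps_const_add[symmetric] add.assoc[symmetric] del: fps_const_add)
qed

lemma E1_tail_SB: "j < f \<Longrightarrow> \<exists>B. E1_tail j \<in> SB B"
proof -
  assume j: "j < f"
  have pj: "prv f j < f" by (rule prv_less[OF f_pos])
  obtain C where "vge C (\<rho> j - x j)" using vge_exists by blast
  moreover have "fps_const (1 / of_nat p) * (gamma * H (prv f j)) \<in> SB (-1)"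
    using pd_nil_SB[OF pd_nil_gamma, of 1] H_SB[OF pj]
    by (intro SB_mult0 SB_const) (auto simp: vge_iff vv_divide intro: SB_mult0)
  ultimately have "E1_tail j \<in> SB (min C (-1))"
    unfolding E1_tail_eq[OF j] by (intro SB_add SB_const) (auto elim: vge_mono SB_mono)
  then show ?thesis by blast
qed

text \<open>Differentiating a series in gamma gains a factor p, which cancels the denominator in
  E_1; the constant term, of unknown valuation, drops out.\<close>

lemma E1_tail_X_deriv: "j < f \<Longrightarrow> fps_X * fps_deriv (E1_tail j) \<in> SB 0"
proof -
  assume j: "j < f"
  have pj: "prv f j < f" by (rule prv_less[OF f_pos])
  obtain C where C: "\<forall>n. vge C (fps_nth (h (prv f j)) n)" using h_bounded[OF pj] by blast
  have "fps_X * fps_deriv (subst gamma (h (prv f j))) \<in> SB (0 + 1)"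
    using C h_int[OF pj] by (intro subst_deriv_SB[OF pd_nil_gamma gamma_X_deriv, of C]) auto
  then have "fps_const (1 / of_nat p) * (fps_X * fps_deriv (subst gamma (h (prv f j)))) \<in> SB (-1 + (0 + 1))"
    by (intro SB_mult[OF SB_const]) (auto simp: vge_iff vv_divide)
  moreover have eq: "fps_X * fps_deriv (E1_tail j) = fps_const (1 / of_nat p) * (fps_X * fps_deriv (subst gamma (h (prv f j))))"
    by (simp add: E1_tail_def mult.left_commute)
  ultimately show ?thesis unfolding eq by simp
qed

section \<open>The module structure and the monodromy operator\<close>

abbreviation "E1 \<equiv> E1_gen p f v \<theta>1 \<rho> \<Delta>"
abbreviation "E2 \<equiv> E2_gen f \<theta>2"
abbreviation "MM \<equiv> M_mod p f v K frob \<theta>1 \<theta>2 \<rho> \<Delta>"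

definition lin_comb :: "(nat \<Rightarrow> 'a fps) \<Rightarrow> (nat \<Rightarrow> 'a fps) \<Rightarrow> 'a calDmod" where
  "lin_comb s t = smul s E1 + smul t E2"

lemma lin_comb_components:
  "fst (lin_comb s t) j = (if j < f then s j * fps_const (\<theta>1 j) else 0)"
  "snd (lin_comb s t) j = (if j < f then s j * (fps_const (\<theta>1 j) * E1_tail j) + t j * fps_const (\<theta>2 j) else 0)"
  using prv_less[OF f_pos, of j]
  by (auto simp: lin_comb_def smul_def E1_gen_def E2_gen_def tup_def E1_tail_def subst_gamma_Delta mult.assoc)

lemma lin_comb_eqI:
  assumes "\<And>j. j < f \<Longrightarrow> fst y j = s j * fps_const (\<theta>1 j)"
    "\<And>j. j < f \<Longrightarrow> snd y j = s j * (fps_const (\<theta>1 j) * E1_tail j) + t j * fps_const (\<theta>2 j)"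
    "\<And>j. j \<ge> f \<Longrightarrow> fst y j = 0" "\<And>j. j \<ge> f \<Longrightarrow> snd y j = 0"
  shows "y = lin_comb s t"
proof (rule prod_eqI)
  show "fst y = fst (lin_comb s t)" by (rule ext) (use assms in \<open>simp add: lin_comb_components not_less\<close>)
  show "snd y = snd (lin_comb s t)" by (rule ext) (use assms in \<open>simp add: lin_comb_components not_less\<close>)
qed

lemma MM_iff: "y \<in> MM \<longleftrightarrow> (\<exists>s\<in>SO. \<exists>t\<in>SO. y = lin_comb s t)"
  by (auto simp: M_mod_def lin_comb_def)

lemma \<theta>2_nz: "j < f \<Longrightarrow> \<theta>2 j \<noteq> 0" using nz \<theta>2 by simp

lemma SO_tup: "(\<And>j. j < f \<Longrightarrow> F j \<in> SB 0) \<Longrightarrow> tup f F \<in> SO"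
  by (simp add: SO_iff tup_def)

lemma lin_comb_tup: "lin_comb (tup f s) (tup f t) = lin_comb s t"
  by (rule lin_comb_eqI) (auto simp: lin_comb_components tup_def)

lemma lin_comb_in_MM:
  "(\<And>j. j < f \<Longrightarrow> s j \<in> SB 0) \<Longrightarrow> (\<And>j. j < f \<Longrightarrow> t j \<in> SB 0) \<Longrightarrow> lin_comb s t \<in> MM"
  unfolding MM_iff using SO_tup lin_comb_tup by metis

lemma lin_comb_inject:
  assumes "lin_comb s t = lin_comb s' t'" "j < f"
  shows "s j = s' j" "t j = t' j"
proof -
  have e: "fps_const c \<noteq> 0" if "c \<noteq> 0" for c :: 'a using that by simp
  have "s j * fps_const (\<theta>1 j) = s' j * fps_const (\<theta>1 j)"
    using arg_cong[OF assms(1), of "\<lambda>y. fst y j"] assms(2) by (simp add: lin_comb_components)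
  then show s: "s j = s' j" using e[OF nz(3)[OF assms(2)]] by (simp only: mult_cancel_right) simp
  have "t j * fps_const (\<theta>2 j) = t' j * fps_const (\<theta>2 j)"
    using arg_cong[OF assms(1), of "\<lambda>y. snd y j"] assms(2) s by (simp add: lin_comb_components)
  then show "t j = t' j" using e[OF \<theta>2_nz[OF assms(2)]] by (simp only: mult_cancel_right) simp
qed

lemma lin_comb_add: "lin_comb s t + lin_comb s' t' = lin_comb (s + s') (t + t')"
  by (rule lin_comb_eqI) (auto simp: lin_comb_components algebra_simps)

lemma smul_lin_comb: "smul c (lin_comb s t) = lin_comb (\<lambda>j. c j * s j) (\<lambda>j. c j * t j)"
  by (rule lin_comb_eqI) (auto simp: lin_comb_components smul_def algebra_simps)

lemma MM_calD: "MM \<subseteq> calD p f v K frob"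
proof
  fix y assume "y \<in> MM"
  then obtain s t where st: "s \<in> SO" "t \<in> SO" "y = lin_comb s t" by (auto simp: MM_iff)
  have "\<exists>B. fst y j \<in> SB B" "\<exists>B. snd y j \<in> SB B" if j: "j < f" for j
  proof -
    have stj: "s j \<in> SB 0" "t j \<in> SB 0" using st j by (auto simp: SO_iff)
    obtain C D where C: "vge C (\<theta>1 j)" and D: "vge D (\<theta>2 j)" using vge_exists by blast
    obtain B where B: "E1_tail j \<in> SB B" using E1_tail_SB[OF j] by blast
    show "\<exists>B. fst y j \<in> SB B" using st(3) j SB_0mult[OF stj(1) SB_const[OF C]] by (auto simp: lin_comb_components)
    have "s j * (fps_const (\<theta>1 j) * E1_tail j) \<in> SB (min (C + B) D)"
      using SB_0mult[OF stj(1) SB_mult[OF SB_const[OF C] B]] by (rule SB_mono) simp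
    moreover have "t j * fps_const (\<theta>2 j) \<in> SB (min (C + B) D)"
      using SB_0mult[OF stj(2) SB_const[OF D]] by (rule SB_mono) simp
    ultimately show "\<exists>B. snd y j \<in> SB B" using st(3) j SB_add by (auto simp: lin_comb_components)
  qed
  then show "y \<in> calD p f v K frob"
    by (auto simp: calD_def mem_Times_iff SE_iff st(3)) (simp_all add: lin_comb_components)
qed

lemma MM_submodule: "SO_submodule SO MM"
  unfolding SO_submodule_def
proof (intro conjI ballI)
  have "lin_comb 0 0 = 0" by (rule lin_comb_eqI[symmetric]) auto
  then show "0 \<in> MM" using lin_comb_in_MM[of 0 0] by simp
next
  fix y z assume "y \<in> MM" "z \<in> MM"
  then show "y + z \<in> MM"
    by (auto simp: MM_iff lin_comb_add) (metis S_O.add)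
next
  fix c y assume c: "c \<in> SO" and "y \<in> MM"
  then obtain s t where "s \<in> SO" "t \<in> SO" "y = lin_comb s t" by (auto simp: MM_iff)
  then show "smul c y \<in> MM"
    using c by (auto simp: smul_lin_comb SO_iff intro!: lin_comb_in_MM SB_mult0)
qed

lemma MM_free: "free_finite_rank SO MM"
  unfolding free_finite_rank_def
proof (intro exI conjI ballI allI impI)
  let ?b = "\<lambda>i::nat. if i = 0 then E1 else E2"
  have sum2: "(\<Sum>i<2. smul (c i) (?b i)) = lin_comb (c 0) (c 1)" for c
    by (simp add: lin_comb_def numeral_2_eq_2)
  show "?b i \<in> MM" if "i < 2" for i
  proof -
    have "smul (\<lambda>_. 1) E1 + smul 0 E2 = E1" "smul 0 E1 + smul (\<lambda>_. 1) E2 = E2"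
      by (auto simp: smul_def prod_eq_iff)
    then have "lin_comb (\<lambda>_. 1) 0 = E1" "lin_comb 0 (\<lambda>_. 1) = E2" by (simp_all add: lin_comb_def)
    then show ?thesis using lin_comb_in_MM[of "\<lambda>_. 1" 0] lin_comb_in_MM[of 0 "\<lambda>_. 1"] SB_one by auto
  qed
  fix y assume "y \<in> MM"
  then obtain s t where st: "s \<in> SO" "t \<in> SO" "y = lin_comb s t" by (auto simp: MM_iff)
  show "\<exists>!c. (\<forall>i<2. c i \<in> SO) \<and> (\<forall>i\<ge>2. c i = 0) \<and> y = (\<Sum>i<2. smul (c i) (?b i))"
  proof (rule ex1I)
    let ?c = "\<lambda>i::nat. if i = 0 then s else if i = 1 then t else 0"
    show "(\<forall>i<2. ?c i \<in> SO) \<and> (\<forall>i\<ge>2. ?c i = 0) \<and> y = (\<Sum>i<2. smul (?c i) (?b i))"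
      unfolding sum2 using st by auto
    fix c assume c: "(\<forall>i<2. c i \<in> SO) \<and> (\<forall>i\<ge>2. c i = 0) \<and> y = (\<Sum>i<2. smul (c i) (?b i))"
    then have "lin_comb s t = lin_comb (c 0) (c 1)" unfolding sum2 using st(3) by simp
    note inj = lin_comb_inject[OF this]
    have "c 0 = s" "c 1 = t"
    proof -
      have "c 0 \<in> SO" "c 1 \<in> SO" using c by auto
      then show "c 0 = s" "c 1 = t" using inj st by (auto simp: SO_iff not_less intro!: ext) (metis not_less)+
    qed
    then show "c = ?c" using c by (auto intro!: ext)
  qed
qed

lemma MM_isogeny: "{y. \<exists>n. smul (\<lambda>j. of_nat (p ^ n)) y \<in> MM} = calD p f v K frob"
proof (intro subset_antisym subsetI)
  fix y assume "y \<in> {y. \<exists>n. smul (\<lambda>j. of_nat (p ^ n)) y \<in> MM}"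
  then obtain n where "smul (\<lambda>j. of_nat (p ^ n)) y \<in> calD p f v K frob" using MM_calD by blast
  then have "(\<forall>j<f. \<exists>B. of_nat (p ^ n) * fst y j \<in> SB B) \<and> (\<forall>j\<ge>f. of_nat (p ^ n) * fst y j = 0)"
    "(\<forall>j<f. \<exists>B. of_nat (p ^ n) * snd y j \<in> SB B) \<and> (\<forall>j\<ge>f. of_nat (p ^ n) * snd y j = 0)"
    by (auto simp: calD_def smul_def SE_iff simp del: of_nat_power)
  then show "y \<in> calD p f v K frob"
    unfolding SB_p_power_iff by (auto simp: calD_def mem_Times_iff SE_iff)
next
  fix y assume "y \<in> calD p f v K frob"
  then have y: "fst y \<in> S_E p f v K frob" "snd y \<in> S_E p f v K frob" by (auto simp: calD_def mem_Times_iff)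
  define s where "s = (\<lambda>j. fst y j * fps_const (inverse (\<theta>1 j)))"
  define t where "t = (\<lambda>j. (snd y j - fst y j * E1_tail j) * fps_const (inverse (\<theta>2 j)))"
  have ymk: "y = lin_comb s t"
  proof (rule lin_comb_eqI)
    fix j assume j: "j < f"
    have c: "fps_const (inverse c) * fps_const c = 1" if "c \<noteq> 0" for c :: 'a using that by simp
    show 1: "fst y j = s j * fps_const (\<theta>1 j)"
      using c[OF nz(3)[OF j]] by (simp add: s_def mult.assoc del: fps_const_mult)
    have "t j * fps_const (\<theta>2 j) = snd y j - fst y j * E1_tail j"
      using c[OF \<theta>2_nz[OF j]] by (simp add: t_def mult.assoc del: fps_const_mult)
    then show "snd y j = s j * (fps_const (\<theta>1 j) * E1_tail j) + t j * fps_const (\<theta>2 j)"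
      using 1 by (simp add: mult.assoc[symmetric])
  qed (use y in \<open>auto simp: SE_iff\<close>)
  have "\<exists>B. s j \<in> SB B \<and> t j \<in> SB B" if j: "j < f" for j
  proof -
    obtain A B where A: "fst y j \<in> SB A" and B: "snd y j \<in> SB B" using y j unfolding SE_iff by blast
    obtain C D where C: "vge C (inverse (\<theta>1 j))" and D: "vge D (inverse (\<theta>2 j))" using vge_exists by blast
    obtain E where E: "E1_tail j \<in> SB E" using E1_tail_SB[OF j] by blast
    have "snd y j - fst y j * E1_tail j \<in> SB (min B (A + E))"
      using SB_mono[OF B] SB_mono[OF SB_mult[OF A E]] by (intro SB_diff) auto
    then have "t j \<in> SB (min B (A + E) + D)" unfolding t_def by (intro SB_mult SB_const D)
    moreover have "s j \<in> SB (A + C)" unfolding s_def by (intro SB_mult SB_const A C)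
    ultimately show ?thesis
      by (intro exI[of _ "min (min B (A + E) + D) (A + C)"]) (auto elim: SB_mono)
  qed
  then have "tup f s \<in> S_E p f v K frob" "tup f t \<in> S_E p f v K frob"
    unfolding SE_iff by (auto simp: tup_def)
  then obtain n m where nm: "(\<lambda>j. of_nat (p ^ n) * tup f s j) \<in> SO" "(\<lambda>j. of_nat (p ^ m) * tup f t j) \<in> SO"
    unfolding S_E_def by blast
  have "lin_comb (\<lambda>j. of_nat (p ^ (n + m)) * s j) (\<lambda>j. of_nat (p ^ (n + m)) * t j) \<in> MM"
  proof (rule lin_comb_in_MM)
    fix j assume j: "j < f"
    then have "of_nat (p ^ n) * s j \<in> SB 0" "of_nat (p ^ m) * t j \<in> SB 0"
      using nm by (auto simp: SO_iff tup_def simp del: of_nat_power)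
    then show "of_nat (p ^ (n + m)) * s j \<in> SB 0" "of_nat (p ^ (n + m)) * t j \<in> SB 0"
      unfolding SB_p_power_iff by (auto elim: SB_mono)
  qed
  then show "y \<in> {y. \<exists>n. smul (\<lambda>j. of_nat (p ^ n)) y \<in> MM}"
    unfolding ymk mem_Collect_eq smul_lin_comb by blast
qed

lemma MM_N_stable:
  assumes "y \<in> MM"
  shows "N_calD f y \<in> MM"
proof -
  obtain s t where st: "s \<in> SO" "t \<in> SO" "y = lin_comb s t" using assms by (auto simp: MM_iff)
  define a where "a = (\<lambda>j. - (fps_X * fps_deriv (s j)))"
  \<comment> \<open>N E_1 is 1/\<Theta> times \<open>1 - fps_X * fps_deriv (E1_tail j)\<close> times
    E_2, since \<theta>2 = \<Theta> \<theta>1; the factor 1/\<Theta> is integral because v(\<Theta>)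
    <= 0.\<close>
  define b where "b = (\<lambda>j. - (fps_X * fps_deriv (t j)) +
    fps_const (1 / \<Theta> j) * (s j * (1 - fps_X * fps_deriv (E1_tail j))))"
  have "N_calD f y = lin_comb a b"
  proof (rule lin_comb_eqI)
    fix j assume j: "j < f"
    show "fst (N_calD f y) j = a j * fps_const (\<theta>1 j)"
      using j by (simp add: N_calD_components st(3) lin_comb_components a_def mult.assoc)
    have c: "fps_const (1 / \<Theta> j) * fps_const (\<theta>2 j) = fps_const (\<theta>1 j)"
      using nz(2)[OF j] \<theta>2[OF j] by simp
    have "fps_const (1 / \<Theta> j) * (s j * (1 - fps_X * fps_deriv (E1_tail j))) * fps_const (\<theta>2 j) =
      fps_const (\<theta>1 j) * (s j * (1 - fps_X * fps_deriv (E1_tail j)))"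
      by (simp only: c[symmetric] mult_ac)
    then show "snd (N_calD f y) j = a j * (fps_const (\<theta>1 j) * E1_tail j) + b j * fps_const (\<theta>2 j)"
      using j by (simp add: N_calD_components st(3) lin_comb_components a_def b_def algebra_simps)
  qed (auto simp: N_calD_def tens_def N_S_def eta1_def eta2_def N_D_def tup_def st(3) lin_comb_components)
  moreover have "a j \<in> SB 0" "b j \<in> SB 0" if j: "j < f" for j
  proof -
    have stj: "s j \<in> SB 0" "t j \<in> SB 0" using st j by (auto simp: SO_iff)
    show "a j \<in> SB 0" unfolding a_def by (intro SB_uminus SB_X_deriv stj)
    have "vge 0 (1 / \<Theta> j)" using nz(2)[OF j] S(4)[OF j] by (simp add: vge_iff vv_divide)
    then show "b j \<in> SB 0" unfolding b_def
      by (intro SB_add SB_uminus SB_X_deriv stj SB_mult0 SB_const SB_diff SB_one E1_tail_X_deriv j)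
  qed
  ultimately show ?thesis by (simp add: lin_comb_in_MM)
qed

subsection \<open>Frobenius\<close>

definition Frob_tail :: "nat \<Rightarrow> 'a fps" where
  "Frob_tail j = fps_const (1 / of_nat p) * (Frob gamma * Frob (H (prv f j)))"

text \<open>The index j is that of the source: \<open>phi_coeff1\<close> and
  \<open>phi_coeff2\<close> are the coordinates of the image at e_(j+1).\<close>

definition phi_coeff1 :: "(nat \<Rightarrow> 'a fps) \<Rightarrow> nat \<Rightarrow> 'a fps" where
  "phi_coeff1 s j = fps_const (of_nat p * \<Lambda> j) * Frob (s j)"

definition phi_coeff2 :: "(nat \<Rightarrow> 'a fps) \<Rightarrow> (nat \<Rightarrow> 'a fps) \<Rightarrow> nat \<Rightarrow> 'a fps" where
  "phi_coeff2 s t j = fps_const (\<Lambda> j / \<Theta> (nxt f j)) *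
     (fps_const (\<Theta> j) * Frob (t j) - Frob (s j) * (fps_const (x j) + subst gamma (h j)) + Frob (s j) * Frob_tail j)"

text \<open>Frobenius makes gamma divisible by p^(p-1); after division by p there remains p^(p-2),
  and p >= 3.\<close>

lemma Frob_tail_SB: "Frob_tail j \<in> SB 1"
proof -
  have pj: "prv f j < f" by (rule prv_less[OF f_pos])
  have "Frob_tail j \<in> SB (- 1 + ((real p - 1) + 0))"
    unfolding Frob_tail_def by (intro SB_mult SB_const gamma_frobenius SB_frobenius H_SB pj) (auto simp: vge_iff vv_divide)
  then show ?thesis by (rule SB_mono) (use p_ge_3 in simp)
qed

lemma Frob_const: "Frob (fps_const c) = fps_const c" by simp

text \<open>Frobenius turns the tail at i into \<rho>_i - x_i plus a small term, while p times the
  tail at the next index is \<rho>_i + \<Delta>(gamma - 1). Subtracting the E_1-part cancels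
  \<rho>_i and leaves the combination of \<phi>(t) and \<phi>(s) in
  \<open>phi_coeff2\<close>.\<close>

lemma phi_lin_comb: "phi_calD p f lam (lin_comb s t) = lin_comb (\<lambda>j. phi_coeff1 s (prv f j)) (\<lambda>j. phi_coeff2 s t (prv f j))"
proof (rule lin_comb_eqI)
  fix j assume j: "j < f"
  define i where "i = prv f j"
  have i: "i < f" "nxt f i = j" using prv_less[OF f_pos] nxt_prv[OF j] by (auto simp: i_def)
  have X0: "fps_nth (fps_X ^ p :: 'a fps) 0 = 0" by (simp add: fps_X_power_nth)
  note Fr = fps_compose_mult_distrib[OF X0] fps_compose_add_distrib Frob_const
  have phi: "fst (phi_calD p f lam y) j = Frob (fst y i) * fps_const (of_nat p * lam)"
    "snd (phi_calD p f lam y) j = Frob (snd y i) * fps_const lam" for y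
    using j i by (auto simp: phi_calD_def tens_def phi_S_def phi_D_def eta1_def eta2_def tup_def i_def)
  have l1: "\<Lambda> i * \<theta>1 j = lam * \<theta>1 i" using lam[OF i(1)] i(2) by simp
  have c1: "fps_const (\<theta>1 i) * fps_const (of_nat p * lam) = fps_const (of_nat p * \<Lambda> i) * fps_const (\<theta>1 j)"
    using l1 by (simp add: mult_ac)
  show "fst (phi_calD p f lam (lin_comb s t)) j = phi_coeff1 s (prv f j) * fps_const (\<theta>1 j)"
    unfolding phi using i j c1
    by (simp add: lin_comb_components Fr phi_coeff1_def i_def[symmetric] mult.assoc mult.left_commute[of _ "Frob _"] del: fps_const_mult)
  let ?k = "fps_const (lam * \<theta>1 i)"
  have e: "Frob (E1_tail i) = fps_const (\<rho> i - x i) + Frob_tail i"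
    unfolding E1_tail_eq[OF i(1)] Frob_tail_def Fr ..
  have pe: "fps_const (of_nat p) * E1_tail j = fps_const (\<rho> i) + subst gamma (h i)"
    unfolding E1_tail_def i_def[symmetric] mult.assoc[symmetric] fps_const_mult by simp
  have k2: "fps_const (\<Lambda> i / \<Theta> j) * fps_const (\<theta>2 j) = ?k"
    using l1 \<theta>2[OF j] nz(2)[OF j] by simp
  have k3: "fps_const (\<theta>2 i) * fps_const lam = ?k * fps_const (\<Theta> i)"
    using \<theta>2[OF i(1)] by (simp add: mult_ac)
  have k4: "fps_const (of_nat p * \<Lambda> i) * fps_const (\<theta>1 j) = ?k * fps_const (of_nat p)"
    using l1 by (simp add: mult_ac)
  have k5: "fps_const (\<theta>1 i) * fps_const lam = ?k" by (simp add: mult_ac)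
  have "snd (phi_calD p f lam (lin_comb s t)) j =
     Frob (s i) * (fps_const (\<theta>1 i) * Frob (E1_tail i)) * fps_const lam + Frob (t i) * fps_const (\<theta>2 i) * fps_const lam"
    unfolding phi using i by (simp add: lin_comb_components Fr distrib_right)
  also have "\<dots> = ?k * (Frob (s i) * Frob (E1_tail i) + fps_const (\<Theta> i) * Frob (t i))"
  proof -
    have "Frob (s i) * (fps_const (\<theta>1 i) * Frob (E1_tail i)) * fps_const lam =
        (fps_const (\<theta>1 i) * fps_const lam) * (Frob (s i) * Frob (E1_tail i))" by (simp only: mult_ac)
    moreover have "Frob (t i) * fps_const (\<theta>2 i) * fps_const lam = (fps_const (\<theta>2 i) * fps_const lam) * Frob (t i)"
      by (simp only: mult_ac)
    ultimately show ?thesis unfolding k3 k5 by (simp only: distrib_left mult_ac)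
  qed
  also have "\<dots> = ?k * (Frob (s i) * (fps_const (\<rho> i) + subst gamma (h i)) +
     (fps_const (\<Theta> i) * Frob (t i) - Frob (s i) * (fps_const (x i) + subst gamma (h i)) + Frob (s i) * Frob_tail i))"
    unfolding e fps_const_sub[symmetric] by (simp add: algebra_simps del: fps_const_sub fps_const_mult)
  also have "\<dots> = phi_coeff1 s i * (fps_const (\<theta>1 j) * E1_tail j) + phi_coeff2 s t i * fps_const (\<theta>2 j)"
  proof -
    have "phi_coeff1 s i * (fps_const (\<theta>1 j) * E1_tail j) = (fps_const (of_nat p * \<Lambda> i) * fps_const (\<theta>1 j)) * (Frob (s i) * E1_tail j)"
      unfolding phi_coeff1_def by (simp only: mult_ac)
    also have "\<dots> = ?k * (Frob (s i) * (fps_const (of_nat p) * E1_tail j))"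
      unfolding k4 by (simp only: mult_ac)
    finally have 1: "phi_coeff1 s i * (fps_const (\<theta>1 j) * E1_tail j) = ?k * (Frob (s i) * (fps_const (\<rho> i) + subst gamma (h i)))"
      unfolding pe .
    have "phi_coeff2 s t i * fps_const (\<theta>2 j) = (fps_const (\<Lambda> i / \<Theta> j) * fps_const (\<theta>2 j)) *
      (fps_const (\<Theta> i) * Frob (t i) - Frob (s i) * (fps_const (x i) + subst gamma (h i)) + Frob (s i) * Frob_tail i)"
      unfolding phi_coeff2_def i(2) by (simp only: mult_ac)
    then show ?thesis unfolding 1 k2 by (simp only: distrib_left)
  qed
  finally show "snd (phi_calD p f lam (lin_comb s t)) j =
      phi_coeff1 s (prv f j) * (fps_const (\<theta>1 j) * E1_tail j) + phi_coeff2 s t (prv f j) * fps_const (\<theta>2 j)"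
    by (simp only: i_def)
qed (auto simp: phi_calD_def tens_def phi_D_def eta1_def eta2_def tup_def)

lemma MM_phi_stable:
  assumes "y \<in> MM"
  shows "phi_calD p f lam y \<in> MM"
proof -
  obtain s t where st: "s \<in> SO" "t \<in> SO" "y = lin_comb s t" using assms by (auto simp: MM_iff)
  have "phi_coeff1 s i \<in> SB 0" "phi_coeff2 s t i \<in> SB 0" if i: "i < f" for i
  proof -
    have sti: "Frob (s i) \<in> SB 0" "Frob (t i) \<in> SB 0" using st i by (auto simp: SO_iff intro!: SB_frobenius)
    have ni: "nxt f i < f" by (rule nxt_less[OF f_pos])
    have nzi: "\<Lambda> i \<noteq> 0" "\<Theta> i \<noteq> 0" "\<Theta> (nxt f i) \<noteq> 0" using nz i ni by auto
    show "phi_coeff1 s i \<in> SB 0" unfolding phi_coeff1_def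
      using S(1)[OF i] nzi by (intro SB_mult0 SB_const sti) (simp add: vge_iff vv_mult)
    let ?B = "vv (\<Theta> (nxt f i)) - vv (\<Lambda> i)"
    have "fps_const (\<Theta> i) * Frob (t i) \<in> SB (vv (\<Theta> i))"
      using nzi by (intro SB_mult0 SB_const sti) (simp add: vge_iff)
    then have 1: "fps_const (\<Theta> i) * Frob (t i) \<in> SB ?B" using S(2)[OF i] by (elim SB_mono) simp
    have "fps_const (x i) + subst gamma (h i) \<in> SB ?B"
      unfolding subst_x_h[OF i, symmetric] by (rule subst_SB[OF pd_nil_gamma x_h[OF i]])
    then have 2: "Frob (s i) * (fps_const (x i) + subst gamma (h i)) \<in> SB ?B" by (rule SB_0mult[OF sti(1)])
    have 3: "Frob (s i) * Frob_tail i \<in> SB ?B"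
      using SB_0mult[OF sti(1) Frob_tail_SB[of i]] S(1,3)[OF i] by (elim SB_mono) simp
    have "phi_coeff2 s t i \<in> SB (- ?B + ?B)"
      unfolding phi_coeff2_def using nzi
      by (intro SB_mult[OF SB_const] SB_add SB_diff 1 2 3) (simp add: vge_iff vv_divide)
    then show "phi_coeff2 s t i \<in> SB 0" by simp
  qed
  then show ?thesis unfolding st(3) phi_lin_comb using prv_less[OF f_pos] by (intro lin_comb_in_MM) auto
qed



section \<open>Divisibility of Frobenius on the filtration\<close>

text \<open>The part of \<open>E1\<close> that comes from \<open>\<Delta>\<close> is, up to a constant, divisible by $(u-p)^p$;
  hence it does not contribute in degrees below \<open>w\<close>.\<close>

lemma Fil_relations:
  assumes y: "lin_comb s t \<in> Fil_calD p f v K frob r L w" and i: "i < f"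
    and st: "s i \<in> SB 0" "t i \<in> SB 0"
  defines "\<sigma> \<equiv> \<lambda>n. taylor n (dilate (s i))" and "\<tau> \<equiv> \<lambda>n. taylor n (dilate (t i))"
  shows "if L i = Infty then \<forall>n<w. \<sigma> n = 0 else log_rel w (\<Theta> i) (x i) \<sigma> \<tau>"
    and "n < w - r i \<Longrightarrow> \<sigma> n = 0 \<and> \<tau> n = 0"
proof -
  have pi: "prv f i < f" by (rule prv_less[OF f_pos])
  have wp: "w < p" using w by simp
  have vn: "vnull (fps_nth (dilate F))" if "F \<in> SB B" for F B using dilate_null[OF that] .
  have A: "fst (lin_comb s t) i = fps_const (\<theta>1 i) * s i"
    using i by (simp add: lin_comb_components mult.commute)
  have trA: "dilate (fst (lin_comb s t) i) = fps_const (\<theta>1 i) * dilate (s i)" unfolding A dilate_mult by simp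
  define c where "c = \<theta>1 i * (1 / of_nat p * (1 / of_nat p * of_nat p ^ p))"
  \<comment> \<open>In T this is p^(p-1) T^p, so the whole contribution of H has no Taylor
    coefficient below p > w.\<close>
  have trgp: "dilate gamma = fps_const (1 / of_nat p * of_nat p ^ p) * (fps_X - 1) ^ p"
  proof -
    have "dilate gamma = fps_const (1 / of_nat p) * (fps_const (of_nat p) * (fps_X - 1)) ^ p"
      by (simp add: gam_def dilate_mult dilate_power dilate_X_p)
    also have "\<dots> = fps_const (1 / of_nat p) * fps_const (of_nat p ^ p) * (fps_X - 1) ^ p"
      by (simp only: power_mult_distrib fps_const_power mult.assoc)
    finally show ?thesis by (simp only: fps_const_mult)
  qed
  have B: "snd (lin_comb s t) i = fps_const (\<theta>1 i * (\<rho> i - x i)) * s i +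
      (fps_const (\<theta>1 i * (1 / of_nat p)) * (gamma * (s i * H (prv f i))) + fps_const (\<theta>2 i) * t i)"
    using i unfolding lin_comb_components E1_tail_eq[OF i]
    by (simp only: if_True fps_const_mult[symmetric]) (simp add: algebra_simps del: fps_const_mult)
  have trB: "dilate (snd (lin_comb s t) i) = fps_const (\<theta>1 i * (\<rho> i - x i)) * dilate (s i) +
      (fps_const c * ((fps_X - 1) ^ p * dilate (s i * H (prv f i))) + fps_const (\<theta>2 i) * dilate (t i))"
  proof -
    have "fps_const (\<theta>1 i * (1 / of_nat p)) * (fps_const (1 / of_nat p * of_nat p ^ p) * (fps_X - 1) ^ p * dilate (s i * H (prv f i)))
      = fps_const c * ((fps_X - 1) ^ p * dilate (s i * H (prv f i)))"
      unfolding c_def by (simp only: fps_const_mult[symmetric] mult_ac)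
    then show ?thesis unfolding B dilate_add dilate_mult[of "fps_const _"] dilate_mult[of gamma] trgp dilate_const by simp
  qed
  have sH: "s i * H (prv f i) \<in> SB 0" using st H_SB[OF pi] by (simp add: SB_mult0)
  have nX: "vnull (fps_nth ((fps_X - 1) ^ k * dilate (s i * H (prv f i))))" for k
  proof (induction k)
    case (Suc k)
    then show ?case using vnull_X1_mult by (simp add: mult.assoc)
  qed (simp add: vn[OF sH])
  have nc: "vnull (fps_nth (fps_const a * F))" if "vnull (fps_nth F)" for a F
  proof -
    have "fps_nth (fps_const a * F) = (\<lambda>n. a * fps_nth F n)" by (rule ext) simp
    then show ?thesis using vnull_cmult[OF that, of a] by (simp only:)
  qed
  have na: "vnull (fps_nth (F + G))" if "vnull (fps_nth F)" "vnull (fps_nth G)" for F G :: "'a fps"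
  proof -
    have "fps_nth (F + G) = (\<lambda>n. fps_nth F n + fps_nth G n)" by (rule ext) simp
    then show ?thesis using vnull_add[OF that] by (simp only:)
  qed
  have sA: "taylor n (dilate (fst (lin_comb s t) i)) = \<theta>1 i * \<sigma> n" for n
    unfolding trA \<sigma>_def by (rule taylor_cmult[OF vn[OF st(1)]])
  have sB: "taylor n (dilate (snd (lin_comb s t) i)) = \<theta>1 i * ((\<rho> i - x i) * \<sigma> n + \<Theta> i * \<tau> n)" if "n < w" for n
  proof -
    have "n < p" using that wp by simp
    then have "taylor n (dilate (snd (lin_comb s t) i)) = \<theta>1 i * (\<rho> i - x i) * \<sigma> n + \<theta>2 i * \<tau> n"
      unfolding trB \<sigma>_def \<tau>_def
      by (simp add: taylor_add taylor_cmult nc na nX vn[OF st(1)] vn[OF st(2)] taylor_X1_power_mult vn[OF sH] del: fps_const_mult)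
    then show ?thesis by (simp add: \<theta>2[OF i] algebra_simps)
  qed
  have nA: "vnull (fps_nth (dilate (fst (lin_comb s t) i)))" unfolding trA by (intro nc vn[OF st(1)])
  have nB: "vnull (fps_nth (dilate (snd (lin_comb s t) i)))"
    unfolding trB by (intro na nc nX vn[OF st(1)] vn[OF st(2)])
  have \<theta>: "\<theta>1 i \<noteq> 0" "\<Theta> i \<noteq> 0" using nz i by auto
  have "(if L i = Infty then \<forall>n<w. \<sigma> n = 0 else log_rel w (\<Theta> i) (x i) \<sigma> \<tau>) \<and>
    (\<forall>n<w - r i. \<sigma> n = 0 \<and> \<tau> n = 0)"
  proof (cases "L i = Infty")
    case True
    have 1: "\<sigma> n = 0" if "n < w" for n
      using Fil_infinite_slope(1)[OF y i True nA nB that] \<theta> by (simp add: sA)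
    have "\<tau> n = 0" if "n < w - r i" for n
      using Fil_infinite_slope(2)[OF y i True nA nB that] sB[of n] 1[of n] that \<theta> by simp
    then show ?thesis using 1 True by simp
  next
    case False
    then have Li: "L i = Fin (\<rho> i)" using L[OF i] by simp
    have rel: "\<Theta> i * \<tau> n = x i * \<sigma> n + (\<Sum>a=1..n. log_coeff a * \<sigma> (n - a))" if n: "n < w" for n
    proof -
      have "\<theta>1 i * ((\<rho> i - x i) * \<sigma> n + \<Theta> i * \<tau> n) = \<rho> i * (\<theta>1 i * \<sigma> n) + (\<Sum>a=1..n. log_coeff a * (\<theta>1 i * \<sigma> (n - a)))"
        using Fil_finite_slope(1)[OF y i Li nA nB n] unfolding sA sB[OF n] .
      also have "\<dots> = \<theta>1 i * (\<rho> i * \<sigma> n + (\<Sum>a=1..n. log_coeff a * \<sigma> (n - a)))"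
        by (simp add: distrib_left sum_distrib_left mult_ac)
      finally have "(\<rho> i - x i) * \<sigma> n + \<Theta> i * \<tau> n = \<rho> i * \<sigma> n + (\<Sum>a=1..n. log_coeff a * \<sigma> (n - a))"
        using \<theta> by simp
      then show ?thesis by (simp add: algebra_simps)
    qed
    have 1: "\<sigma> n = 0" if "n < w - r i" for n
      using Fil_finite_slope(2)[OF y i Li nA nB that] \<theta> by (simp add: sA)
    have "\<tau> n = 0" if n: "n < w - r i" for n
    proof -
      have "\<Theta> i * \<tau> n = 0" using rel[of n] n 1 by (auto intro!: sum.neutral)
      then show ?thesis using \<theta> by simp
    qed
    then show ?thesis using 1 rel False by (simp add: log_rel_def)
  qed
  then show "if L i = Infty then \<forall>n<w. \<sigma> n = 0 else log_rel w (\<Theta> i) (x i) \<sigma> \<tau>"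
    "n < w - r i \<Longrightarrow> \<sigma> n = 0 \<and> \<tau> n = 0" by auto
qed

text \<open>The passage from weight w to r_i: both sequences start in degree d = w - r_i, and
  dividing by p^d T^d preserves the congruence and turns the bound d + n into n. The estimates for
  weight r_i then all increase by d.\<close>

lemma coefficient_bounds:
  assumes i: "i < f" and \<sigma>: "\<And>n. n < w \<Longrightarrow> vge (real n) (\<sigma> n)" and \<tau>: "\<And>n. n < w \<Longrightarrow> vge (real n) (\<tau> n)"
    and rel: "if L i = Infty then \<forall>n<w. \<sigma> n = 0 else log_rel w (\<Theta> i) (x i) \<sigma> \<tau>"
    and low: "\<And>n. n < w - r i \<Longrightarrow> \<sigma> n = 0 \<and> \<tau> n = 0"
  shows "n < w \<Longrightarrow> vge (real w - 1 - vv (\<Lambda> i)) (\<sigma> n)"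
    and "vge (real w - vv (\<Lambda> i) + vv (\<Theta> (nxt f i)))
      (coeff (smult (\<Theta> i) (P i * trunc_poly w \<tau>) - (Q0 i + smult (x i) (P i)) * trunc_poly w \<sigma>) m)"
proof -
  define d where "d = w - r i"
  have dw: "w = d + r i" "real w = real d + real (r i)" using r(2)[OF i] by (auto simp: d_def)
  define pd where "pd = (of_nat p ^ d :: 'a)"
  have pd: "pd \<noteq> 0" "vv pd = real d" by (auto simp: pd_def vv_power)
  define \<sigma>' where "\<sigma>' = (\<lambda>n. \<sigma> (d + n) / pd)"
  define \<tau>' where "\<tau>' = (\<lambda>n. \<tau> (d + n) / pd)"
  have 1: "\<forall>n<r i. vge (real n) (\<sigma>' n)" "\<forall>n<r i. vge (real n) (\<tau>' n)"
    using \<sigma>[of "d + _"] \<tau>[of "d + _"] dw pd by (auto simp: \<sigma>'_def \<tau>'_def vge_divide add.commute)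
  have 2: "if L i = Infty then \<forall>n<r i. \<sigma>' n = 0 else log_rel (r i) (\<Theta> i) (x i) \<sigma>' \<tau>'"
  proof (cases "L i = Infty")
    case True
    then show ?thesis using rel dw by (simp add: \<sigma>'_def)
  next
    case False
    then have rel': "log_rel w (\<Theta> i) (x i) \<sigma> \<tau>" using rel by simp
    have "log_rel (r i) (\<Theta> i) (x i) \<sigma>' \<tau>'"
      unfolding log_rel_def
    proof (intro allI impI)
      fix n assume n: "n < r i"
      have "\<Theta> i * \<tau> (d + n) = x i * \<sigma> (d + n) + (\<Sum>a=1..d+n. log_coeff a * \<sigma> (d + n - a))"
        using rel' n dw by (simp add: log_rel_def)
      also have "(\<Sum>a=1..d+n. log_coeff a * \<sigma> (d + n - a)) = (\<Sum>a=1..n. log_coeff a * \<sigma> (d + (n - a)))"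
      proof (rule sum.mono_neutral_cong_right)
        show "\<forall>a\<in>{1..d + n} - {1..n}. log_coeff a * \<sigma> (d + n - a) = 0"
          using low by (auto simp: d_def)
      qed auto
      finally have "\<Theta> i * \<tau> (d + n) / pd = (x i * \<sigma> (d + n) + (\<Sum>a=1..n. log_coeff a * \<sigma> (d + (n - a)))) / pd"
        by simp
      then show "\<Theta> i * \<tau>' n = x i * \<sigma>' n + (\<Sum>a=1..n. log_coeff a * \<sigma>' (n - a))"
        by (simp add: \<sigma>'_def \<tau>'_def add_divide_distrib sum_divide_distrib)
    qed
    then show ?thesis using False by simp
  qed
  have core: "(\<forall>n<r i. vge (real (r i) - 1 - vv (\<Lambda> i)) (\<sigma>' n)) \<and>
    (\<forall>m. vge (real (r i) - vv (\<Lambda> i) + vv (\<Theta> (nxt f i)))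
      (coeff (smult (\<Theta> i) (P i * trunc_poly (r i) \<tau>') - (Q0 i + smult (x i) (P i)) * trunc_poly (r i) \<sigma>') m))"
    using cd[OF i] 1 2 unfolding comp_data_def by blast
  show "vge (real w - 1 - vv (\<Lambda> i)) (\<sigma> n)" if n: "n < w"
  proof (cases "n < d")
    case True
    then show ?thesis using low by (simp add: d_def)
  next
    case False
    then obtain m where m: "n = d + m" using le_Suc_ex not_less by blast
    then have "vge (real (r i) - 1 - vv (\<Lambda> i)) (\<sigma> n / pd)" using core n dw by (auto simp: \<sigma>'_def)
    then show ?thesis using pd dw(2) by (simp add: vge_divide algebra_simps)
  qed
  \<comment> \<open>Since the coefficients below d vanish, the truncation splits off p^d T^d, and so
    does the combination of the two truncations.\<close>
  have tp: "trunc_poly w \<phi> = monom pd d * trunc_poly (r i) (\<lambda>n. \<phi> (d + n) / pd)"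
    if "\<And>n. n < d \<Longrightarrow> \<phi> n = 0" for \<phi>
  proof (rule poly_eqI)
    fix n
    show "coeff (trunc_poly w \<phi>) n = coeff (monom pd d * trunc_poly (r i) (\<lambda>n. \<phi> (d + n) / pd)) n"
      using that pd dw(1) by (auto simp: coeff_monom_mult coeff_trunc not_less)
  qed
  have tps: "trunc_poly w \<sigma> = monom pd d * trunc_poly (r i) \<sigma>'" "trunc_poly w \<tau> = monom pd d * trunc_poly (r i) \<tau>'"
    unfolding \<sigma>'_def \<tau>'_def using low unfolding d_def[symmetric] by (intro tp; blast)+
  have "smult (\<Theta> i) (P i * trunc_poly w \<tau>) - (Q0 i + smult (x i) (P i)) * trunc_poly w \<sigma> =
    monom pd d * (smult (\<Theta> i) (P i * trunc_poly (r i) \<tau>') - (Q0 i + smult (x i) (P i)) * trunc_poly (r i) \<sigma>')"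
    unfolding tps right_diff_distrib
    by (simp only: mult_smult_right mult.left_commute[of _ "monom pd d"])
  then have "coeff (smult (\<Theta> i) (P i * trunc_poly w \<tau>) - (Q0 i + smult (x i) (P i)) * trunc_poly w \<sigma>) m =
    (if m < d then 0 else pd * coeff (smult (\<Theta> i) (P i * trunc_poly (r i) \<tau>') -
      (Q0 i + smult (x i) (P i)) * trunc_poly (r i) \<sigma>') (m - d))"
    by (simp only: coeff_monom_mult)
  moreover have "vge (real w - vv (\<Lambda> i) + vv (\<Theta> (nxt f i)))
     (pd * coeff (smult (\<Theta> i) (P i * trunc_poly (r i) \<tau>') - (Q0 i + smult (x i) (P i)) * trunc_poly (r i) \<sigma>') (m - d))"
  proof -
    have "vge (real d) pd" using pd by (simp add: vge_iff)
    note b = vge_mult[OF this conjunct2[OF core, rule_format, of "m - d"]]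
    have "real d + (real (r i) - vv (\<Lambda> i) + vv (\<Theta> (nxt f i))) = real w - vv (\<Lambda> i) + vv (\<Theta> (nxt f i))"
      using dw(2) by simp
    then show ?thesis using b by (simp only:)
  qed
  ultimately show "vge (real w - vv (\<Lambda> i) + vv (\<Theta> (nxt f i)))
      (coeff (smult (\<Theta> i) (P i * trunc_poly w \<tau>) - (Q0 i + smult (x i) (P i)) * trunc_poly w \<sigma>) m)"
    by simp
qed

lemma fps_pcompose_trunc:
  "fps_of_poly (pcompose (trunc_poly w \<phi>) [:-1, 1:]) = (\<Sum>n<w. fps_const (\<phi> n) * (fps_X - 1) ^ n)"
proof -
  have mon: "fps_of_poly (pcompose (monom a n) [:-1, 1:]) = fps_const a * (fps_X - 1) ^ n" for a :: 'a and n
  proof (induction n)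
    case 0
    then show ?case by (simp add: monom_0 fps_of_poly_const)
  next
    case (Suc n)
    have "fps_of_poly [:-1, 1 :: 'a:] = fps_X - 1"
      by (simp add: fps_of_poly_pCons fps_const_neg[symmetric] del: fps_const_neg)
    then show ?case
      using Suc by (simp only: monom_Suc pcompose_pCons fps_of_poly_add fps_of_poly_mult)
        (simp add: mult.left_commute)
  qed
  show ?thesis unfolding trunc_poly_def pcompose_sum fps_of_poly_sum by (intro sum.cong refl mon)
qed

text \<open>The series are replaced by Taylor polynomials, at the cost of multiples of p^w, and
  gamma by u^p/p, at the cost of a factor p in terms containing \<phi>(s). Both errors are within
  the required bounds by the inequalities in \<open>comp_data\<close>.\<close>

lemma Fil_bounds:
  assumes y: "lin_comb s t \<in> Fil_calD p f v K frob r L w" and i: "i < f"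
    and st: "s i \<in> SB 0" "t i \<in> SB 0"
  shows "phi_coeff1 s i \<in> SB (real w)" "phi_coeff2 s t i \<in> SB (real w)"
proof -
  define \<sigma> where "\<sigma> = (\<lambda>n. taylor n (dilate (s i)))"
  define \<tau> where "\<tau> = (\<lambda>n. taylor n (dilate (t i)))"
  define \<Omega> where "\<Omega> = \<Theta> (nxt f i)"
  have wp: "w < p" using w by simp
  have nzi: "\<Lambda> i \<noteq> 0" "\<Theta> i \<noteq> 0" "\<Omega> \<noteq> 0"
    using nz i nxt_less[OF f_pos] by (auto simp: \<Omega>_def)
  note Si = S[OF i, folded \<Omega>_def]
  have small: "vge (real n) (taylor n (dilate F))" if "F \<in> SB 0" "n < w" for F n
    by (rule vge_mono[OF taylor_dilate_vge[OF that(1)]]) (use vv_pdv_ge[of n n] that wp in simp)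
  have "vge (real w - 1 - vv (\<Lambda> i)) (\<sigma> n)" if "n < w" for n
    using coefficient_bounds(1)[OF i _ _ Fil_relations[OF y i st] that] small st by (simp add: \<sigma>_def)
  note \<sigma>b = this
  define W where "W = smult (\<Theta> i) (P i * trunc_poly w \<tau>) - (Q0 i + smult (x i) (P i)) * trunc_poly w \<sigma>"
  have Wb: "vge (real w - vv (\<Lambda> i) + vv \<Omega>) (coeff W m)" for m
    unfolding W_def \<sigma>_def \<tau>_def \<Omega>_def
    by (rule coefficient_bounds(2)[OF i _ _ Fil_relations[OF y i st]]) (use small st in auto)
  let ?G = "dilate (s i)" and ?T = "dilate (t i)"
  let ?c = "\<lambda>q. fps_of_poly (pcompose q [:-1, 1:] :: 'a poly)"
  \<comment> \<open>The Taylor polynomials in T, rewritten as series in X = T + 1.\<close>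
  define GS where "GS = ?c (trunc_poly w \<sigma>)"
  define TS where "TS = ?c (trunc_poly w \<tau>)"
  have rest: "vge (real w) (fps_nth (?G - GS) k)" "vge (real w) (fps_nth (?T - TS) k)" for k
    unfolding GS_def TS_def fps_pcompose_trunc \<sigma>_def \<tau>_def
    by (rule dilate_expansion[OF st(1) wp], rule dilate_expansion[OF st(2) wp])
  have GSb: "vge (real w - 1 - vv (\<Lambda> i)) (fps_nth GS k)" for k
    unfolding GS_def fps_of_poly_nth by (rule vge_pcompose) (use \<sigma>b in \<open>simp add: coeff_trunc\<close>)
  have Gb: "vge (real w - 1 - vv (\<Lambda> i)) (fps_nth ?G k)" for k
  proof -
    have "vge (real w - 1 - vv (\<Lambda> i)) (fps_nth (?G - GS) k + fps_nth GS k)"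
      using Si(1) by (intro vge_add GSb vge_mono[OF rest(1)]) simp
    then show ?thesis by simp
  qed
  have FG: "Frob (s i) \<in> SB (real w - 1 - vv (\<Lambda> i))"
    unfolding frobenius_eq_dilate by (rule compose_upow_SB[OF Gb])
  show "phi_coeff1 s i \<in> SB (real w)"
  proof -
    have "phi_coeff1 s i \<in> SB ((1 + vv (\<Lambda> i)) + (real w - 1 - vv (\<Lambda> i)))"
      unfolding phi_coeff1_def using nzi by (intro SB_mult[OF SB_const] FG) (simp add: vge_iff vv_mult)
    then show ?thesis by simp
  qed
  \<comment> \<open>The second coordinate without the factor \<Lambda>/\<Omega>, before X is set to
    u^p/p; the argument of \<open>h i\<close> is then u^p/p instead of gamma.\<close>
  define E where "E = fps_const (\<Theta> i) * ?T - ?G * (fps_const (x i) + h i)"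
  have Eb: "vge (real w - vv (\<Lambda> i) + vv \<Omega>) (fps_nth E k)" for k
  proof -
    have Pm: "?c (P i) * h i = ?c (Q0 i)" unfolding h_def by (rule expm1_mult[OF P_unit[OF i]])
    have "?c W = fps_const (\<Theta> i) * (?c (P i) * TS) - (?c (Q0 i) + fps_const (x i) * ?c (P i)) * GS"
      unfolding W_def GS_def TS_def
      by (simp add: pcompose_diff pcompose_smult pcompose_mult pcompose_add
          fps_of_poly_diff fps_of_poly_smult fps_of_poly_mult fps_of_poly_add)
    also have "\<dots> = ?c (P i) * (fps_const (\<Theta> i) * TS - GS * (fps_const (x i) + h i))"
      unfolding Pm[symmetric] by (simp add: algebra_simps)
    finally have "inverse (?c (P i)) * ?c W = inverse (?c (P i)) * (?c (P i) * (fps_const (\<Theta> i) * TS - GS * (fps_const (x i) + h i)))"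
      by simp
    also have "\<dots> = fps_const (\<Theta> i) * TS - GS * (fps_const (x i) + h i)"
      unfolding mult.assoc[symmetric]
      by (subst inverse_mult_eq_1) (use P_unit[OF i] in \<open>simp_all only: pcompose_m1_nth0 mult_1_left not_False_eq_True\<close>)
    finally have main: "fps_const (\<Theta> i) * TS - GS * (fps_const (x i) + h i) = inverse (?c (P i)) * ?c W" by simp
    have i0: "fps_nth (?c (P i)) 0 \<noteq> 0" "vv (fps_nth (?c (P i)) 0) = 0"
      unfolding pcompose_m1_nth0 using P_unit[OF i] P_vv[OF i] by auto
    have "vge (0 + (real w - vv (\<Lambda> i) + vv \<Omega>)) (fps_nth (inverse (?c (P i)) * ?c W) k)"
      by (intro vge_fps_mult vge_fps_inverse i0) (auto simp: P_int[OF i] Wb intro!: vge_pcompose)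
    then have 1: "vge (real w - vv (\<Lambda> i) + vv \<Omega>) (fps_nth (fps_const (\<Theta> i) * TS - GS * (fps_const (x i) + h i)) k)"
      unfolding main by simp
    have 2: "vge (real w - vv (\<Lambda> i) + vv \<Omega>) (fps_nth (fps_const (\<Theta> i) * (?T - TS)) k)"
    proof -
      have "vge (vv (\<Theta> i) + real w) (\<Theta> i * fps_nth (?T - TS) k)"
        using nzi by (intro vge_mult rest) (simp add: vge_iff)
      then show ?thesis using Si(2) by (simp add: vge_mono)
    qed
    have 3: "vge (real w - vv (\<Lambda> i) + vv \<Omega>) (fps_nth ((?G - GS) * (fps_const (x i) + h i)) k)"
      using vge_fps_mult[OF rest(1) x_h[OF i], of k] by (simp add: \<Omega>_def add_diff_eq diff_add_eq)
    \<comment> \<open>A main term, equal to W divided by the denominator of the approximant, and two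
      remainders carrying p^w times \<Theta> and x + \<open>h i\<close>, respectively.\<close>
    have "E = (fps_const (\<Theta> i) * TS - GS * (fps_const (x i) + h i)) + fps_const (\<Theta> i) * (?T - TS)
        - (?G - GS) * (fps_const (x i) + h i)"
      by (simp add: E_def algebra_simps)
    then have "fps_nth E k = fps_nth (fps_const (\<Theta> i) * TS - GS * (fps_const (x i) + h i)) k
        + fps_nth (fps_const (\<Theta> i) * (?T - TS)) k - fps_nth ((?G - GS) * (fps_const (x i) + h i)) k"
      by (simp only: fps_add_nth fps_sub_nth)
    then show ?thesis using vge_diff[OF vge_add[OF 1 2] 3] by simp
  qed
  have gg0: "fps_nth upow 0 = 0" by simp
  have Ec: "fps_compose E upow = fps_const (\<Theta> i) * Frob (t i) - Frob (s i) * (fps_const (x i) + subst upow (h i))"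
    unfolding E_def frobenius_eq_dilate subst_upow
    by (simp add: fps_compose_sub_distrib fps_compose_mult_distrib fps_compose_add_distrib)
  have diff: "subst gamma (h i) - subst upow (h i) \<in> SB 1"
  proof -
    obtain C where "\<forall>n. vge C (fps_nth (h i) n)" using h_bounded[OF i] by blast
    then have "subst gamma (h i) - subst upow (h i) \<in> SB (0 + 1)"
      using h_int[OF i] by (intro subst_diff_SB[OF pd_nil_gamma pd_nil_upow gamma_minus_upow, of C]) auto
    then show ?thesis by simp
  qed
  let ?B = "real w - vv (\<Lambda> i) + vv \<Omega>"
  have "phi_coeff2 s t i = fps_const (\<Lambda> i / \<Omega>) *
      (fps_compose E upow - Frob (s i) * (subst gamma (h i) - subst upow (h i)) + Frob (s i) * Frob_tail i)"
    unfolding phi_coeff2_def Ec \<Omega>_def[symmetric] by (simp add: algebra_simps)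
  also have "\<dots> \<in> SB ((vv (\<Lambda> i) - vv \<Omega>) + ?B)"
  proof (intro SB_mult[OF SB_const] SB_add SB_diff)
    show "vge (vv (\<Lambda> i) - vv \<Omega>) (\<Lambda> i / \<Omega>)" using nzi by (simp add: vge_iff vv_divide)
    show "fps_compose E upow \<in> SB ?B" by (rule compose_upow_SB[OF Eb])
    \<comment> \<open>The bound for \<phi>(s) is short of w - v(\<Lambda>) by exactly 1, which the
      congruence of gamma and u^p/p modulo p restores; then v(\<Omega>) <= 0 is used.\<close>
    show "Frob (s i) * (subst gamma (h i) - subst upow (h i)) \<in> SB ?B"
      using SB_mult[OF FG diff] by (rule SB_mono) (use Si in simp)
    show "Frob (s i) * Frob_tail i \<in> SB ?B"
      using SB_mult[OF FG Frob_tail_SB] by (rule SB_mono) (use Si in simp)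
  qed
  finally show "phi_coeff2 s t i \<in> SB (real w)" by simp
qed

lemma MM_divisible:
  assumes "y \<in> MM \<inter> Fil_calD p f v K frob r L w"
  shows "\<exists>z\<in>MM. phi_calD p f lam y = smul (\<lambda>j. of_nat (p ^ w)) z"
proof -
  obtain s t where st: "s \<in> SO" "t \<in> SO" "y = lin_comb s t" using assms by (auto simp: MM_iff)
  define a where "a = (\<lambda>j. fps_const (inverse (of_nat (p ^ w))) * phi_coeff1 s (prv f j))"
  define b where "b = (\<lambda>j. fps_const (inverse (of_nat (p ^ w))) * phi_coeff2 s t (prv f j))"
  have pw: "of_nat (p ^ w) * (fps_const (inverse (of_nat (p ^ w))) * F) = F" for F :: "'a fps"
    unfolding mult.assoc[symmetric] fps_of_nat[symmetric] fps_const_mult by simp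
  have "phi_calD p f lam y = smul (\<lambda>j. of_nat (p ^ w)) (lin_comb a b)"
    unfolding st(3) phi_lin_comb smul_lin_comb a_def b_def pw ..
  moreover have "lin_comb a b \<in> MM"
  proof (rule lin_comb_in_MM)
    fix j assume "j < f"
    have i: "prv f j < f" by (rule prv_less[OF f_pos])
    have sti: "s (prv f j) \<in> SB 0" "t (prv f j) \<in> SB 0" using st i by (auto simp: SO_iff)
    have "lin_comb s t \<in> Fil_calD p f v K frob r L w" using assms st(3) by simp
    note FB = Fil_bounds[OF this i sti]
    have c: "fps_const (inverse (of_nat (p ^ w))) \<in> SB (- real w)"
      by (rule SB_const) (simp add: vge_iff vv_inverse vv_power)
    show "a j \<in> SB 0" "b j \<in> SB 0"
      unfolding a_def b_def using SB_mult[OF c FB(1)] SB_mult[OF c FB(2)] by simp_all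
  qed
  ultimately show ?thesis by blast
qed

lemma MM_strongly_divisible: "strongly_divisible p f v K frob r lam L w MM"
  unfolding strongly_divisible_def
  using MM_calD MM_submodule MM_free MM_isogeny MM_phi_stable MM_N_stable MM_divisible by blast

end

theorem theorem5p13:
  fixes p f w :: nat
    and v :: "'e::field_char_0 \<Rightarrow> ereal"
    and K :: "'e set" and frob :: "'e \<Rightarrow> 'e"
    and r :: "nat \<Rightarrow> nat" and k' :: "nat \<Rightarrow> ereal" and Jinf :: "nat set"
    and \<Lambda> \<Theta> x \<rho> \<theta>1 \<theta>2 :: "nat \<Rightarrow> 'e" and lam :: 'e
    and \<Delta> :: "nat \<Rightarrow> 'e poly fract"
    and L :: "nat \<Rightarrow> 'e proj_line"
  assumes "prime p" and "odd p" and "1 \<le> f"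
    and "padic_field p v"
    and "unramified_subfield v f K"
    and "arith_frobenius p v K frob"
    and "\<forall>j<f. 1 \<le> r j \<and> r j < p - 1"
    and "\<forall>j<f. r j \<le> w" and "w < p - 1"
    and "\<forall>j<f. k' j \<in> K_set (r j)"
    and "Jinf = {j. j < f \<and> k' j = \<infinity>}"
    and "(\<Sum>j<f. r j - 1) \<ge> 2 * (\<Sum>j\<in>Jinf. r j)"
    and "valid_k v f r k'"
    and "\<forall>j<f. \<Lambda> j \<noteq> 0 \<and> \<Theta> j \<noteq> 0"
    and "\<forall>j<f. cond_C v (r j) (k' j) (\<Lambda> j) (\<Theta> j) (\<Theta> (nxt f j)) (x j)"
    and "\<forall>j<f. \<Delta> j = delta (r j) (l_of (r j) (k' j)) (x j)"
    and "\<forall>j<f. of_nat p * \<rho> j - \<rho> (prv f j) = of_nat p * x j + value_at_m1 (\<Delta> (prv f j))"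
    and "\<forall>j<f. L j = (if j \<in> Jinf then Infty else Fin (\<rho> j))"
    and "0 \<le> v lam" and "lam ^ f = (\<Prod>j<f. \<Lambda> j)"
    and "\<forall>j<f. \<theta>1 j \<noteq> 0"
    and "\<forall>j<f. \<Lambda> j = lam * \<theta>1 j / \<theta>1 (nxt f j)"
    and "\<forall>j<f. \<theta>2 j = \<Theta> j * \<theta>1 j"
  shows "(\<forall>j<f. \<Delta> j \<in> E_T_Delta v) \<and>
         strongly_divisible p f v K frob r lam L w (M_mod p f v K frob \<theta>1 \<theta>2 \<rho> \<Delta>)"
proof -
  note A = assms
  interpret odd_padic p v
    using A(1,2,4) by unfold_locales (simp_all add: padic_field_def)
  have nxt: "nxt f j < f" for j using nxt_less[of f j] A(3) by simp
  have "\<exists>P Q0. \<Delta> j = Fract Q0 P \<and> comp_data (r j) (L j = Infty) (\<Lambda> j) (\<Theta> j) (\<Theta> (nxt f j)) (x j) P Q0"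
    if j: "j < f" for j
  proof -
    have "r j < p" using A(7) j by auto
    moreover have "L j = Infty \<longleftrightarrow> k' j = \<infinity>" using A(11,18) j by simp
    ultimately show ?thesis
      using comp_data_exists[of "r j" "k' j" "\<Lambda> j" "\<Theta> j" "\<Theta> (nxt f j)" "x j"] A(7,10,14,15,16) j nxt
      by simp
  qed
  then have "\<forall>j. \<exists>PQ. j < f \<longrightarrow> \<Delta> j = Fract (snd PQ) (fst PQ) \<and>
      comp_data (r j) (L j = Infty) (\<Lambda> j) (\<Theta> j) (\<Theta> (nxt f j)) (x j) (fst PQ) (snd PQ)"
    by (metis fst_conv snd_conv)
  then obtain PQ where PQ: "\<And>j. j < f \<Longrightarrow> \<Delta> j = Fract (snd (PQ j)) (fst (PQ j)) \<and>
      comp_data (r j) (L j = Infty) (\<Lambda> j) (\<Theta> j) (\<Theta> (nxt f j)) (x j) (fst (PQ j)) (snd (PQ j))"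
    by metis
  interpret breuil_module p v f K frob r w \<Lambda> \<Theta> x \<rho> \<theta>1 \<theta>2 lam \<Delta> L "\<lambda>j. fst (PQ j)" "\<lambda>j. snd (PQ j)"
  proof unfold_locales
    fix j assume j: "j < f"
    show "\<Lambda> j * \<theta>1 (nxt f j) = lam * \<theta>1 j" using A(21,22) j nxt[of j] by simp
    show "L j = Infty \<or> L j = Fin (\<rho> j)" using A(18) j by simp
  qed (use A PQ in simp_all)
  show ?thesis using Delta_in_E_T_Delta MM_strongly_divisible by blast
qed

end
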